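(* Let $\Omega$ be a bounded open subset of $\mathbb{R}^2$ with a Lipschitz boundary and let $Y=(0,1)^2$. Let $\Sigma_n$ be a sequence of (not necessarily symmetric) matrix-valued functions in $L^\infty(\mathbb{R}^2)^{2\times2}$ such that each $\Sigma_n$ is $Y$-periodic and such that there exists $\alpha>0$ with $\Sigma_n\xi\cdot\xi\ge\alpha|\xi|^2$ a.e. in $\mathbb{R}^2$ for all $n\in\mathbb{N}$ and all $\xi\in\mathbb{R}^2$. Let $\varepsilon_n>0$ with $\varepsilon_n\to0$, and set $\sigma_n(x)=\Sigma_n(x/\varepsilon_n)$ for a.e. $x\in\mathbb{R}^2$. Let $(\sigma_n)_*$ be the constant effective matrix associated with $\Sigma_n$ (see context), and assume that $(\sigma_n)_*\to\sigma_*$ in $\mathbb{R}^{2\times2}$. Let $f\in H^{-1}(\Omega)\cap W^{-1,q}(\Omega)$ with $q>2$, and let $u_n$ be the solution of $$-\operatorname{div}(\sigma_n\nabla u_n)=f\ \text{ in }\Omega,\qquad u_n=0\ \text{ on }\partial\Omega .$$ Then $u_n$ converges uniformly in $\Omega$ to the solution $u\in H^1_0(\Omega)$ of $$-\operatorname{div}(\sigma_*\nabla u)=f\ \text{ in }\Omega,\qquad u=0\ \text{ on }\partial\Omega .$$ Moreover, with the functions $w_n^1,w_n^2$ defined in the context, $$\nabla u_n-\sum_{i=1}^2\partial_i u\,\nabla w_n^i\longrightarrow0\quad\text{strongly in }L^1(\Omega)^2 .$$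
   Context: $H^1_\sharp(Y)$ is the set of $Y$-periodic functions belonging to $H^1_{\mathrm{loc}}(\mathbb{R}^2)$. For $\lambda\in\mathbb{R}^2$, $W_n^\lambda$ is the function such that $W_n^\lambda-\lambda\cdot y\in H^1_\sharp(Y)$, $\int_Y(W_n^\lambda(y)-\lambda\cdot y)\,dy=0$ and $\int_Y\Sigma_n\nabla W_n^\lambda\cdot\nabla\varphi\,dy=0$ for all $\varphi\in H^1_\sharp(Y)$ (equivalently $\operatorname{div}(\Sigma_n\nabla W_n^\lambda)=0$ in $\mathscr{D}'(\mathbb{R}^2)$). The constant matrix $(\sigma_n)_*$ is defined by $(\sigma_n)_*\lambda\cdot\mu=\int_Y\Sigma_n\nabla W_n^\lambda\cdot\nabla W_n^\mu\,dy$ for all $\lambda,\mu\in\mathbb{R}^2$. For $i=1,2$, $w_n^i(x):=\varepsilon_n W_n^{e_i}(x/\varepsilon_n)$ for $x\in\Omega$, where $(e_1,e_2)$ is the canonical basis of $\mathbb{R}^2$. *)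

theory Defs
  imports "HOL-Analysis.Analysis"
begin

type_synonym R2 = "real ^ 2"

definition grad :: "(R2 \<Rightarrow> real) \<Rightarrow> R2 \<Rightarrow> R2" where
  "grad f x = (\<chi> i. frechet_derivative f (at x) (axis i 1))"

primrec C_k :: "nat \<Rightarrow> (R2 \<Rightarrow> real) \<Rightarrow> bool" where
  "C_k 0 f \<longleftrightarrow> continuous_on UNIV f"
| "C_k (Suc k) f \<longleftrightarrow> (\<forall>x. f differentiable (at x)) \<and> (\<forall>i. C_k k (\<lambda>x. grad f x $ i))"

definition test_functions :: "R2 set \<Rightarrow> (R2 \<Rightarrow> real) set" where
  "test_functions U = {\<phi>. (\<forall>k. C_k k \<phi>) \<and> compact (closure {x. \<phi> x \<noteq> 0}) \<and>
                          closure {x. \<phi> x \<noteq> 0} \<subseteq> U}"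

text \<open>Elements of these spaces are represented by functions on the whole plane; everything
  below depends only on their restriction to the open set \<open>U\<close>, up to null sets.\<close>

definition L2 :: "R2 set \<Rightarrow> (R2 \<Rightarrow> 'b::euclidean_space) set" where
  "L2 U = {f. f \<in> borel_measurable (lebesgue_on U) \<and>
              integrable (lebesgue_on U) (\<lambda>x. (norm (f x))\<^sup>2)}"

definition L1_loc :: "R2 set \<Rightarrow> (R2 \<Rightarrow> 'b::euclidean_space) set" where
  "L1_loc U = {f. \<forall>K. compact K \<longrightarrow> K \<subseteq> U \<longrightarrow> integrable (lebesgue_on K) f}"

definition L2_loc :: "R2 set \<Rightarrow> (R2 \<Rightarrow> 'b::euclidean_space) set" where
  "L2_loc U = {f. \<forall>K. compact K \<longrightarrow> K \<subseteq> U \<longrightarrow> f \<in> L2 K}"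

definition is_weak_grad :: "R2 set \<Rightarrow> (R2 \<Rightarrow> real) \<Rightarrow> (R2 \<Rightarrow> R2) \<Rightarrow> bool" where
  "is_weak_grad U u G \<longleftrightarrow> u \<in> L1_loc U \<and> G \<in> L1_loc U \<and>
     (\<forall>\<phi>\<in>test_functions U. \<forall>i.
        (\<integral>x. u x * grad \<phi> x $ i \<partial>lebesgue_on U) = - (\<integral>x. G x $ i * \<phi> x \<partial>lebesgue_on U))"

text \<open>The weak gradient on an open set is unique almost everywhere; \<open>wgrad U u\<close> is an arbitrary
  representative of it (meaningful only if a weak gradient exists).\<close>

definition wgrad :: "R2 set \<Rightarrow> (R2 \<Rightarrow> real) \<Rightarrow> R2 \<Rightarrow> R2" where
  "wgrad U u = (SOME G. is_weak_grad U u G)"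

definition H1 :: "R2 set \<Rightarrow> (R2 \<Rightarrow> real) set" where
  "H1 U = {u \<in> L2 U. \<exists>G\<in>L2 U. is_weak_grad U u G}"

definition H1_loc :: "R2 set \<Rightarrow> (R2 \<Rightarrow> real) set" where
  "H1_loc U = {u \<in> L2_loc U. \<exists>G\<in>L2_loc U. is_weak_grad U u G}"

definition H1_0 :: "R2 set \<Rightarrow> (R2 \<Rightarrow> real) set" where
  "H1_0 U = {u \<in> H1 U. \<exists>\<phi>. (\<forall>k::nat. \<phi> k \<in> test_functions U) \<and>
     (\<lambda>k. \<integral>x. (u x - \<phi> k x)\<^sup>2 + (norm (wgrad U u x - grad (\<phi> k) x))\<^sup>2 \<partial>lebesgue_on U)
       \<longlonglongrightarrow> 0}"

definition W1_norm :: "R2 set \<Rightarrow> real \<Rightarrow> (R2 \<Rightarrow> real) \<Rightarrow> real" where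
  "W1_norm U p \<phi> =
     (\<integral>x. \<bar>\<phi> x\<bar> powr p + norm (grad \<phi> x) powr p \<partial>lebesgue_on U) powr (1 / p)"

text \<open>For \<open>1 < q < \<infinity>\<close>, \<open>W\<^sup>-\<^sup>1\<^sup>,\<^sup>q(U)\<close> is the dual of \<open>W\<^sub>0\<^sup>1\<^sup>,\<^sup>p(U)\<close> with \<open>1/p + 1/q = 1\<close>. As test
  functions are dense in \<open>W\<^sub>0\<^sup>1\<^sup>,\<^sup>p(U)\<close>, its elements are identified with the distributions that are
  bounded for the \<open>W\<^sup>1\<^sup>,\<^sup>p\<close> norm; this also gives a meaning to intersections for different \<open>q\<close>.\<close>

definition W_minus1 :: "R2 set \<Rightarrow> real \<Rightarrow> ((R2 \<Rightarrow> real) \<Rightarrow> real) set" where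
  "W_minus1 U q = {f.
     (\<forall>\<phi>\<in>test_functions U. \<forall>\<psi>\<in>test_functions U. \<forall>a b.
        f (\<lambda>x. a * \<phi> x + b * \<psi> x) = a * f \<phi> + b * f \<psi>) \<and>
     (\<exists>C. \<forall>\<phi>\<in>test_functions U. \<bar>f \<phi>\<bar> \<le> C * W1_norm U (q / (q - 1)) \<phi>)}"

abbreviation H_minus1 :: "R2 set \<Rightarrow> ((R2 \<Rightarrow> real) \<Rightarrow> real) set" where
  "H_minus1 U \<equiv> W_minus1 U 2"

text \<open>Near each boundary point, after an orthogonal change of coordinates, \<open>U\<close> is the strict
  epigraph of a Lipschitz function of one variable.\<close>

definition lipschitz_boundary :: "R2 set \<Rightarrow> bool" where
  "lipschitz_boundary U \<longleftrightarrow>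
     (\<forall>p\<in>frontier U. \<exists>r>0. \<exists>T :: R2 \<Rightarrow> R2. \<exists>\<gamma> :: real \<Rightarrow> real. \<exists>L.
        orthogonal_transformation T \<and> L-lipschitz_on UNIV \<gamma> \<and>
        (\<forall>x\<in>ball p r. x \<in> U \<longleftrightarrow> \<gamma> (T x $ 1) < T x $ 2))"

definition L_inf :: "(R2 \<Rightarrow> real ^ 2 ^ 2) set" where
  "L_inf = {A \<in> borel_measurable lebesgue. \<exists>M. AE x in lebesgue. norm (A x) \<le> M}"

text \<open>\<open>- div (A \<nabla>u) = f\<close> in the sense of distributions, with \<open>u \<in> H\<^sub>0\<^sup>1(U)\<close>.\<close>

definition dirichlet_solution ::
  "R2 set \<Rightarrow> (R2 \<Rightarrow> real ^ 2 ^ 2) \<Rightarrow> ((R2 \<Rightarrow> real) \<Rightarrow> real) \<Rightarrow> (R2 \<Rightarrow> real) \<Rightarrow> bool" where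
  "dirichlet_solution U A f u \<longleftrightarrow> u \<in> H1_0 U \<and>
     (\<forall>\<phi>\<in>test_functions U. (\<integral>x. (A x *v wgrad U u x) \<bullet> grad \<phi> x \<partial>lebesgue_on U) = f \<phi>)"

definition Y :: "R2 set" where
  "Y = {y. \<forall>i. 0 < y $ i \<and> y $ i < 1}"

definition Y_periodic :: "(R2 \<Rightarrow> 'b) \<Rightarrow> bool" where
  "Y_periodic f \<longleftrightarrow> (\<forall>k. (\<forall>i. k $ i \<in> \<int>) \<longrightarrow> (AE y in lebesgue. f (y + k) = f y))"

definition H1_per :: "(R2 \<Rightarrow> real) set" where
  "H1_per = {u \<in> H1_loc UNIV. Y_periodic u}"

definition cell_solution :: "(R2 \<Rightarrow> real ^ 2 ^ 2) \<Rightarrow> R2 \<Rightarrow> (R2 \<Rightarrow> real) \<Rightarrow> bool" where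
  "cell_solution A \<xi> W \<longleftrightarrow>
     (\<lambda>y. W y - \<xi> \<bullet> y) \<in> H1_per \<and>
     (\<integral>y. W y - \<xi> \<bullet> y \<partial>lebesgue_on Y) = 0 \<and>
     (\<forall>\<phi>\<in>H1_per. (\<integral>y. (A y *v wgrad UNIV W y) \<bullet> wgrad UNIV \<phi> y \<partial>lebesgue_on Y) = 0)"

definition effective_matrix ::
  "(R2 \<Rightarrow> real ^ 2 ^ 2) \<Rightarrow> (R2 \<Rightarrow> R2 \<Rightarrow> real) \<Rightarrow> real ^ 2 ^ 2 \<Rightarrow> bool" where
  "effective_matrix A W B \<longleftrightarrow>
     (\<forall>\<xi> \<eta>. (B *v \<xi>) \<bullet> \<eta> =
        (\<integral>y. (A y *v wgrad UNIV (W \<xi>) y) \<bullet> wgrad UNIV (W \<eta>) y \<partial>lebesgue_on Y))"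

definition rescale :: "real \<Rightarrow> (R2 \<Rightarrow> real) \<Rightarrow> R2 \<Rightarrow> real" where
  "rescale \<epsilon> W x = \<epsilon> * W (x /\<^sub>R \<epsilon>)"

text \<open>Uniform convergence of elements of \<open>H\<^sup>1\<close>, which are defined up to null sets only, is
  uniform convergence of their continuous representatives.\<close>

definition converges_uniformly ::
  "R2 set \<Rightarrow> (nat \<Rightarrow> R2 \<Rightarrow> real) \<Rightarrow> (R2 \<Rightarrow> real) \<Rightarrow> bool" where
  "converges_uniformly U u v \<longleftrightarrow>
     (\<exists>u' v'. (\<forall>n. continuous_on U (u' n) \<and> (AE x in lebesgue_on U. u' n x = u n x)) \<and>
              continuous_on U v' \<and> (AE x in lebesgue_on U. v' x = v x) \<and>
              uniform_limit U u' v' sequentially)"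

definition converges_L1 ::
  "R2 set \<Rightarrow> (nat \<Rightarrow> R2 \<Rightarrow> R2) \<Rightarrow> (R2 \<Rightarrow> R2) \<Rightarrow> bool" where
  "converges_L1 U F G \<longleftrightarrow>
     (\<forall>n. integrable (lebesgue_on U) (F n)) \<and> integrable (lebesgue_on U) G \<and>
     (\<lambda>n. \<integral>x. norm (F n x - G x) \<partial>lebesgue_on U) \<longlonglongrightarrow> 0"

end

theory Submission
 imports Defs "HOL-Complex_Analysis.Great_Picard"
begin

text \<open>Let \<open>w\<^sub>n = (w\<^sub>n\<^sup>1, w\<^sub>n\<^sup>2)\<close>. For a test function \<open>\<Phi>\<close> close to \<open>u\<close> in \<open>H\<^sup>1\<close>, put \<open>z\<^sub>n = u\<^sub>n - \<Phi>(w\<^sub>n)\<close> and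
  \<open>Z\<^sub>n = \<nabla>u\<^sub>n - \<Sum>\<^sub>i \<partial>\<^sub>i\<Phi>(w\<^sub>n) \<nabla>w\<^sub>n\<^sup>i = \<nabla>z\<^sub>n\<close>. Testing the equation of \<open>u\<^sub>n\<close> with \<open>z\<^sub>n\<close> and the cell equations with
  \<open>\<partial>\<^sub>i\<Phi>(w\<^sub>n) z\<^sub>n\<close> bounds \<open>\<alpha> \<parallel>Z\<^sub>n\<parallel>\<^sup>2\<close> by \<open>\<integral> \<sigma>\<^sub>* \<nabla>(u - \<Phi>) \<bullet> Z\<^sub>n\<close> plus an error in which only the symmetrised energy
  densities of the cell solutions occur, since the Hessian of \<open>\<Phi>\<close> is symmetric. These densities are bounded in
  \<open>L\<^sup>1\<close> and periodic, hence converge weakly-* as measures to their means, so the error vanishes once \<open>z\<^sub>n\<close>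
  converges uniformly. As there is no uniform \<open>L\<^sup>\<infinity>\<close> bound on \<open>\<Sigma>\<^sub>n\<close>, compactness in the uniform norm cannot come from
  De Giorgi's theorem. In the plane it comes from bounded energy alone: by Courant--Lebesgue some small square
  around each point has small oscillation on its boundary, and Stampacchia's maximum principle, whose constants
  depend on the lower bound \<open>\<alpha>\<close> only, carries this to the interior. The same argument on one cell bounds
  \<open>w\<^sub>n - x\<close> by a multiple of \<open>\<epsilon>\<^sub>n\<close>.\<close>

text \<open>The upper bound of each \<open>\<Sigma> n\<close> is only qualitative: it multiplies
  errors that vanish when C1 approximants are passed to the limit in L2, and so leaves no trace in
  any constant. Nonlinear test functions are always built from such approximants; no chain rule for
  Sobolev functions enters. Bounded energy alone does not make the energy near a point small
  uniformly in n. A pigeonhole does: of N concentric dyadic annuli one carries at most 1/N of the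
  energy, and the maximum principle carries the control inwards from there. The right-hand side
  enters with the power 1/2 - 1/q of the measure of the set tested, positive because q > 2; this
  makes the level-set iteration superlinear. Coercivity bounds \<open>A a . b + A b . a\<close> by
  the diagonal terms, but not \<open>A a . b\<close> alone, hence the need for the symmetry of the
  Hessian. The estimate at fixed \<Phi> bounds both z_n and Z_n by the distance of \<nabla>\<Phi>
  from \<nabla>u. It therefore identifies every uniform limit with u, and replacing \<nabla>\<Phi>
  by \<nabla>u leaves products of two L2 factors, which is why the corrector result lives in
  L1.\<close>

abbreviation (input) leb :: "'a::euclidean_space measure" where "leb == lebesgue"

section \<open>Square integrability over an arbitrary measure\<close>

definition sq :: "'a measure => ('a => 'b::euclidean_space) => bool" where
 "sq M f \<longleftrightarrow> f \<in> borel_measurable M & integrable M (%x. (norm (f x))^2)"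

definition nrm2 :: "'a measure => ('a => 'b::euclidean_space) => real" where
 "nrm2 M f = sqrt (LINT x|M. (norm (f x))^2)"

lemma sq_meas [measurable_dest]: "sq M f ==> f \<in> borel_measurable M"
 and sq_int: "sq M f ==> integrable M (%x. (norm (f x))^2)"
 by (auto simp: sq_def)

lemma nrm2_nonneg [simp]: "0 <= nrm2 M f"
 by (simp add: nrm2_def)

lemma nrm2_square: "(nrm2 M f)^2 = (LINT x|M. (norm (f x))^2)"
 by (simp add: nrm2_def)

lemma sq_dominated:
 fixes f :: "'a => 'b::euclidean_space" and g :: "'a => 'c::euclidean_space"
 assumes "sq M g" "f \<in> borel_measurable M" "AE x in M. norm (f x) <= C * norm (g x)"
 shows "sq M f"
proof -
 have "integrable M (%x. (norm (f x))^2)"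
 proof (rule Bochner_Integration.integrable_bound)
  show "integrable M (%x. C^2 * (norm (g x))^2)"
   using assms(1) by (auto simp: sq_def)
  show "(%x. (norm (f x))^2) \<in> borel_measurable M"
   using assms(2) by measurable
  show "AE x in M. norm ((norm (f x))^2) <= norm (C^2 * (norm (g x))^2)"
   using assms(3)
  proof eventually_elim
   case (elim x)
   hence "(norm (f x))^2 <= (C * norm (g x))^2"
    by (intro power_mono) auto
   thus ?case by (simp add: power_mult_distrib)
  qed
 qed
 with assms(2) show ?thesis by (simp add: sq_def)
qed

lemma nrm2_dominated:
 fixes f :: "'a => 'b::euclidean_space" and g :: "'a => 'c::euclidean_space"
 assumes "sq M g" "f \<in> borel_measurable M" "AE x in M. norm (f x) <= C * norm (g x)" "0 <= C"
 shows "nrm2 M f <= C * nrm2 M g"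
proof -
 have "(LINT x|M. (norm (f x))^2) <= (LINT x|M. C^2 * (norm (g x))^2)"
 proof (rule integral_mono_AE)
  show "integrable M (%x. (norm (f x))^2)"
   using sq_dominated[OF assms(1-3)] by (simp add: sq_def)
  show "integrable M (%x. C^2 * (norm (g x))^2)"
   using assms(1) by (auto simp: sq_def)
  show "AE x in M. (norm (f x))^2 <= C^2 * (norm (g x))^2"
   using assms(3)
  proof eventually_elim
   case (elim x)
   hence "(norm (f x))^2 <= (C * norm (g x))^2"
    by (intro power_mono) auto
   thus ?case by (simp add: power_mult_distrib)
  qed
 qed
 hence "sqrt (LINT x|M. (norm (f x))^2) <= sqrt (C^2 * (LINT x|M. (norm (g x))^2))"
  by simp
 thus ?thesis
  using assms(4) by (simp add: nrm2_def real_sqrt_mult)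
qed

lemma sq_add:
 assumes "sq M f" "sq M g" shows "sq M (%x. f x + g x)"
proof -
 note [measurable] = sq_meas[OF assms(1)] sq_meas[OF assms(2)]
 have "integrable M (%x. (norm (f x + g x))^2)"
 proof (rule Bochner_Integration.integrable_bound)
  show "integrable M (%x. 2 * (norm (f x))^2 + 2 * (norm (g x))^2)"
   using assms by (auto simp: sq_def)
  show "AE x in M. norm ((norm (f x + g x))^2) <= norm (2 * (norm (f x))^2 + 2 * (norm (g x))^2)"
  proof (rule AE_I2)
   fix x
   have "(norm (f x + g x))^2 <= (norm (f x) + norm (g x))^2"
    by (intro power_mono norm_triangle_ineq) auto
   also have "... <= 2 * (norm (f x))^2 + 2 * (norm (g x))^2"
    using sum_squares_bound[of "norm (f x)" "norm (g x)"] by (simp add: power2_sum)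
   finally show "norm ((norm (f x + g x))^2) <= norm (2 * (norm (f x))^2 + 2 * (norm (g x))^2)"
    by simp
  qed
 qed measurable
 thus ?thesis by (simp add: sq_def)
qed

lemma sq_scaleR: "sq M f ==> sq M (%x. c *\<^sub>R f x)"
 by (auto simp: sq_def power_mult_distrib)

lemma sq_mult: "sq M (f :: 'a => real) ==> sq M (%x. c * f x)"
 using sq_scaleR[of M f c] by simp

lemma sq_uminus: "sq M f ==> sq M (%x. - f x)"
 by (auto simp: sq_def)

lemma sq_diff: "sq M f ==> sq M g ==> sq M (%x. f x - g x)"
 using sq_add[OF _ sq_uminus, of M f g] by simp

lemma sq_zero [simp]: "sq M (%x. 0)"
 by (simp add: sq_def)

lemma nrm2_zero [simp]: "nrm2 M (%x. 0) = 0"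
 by (simp add: nrm2_def)

lemma sq_bmult:
 assumes "sq M f" "b \<in> borel_measurable M" "AE x in M. \<bar>b x\<bar> <= C"
 shows "sq M (%x. b x *\<^sub>R f x)"
proof (rule sq_dominated[OF assms(1), where C = C])
 show "(%x. b x *\<^sub>R f x) \<in> borel_measurable M"
  using sq_meas[OF assms(1)] assms(2) by measurable
 show "AE x in M. norm (b x *\<^sub>R f x) <= C * norm (f x)"
  using assms(3) by eventually_elim (auto intro: mult_right_mono)
qed

lemma measurable_vec_component [measurable]:
 "f \<in> borel_measurable M ==> (%x. (f x :: real^'n) $ i) \<in> borel_measurable M"
 using borel_measurable_inner[of f M "%_. axis i 1"] by (simp add: inner_axis)

lemma sq_component: "sq M f ==> sq M (%x. (f x :: real^'n) $ i)"
 by (rule sq_dominated[where C = 1]) (auto intro!: component_le_norm_cart measurable_vec_component dest: sq_meas)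

lemma nrm2_norm [simp]: "nrm2 M (%x. norm (f x)) = nrm2 M f"
 by (simp add: nrm2_def)

lemma sq_cong_AE:
 assumes "sq M f" "g \<in> borel_measurable M" "AE x in M. g x = f x"
 shows "sq M g"
 by (rule sq_dominated[OF assms(1,2), where C = 1]) (use assms(3) in eventually_elim, simp)

lemma nrm2_cong_AE:
 assumes "f \<in> borel_measurable M" "g \<in> borel_measurable M" "AE x in M. f x = g x"
 shows "nrm2 M f = nrm2 M g"
 unfolding nrm2_def
 by (intro arg_cong[where f = sqrt] integral_cong_AE) (use assms in \<open>auto\<close>)

lemma sq_norm_mult_integrable:
 assumes "sq M f" "sq M g"
 shows "integrable M (%x. norm (f x) * norm (g x))"
proof (rule Bochner_Integration.integrable_bound)
 show "integrable M (%x. (norm (f x))^2 + (norm (g x))^2)"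
  using assms by (auto simp: sq_def)
 show "(%x. norm (f x) * norm (g x)) \<in> borel_measurable M"
  using assms[THEN sq_meas] by measurable
 show "AE x in M. norm (norm (f x) * norm (g x)) <= norm ((norm (f x))^2 + (norm (g x))^2)"
 proof (rule AE_I2)
  fix x
  have "0 <= norm (f x) * norm (g x)" by simp
  with sum_squares_bound[of "norm (f x)" "norm (g x)"]
  show "norm (norm (f x) * norm (g x)) <= norm ((norm (f x))^2 + (norm (g x))^2)"
   unfolding real_norm_def by linarith
 qed
qed

lemma Cauchy_Schwarz_nrm2:
 assumes "sq M f" "sq M g"
 shows "(LINT x|M. norm (f x) * norm (g x)) <= nrm2 M f * nrm2 M g"
proof -
 note [measurable] = assms[THEN sq_meas]
 define I where "I = (LINT x|M. norm (f x) * norm (g x))"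
 have I0: "0 <= I" unfolding I_def by (intro integral_nonneg_AE) auto
 have "(\<integral>\<^sup>+x. ennreal (norm (f x)) * ennreal (norm (g x)) \<partial>M)^2
   <= (\<integral>\<^sup>+x. ennreal (norm (f x)) ^ 2 \<partial>M) * (\<integral>\<^sup>+x. ennreal (norm (g x)) ^ 2 \<partial>M)"
  by (rule Cauchy_Schwarz_nn_integral) measurable
 also have "(\<integral>\<^sup>+x. ennreal (norm (f x)) * ennreal (norm (g x)) \<partial>M) = ennreal I"
  unfolding I_def using nn_integral_eq_integral[OF sq_norm_mult_integrable[OF assms]]
  by (simp add: ennreal_mult)
 also have "(\<integral>\<^sup>+x. ennreal (norm (f x)) ^ 2 \<partial>M) = ennreal ((nrm2 M f)^2)"
  unfolding nrm2_square using nn_integral_eq_integral[OF sq_int[OF assms(1)]]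
  by (simp add: ennreal_power)
 also have "(\<integral>\<^sup>+x. ennreal (norm (g x)) ^ 2 \<partial>M) = ennreal ((nrm2 M g)^2)"
  unfolding nrm2_square using nn_integral_eq_integral[OF sq_int[OF assms(2)]]
  by (simp add: ennreal_power)
 finally have "I^2 <= (nrm2 M f * nrm2 M g)^2"
  using I0 by (simp add: ennreal_power ennreal_mult[symmetric] power_mult_distrib)
 thus ?thesis
  unfolding I_def[symmetric] by (rule power2_le_imp_le) simp
qed

lemma sq_inner_integrable:
 assumes "sq M f" "sq M g"
 shows "integrable M (%x. f x \<bullet> g x)"
proof (rule Bochner_Integration.integrable_bound[OF sq_norm_mult_integrable[OF assms]])
 show "(%x. f x \<bullet> g x) \<in> borel_measurable M"
  using assms[THEN sq_meas] by measurable
 show "AE x in M. norm (f x \<bullet> g x) <= norm (norm (f x) * norm (g x))"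
  by (simp add: Cauchy_Schwarz_ineq2)
qed

lemma sq_mult_integrable:
 "sq M f ==> sq M g ==> integrable M (%x. f x * g x :: real)"
 using sq_inner_integrable[of M f g] by simp

lemma inner_nrm2_bound:
 assumes "sq M f" "sq M g"
 shows "\<bar>(LINT x|M. f x \<bullet> g x)\<bar> <= nrm2 M f * nrm2 M g"
proof -
 have "\<bar>(LINT x|M. f x \<bullet> g x)\<bar> <= (LINT x|M. norm (f x \<bullet> g x))"
  using integral_norm_bound[of M "%x. f x \<bullet> g x"] by simp
 also have "... <= (LINT x|M. norm (f x) * norm (g x))"
  by (intro integral_mono integrable_norm sq_inner_integrable sq_norm_mult_integrable assms)
    (simp add: Cauchy_Schwarz_ineq2)
 also note Cauchy_Schwarz_nrm2[OF assms]
 finally show ?thesis .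
qed

lemma nrm2_triangle:
 assumes "sq M f" "sq M g"
 shows "nrm2 M (%x. f x + g x) <= nrm2 M f + nrm2 M g"
proof (rule power2_le_imp_le)
 have "(nrm2 M (%x. f x + g x))^2
   <= (LINT x|M. (norm (f x))^2 + 2 * (norm (f x) * norm (g x)) + (norm (g x))^2)"
  unfolding nrm2_square
 proof (intro integral_mono Bochner_Integration.integrable_add integrable_mult_right
    sq_norm_mult_integrable sq_int assms)
  show "sq M (%x. f x + g x)"
   by (rule sq_add[OF assms])
  fix x
  have "(norm (f x + g x))^2 <= (norm (f x) + norm (g x))^2"
   by (intro power_mono norm_triangle_ineq) auto
  thus "(norm (f x + g x))^2 <= (norm (f x))^2 + 2 * (norm (f x) * norm (g x)) + (norm (g x))^2"
   by (simp add: power2_sum)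
 qed
 also have "... = (nrm2 M f)^2 + 2 * (LINT x|M. norm (f x) * norm (g x)) + (nrm2 M g)^2"
  unfolding nrm2_square using assms sq_norm_mult_integrable[OF assms] by (simp add: sq_int)
 also have "... <= (nrm2 M f + nrm2 M g)^2"
  using Cauchy_Schwarz_nrm2[OF assms] by (simp add: power2_sum)
 finally show "(nrm2 M (%x. f x + g x))^2 <= (nrm2 M f + nrm2 M g)^2" .
qed simp

lemma nrm2_uminus [simp]: "nrm2 M (%x. - f x) = nrm2 M f"
 by (simp add: nrm2_def)

lemma nrm2_commute: "nrm2 M (%x. f x - g x) = nrm2 M (%x. g x - f x)"
 by (simp add: nrm2_def norm_minus_commute)

lemma nrm2_triangle_diff:
 assumes "sq M f" "sq M g"
 shows "nrm2 M f <= nrm2 M g + nrm2 M (%x. f x - g x)"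
 using nrm2_triangle[OF assms(2) sq_diff[OF assms]] by simp

lemma nrm2_zero_iff:
 assumes "sq M f"
 shows "nrm2 M f = 0 \<longleftrightarrow> (AE x in M. f x = 0)"
 unfolding nrm2_def using integral_nonneg_eq_0_iff_AE[OF sq_int[OF assms]] by simp

text \<open>Square integrability of all terms and of the limit is part of the notion: the Bochner
  integral of a non-integrable function is 0, so convergence of \<open>nrm2\<close> alone would say
  nothing.\<close>

definition L2lim :: "'a measure => (nat => 'a => 'b::euclidean_space) => ('a => 'b) => bool" where
 "L2lim M F f \<longleftrightarrow> (\<forall>n. sq M (F n)) & sq M f & (%n. nrm2 M (%x. F n x - f x)) \<longlonglongrightarrow> 0"

lemma L2limD:
 assumes "L2lim M F f"
 shows "sq M (F n)" "sq M f" "(%n. nrm2 M (%x. F n x - f x)) \<longlonglongrightarrow> 0"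
 using assms by (auto simp: L2lim_def)

lemma L2lim_subseq: "L2lim M F f ==> strict_mono r ==> L2lim M (%n. F (r n)) f"
 unfolding L2lim_def by (auto dest: LIMSEQ_subseq_LIMSEQ simp: o_def)

lemma L2lim_const: "sq M f ==> L2lim M (%_. f) f"
 by (simp add: L2lim_def)

lemma L2lim_squeeze:
 assumes "!!n. sq M (F n)" "sq M f" "!!n. nrm2 M (%x. F n x - f x) <= e n" "e \<longlonglongrightarrow> 0"
 shows "L2lim M F f"
proof -
 have "(%n. nrm2 M (%x. F n x - f x)) \<longlonglongrightarrow> 0"
  by (rule Lim_null_comparison[OF _ assms(4)]) (simp add: assms(3))
 with assms(1,2) show ?thesis by (simp add: L2lim_def)
qed

lemma L2lim_add:
 assumes "L2lim M F f" "L2lim M H h"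
 shows "L2lim M (%n x. F n x + H n x) (%x. f x + h x)"
proof (rule L2lim_squeeze)
 note A = L2limD[OF assms(1)] and B = L2limD[OF assms(2)]
 show "sq M (%x. F n x + H n x)" for n by (intro sq_add A B)
 show "sq M (%x. f x + h x)" by (intro sq_add A B)
 show "nrm2 M (%x. F n x + H n x - (f x + h x))
   <= nrm2 M (%x. F n x - f x) + nrm2 M (%x. H n x - h x)" for n
  using nrm2_triangle[OF sq_diff[OF A(1,2)] sq_diff[OF B(1,2)], of n n]
  by (simp add: add_diff_add)
 show "(%n. nrm2 M (%x. F n x - f x) + nrm2 M (%x. H n x - h x)) \<longlonglongrightarrow> 0"
  by (rule tendsto_add_zero[OF A(3) B(3)])
qed

lemma L2lim_uminus:
 assumes "L2lim M F f"
 shows "L2lim M (%n x. - F n x) (%x. - f x)"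
proof (rule L2lim_squeeze)
 note A = L2limD[OF assms(1)]
 show "sq M (%x. - F n x)" for n by (intro sq_uminus A)
 show "sq M (%x. - f x)" by (intro sq_uminus A)
 show "nrm2 M (%x. - F n x - - f x) <= nrm2 M (%x. F n x - f x)" for n
 proof -
  have "(%x. - F n x - - f x) = (%x. - (F n x - f x))" by (simp add: fun_eq_iff)
  thus ?thesis by (simp only: nrm2_uminus order_refl)
 qed
 show "(%n. nrm2 M (%x. F n x - f x)) \<longlonglongrightarrow> 0"
  by (rule A(3))
qed

lemma L2lim_diff:
 "L2lim M F f ==> L2lim M H h ==> L2lim M (%n x. F n x - H n x) (%x. f x - h x)"
 using L2lim_add[of M F f "%n x. - H n x" "%x. - h x"] L2lim_uminus[of M H h] by simp

lemma L2lim_sum: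
 "(!!i. i \<in> I ==> L2lim M (F i) (f i)) ==> L2lim M (%n x. \<Sum>i\<in>I. F i n x) (%x. \<Sum>i\<in>I. f i x)"
proof (induction I rule: infinite_finite_induct)
 case (insert i I)
 thus ?case by (simp add: L2lim_add)
qed (auto intro: L2lim_const)

lemma L2lim_cong_AE:
 assumes "L2lim M F f" "g \<in> borel_measurable M" "AE x in M. g x = f x"
 shows "L2lim M F g"
proof -
 have g: "sq M g" using assms sq_cong_AE L2limD by blast
 have "nrm2 M (%x. F n x - g x) = nrm2 M (%x. F n x - f x)" for n
 proof -
  note [measurable] = L2limD(1,2)[OF assms(1), THEN sq_meas] assms(2)
  show ?thesis by (rule nrm2_cong_AE) (measurable, use assms(3) in \<open>auto elim!: eventually_mono\<close>)
 qed
 thus ?thesis using assms(1) g by (simp add: L2lim_def)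
qed

lemma L2lim_norm:
 assumes "L2lim M F f"
 shows "(%n. nrm2 M (F n)) \<longlonglongrightarrow> nrm2 M f"
proof -
 note A = L2limD[OF assms]
 have "\<bar>nrm2 M (F n) - nrm2 M f\<bar> <= nrm2 M (%x. F n x - f x)" for n
  using nrm2_triangle_diff[OF A(1,2), of n] nrm2_triangle_diff[OF A(2) A(1), of n]
   nrm2_commute[of M f "F n"] by linarith
 hence "(%n. nrm2 M (F n) - nrm2 M f) \<longlonglongrightarrow> 0"
  by (intro Lim_null_comparison[OF _ A(3)]) auto
 thus ?thesis by (simp add: LIM_zero_iff)
qed

lemma L2lim_inner:
 assumes "L2lim M F f" "L2lim M H h"
 shows "(%n. LINT x|M. F n x \<bullet> H n x) \<longlonglongrightarrow> (LINT x|M. f x \<bullet> h x)"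
proof -
 note A = L2limD[OF assms(1)] and B = L2limD[OF assms(2)]
 have "\<bar>(LINT x|M. F n x \<bullet> H n x) - (LINT x|M. f x \<bullet> h x)\<bar>
   <= nrm2 M (%x. F n x - f x) * nrm2 M (H n) + nrm2 M f * nrm2 M (%x. H n x - h x)" for n
 proof -
  have "(LINT x|M. F n x \<bullet> H n x) - (LINT x|M. f x \<bullet> h x)
    = (LINT x|M. (F n x - f x) \<bullet> H n x) + (LINT x|M. f x \<bullet> (H n x - h x))"
   using sq_inner_integrable[OF A(1) B(1), of n n] sq_inner_integrable[OF A(2) B(1), of n]
    sq_inner_integrable[OF A(2) B(2)]
   by (simp add: inner_diff_left inner_diff_right)
  also have "\<bar>...\<bar> <= nrm2 M (%x. F n x - f x) * nrm2 M (H n) + nrm2 M f * nrm2 M (%x. H n x - h x)"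
   using inner_nrm2_bound[OF sq_diff[OF A(1,2)] B(1), of n n] inner_nrm2_bound[OF A(2) sq_diff[OF B(1,2)], of n]
   by linarith
  finally show ?thesis .
 qed
 note bd = this
 have "(%n. nrm2 M (%x. F n x - f x) * nrm2 M (H n) + nrm2 M f * nrm2 M (%x. H n x - h x))
   \<longlonglongrightarrow> 0 * nrm2 M h + nrm2 M f * 0"
  by (rule tendsto_add[OF tendsto_mult[OF A(3) L2lim_norm[OF assms(2)]] tendsto_mult[OF tendsto_const B(3)]])
 hence lim: "(%n. nrm2 M (%x. F n x - f x) * nrm2 M (H n) + nrm2 M f * nrm2 M (%x. H n x - h x))
   \<longlonglongrightarrow> 0"
  by (simp only: mult_zero_left mult_zero_right add_0)
 have "(%n. (LINT x|M. F n x \<bullet> H n x) - (LINT x|M. f x \<bullet> h x)) \<longlonglongrightarrow> 0"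
  by (rule Lim_null_comparison[OF _ lim]) (use bd in simp)
 thus ?thesis by (simp add: LIM_zero_iff)
qed

lemma L2lim_AE_subseq:
 assumes "L2lim M F f"
 shows "\<exists>r::nat=>nat. strict_mono r & (AE x in M. (%n. F (r n) x) \<longlonglongrightarrow> f x)"
proof -
 note A = L2limD[OF assms]
 have I: "integrable M (%x. (norm (F n x - f x))^2)" for n
  using sq_diff[OF A(1,2)] by (simp add: sq_def)
 have "(%n. (nrm2 M (%x. F n x - f x))^2) \<longlonglongrightarrow> 0^2"
  by (intro tendsto_intros A)
 hence "(%n. LINT x|M. norm ((norm (F n x - f x))^2)) \<longlonglongrightarrow> 0"
  by (simp add: nrm2_square)
 from tendsto_L1_AE_subseq[OF I this] obtain r :: "nat => nat"
  where r: "strict_mono r" "AE x in M. (%n. (norm (F (r n) x - f x))^2) \<longlonglongrightarrow> 0" by blast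
 from r(2) have "AE x in M. (%n. F (r n) x) \<longlonglongrightarrow> f x"
 proof eventually_elim
  case (elim x)
  hence "(%n. sqrt ((norm (F (r n) x - f x))^2)) \<longlonglongrightarrow> sqrt 0"
   by (rule tendsto_real_sqrt)
  hence "(%n. F (r n) x - f x) \<longlonglongrightarrow> 0"
   by (simp add: tendsto_norm_zero_iff)
  thus ?case by (simp add: LIM_zero_iff)
 qed
 with r(1) show ?thesis by blast
qed

text \<open>Split \<open>b n F n - c f\<close> into \<open>b n (F n - f)\<close>, controlled by the
  bound C, and \<open>(b n - c) f\<close>, which tends to 0 by dominated convergence with majorant
  \<open>(2 C |f|)^2\<close>. This is the device by which nonlinear expressions in smooth
  approximants are passed to the limit.\<close>

lemma L2lim_bounded_mult:
 assumes L: "L2lim M F f" and b: "!!n. b n \<in> borel_measurable M" "c \<in> borel_measurable M"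
  and bd: "!!n. AE x in M. \<bar>b n x\<bar> <= C" and lim: "AE x in M. (%n. b n x) \<longlonglongrightarrow> c x"
 shows "L2lim M (%n x. b n x *\<^sub>R F n x) (%x. c x *\<^sub>R f x)"
proof -
 note A = L2limD[OF L]
 note [measurable] = b sq_meas[OF A(1)] sq_meas[OF A(2)]
 have all: "AE x in M. \<forall>n. \<bar>b n x\<bar> <= C"
  using bd by (simp add: AE_all_countable)
 have cb: "AE x in M. \<bar>c x\<bar> <= C"
  using all lim
 proof eventually_elim
  case (elim x)
  thus ?case
   by (intro LIMSEQ_le_const2[of "%n. \<bar>b n x\<bar>"] tendsto_rabs) auto
 qed
 have dct: "(%n. LINT x|M. (norm ((b n x - c x) *\<^sub>R f x))^2) \<longlonglongrightarrow> (LINT x|M. 0)"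
 proof (rule integral_dominated_convergence[where w = "%x. (2 * C)^2 * (norm (f x))^2"])
  show "integrable M (%x. (2 * C)^2 * (norm (f x))^2)"
   using A(2) by (simp add: sq_def)
  show "AE x in M. (%n. (norm ((b n x - c x) *\<^sub>R f x))^2) \<longlonglongrightarrow> 0"
   using lim
  proof eventually_elim
   case (elim x)
   have "(%n. (norm ((b n x - c x) *\<^sub>R f x))^2) \<longlonglongrightarrow> (norm ((c x - c x) *\<^sub>R f x))^2"
    by (intro tendsto_intros elim)
   thus ?case by simp
  qed
  show "AE x in M. norm ((norm ((b n x - c x) *\<^sub>R f x))^2) <= (2 * C)^2 * (norm (f x))^2" for n
   using all cb
  proof eventually_elim
   case (elim x)
   have "\<bar>b n x - c x\<bar> <= 2 * C" using elim(1)[THEN spec, of n] elim(2) by linarith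
   hence "\<bar>b n x - c x\<bar>^2 <= (2 * C)^2" by (intro power_mono) auto
   thus ?case by (simp add: power_mult_distrib mult_right_mono)
  qed
 qed measurable
 have 1: "L2lim M (%n x. (b n x - c x) *\<^sub>R f x) (%x. 0)"
  unfolding L2lim_def
 proof (intro conjI allI)
  show "sq M (%x. (b n x - c x) *\<^sub>R f x)" for n
  proof (rule sq_bmult[OF A(2), where C = "2 * C"])
   show "AE x in M. \<bar>b n x - c x\<bar> <= 2 * C"
    using bd[of n] cb by eventually_elim linarith
  qed measurable
  show "(%n. nrm2 M (%x. (b n x - c x) *\<^sub>R f x - 0)) \<longlonglongrightarrow> 0"
   using tendsto_real_sqrt[OF dct] by (simp add: nrm2_def)
 qed simp
 have C0: "0 <= C \<or> (AE x in M. False)"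
 by (smt (verit, ccfv_SIG) AE_cong cb)
 have 2: "L2lim M (%n x. b n x *\<^sub>R (F n x - f x)) (%x. 0)"
 proof (rule L2lim_squeeze[where e = "%n. \<bar>C\<bar> * nrm2 M (%x. F n x - f x)"])
  show "sq M (%x. b n x *\<^sub>R (F n x - f x))" for n
   by (rule sq_bmult[OF sq_diff[OF A(1,2)] b(1) bd])
  show "nrm2 M (%x. b n x *\<^sub>R (F n x - f x) - 0) <= \<bar>C\<bar> * nrm2 M (%x. F n x - f x)" for n
  proof (rule nrm2_dominated[OF sq_diff[OF A(1,2)]])
   show "AE x in M. norm (b n x *\<^sub>R (F n x - f x) - 0) <= \<bar>C\<bar> * norm (F n x - f x)"
    using bd[of n] by eventually_elim (auto intro!: mult_right_mono)
  qed auto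
  show "(%n. \<bar>C\<bar> * nrm2 M (%x. F n x - f x)) \<longlonglongrightarrow> 0"
   using tendsto_mult[OF tendsto_const A(3), of "\<bar>C\<bar>"] by simp
 qed simp
 have 3: "L2lim M (%n x. c x *\<^sub>R f x) (%x. c x *\<^sub>R f x)"
  by (intro L2lim_const sq_bmult[OF A(2) b(2) cb])
 show ?thesis
  using L2lim_add[OF L2lim_add[OF 2 1] 3] by (simp add: algebra_simps)
qed

lemma L2lim_bmult:
 assumes "L2lim M F f" "b \<in> borel_measurable M" "AE x in M. \<bar>b x\<bar> <= C"
 shows "L2lim M (%n x. b x *\<^sub>R F n x) (%x. b x *\<^sub>R f x)"
 by (rule L2lim_bounded_mult[where C = C]) (use assms in auto)

lemma L2lim_vec:
 assumes "!!i. L2lim M (%n x. (F n x :: real^'n) $ i) (%x. f x $ i)" shows "L2lim M F f"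
proof -
 have "L2lim M (%n x. \<Sum>i\<in>UNIV. F n x $ i *\<^sub>R (axis i 1 :: real^'n)) (%x. \<Sum>i\<in>UNIV. f x $ i *\<^sub>R (axis i 1 :: real^'n))"
 proof (intro L2lim_sum)
  fix i :: 'n assume "i \<in> UNIV"
  note A = L2limD[OF assms[of i]]
  show "L2lim M (%n x. F n x $ i *\<^sub>R (axis i 1 :: real^'n)) (%x. f x $ i *\<^sub>R (axis i 1 :: real^'n))"
  proof (rule L2lim_squeeze)
   show "sq M (%x. F n x $ i *\<^sub>R (axis i 1 :: real^'n))" for n
    by (rule sq_dominated[OF A(1)[of n], where C = 1]) (use sq_meas[OF A(1)[of n]] in \<open>auto\<close>)
   show "sq M (%x. f x $ i *\<^sub>R (axis i 1 :: real^'n))"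
    by (rule sq_dominated[OF A(2), where C = 1]) (use sq_meas[OF A(2)] in \<open>auto\<close>)
   show "nrm2 M (%x. F n x $ i *\<^sub>R (axis i 1 :: real^'n) - f x $ i *\<^sub>R (axis i 1 :: real^'n)) <= nrm2 M (%x. F n x $ i - f x $ i)" for n
    by (simp add: nrm2_def flip: scaleR_diff_left)
  qed (rule A)
 qed
 also have "(%n x. \<Sum>i\<in>UNIV. F n x $ i *\<^sub>R (axis i 1 :: real^'n)) = F"
  using basis_expansion[of "F _ _"] by (auto simp: scalar_mult_eq_scaleR)
 also have "(%x. \<Sum>i\<in>UNIV. f x $ i *\<^sub>R (axis i 1 :: real^'n)) = f"
  using basis_expansion[of "f _"] by (auto simp: scalar_mult_eq_scaleR)
 finally show ?thesis .
qed

text \<open>The norm of a matrix is here the Euclidean norm of its vector of rows, that is the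
  Hilbert-Schmidt norm; Cauchy-Schwarz on each row suffices.\<close>

lemma norm_matvec_le: "norm ((A :: real^'n^'m) *v x) <= norm A * norm x"
proof -
 have "norm (A *v x) <= norm (\<chi> i. norm (A $ i) * norm x)"
 proof (rule norm_le_componentwise_cart)
  fix i
  have "(A *v x) $ i = A $ i \<bullet> x"
   by (simp add: matrix_vector_mult_def inner_vec_def)
  thus "norm ((A *v x) $ i) <= norm ((\<chi> i. norm (A $ i) * norm x) $ i)"
   by (simp add: abs_mult Cauchy_Schwarz_ineq2)
 qed
 also have "(\<chi> i. norm (A $ i) * norm x) = norm x *\<^sub>R (\<chi> i. norm (A $ i))"
  by (simp add: vec_eq_iff)
 also have "norm (...) = norm A * norm x"
  by (simp add: norm_vec_def[where 'a = "real^'n"] norm_vec_def[of "\<chi> i. norm (A $ i)"])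
 finally show ?thesis .
qed

lemma measurable_matvec [measurable]:
 assumes "A \<in> borel_measurable M" "f \<in> borel_measurable M"
 shows "(%x. (A x :: real^'n^'m) *v f x) \<in> borel_measurable M"
proof -
 have c: "continuous_on UNIV (%p :: (real^'n^'m) \<times> (real^'n). fst p *v snd p)"
  unfolding matrix_vector_mult_def by (intro continuous_intros)
 have "(%x. (A x, f x)) \<in> borel_measurable M" using assms by measurable
 from borel_measurable_continuous_on[OF c this] show ?thesis by simp
qed

lemma sq_matvec:
 assumes "A \<in> borel_measurable M" "AE x in M. norm (A x) <= C" "sq M f"
 shows "sq M (%x. (A x :: real^'n^'m) *v f x)"
proof (rule sq_dominated[OF assms(3), where C = C])
 show "(%x. A x *v f x) \<in> borel_measurable M" using assms sq_meas by measurable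
 show "AE x in M. norm (A x *v f x) <= C * norm (f x)"
  using assms(2) by eventually_elim (meson mult_right_mono norm_ge_zero norm_matvec_le order_trans)
qed

lemma nrm2_matvec:
 assumes "A \<in> borel_measurable M" "AE x in M. norm (A x) <= C" "sq M f" "0 <= C"
 shows "nrm2 M (%x. (A x :: real^'n^'m) *v f x) <= C * nrm2 M f"
proof (rule nrm2_dominated[OF assms(3)])
 show "(%x. A x *v f x) \<in> borel_measurable M" using assms sq_meas by measurable
 show "AE x in M. norm (A x *v f x) <= C * norm (f x)"
  using assms(2) by eventually_elim (meson mult_right_mono norm_ge_zero norm_matvec_le order_trans)
qed fact

section \<open>Passing between the whole plane and its measurable subsets\<close>

lemma sq_lebesgue_on:
 fixes f :: "'a::euclidean_space => 'b::euclidean_space"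
 assumes "S \<in> sets leb"
 shows "sq (lebesgue_on S) f \<longleftrightarrow> sq leb (%x. indicator S x *\<^sub>R f x)"
proof -
 have "(norm (indicator S x *\<^sub>R f x))^2 = indicator S x *\<^sub>R (norm (f x))^2" for x
  by (simp add: indicator_def)
 thus ?thesis
  using assms by (simp add: sq_def borel_measurable_restrict_space_iff integrable_restrict_space)
qed

lemma nrm2_lebesgue_on:
 fixes f :: "'a::euclidean_space => 'b::euclidean_space"
 assumes "S \<in> sets leb"
 shows "nrm2 (lebesgue_on S) f = nrm2 leb (%x. indicator S x *\<^sub>R f x)"
proof -
 have "(norm (indicator S x *\<^sub>R f x))^2 = indicator S x *\<^sub>R (norm (f x))^2" for x
  by (simp add: indicator_def)
 thus ?thesis
  using assms by (simp add: nrm2_def integral_restrict_space)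
qed

lemma L2lim_lebesgue_on:
 fixes f :: "'a::euclidean_space => 'b::euclidean_space"
 assumes "S \<in> sets leb"
 shows "L2lim (lebesgue_on S) F f \<longleftrightarrow>
  L2lim leb (%n x. indicator S x *\<^sub>R F n x) (%x. indicator S x *\<^sub>R f x)"
 using assms by (simp add: L2lim_def sq_lebesgue_on nrm2_lebesgue_on scaleR_diff_right)

lemma sq_subset:
 fixes f :: "'a::euclidean_space => 'b::euclidean_space"
 assumes "S \<in> sets leb" "T \<in> sets leb" "T \<subseteq> S" "sq (lebesgue_on S) f"
 shows "sq (lebesgue_on T) f"
proof -
 have "sq leb (%x. indicator T x *\<^sub>R (indicator S x *\<^sub>R f x))"
  by (rule sq_bmult[where C = 1]) (use assms in \<open>auto simp: sq_lebesgue_on indicator_def\<close>)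
 also have "(%x. indicator T x *\<^sub>R (indicator S x *\<^sub>R f x)) = (%x. indicator T x *\<^sub>R f x)"
  using assms(3) by (auto simp: indicator_def fun_eq_iff)
 finally show ?thesis using assms by (simp add: sq_lebesgue_on)
qed

lemma nrm2_subset:
 fixes f :: "'a::euclidean_space => 'b::euclidean_space"
 assumes "S \<in> sets leb" "T \<in> sets leb" "T \<subseteq> S" "sq (lebesgue_on S) f"
 shows "nrm2 (lebesgue_on T) f <= nrm2 (lebesgue_on S) f"
proof -
 note T = sq_subset[OF assms]
 have "nrm2 leb (%x. indicator T x *\<^sub>R f x) <= 1 * nrm2 leb (%x. indicator S x *\<^sub>R f x)"
  by (rule nrm2_dominated)
    (use assms T in \<open>auto simp: sq_lebesgue_on sq_meas indicator_def\<close>)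
 thus ?thesis using assms by (simp add: nrm2_lebesgue_on)
qed

lemma L2lim_subset:
 fixes f :: "'a::euclidean_space => 'b::euclidean_space"
 assumes "S \<in> sets leb" "T \<in> sets leb" "T \<subseteq> S" "L2lim (lebesgue_on S) F f"
 shows "L2lim (lebesgue_on T) F f"
proof -
 note A = L2limD[OF assms(4)]
 show ?thesis
  by (rule L2lim_squeeze[OF _ _ _ A(3)])
    (intro sq_subset[OF assms(1-3)] nrm2_subset[OF assms(1-3)] sq_diff A)+
qed

lemma integrable_mult_bounded:
 fixes u g :: "'a => real"
 assumes "integrable M u" "g \<in> borel_measurable M" "!!x. \<bar>g x\<bar> <= C"
 shows "integrable M (%x. u x * g x)"
proof (rule Bochner_Integration.integrable_bound)
 show "integrable M (%x. C * u x)" using assms by auto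
 show "(%x. u x * g x) \<in> borel_measurable M"
  using borel_measurable_integrable[OF assms(1)] assms(2) by measurable
 show "AE x in M. norm (u x * g x) <= norm (C * u x)"
 proof (rule AE_I2)
  fix x
  have "\<bar>u x\<bar> * \<bar>g x\<bar> <= \<bar>u x\<bar> * \<bar>C\<bar>" using assms(3)[of x] by (intro mult_left_mono) auto
  thus "norm (u x * g x) <= norm (C * u x)" by (simp add: abs_mult mult.commute)
 qed
qed

lemma sq_imp_integrable_finite:
 fixes f :: "'a => 'b::euclidean_space"
 assumes "sq M f" "emeasure M (space M) < \<infinity>"
 shows "integrable M f"
proof -
 have "sq M (%x. 1::real)" using assms(2) by (auto simp: sq_def integrable_iff_bounded)
 from sq_norm_mult_integrable[OF assms(1) this] have "integrable M (%x. norm (f x))" by simp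
 thus ?thesis using sq_meas[OF assms(1)] by (simp add: integrable_norm_iff)
qed

section \<open>Continuously differentiable functions\<close>

definition C1 :: "(R2 => real) => bool" where
 "C1 ph \<longleftrightarrow> (\<forall>x. ph differentiable (at x)) & continuous_on UNIV (grad ph)"

text \<open>Only one continuous derivative is asked for, since truncations and products of smoothed
  functions serve as test functions. Vanishing off some compact subset of \<open>U\<close> avoids
  handling closures of supports.\<close>

definition C1c :: "R2 set => (R2 => real) set" where
 "C1c U = {ph. C1 ph & (\<exists>K. compact K & K \<subseteq> U & (\<forall>x. x ~: K --> ph x = 0))}"

lemma linear_functional_R2: "linear f ==> f (h :: R2) = h \<bullet> (\<chi> i. f (axis i 1))" for f :: "R2 => real"
proof -
 assume f: "linear f"
 have "f h = f (\<Sum>i\<in>UNIV. h $ i *\<^sub>R axis i 1)"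
  using basis_expansion[of h] by (simp add: scalar_mult_eq_scaleR)
 also have "... = (\<Sum>i\<in>UNIV. h $ i * f (axis i 1))"
  using f by (simp add: linear_sum linear_scale)
 finally show ?thesis by (simp add: inner_vec_def)
qed

lemma differentiable_GDERIV: "ph differentiable (at x) ==> GDERIV ph x :> grad ph x"
proof -
 assume "ph differentiable (at x)"
 hence d: "(ph has_derivative frechet_derivative ph (at x)) (at x)"
  by (simp add: frechet_derivative_works)
 hence "frechet_derivative ph (at x) = (%h. h \<bullet> grad ph x)"
  unfolding grad_def using linear_functional_R2 has_derivative_linear by blast
 thus ?thesis using d unfolding gderiv_def by simp
qed

lemma GDERIV_differentiable: "GDERIV ph x :> D ==> ph differentiable (at x)"
 by (auto simp: gderiv_def differentiable_def)

lemma GDERIV_unique: "GDERIV ph x :> D ==> grad ph x = D"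
proof -
 assume D: "GDERIV ph x :> D"
 hence "(%h. h \<bullet> grad ph x) = (%h. h \<bullet> D)"
  using differentiable_GDERIV[OF GDERIV_differentiable[OF D]]
  by (auto simp: gderiv_def intro: has_derivative_unique)
 hence "(grad ph x - D) \<bullet> (grad ph x - D) = 0"
  by (metis inner_diff_right right_minus_eq)
 thus ?thesis by simp
qed

lemma C1I:
 assumes "!!x. GDERIV ph x :> g x" "continuous_on UNIV g"
 shows "C1 ph" "grad ph = g"
proof -
 show "grad ph = g" using GDERIV_unique[OF assms(1)] by auto
 thus "C1 ph" using assms GDERIV_differentiable by (auto simp: C1_def)
qed

lemma C1D:
 assumes "C1 ph"
 shows "GDERIV ph x :> grad ph x" "continuous_on UNIV (grad ph)" "continuous_on UNIV ph"
 using assms unfolding C1_def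
 by (auto intro: differentiable_GDERIV simp: continuous_at_imp_continuous_on differentiable_imp_continuous_within)

lemma C1_measurable:
 assumes "C1 ph" shows "ph \<in> borel_measurable borel" "grad ph \<in> borel_measurable borel"
 using C1D[OF assms] by (auto intro: borel_measurable_continuous_onI)

lemma continuous_on_componentwise_cart:
 fixes f :: "'a::topological_space => real^'n"
 shows "continuous_on S f \<longleftrightarrow> (\<forall>i. continuous_on S (%x. f x $ i))"
proof
 assume "\<forall>i. continuous_on S (%x. f x $ i)"
 hence "continuous_on S (%x. \<chi> i. f x $ i)" by (intro continuous_on_vec_lambda) auto
 thus "continuous_on S f" by simp
qed (auto intro: continuous_intros)

lemma C1_const [simp]: "C1 (%x. c)" and grad_const [simp]: "grad (%x. c) = (%x. 0)"
 using C1I[of "%x. c" "%x. 0"] by (auto simp: GDERIV_const)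

lemma
 assumes "C1 f" "C1 g"
 shows C1_add: "C1 (%x. f x + g x)" and grad_add: "grad (%x. f x + g x) = (%x. grad f x + grad g x)"
  and C1_diff: "C1 (%x. f x - g x)" and grad_diff: "grad (%x. f x - g x) = (%x. grad f x - grad g x)"
  and C1_mult: "C1 (%x. f x * g x)"
  and grad_mult: "grad (%x. f x * g x) = (%x. f x *\<^sub>R grad g x + g x *\<^sub>R grad f x)"
proof -
 note D = C1D[OF assms(1)] C1D[OF assms(2)]
 have 1: "GDERIV (%x. f x + g x) x :> grad f x + grad g x" for x by (intro GDERIV_add D)
 have 2: "continuous_on UNIV (%x. grad f x + grad g x)" by (intro continuous_intros D)
 show "C1 (%x. f x + g x)" "grad (%x. f x + g x) = (%x. grad f x + grad g x)"
  using C1I[OF 1 2] by blast+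
 have 1: "GDERIV (%x. f x - g x) x :> grad f x - grad g x" for x by (intro GDERIV_diff D)
 have 2: "continuous_on UNIV (%x. grad f x - grad g x)" by (intro continuous_intros D)
 show "C1 (%x. f x - g x)" "grad (%x. f x - g x) = (%x. grad f x - grad g x)"
  using C1I[OF 1 2] by blast+
 have 1: "GDERIV (%x. f x * g x) x :> f x *\<^sub>R grad g x + g x *\<^sub>R grad f x" for x by (intro GDERIV_mult D)
 have 2: "continuous_on UNIV (%x. f x *\<^sub>R grad g x + g x *\<^sub>R grad f x)" by (intro continuous_intros D)
 show "C1 (%x. f x * g x)" "grad (%x. f x * g x) = (%x. f x *\<^sub>R grad g x + g x *\<^sub>R grad f x)"
  using C1I[OF 1 2] by blast+
qed

lemma
 assumes "C1 f"
 shows C1_cmult: "C1 (%x. c * f x)" and grad_cmult: "grad (%x. c * f x) = (%x. c *\<^sub>R grad f x)"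
  and C1_uminus: "C1 (%x. - f x)" and grad_uminus: "grad (%x. - f x) = (%x. - grad f x)"
 using C1_mult[OF C1_const assms] grad_mult[OF C1_const assms]
  C1_diff[OF C1_const assms, of 0] grad_diff[OF C1_const assms, of 0] by auto

lemma C1_sum:
 assumes "finite I" "!!i. i \<in> I ==> C1 (f i)"
 shows "C1 (%x. \<Sum>i\<in>I. f i x) & grad (%x. \<Sum>i\<in>I. f i x) = (%x. \<Sum>i\<in>I. grad (f i) x)"
 using assms by (induction I rule: finite_induct) (auto simp: C1_add grad_add)

lemma
 assumes "C1 f" "!!t. DERIV b t :> b' t" "continuous_on UNIV b'"
 shows C1_compose_real: "C1 (%x. b (f x))"
  and grad_compose_real: "grad (%x. b (f x)) = (%x. b' (f x) *\<^sub>R grad f x)"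
proof -
 note D = C1D[OF assms(1)]
 have 1: "GDERIV (%x. b (f x)) x :> b' (f x) *\<^sub>R grad f x" for x
  by (intro GDERIV_DERIV_compose D assms(2))
 have 2: "continuous_on UNIV (%x. b' (f x) *\<^sub>R grad f x)"
  by (intro continuous_intros continuous_on_compose2[OF assms(3)] D subset_UNIV)
 show "C1 (%x. b (f x))" "grad (%x. b (f x)) = (%x. b' (f x) *\<^sub>R grad f x)"
  using C1I[OF 1 2] by blast+
qed

lemma
 fixes om :: "R2 => R2"
 assumes "C1 Ph" "!!i. C1 (%x. om x $ i)"
 shows C1_compose: "C1 (%x. Ph (om x))"
  and grad_compose: "grad (%x. Ph (om x)) = (%x. \<Sum>i\<in>UNIV. grad Ph (om x) $ i *\<^sub>R grad (%x. om x $ i) x)"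
proof -
 have c: "continuous_on UNIV om"
  using C1D(3)[OF assms(2)] by (subst continuous_on_componentwise_cart) auto
 have "GDERIV (%x. Ph (om x)) x :> (\<Sum>i\<in>UNIV. grad Ph (om x) $ i *\<^sub>R grad (%x. om x $ i) x)" for x
 proof -
  have 1: "(om has_derivative (%h. \<chi> i. h \<bullet> grad (%x. om x $ i) x)) (at x)"
  proof (rule has_derivative_componentwise_within[THEN iffD2], rule ballI)
   fix b :: R2 assume "b \<in> Basis"
   then obtain i where b: "b = axis i 1" by (auto simp: Basis_vec_def)
   show "((%x. om x \<bullet> b) has_derivative (%h. (\<chi> i. h \<bullet> grad (%x. om x $ i) x) \<bullet> b)) (at x)"
    using C1D(1)[OF assms(2), of i x] unfolding b gderiv_def by (simp add: inner_axis)
  qed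
  have "((%x. Ph (om x)) has_derivative (%h. (\<chi> i. h \<bullet> grad (%x. om x $ i) x) \<bullet> grad Ph (om x))) (at x)"
   using has_derivative_compose[OF 1, of Ph "%h. h \<bullet> grad Ph (om x)"] C1D(1)[OF assms(1), of "om x"]
   by (simp add: gderiv_def)
  also have "(%h. (\<chi> i. h \<bullet> grad (%x. om x $ i) x) \<bullet> grad Ph (om x))
   = (%h. h \<bullet> (\<Sum>i\<in>UNIV. grad Ph (om x) $ i *\<^sub>R grad (%x. om x $ i) x))"
  proof
   fix h :: R2
   have "(\<chi> i. h \<bullet> grad (%x. om x $ i) x) \<bullet> grad Ph (om x) = (\<Sum>i\<in>UNIV. (h \<bullet> grad (%x. om x $ i) x) * grad Ph (om x) $ i)"
    by (subst inner_vec_def) simp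
   thus "(\<chi> i. h \<bullet> grad (%x. om x $ i) x) \<bullet> grad Ph (om x)
    = h \<bullet> (\<Sum>i\<in>UNIV. grad Ph (om x) $ i *\<^sub>R grad (%x. om x $ i) x)"
    by (simp only: inner_sum_right inner_scaleR_right mult.commute)
  qed
  finally show ?thesis by (simp add: gderiv_def)
 qed
 moreover have "continuous_on UNIV (%x. \<Sum>i\<in>UNIV. grad Ph (om x) $ i *\<^sub>R grad (%x. om x $ i) x)"
  by (intro continuous_intros C1D(2) assms continuous_on_compose2[OF C1D(2)[OF assms(1)] c]) auto
 ultimately show "C1 (%x. Ph (om x))"
  "grad (%x. Ph (om x)) = (%x. \<Sum>i\<in>UNIV. grad Ph (om x) $ i *\<^sub>R grad (%x. om x $ i) x)"
  by (rule C1I)+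
qed

lemma
 assumes "C1 f"
 shows C1_affine: "C1 (%x. f (a + b *\<^sub>R x))"
  and grad_affine: "grad (%x. f (a + b *\<^sub>R x)) = (%x. b *\<^sub>R grad f (a + b *\<^sub>R x))"
proof -
 have "GDERIV (%x. f (a + b *\<^sub>R x)) x :> b *\<^sub>R grad f (a + b *\<^sub>R x)" for x
 proof -
  have "((%x. a + b *\<^sub>R x) has_derivative (%h. b *\<^sub>R h)) (at x)"
   by (auto intro!: derivative_eq_intros)
  from has_derivative_compose[OF this, of f "%h. h \<bullet> grad f (a + b *\<^sub>R x)"] C1D(1)[OF assms, of "a + b *\<^sub>R x"]
  show ?thesis by (simp add: gderiv_def mult.commute)
 qed
 moreover have "continuous_on UNIV (%x. b *\<^sub>R grad f (a + b *\<^sub>R x))"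
  by (intro continuous_intros continuous_on_compose2[OF C1D(2)[OF assms]]) auto
 ultimately show "C1 (%x. f (a + b *\<^sub>R x))"
  "grad (%x. f (a + b *\<^sub>R x)) = (%x. b *\<^sub>R grad f (a + b *\<^sub>R x))"
  by (rule C1I)+
qed

lemma C_k_continuous: "C_k k f ==> continuous_on UNIV f"
 by (cases k) (auto simp: continuous_at_imp_continuous_on differentiable_imp_continuous_within)

lemma C_k_C1: "C_k (Suc k) f ==> C1 f"
proof -
 assume f: "C_k (Suc k) f"
 hence "continuous_on UNIV (%x. grad f x $ i)" for i by (auto intro: C_k_continuous)
 thus ?thesis using f by (subst C1_def, subst continuous_on_componentwise_cart) auto
qed

lemma C_k_add: "C_k k f ==> C_k k g ==> C_k k (%x. f x + g x)"
proof (induction k arbitrary: f g)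
 case 0 thus ?case by (auto intro: continuous_intros)
next
 case (Suc k)
 note C = C_k_C1[OF Suc.prems(1)] C_k_C1[OF Suc.prems(2)]
 show ?case
  using Suc C1_add[OF C] by (auto simp: grad_add[OF C] C1_def)
qed

lemma C_k_cmult: "C_k k f ==> C_k k (%x. c * f x)"
proof (induction k arbitrary: f)
 case 0 thus ?case by (auto intro: continuous_intros)
next
 case (Suc k)
 note C = C_k_C1[OF Suc.prems(1)]
 show ?case
  using Suc C1_cmult[OF C, of c] by (auto simp: grad_cmult[OF C] C1_def)
qed

lemma C_k_affine: "C_k k f ==> C_k k (%x. f (a + b *\<^sub>R x))"
proof (induction k arbitrary: f)
 case 0 thus ?case by (auto intro!: continuous_on_compose2[of UNIV f] continuous_intros)
next
 case (Suc k)
 note C = C_k_C1[OF Suc.prems(1)]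
 show ?case
  using Suc C1_affine[OF C, of a b]
  by (auto simp: grad_affine[OF C] C1_def intro!: C_k_cmult)
qed

lemma test_functionsI:
 assumes "!!k. C_k k ph" "compact K" "K \<subseteq> U" "!!x. x ~: K ==> ph x = 0"
 shows "ph \<in> test_functions U"
proof -
 have "closure {x. ph x ~= 0} \<subseteq> K"
  by (rule closure_minimal) (use assms compact_imp_closed in auto)
 thus ?thesis
  unfolding test_functions_def using assms
  by (auto intro: compact_closure[THEN iffD2] bounded_subset[OF compact_imp_bounded] simp: closure_subset)
qed

lemma test_functionsE:
 assumes "ph \<in> test_functions U"
 obtains K where "compact K" "K \<subseteq> U" "!!x. x ~: K ==> ph x = 0"
proof
 show "compact (closure {x. ph x ~= 0})" "closure {x. ph x ~= 0} \<subseteq> U"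
  using assms by (auto simp: test_functions_def)
 show "ph x = 0" if "x ~: closure {x. ph x ~= 0}" for x
  using that closure_subset[of "{x. ph x ~= 0}"] by auto
qed

lemma test_functions_C_k: "ph \<in> test_functions U ==> C_k k ph"
 by (auto simp: test_functions_def)

lemma test_functions_C1: "ph \<in> test_functions U ==> C1 ph"
 by (rule C_k_C1[of 0]) (rule test_functions_C_k)

lemma test_functions_C1c: "ph \<in> test_functions U ==> ph \<in> C1c U"
by (smt (verit, del_insts) C1c_def mem_Collect_eq test_functionsE test_functions_C1)

lemma grad_eq_0_outside:
 assumes "compact K" "!!x. x ~: K ==> ph x = 0" "x ~: K"
 shows "grad ph x = 0"
proof (rule GDERIV_unique)
 have o: "open (- K)" using assms(1) compact_imp_closed by blast
 have "((%x. 0) has_derivative (%h. 0)) (at x)" by simp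
 hence "(ph has_derivative (%h. 0)) (at x)"
  by (rule has_derivative_transform_within_open[OF _ o]) (use assms in auto)
 thus "GDERIV ph x :> 0" by (simp add: gderiv_def)
qed

lemma test_functions_grad:
 assumes "ph \<in> test_functions U"
 shows "(%x. grad ph x $ i) \<in> test_functions U"
proof -
 obtain K where K: "compact K" "K \<subseteq> U" "!!x. x ~: K ==> ph x = 0"
  using test_functionsE[OF assms] by metis
 show ?thesis
 proof (rule test_functionsI[OF _ K(1,2)])
  show "C_k k (%x. grad ph x $ i)" for k
   using test_functions_C_k[OF assms, of "Suc k"] by simp
  show "grad ph x $ i = 0" if "x ~: K" for x
   using grad_eq_0_outside[OF K(1,3) that] by simp
 qed
qed

lemma uniformly_continuous_compact_support:
 fixes f :: "R2 => 'b::real_normed_vector"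
 assumes "continuous_on UNIV f" "!!x. x ~: K ==> f x = 0" "compact K"
 shows "uniformly_continuous_on UNIV f"
proof -
 obtain r where r: "K \<subseteq> cball 0 r" using bounded_subset_ballD[OF compact_imp_bounded[OF assms(3)], of 0] ball_subset_cball by blast
 have "uniformly_continuous_on (cball 0 (r + 1)) f"
  by (intro compact_uniformly_continuous continuous_on_subset[OF assms(1)]) auto
 show ?thesis
  unfolding uniformly_continuous_on_def
 proof (intro allI impI)
  fix e :: real assume e: "e > 0"
  with \<open>uniformly_continuous_on (cball 0 (r + 1)) f\<close> obtain d where d: "d > 0"
   "!!x x'. x \<in> cball 0 (r + 1) ==> x' \<in> cball 0 (r + 1) ==> dist x' x < d ==> dist (f x') (f x) < e"
   unfolding uniformly_continuous_on_def by meson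
  \<comment> \<open>The cap 1 on the distance: if one of the points leaves the ball of radius r + 1,
    both lie outside the ball of radius r, hence outside \<open>K\<close>, and both values are
    0.\<close>
  have "dist (f x') (f x) < e" if "dist x' x < min d 1" for x x'
  proof (cases "x \<in> cball 0 (r + 1) & x' \<in> cball 0 (r + 1)")
   case True thus ?thesis using d that by auto
  next
   case False
   have "norm x' <= norm x + dist x' x" "norm x <= norm x' + dist x' x"
    by (metis add.commute dist_commute dist_norm norm_triangle_sub)+
   hence "x ~: K" "x' ~: K" using False r that by fastforce+
   thus ?thesis using assms(2) e by simp
  qed
  thus "\<exists>d>0. \<forall>x\<in>UNIV. \<forall>x'\<in>UNIV. dist x' x < d --> dist (f x') (f x) < e"
   using d(1) by (intro exI[of _ "min d 1"]) auto
 qed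
qed

lemma bounded_compact_support:
 fixes f :: "R2 => 'b::real_normed_vector"
 assumes "continuous_on UNIV f" "!!x. x ~: K ==> f x = 0" "compact K"
 obtains B where "B > 0" "!!x. norm (f x) <= B"
proof -
 have "bounded (f ` K)" using assms by (intro compact_imp_bounded compact_continuous_image) (auto intro: continuous_on_subset)
 then obtain B where B: "B > 0" "!!x. x \<in> K ==> norm (f x) <= B" by (auto simp: bounded_pos)
 show ?thesis
 proof (rule that[OF B(1)])
  fix x show "norm (f x) <= B"
   using B assms(2)[of x] by (cases "x \<in> K") auto
 qed
qed

text \<open>Mean value theorem along the segment, with uniform continuity of the gradient. The
  uniformity in the base point is the purpose: the error can be integrated, which gives
  differentiation of convolutions and the vanishing of integrals of gradients.\<close>

lemma C1_uniform_first_order: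
 assumes "C1 g" "compact K" "!!x. x ~: K ==> g x = 0" "e > 0"
 obtains d where "d > 0" "!!z h. norm h < d ==> \<bar>g (z + h) - g z - h \<bullet> grad g z\<bar> <= e * norm h"
proof -
 note D = C1D[OF assms(1)]
 have "uniformly_continuous_on UNIV (grad g)"
  by (rule uniformly_continuous_compact_support[OF D(2) grad_eq_0_outside[OF assms(2,3)] assms(2)])
 then obtain d where d: "d > 0" "!!x x'. dist x' x < d ==> dist (grad g x') (grad g x) < e"
  using assms(4) unfolding uniformly_continuous_on_def by (metis UNIV_I)
 show ?thesis
 proof (rule that[OF d(1)])
  fix z h :: R2 assume h: "norm h < d"
  have der: "DERIV (%t. g (z + t *\<^sub>R h)) t :> h \<bullet> grad g (z + t *\<^sub>R h)" for t :: real
  proof -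
   have "((%t. z + t *\<^sub>R h) has_derivative (%s. s *\<^sub>R h)) (at t)"
    by (auto intro!: derivative_eq_intros)
   from has_derivative_compose[OF this, of g "%k. k \<bullet> grad g (z + t *\<^sub>R h)"] D(1)[of "z + t *\<^sub>R h"]
   show ?thesis unfolding gderiv_def has_field_derivative_def
    by (simp add: mult_commute_abs)
  qed
  obtain t :: real where t: "0 < t" "t < 1" "g (z + 1 *\<^sub>R h) - g (z + 0 *\<^sub>R h) = (1 - 0) * (h \<bullet> grad g (z + t *\<^sub>R h))"
   using MVT2[of 0 1 "%t. g (z + t *\<^sub>R h)" "%t. h \<bullet> grad g (z + t *\<^sub>R h)"] der by auto
  hence "g (z + h) - g z - h \<bullet> grad g z = h \<bullet> (grad g (z + t *\<^sub>R h) - grad g z)"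
   by (simp add: inner_diff_right)
  also have "\<bar>...\<bar> <= norm h * norm (grad g (z + t *\<^sub>R h) - grad g z)"
   by (rule Cauchy_Schwarz_ineq2)
  also have "... <= norm h * e"
  proof (intro mult_left_mono)
   have "norm (t *\<^sub>R h) < d"
   proof -
    have "t * norm h <= 1 * norm h" using t by (intro mult_right_mono) auto
    thus ?thesis using h t by (simp only: norm_scaleR abs_of_pos[OF t(1)])
   qed
   thus "norm (grad g (z + t *\<^sub>R h) - grad g z) <= e"
    using d(2)[of "z + t *\<^sub>R h" z] by (simp add: dist_norm)
  qed simp
  finally show "\<bar>g (z + h) - g z - h \<bullet> grad g z\<bar> <= e * norm h" by (simp add: mult.commute)
 qed
qed

section \<open>Smooth bump functions\<close>

text \<open>For \<open>m = 0\<close> this is the flat function exp(-1/t). The powers of 1/t make the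
  family closed under differentiation up to linear combinations, so smoothness of every order
  follows by one induction.\<close>

definition expo :: "nat => real => real" where
 "expo m t = (if t > 0 then (1 / t) ^ m * exp (- (1 / t)) else 0)"

lemma DERIV_expo: "DERIV (expo m) t :> expo (m + 2) t - real m * expo (m + 1) t"
proof -
 consider "t > 0" | "t < 0" | "t = 0" by linarith
 thus ?thesis
 proof cases
  case 1
  define u where "u = 1 / t"
  have u: "DERIV (%t. 1 / t) t :> - (u * u)"
   using 1 by (auto intro!: derivative_eq_intros simp: u_def)
  have e: "DERIV (%t. exp (- (1 / t))) t :> exp (- u) * (u * u)"
   using DERIV_fun_exp[OF DERIV_minus[OF u]] by (simp add: u_def)
  have p: "DERIV (%t. (1 / t) ^ m) t :> real m * u ^ (m - Suc 0) * - (u * u)"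
   using DERIV_power[OF u, of m] by (simp add: u_def)
  have "real m * u ^ (m - Suc 0) * - (u * u) = - real m * u ^ (m + 1)"
   by (cases m) (auto simp: algebra_simps)
  with p have p: "DERIV (%t. (1 / t) ^ m) t :> - real m * u ^ (m + 1)" by (rule DERIV_cong)
  have "DERIV (%t. (1 / t) ^ m * exp (- (1 / t))) t :> expo (m + 2) t - real m * expo (m + 1) t"
   using DERIV_mult[OF p e] 1 by (simp add: expo_def u_def algebra_simps)
  thus ?thesis
   by (rule has_field_derivative_transform_within_open[where S = "{0<..}"])
     (use 1 in \<open>auto simp: expo_def\<close>)
 next
  case 2
  have "DERIV (%t::real. 0::real) t :> 0" by simp
  hence "DERIV (expo m) t :> 0"
   by (rule has_field_derivative_transform_within_open[where S = "{..<0}"])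
     (use 2 in \<open>auto simp: expo_def\<close>)
  thus ?thesis using 2 by (simp add: expo_def)
 next
  case 3
  \<comment> \<open>The substitution h = 1/x turns the difference quotient at 0 into x^(m+1) / exp
    x.\<close>
  have "((%h. (expo m h - expo m 0) / h) \<longlongrightarrow> 0) (at_right 0)"
   unfolding filterlim_at_right_to_top
  proof (rule Lim_transform_eventually)
   show "((%x. x ^ (m + 1) / exp x) \<longlongrightarrow> (0::real)) at_top" by (rule tendsto_power_div_exp_0)
   show "\<forall>\<^sub>F x in at_top. x ^ (m + 1) / exp x = (expo m (inverse x) - expo m 0) / inverse x"
    using eventually_gt_at_top[of 0]
    by eventually_elim (simp add: expo_def exp_minus field_simps)
  qed
  moreover have "((%h. (expo m h - expo m 0) / h) \<longlongrightarrow> 0) (at_left 0)"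
   by (rule Lim_transform_eventually[OF tendsto_const])
     (auto simp: expo_def eventually_at_filter)
  ultimately have "((%h. (expo m h - expo m 0) / h) \<longlongrightarrow> 0) (at 0)"
   by (simp add: filterlim_at_split)
  hence "DERIV (expo m) 0 :> 0"
   by (simp add: DERIV_def)
  with 3 show ?thesis by (simp add: expo_def)
 qed
qed

text \<open>A product of four flat factors, nonzero exactly on the open square |x_1|, |x_2| < 1.
  Four independent exponents keep the family closed under both partial derivatives, which is what
  the induction for \<open>C_k\<close> needs.\<close>

definition tensor_expo :: "nat => nat => nat => nat => R2 => real" where
 "tensor_expo a b c d x = expo a (1 + x $ 1) * expo b (1 - x $ 1) * (expo c (1 + x $ 2) * expo d (1 - x $ 2))"

lemma GDERIV_tensor_expo:
 "GDERIV (tensor_expo a b c d) x :>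
  (\<chi> i. if i = 1 then tensor_expo (a + 2) b c d x - real a * tensor_expo (a + 1) b c d x
         - tensor_expo a (b + 2) c d x + real b * tensor_expo a (b + 1) c d x
     else tensor_expo a b (c + 2) d x - real c * tensor_expo a b (c + 1) d x
         - tensor_expo a b c (d + 2) x + real d * tensor_expo a b c (d + 1) x)"
proof -
 have co: "GDERIV (%x :: R2. x $ i) x :> axis i 1" for i x
 proof -
  have "((%x :: R2. x $ i) has_derivative (%h. h $ i)) (at x)"
   by (intro bounded_linear_imp_has_derivative bounded_linear_vec_nth)
  thus ?thesis by (simp add: gderiv_def inner_axis)
 qed
 have p: "GDERIV (%x :: R2. expo m (1 + x $ i)) x :> (expo (m + 2) (1 + x $ i) - real m * expo (m + 1) (1 + x $ i)) *\<^sub>R axis i 1" for m i x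
  using GDERIV_DERIV_compose[OF GDERIV_add[OF GDERIV_const[of 1] co[of i]] DERIV_expo[of m]] by simp
 have q: "GDERIV (%x :: R2. expo m (1 - x $ i)) x :> (expo (m + 2) (1 - x $ i) - real m * expo (m + 1) (1 - x $ i)) *\<^sub>R - axis i 1" for m i x
  using GDERIV_DERIV_compose[OF GDERIV_diff[OF GDERIV_const[of 1] co[of i]] DERIV_expo[of m]] by simp
 show ?thesis
  unfolding tensor_expo_def
  by (rule GDERIV_subst[OF GDERIV_mult[OF GDERIV_mult[OF p q] GDERIV_mult[OF p q]]])
    (auto simp: vec_eq_iff forall_2 axis_def algebra_simps)
qed

lemma C_k_tensor_expo: "C_k k (tensor_expo a b c d)"
proof (induction k arbitrary: a b c d)
 case 0
 have "tensor_expo a b c d differentiable (at x)" for x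
  using GDERIV_differentiable[OF GDERIV_tensor_expo] .
 thus ?case
  by (auto intro!: continuous_at_imp_continuous_on differentiable_imp_continuous_within)
next
 case (Suc k)
 have lin: "C_k k (%x. f x - s * g x - h x + t * j x)" if "C_k k f" "C_k k g" "C_k k h" "C_k k j" for f g h j s t
  using C_k_add[OF C_k_add[OF C_k_add[OF that(1) C_k_cmult[OF that(2), of "- s"]] C_k_cmult[OF that(3), of "-1"]] C_k_cmult[OF that(4), of t]]
  by (simp add: algebra_simps)
 have "C_k k (%x. grad (tensor_expo a b c d) x $ i)" for i :: 2
 proof (cases "i = 1")
  case True
  thus ?thesis unfolding GDERIV_unique[OF GDERIV_tensor_expo] by (simp add: lin Suc.IH)
 next
  case False
  thus ?thesis unfolding GDERIV_unique[OF GDERIV_tensor_expo] by (simp add: lin Suc.IH)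
 qed
 thus ?case using GDERIV_differentiable[OF GDERIV_tensor_expo] by auto
qed

lemma tensor_expo_nonneg: "0 <= tensor_expo a b c d x"
 by (auto simp: tensor_expo_def expo_def)

lemma tensor_expo_eq_0: "norm x >= 2 ==> tensor_expo a b c d x = 0"
proof (rule ccontr)
 assume x: "norm x >= 2" and "tensor_expo a b c d x ~= 0"
 hence "\<bar>x $ 1\<bar> < 1" "\<bar>x $ 2\<bar> < 1"
  by (auto simp: tensor_expo_def expo_def abs_if split: if_splits)
 hence "(\<Sum>i\<in>UNIV. \<bar>x $ i\<bar>) < 2" by (simp add: UNIV_2)
 with norm_le_l1_cart[of x] x show False by linarith
qed

section \<open>Convolution and mollification\<close>

lemma lebesgue_scale_shift:
 fixes f :: "R2 => 'b::{banach, second_countable_topology}"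
 assumes "c ~= 0"
 shows integral_scale_shift: "(LINT x|leb. f (a + c *\<^sub>R x)) = (1 / c^2) *\<^sub>R (LINT x|leb. f x)"
  and integrable_scale_shift: "integrable leb f ==> integrable leb (%x. f (a + c *\<^sub>R x))"
  and measurable_scale_shift: "f \<in> borel_measurable leb ==> (%x. f (a + c *\<^sub>R x)) \<in> borel_measurable leb"
proof -
 have T: "(%x::R2. a + (\<Sum>j\<in>Basis. (c * (x \<bullet> j)) *\<^sub>R j)) = (%x. a + c *\<^sub>R x)"
  by (simp add: euclidean_representation flip: scaleR_scaleR scaleR_sum_right)
 have m [measurable]: "(%x. a + c *\<^sub>R x) \<in> leb \<rightarrow>\<^sub>M leb"
  using lebesgue_affine_measurable[of "%_. c" a] assms unfolding T by simp
 have L: "leb = density (distr leb leb (%x::R2. a + c *\<^sub>R x)) (%_. ennreal (c^2))"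
  using lebesgue_affine_euclidean[of "%_::R2. c" a] assms unfolding T
  by simp
 show meas: "(%x. f (a + c *\<^sub>R x)) \<in> borel_measurable leb" if [measurable]: "f \<in> borel_measurable leb" for f :: "R2 => 'b"
  by measurable
 have fwd: "integrable leb (%x. f (a + c *\<^sub>R x))" if "integrable leb f"
 proof -
  note [measurable] = borel_measurable_integrable[OF that]
  have "integrable (density (distr leb leb (%x::R2. a + c *\<^sub>R x)) (%_. ennreal (c^2))) f"
   using that by (subst L[symmetric])
  hence "integrable (distr leb leb (%x::R2. a + c *\<^sub>R x)) (%x. c^2 *\<^sub>R f x)"
   by (subst (asm) integrable_density) auto
  hence "integrable leb (%x. c^2 *\<^sub>R f (a + c *\<^sub>R x))"
   by (subst (asm) integrable_distr_eq) auto
  from integrable_scaleR_right[OF this, of "1 / c^2"] show ?thesis using assms by simp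
 qed
 thus "integrable leb f ==> integrable leb (%x. f (a + c *\<^sub>R x))" .
 show "(LINT x|leb. f (a + c *\<^sub>R x)) = (1 / c^2) *\<^sub>R (LINT x|leb. f x)"
 proof (cases "f \<in> borel_measurable leb")
  case True
  note [measurable] = True
  have "(LINT x|leb. f x) = (\<integral>x. f x \<partial>density (distr leb leb (%x::R2. a + c *\<^sub>R x)) (%_. ennreal (c^2)))"
   by (subst L[symmetric]) (rule refl)
  also have "... = (\<integral>x. c^2 *\<^sub>R f x \<partial>distr leb leb (%x::R2. a + c *\<^sub>R x))"
   by (subst integral_density) auto
  also have "... = (LINT x|leb. c^2 *\<^sub>R f (a + c *\<^sub>R x))"
   by (subst integral_distr) auto
  finally show ?thesis using assms by simp
 next
  \<comment> \<open>For non-measurable integrands both integrals are 0 by convention: the inverse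
    affine map would carry measurability back. The change of variables thus holds without side
    conditions.\<close>
  case False
  have "(%x. f (a + c *\<^sub>R x)) ~: borel_measurable leb"
  proof
   assume n: "(%x. f (a + c *\<^sub>R x)) \<in> borel_measurable leb"
   have T': "(%x::R2. - (1 / c) *\<^sub>R a + (\<Sum>j\<in>Basis. (1 / c * (x \<bullet> j)) *\<^sub>R j)) = (%x. - (1 / c) *\<^sub>R a + (1 / c) *\<^sub>R x)"
    by (simp only: euclidean_representation scaleR_scaleR[symmetric] scaleR_sum_right[symmetric])
   have "(%x. - (1 / c) *\<^sub>R a + (1 / c) *\<^sub>R x) \<in> leb \<rightarrow>\<^sub>M (leb :: R2 measure)"
    using lebesgue_affine_measurable[of "%_. 1 / c" "- (1 / c) *\<^sub>R a"] assms unfolding T' by simp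
   from measurable_compose[OF this n]
   have "(%x. f (a + c *\<^sub>R (- (1 / c) *\<^sub>R a + (1 / c) *\<^sub>R x))) \<in> borel_measurable leb" .
   also have "(%x. f (a + c *\<^sub>R (- (1 / c) *\<^sub>R a + (1 / c) *\<^sub>R x))) = f"
    using assms by (simp add: scaleR_diff_right)
   finally have "f \<in> borel_measurable leb" .
   with False show False by simp
  qed
  hence "\<not> integrable leb (%x. f (a + c *\<^sub>R x))"
   using borel_measurable_integrable by blast
  moreover have "\<not> integrable leb f"
   using False borel_measurable_integrable by blast
  ultimately show ?thesis
   by (simp add: not_integrable_integral_eq)
 qed
qed

lemma AE_scale_shift:
 assumes "AE x in leb. P (x :: R2)" "c ~= 0"
 shows "AE x in leb. P (a + c *\<^sub>R x)"
proof -
 have T: "(%x::R2. a + (\<Sum>j\<in>Basis. (c * (x \<bullet> j)) *\<^sub>R j)) = (%x. a + c *\<^sub>R x)"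
  by (simp add: euclidean_representation flip: scaleR_scaleR scaleR_sum_right)
 have m [measurable]: "(%x. a + c *\<^sub>R x) \<in> leb \<rightarrow>\<^sub>M (leb :: R2 measure)"
  using lebesgue_affine_measurable[of "%_. c" a] assms(2) unfolding T by simp
 obtain N where N: "N \<in> null_sets leb" "{x. \<not> P x} \<subseteq> N"
  using assms(1) unfolding eventually_ae_filter by auto
 have "(LINT x|leb. indicator N (a + c *\<^sub>R x)) = (1 / c^2) *\<^sub>R ((LINT x|leb. indicator N x) :: real)"
  by (rule integral_scale_shift[OF assms(2)])
 also have "... = 0" using N by (simp add: null_sets_def measure_def)
 finally have 0: "(LINT x|leb. indicator N (a + c *\<^sub>R x)) = (0::real)" .
 \<comment> \<open>The preimage of a null set is null because its indicator has integral 0 by the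
   change of variables.\<close>
 have "integrable leb (indicator N :: R2 => real)"
  using N by (auto simp: null_sets_def)
 from integrable_scale_shift[OF assms(2) this]
 have "AE x in leb. indicator N (a + c *\<^sub>R x) = (0::real)"
  using 0 by (subst (asm) integral_nonneg_eq_0_iff_AE) auto
 thus ?thesis
  by eventually_elim (use N(2) in \<open>auto simp: indicator_def split: if_splits\<close>)
qed

definition locint :: "(R2 => real) => bool" where
 "locint u \<longleftrightarrow> (\<forall>R. integrable (lebesgue_on (cball 0 R)) u)"

definition conv :: "(R2 => real) => (R2 => real) => R2 => real" where
 "conv u g x = (LINT y|leb. u y * g (x - y))"

lemma locint_L1_loc: "locint u \<longleftrightarrow> u \<in> L1_loc UNIV"
proof
 assume u: "locint u"
 show "u \<in> L1_loc UNIV"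
  unfolding L1_loc_def
 proof (safe)
  fix K :: "R2 set" assume K: "compact K"
  then obtain R where R: "K \<subseteq> cball 0 R"
   using bounded_subset_ballD[OF compact_imp_bounded[OF K], of 0] ball_subset_cball by blast
  have Ks: "K \<in> sets leb" using K by (simp add: borel_compact)
  have "integrable leb (%x. indicator (cball 0 R) x *\<^sub>R u x)"
   using u by (simp add: locint_def integrable_restrict_space)
  from integrable_mult_bounded[OF this, of "indicator K" 1] Ks
  have "integrable leb (%x. indicator (cball 0 R) x *\<^sub>R u x * indicator K x)"
   by (auto simp: indicator_def)
  also have "(%x. indicator (cball 0 R) x *\<^sub>R u x * indicator K x) = (%x. indicator K x *\<^sub>R u x)"
   using R by (auto simp: fun_eq_iff indicator_def)
  finally show "integrable (lebesgue_on K) u" using Ks by (simp add: integrable_restrict_space)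
 qed
qed (auto simp: L1_loc_def locint_def)

lemma locint_integrable_mult:
 assumes "locint u" "g \<in> borel_measurable leb" "!!x. \<bar>g x\<bar> <= C" "!!x. R < norm x ==> g x = 0"
 shows "integrable leb (%x. u x * g x)"
proof -
 have "integrable leb (%x. indicator (cball 0 R) x *\<^sub>R u x)"
  using assms(1) by (simp add: locint_def integrable_restrict_space)
 from integrable_mult_bounded[OF this assms(2,3)]
 have "integrable leb (%x. indicator (cball 0 R) x *\<^sub>R u x * g x)" .
 also have "(%x. indicator (cball 0 R) x *\<^sub>R u x * g x) = (%x. u x * g x)"
  using assms(4) by (auto simp: fun_eq_iff indicator_def)
 finally show ?thesis .
qed

lemma continuous_lebesgue_measurable:
 fixes f :: "R2 => 'b::{second_countable_topology, real_normed_vector}"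
 shows "continuous_on UNIV f ==> f \<in> borel_measurable leb"
 by (rule measurable_completion, simp, rule borel_measurable_continuous_onI)

lemma measurable_ident_lebesgue: "(%x::R2. x) \<in> borel_measurable leb"
 by (rule continuous_lebesgue_measurable) (rule continuous_on_id)

lemma measurable_ball_lebesgue:
 "cball a r \<in> sets (leb :: R2 measure)" "ball a r \<in> sets (leb :: R2 measure)"
 by simp_all

lemma conv_integrable:
 assumes "locint u" "continuous_on UNIV g" "compact K" "!!x. x ~: K ==> g x = 0"
 shows "integrable leb (%y. u y * g (x - y))"
proof -
 obtain B where B: "!!x. norm (g x) <= B"
  using bounded_compact_support[OF assms(2,4,3)] by metis
 obtain R where R: "K \<subseteq> cball 0 R"
  using bounded_subset_ballD[OF compact_imp_bounded[OF assms(3)], of 0] ball_subset_cball by blast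
 show ?thesis
 proof (rule locint_integrable_mult[OF assms(1)])
  have "continuous_on UNIV (%y. g (x - y))"
   by (intro continuous_on_compose2[OF assms(2)] continuous_intros) auto
  thus "(%y. g (x - y)) \<in> borel_measurable leb" by (rule continuous_lebesgue_measurable)
  show "\<bar>g (x - y)\<bar> <= B" for y using B[of "x - y"] by simp
  show "g (x - y) = 0" if "norm x + R < norm y" for y
  by (smt (verit, ccfv_threshold) R assms(4) mem_cball_0 norm_triangle_ineq3 psubsetD psubsetI that)
 qed
qed

text \<open>Differentiation under the integral sign by integrating the uniform first-order error of
  the kernel against |u| over one fixed ball, where |u| has a finite integral.\<close>

lemma conv_GDERIV:
 assumes u: "locint u" and g: "C1 g" "compact K" "!!x. x ~: K ==> g x = 0"
 shows "GDERIV (conv u g) x :> (\<chi> i. conv u (%z. grad g z $ i) x)"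
 unfolding gderiv_def has_derivative_at_alt
proof (intro conjI allI impI)
 define D where "D = (\<chi> i. conv u (%z. grad g z $ i) x)"
 show "bounded_linear (%h. h \<bullet> (\<chi> i. conv u (%z. grad g z $ i) x))"
  by (rule bounded_linear_inner_left)
 fix e :: real assume e: "e > 0"
 obtain R where R: "K \<subseteq> cball 0 R"
  using bounded_subset_ballD[OF compact_imp_bounded[OF g(2)], of 0] ball_subset_cball by blast
 \<comment> \<open>The summand 1 absorbs increments h with |h| < 1: for z outside this ball neither
   x - z nor x + h - z meets \<open>K\<close>, and the whole integrand vanishes.\<close>
 define S where "S = norm x + R + 1"
 define I where "I = (LINT y|leb. indicator (cball 0 S) y *\<^sub>R \<bar>u y\<bar>)"
 have Ii: "integrable leb (%y. indicator (cball 0 S) y *\<^sub>R \<bar>u y\<bar>)"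
 proof -
  have "integrable (lebesgue_on (cball 0 S)) (%y. \<bar>u y\<bar>)"
   using u by (intro integrable_abs) (simp add: locint_def)
  thus ?thesis by (simp add: integrable_restrict_space)
 qed
 have I0: "I >= 0" unfolding I_def by (intro integral_nonneg_AE) auto
 \<comment> \<open>Dividing by \<open>I + 1\<close> instead of \<open>I\<close> covers the case in
   which u vanishes almost everywhere on the ball.\<close>
 obtain d where d: "d > 0"
  "!!z h. norm h < d ==> \<bar>g (z + h) - g z - h \<bullet> grad g z\<bar> <= e / (I + 1) * norm h"
  using C1_uniform_first_order[OF g, of "e / (I + 1)"] e I0 by (auto simp: divide_simps)
 have gi: "integrable leb (%y. u y * grad g (z - y) $ i)" for z i
  by (rule conv_integrable[OF u _ g(2)])
    (use C1D(2)[OF g(1)] grad_eq_0_outside[OF g(2,3)] in \<open>auto intro: continuous_intros\<close>)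
 have "norm (conv u g y - conv u g x - (y - x) \<bullet> D) <= e * norm (y - x)" if y: "norm (y - x) < min d 1" for y
 proof -
  define h where "h = y - x"
  have "h \<bullet> D = (\<Sum>i\<in>UNIV. h $ i * (LINT z|leb. u z * grad g (x - z) $ i))"
   by (simp add: inner_vec_def D_def conv_def)
  also have "... = (LINT z|leb. (\<Sum>i\<in>UNIV. h $ i * (u z * grad g (x - z) $ i)))"
   using gi by (subst Bochner_Integration.integral_sum) auto
  also have "... = (LINT z|leb. u z * (h \<bullet> grad g (x - z)))"
   by (intro Bochner_Integration.integral_cong) (auto simp: inner_vec_def sum_distrib_left mult_ac)
  finally have hD: "h \<bullet> D = (LINT z|leb. u z * (h \<bullet> grad g (x - z)))" .
  have hi: "integrable leb (%z. u z * (h \<bullet> grad g (x - z)))"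
   using gi by (simp add: inner_vec_def sum_distrib_left mult.left_commute[of "u _"])
  note ci = conv_integrable[OF u C1D(3)[OF g(1)] g(2,3)]
  have "conv u g y - conv u g x - h \<bullet> D = (LINT z|leb. u z * g (x + h - z) - u z * g (x - z) - u z * (h \<bullet> grad g (x - z)))"
   unfolding hD conv_def using ci hi by (simp add: h_def)
  also have "norm ... <= (LINT z|leb. e / (I + 1) * norm h * (indicator (cball 0 S) z *\<^sub>R \<bar>u z\<bar>))"
  proof (rule Bochner_Integration.integral_norm_bound_integral)
   show "integrable leb (%z. u z * g (x + h - z) - u z * g (x - z) - u z * (h \<bullet> grad g (x - z)))"
    by (intro Bochner_Integration.integrable_diff ci hi)
   show "integrable leb (%z. e / (I + 1) * norm h * (indicator (cball 0 S) z *\<^sub>R \<bar>u z\<bar>))"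
    using Ii by (rule integrable_mult_right)
   fix z
   have eq: "u z * g (x + h - z) - u z * g (x - z) - u z * (h \<bullet> grad g (x - z)) =
     u z * (g ((x - z) + h) - g (x - z) - h \<bullet> grad g (x - z))"
    by (simp add: algebra_simps)
   show "norm (u z * g (x + h - z) - u z * g (x - z) - u z * (h \<bullet> grad g (x - z)))
     <= e / (I + 1) * norm h * (indicator (cball 0 S) z *\<^sub>R \<bar>u z\<bar>)"
   proof (cases "z \<in> cball 0 S")
    case True
    have "\<bar>g ((x - z) + h) - g (x - z) - h \<bullet> grad g (x - z)\<bar> <= e / (I + 1) * norm h"
     using y by (intro d(2)) (simp add: h_def)
    hence "\<bar>u z\<bar> * \<bar>g ((x - z) + h) - g (x - z) - h \<bullet> grad g (x - z)\<bar> <= \<bar>u z\<bar> * (e / (I + 1) * norm h)"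
     by (rule mult_left_mono) simp
    thus ?thesis unfolding eq using True by (simp add: abs_mult mult.commute)
   next
    case False
    hence z: "norm x + R + 1 < norm z" by (simp add: S_def)
    have 1: "R < norm (x - z)" using z norm_triangle_ineq2[of z x] by (simp add: norm_minus_commute)
    have "norm z <= norm (x - z + h) + norm x + norm h"
     using norm_triangle_ineq4[of "x + h" "x - z + h"] norm_triangle_ineq[of x h] by simp
    hence 2: "R < norm (x - z + h)" using z y by (simp add: h_def)
    have "x - z ~: K" "x - z + h ~: K" using 1 2 R by auto
    thus ?thesis unfolding eq using False g(3) grad_eq_0_outside[OF g(2,3)] by simp
   qed
  qed
  also have "... = e / (I + 1) * norm h * I" unfolding I_def by simp
  also have "... <= e * norm h"
  proof -
   have "e / (I + 1) * I <= e" using e I0 by (simp add: divide_simps)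
   hence "e / (I + 1) * I * norm h <= e * norm h" by (rule mult_right_mono) simp
   thus ?thesis by (simp add: mult_ac)
  qed
  finally show ?thesis by (simp add: h_def)
 qed
 thus "\<exists>d>0. \<forall>y. norm (y - x) < d -->
   norm (conv u g y - conv u g x - (y - x) \<bullet> (\<chi> i. conv u (%z. grad g z $ i) x)) <= e * norm (y - x)"
  using d(1) unfolding D_def by (intro exI[of _ "min d 1"]) auto
qed

lemma conv_C_k:
 assumes u: "locint u" and g: "g \<in> test_functions UNIV"
 shows "C_k k (conv u g)"
 using g
proof (induction k arbitrary: g)
 case (0 g)
 obtain K where K: "compact K" "!!x. x ~: K ==> g x = 0" using test_functionsE[OF 0] by metis
 have "conv u g differentiable (at x)" for x
  using GDERIV_differentiable[OF conv_GDERIV[OF u test_functions_C1[OF 0] K]] .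
 thus ?case by (auto intro!: continuous_at_imp_continuous_on differentiable_imp_continuous_within)
next
 case (Suc k g)
 obtain K where K: "compact K" "!!x. x ~: K ==> g x = 0" using test_functionsE[OF Suc.prems] by metis
 note G = conv_GDERIV[OF u test_functions_C1[OF Suc.prems] K]
 have "C_k k (%x. grad (conv u g) x $ i)" for i
 proof -
  have "(%x. grad (conv u g) x $ i) = conv u (%z. grad g z $ i)"
   by (simp add: fun_eq_iff GDERIV_unique[OF G])
  thus ?thesis using Suc.IH[OF test_functions_grad[OF Suc.prems, of i]] by simp
 qed
 thus ?case using GDERIV_differentiable[OF G] by simp
qed

lemma C1_conv:
 assumes "locint u" "g \<in> test_functions UNIV"
 shows "C1 (conv u g)"
 using conv_C_k[OF assms, of 1] C_k_C1[of 0] by simp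

lemma grad_conv:
 assumes "locint u" "g \<in> test_functions UNIV"
 shows "grad (conv u g) x $ i = conv u (%z. grad g z $ i) x"
proof -
 obtain K where K: "compact K" "!!x. x ~: K ==> g x = 0" using test_functionsE[OF assms(2)] by metis
 show ?thesis using GDERIV_unique[OF conv_GDERIV[OF assms(1) test_functions_C1[OF assms(2)] K]] by simp
qed

lemma test_functions_reflect:
 assumes "g \<in> test_functions UNIV"
 shows "(%y. g (x - y)) \<in> test_functions UNIV"
proof -
 obtain K where K: "compact K" "!!x. x ~: K ==> g x = 0" using test_functionsE[OF assms] by metis
 show ?thesis
 proof (rule test_functionsI)
  show "C_k k (%y. g (x - y))" for k
   using C_k_affine[OF test_functions_C_k[OF assms, of k], of x "-1"] by simp
  show "compact ((%y. x - y) ` K)" by (intro compact_continuous_image K continuous_intros)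
  show "g (x - y) = 0" if "y ~: (%y. x - y) ` K" for y
   using that by (intro K(2)) (auto simp: image_iff)
 qed simp
qed

text \<open>For fixed x the reflected kernel y -> g (x - y) is itself a test function. The sign from
  the reflection cancels the one in the definition of the weak gradient, so that mollification
  commutes with weak differentiation.\<close>

lemma grad_conv_weak:
 assumes "is_weak_grad UNIV u G" "g \<in> test_functions UNIV"
 shows "grad (conv u g) x $ i = conv (%y. G y $ i) g x"
proof -
 have u: "locint u" using assms(1) by (simp add: is_weak_grad_def locint_L1_loc)
 note t = test_functions_reflect[OF assms(2), of x]
 have gr: "grad (%y. g (x - y)) y = - grad g (x - y)" for y
  using grad_affine[OF test_functions_C1[OF assms(2)], of x "-1"] by simp
 have "(LINT y|leb. u y * grad (%y. g (x - y)) y $ i) = - (LINT y|leb. G y $ i * g (x - y))"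
  using assms(1) t unfolding is_weak_grad_def lebesgue_on_UNIV_eq by simp
 thus ?thesis
  unfolding grad_conv[OF u assms(2)] conv_def gr by simp
qed

text \<open>The bump vanishes for norm at least 2, so the factor 2 (j + 1) places the kernel in the
  ball of radius 1 / (j + 1). Counting from j + 1 avoids the scale 0 and bounds all radii by
  1.\<close>

definition mollifier :: "nat => R2 => real" where
 "mollifier j x = tensor_expo 0 0 0 0 ((2 * real (j + 1)) *\<^sub>R x) /
   (LINT y|leb. tensor_expo 0 0 0 0 ((2 * real (j + 1)) *\<^sub>R y))"

definition moll :: "nat => (R2 => real) => R2 => real" where
 "moll j u = conv u (mollifier j)"

lemma mollifier_eq_0:
 assumes "norm x >= 1 / real (j + 1)" shows "mollifier j x = 0"
proof -
 have "1 <= norm x * real (j + 1)" using assms by (simp add: divide_simps)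
 moreover have "norm ((2 * real (j + 1)) *\<^sub>R x) = 2 * (norm x * real (j + 1))" by simp
 ultimately have "norm ((2 * real (j + 1)) *\<^sub>R x) >= 2" by linarith
 thus ?thesis unfolding mollifier_def by (subst tensor_expo_eq_0) auto
qed

lemma locint_const: "locint (%x. c)"
proof -
 have "integrable leb (%x::R2. indicator (cball 0 R) x * c)" for R
  using lmeasurable_cball[of "0::R2" R] by (simp add: lmeasurable_iff_integrable)
 thus ?thesis unfolding locint_def by (simp add: integrable_restrict_space)
qed

lemma integrable_compact_support:
 fixes f :: "R2 => real"
 assumes "continuous_on UNIV f" "compact K" "!!x. x ~: K ==> f x = 0"
 shows "integrable leb f"
proof -
 have "integrable leb (%x. 1 * f x)"
 proof -
  obtain B where B: "!!x. norm (f x) <= B"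
   using bounded_compact_support[OF assms(1,3,2)] by metis
  obtain R where R: "K \<subseteq> cball 0 R"
   using bounded_subset_ballD[OF compact_imp_bounded[OF assms(2)], of 0] ball_subset_cball by blast
  show ?thesis
  proof (rule locint_integrable_mult[where R = R])
   show "locint (%x. 1)" by (rule locint_const)
   show "f x = 0" if "R < norm x" for x using that R by (intro assms(3)) auto
  qed (use B in \<open>auto intro: continuous_lebesgue_measurable[OF assms(1)]\<close>)
 qed
 thus ?thesis by simp
qed

lemma tensor_integral_pos: "0 < (LINT y|leb. tensor_expo 0 0 0 0 ((2 * real (j + 1)) *\<^sub>R y))"
proof -
 let ?f = "%y. tensor_expo 0 0 0 0 ((2 * real (j + 1)) *\<^sub>R y)"
 have c: "continuous_on UNIV ?f"
  by (rule C_k_continuous[of 0]) (use C_k_affine[OF C_k_tensor_expo, of 0 0 0 0 0 0 "2 * real (j + 1)"] in simp)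
 have i: "integrable leb ?f"
 proof (rule integrable_compact_support[OF c, of "cball 0 1"])
  fix x :: R2 assume "x ~: cball 0 1"
  hence "1 <= norm x" by simp
  have "1 * 2 <= norm x * (2 * real (j + 1))"
   using \<open>1 <= norm x\<close> by (intro mult_mono) auto
  thus "?f x = 0" by (intro tensor_expo_eq_0) (simp add: mult.commute)
 qed simp
 have "(LINT y|leb. ?f y) ~= 0"
 proof
  assume "(LINT y|leb. ?f y) = 0"
  hence "AE x in leb. ?f x = 0"
   using i tensor_expo_nonneg by (subst (asm) integral_nonneg_eq_0_iff_AE) auto
  \<comment> \<open>A closed set of full measure is the whole plane, so a vanishing integral would
    force the bump to vanish at the origin as well.\<close>
  moreover have "closed {x. ?f x = 0}"
   using continuous_closed_vimage[of "{0}" ?f] c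
   by (auto simp: vimage_def continuous_on_eq_continuous_at)
  ultimately have "?f 0 = 0"
   using mem_closed_if_AE_lebesgue[of "{x. ?f x = 0}" 0] by auto
  thus False by (simp add: tensor_expo_def expo_def)
 qed
 moreover have "(LINT y|leb. ?f y) >= 0"
  by (intro integral_nonneg_AE) (auto simp: tensor_expo_nonneg)
 ultimately show ?thesis by simp
qed

lemma mollifier_nonneg: "0 <= mollifier j x"
 unfolding mollifier_def using tensor_integral_pos[of j] tensor_expo_nonneg by simp

lemma mollifier_test: "mollifier j \<in> test_functions UNIV"
proof (rule test_functionsI[where K = "cball 0 1"])
 show "C_k k (mollifier j)" for k
  using C_k_cmult[OF C_k_affine[OF C_k_tensor_expo, of k 0 0 0 0 0 "2 * real (j + 1)"],
    of "1 / (LINT y|leb. tensor_expo 0 0 0 0 ((2 * real (j + 1)) *\<^sub>R y))"]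
  unfolding mollifier_def by simp
 show "mollifier j x = 0" if "x ~: cball 0 1" for x
 proof (rule mollifier_eq_0)
  have "1 / real (j + 1) <= 1" by simp
  moreover have "1 <= norm x" using that by simp
  ultimately show "1 / real (j + 1) <= norm x" by (rule order_trans)
 qed
qed auto

lemma mollifier_continuous: "continuous_on UNIV (mollifier j)"
 by (rule C_k_continuous[OF test_functions_C_k[OF mollifier_test]])

lemma integral_mollifier: "(LINT y|leb. mollifier j y) = 1"
 unfolding mollifier_def using tensor_integral_pos[of j] by simp

lemma integral_mollifier_shift: "(LINT y|leb. mollifier j (x - y)) = 1"
 using integral_scale_shift[of "-1" "mollifier j" x] by (simp add: integral_mollifier)

lemma integrable_mollifier_mult:
 "locint u ==> integrable leb (%y. u y * mollifier j (x - y))"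
proof (rule conv_integrable[OF _ mollifier_continuous, of _ "cball 0 1"])
 show "mollifier j x = 0" if "x ~: cball 0 1" for x
 proof (rule mollifier_eq_0)
  have "1 / real (j + 1) <= 1" by simp
  moreover have "1 <= norm x" using that by simp
  ultimately show "1 / real (j + 1) <= norm x" by (rule order_trans)
 qed
qed auto

lemma locint_add: "locint u ==> locint v ==> locint (%x. u x + v x)"
 and locint_diff: "locint u ==> locint v ==> locint (%x. u x - v x)"
 and locint_cmult: "locint u ==> locint (%x. c * u x)"
 unfolding locint_def by auto

lemma locint_continuous:
 fixes u :: "R2 => real"
 assumes "continuous_on UNIV u" shows "locint u"
proof -
 have "integrable lborel (%x. indicator (cball 0 R) x *\<^sub>R u x)" for R
  by (rule borel_integrable_compact) (auto intro: continuous_on_subset[OF assms])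
 hence "integrable leb (%x. indicator (cball 0 R) x *\<^sub>R u x)" for R
  by (subst integrable_completion) (auto dest: borel_measurable_integrable)
 thus ?thesis unfolding locint_def by (simp add: integrable_restrict_space)
qed

lemma moll_diff:
 "locint u ==> locint v ==> moll j (%x. u x - v x) x = moll j u x - moll j v x"
 using integrable_mollifier_mult[of u, where j = j and x = x] integrable_mollifier_mult[of v, where j = j and x = x]
 by (simp add: moll_def conv_def left_diff_distrib)

lemma moll_cong_AE:
 assumes "locint u" "locint v" "AE y in leb. norm (x - y) < 1 / real (j + 1) --> u y = v y"
 shows "moll j u x = moll j v x"
 unfolding moll_def conv_def
proof (rule integral_cong_AE)
 show "AE y in leb. u y * mollifier j (x - y) = v y * mollifier j (x - y)"
  using assms(3)
 proof eventually_elim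
  case (elim y)
  thus ?case using mollifier_eq_0[of j "x - y"] by (cases "norm (x - y) < 1 / real (j + 1)") auto
 qed
qed (use assms integrable_mollifier_mult borel_measurable_integrable in blast)+

text \<open>The kernel is a probability density concentrated near 0, so averages inherit any bound
  on the distance from a constant. The same fact yields sup bounds, supports (with
  \<open>c = et = 0\<close>), uniform approximation of continuous functions and, later, pointwise
  values of representatives.\<close>

lemma moll_near_const:
 assumes u: "locint u" and c: "AE y in leb. norm (x - y) < 1 / real (j + 1) --> \<bar>u y - c\<bar> <= et"
 shows "\<bar>moll j u x - c\<bar> <= et"
proof -
 note i = integrable_mollifier_mult[OF u, where j = j and x = x] integrable_mollifier_mult[OF locint_const, where j = j and x = x, of c]
  integrable_mollifier_mult[OF locint_const, where j = j and x = x, of et]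
 have cc: "(LINT y|leb. c * mollifier j (x - y)) = c" for c
  by (simp add: integral_mollifier_shift)
 have "moll j u x - c = (LINT y|leb. u y * mollifier j (x - y) - c * mollifier j (x - y))"
  unfolding moll_def conv_def using i cc by (subst Bochner_Integration.integral_diff) auto
 also have "\<bar>...\<bar> <= (LINT y|leb. \<bar>u y * mollifier j (x - y) - c * mollifier j (x - y)\<bar>)"
  by (rule integral_abs_bound)
 also have "... <= (LINT y|leb. et * mollifier j (x - y))"
 proof (rule integral_mono_AE)
  show "integrable leb (%y. \<bar>u y * mollifier j (x - y) - c * mollifier j (x - y)\<bar>)" using i by auto
  show "AE y in leb. \<bar>u y * mollifier j (x - y) - c * mollifier j (x - y)\<bar> <= et * mollifier j (x - y)"
   using c
  proof eventually_elim
   case (elim y)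
   have "\<bar>u y * mollifier j (x - y) - c * mollifier j (x - y)\<bar> = \<bar>u y - c\<bar> * mollifier j (x - y)"
    using mollifier_nonneg[of j "x - y"] by (simp add: abs_mult flip: left_diff_distrib)
   also have "... <= et * mollifier j (x - y)"
   proof (cases "norm (x - y) < 1 / real (j + 1)")
    case True
    thus ?thesis using elim mollifier_nonneg by (intro mult_right_mono) auto
   next
    case False
    thus ?thesis using mollifier_eq_0[of j "x - y"] by simp
   qed
   finally show ?case .
  qed
 qed (rule i)
 also have "... = et" by (rule cc)
 finally show ?thesis .
qed

lemma C_k_moll: "locint u ==> C_k k (moll j u)"
 unfolding moll_def by (rule conv_C_k[OF _ mollifier_test])

lemma C1_moll: "locint u ==> C1 (moll j u)"
 unfolding moll_def by (rule C1_conv[OF _ mollifier_test])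

lemma grad_moll_weak: "is_weak_grad UNIV u G ==> grad (moll j u) x $ i = moll j (%y. G y $ i) x"
 unfolding moll_def by (rule grad_conv_weak[OF _ mollifier_test])

lemma integrable_mollifier_shift:
 "integrable leb (%y. mollifier j (x - y))" "integrable leb (%x. mollifier j (x - y))"
proof -
 have i: "integrable leb (mollifier j)"
  using integral_mollifier[of j] not_integrable_integral_eq[of leb "mollifier j"] by fastforce
 show "integrable leb (%y. mollifier j (x - y))"
  using integrable_scale_shift[OF _ i, of "-1" x] by simp
 show "integrable leb (%x. mollifier j (x - y))"
  using integrable_scale_shift[OF _ i, of 1 "- y"] by simp
qed

lemma nn_integral_mollifier_shift:
 "(\<integral>\<^sup>+y. mollifier j (x - y) \<partial>lborel) = 1" "(\<integral>\<^sup>+x. mollifier j (x - y) \<partial>lborel) = 1"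
proof -
 have *: "(\<integral>\<^sup>+y. f y \<partial>lborel) = 1" if f: "integrable leb f" "(LINT y|leb. f y) = 1" "!!x. 0 <= f x"
  for f :: "R2 => real"
  using nn_integral_eq_integral[OF f(1)] f(2,3) by (simp add: nn_integral_completion)
 show "(\<integral>\<^sup>+y. mollifier j (x - y) \<partial>lborel) = 1"
  by (intro * integrable_mollifier_shift integral_mollifier_shift mollifier_nonneg)
 have "(LINT x|leb. mollifier j (x - y)) = 1"
  using integral_scale_shift[of 1 "mollifier j" "- y"] by (simp add: integral_mollifier)
 thus "(\<integral>\<^sup>+x. mollifier j (x - y) \<partial>lborel) = 1"
  by (intro * integrable_mollifier_shift mollifier_nonneg)
qed

lemma locint_sq:
 assumes "sq leb u" shows "locint u"
 unfolding locint_def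
proof
 fix R
 have "sq (lebesgue_on (cball 0 R)) u"
  by (rule sq_subset[of UNIV]) (use assms in \<open>auto simp: lebesgue_on_UNIV_eq\<close>)
 moreover have "emeasure (lebesgue_on (cball 0 R)) (space (lebesgue_on (cball (0::R2) R))) < \<infinity>"
  using lmeasurable_cball[of "0::R2" R] by (simp add: emeasure_restrict_space fmeasurable_def)
 ultimately show "integrable (lebesgue_on (cball 0 R)) u" by (rule sq_imp_integrable_finite)
qed

text \<open>Mollification is a contraction of L2: Cauchy-Schwarz with respect to the probability
  density given by the kernel, its square root being put on each factor, and then Tonelli.\<close>

lemma
 assumes v: "sq leb v"
 shows sq_moll: "sq leb (moll j v)" and nrm2_moll_le: "nrm2 leb (moll j v) <= nrm2 leb v"
proof -
 \<comment> \<open>Tonelli is applied to the Borel product measure, so v is first replaced by a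
   Borel function equal to it almost everywhere; mollification does not see the difference.\<close>
 obtain w where w [measurable]: "w \<in> borel_measurable lborel" and ae: "AE x in lborel. v x = w x"
  using completion_ex_borel_measurable_real[OF sq_meas[OF v]] by metis
 have ae': "AE x in leb. v x = w x" using ae by (rule AE_completion)
 have wl: "w \<in> borel_measurable leb" using w by (rule measurable_completion)
 have sw: "sq leb w"
  by (rule sq_cong_AE[OF v wl]) (use ae' in eventually_elim, simp)
 have eq: "moll j v = moll j w"
  by (intro ext moll_cong_AE locint_sq v sw) (use ae' in eventually_elim, simp)
 have [measurable]: "mollifier j \<in> borel_measurable borel"
  by (rule borel_measurable_continuous_onI[OF mollifier_continuous])
 have pt: "ennreal ((moll j w x)^2) <= (\<integral>\<^sup>+y. ennreal ((w y)^2) * ennreal (mollifier j (x - y)) \<partial>lborel)" for x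
 proof -
  define I where "I = (LINT y|leb. \<bar>w y\<bar> * mollifier j (x - y))"
  have i: "integrable leb (%y. \<bar>w y\<bar> * mollifier j (x - y))"
   using integrable_abs[OF integrable_mollifier_mult[OF locint_sq[OF sw], where j = j and x = x]]
   by (simp add: abs_mult mollifier_nonneg)
  have "\<bar>moll j w x\<bar> <= I"
   unfolding I_def moll_def conv_def
   using integral_abs_bound[of leb "%y. w y * mollifier j (x - y)"]
   by (simp add: abs_mult mollifier_nonneg)
  hence "(moll j w x)^2 <= I^2" by (meson abs_ge_zero abs_le_square_iff abs_of_nonneg order_trans abs_ge_self)
  hence "ennreal ((moll j w x)^2) <= (ennreal I)^2"
   using \<open>\<bar>moll j w x\<bar> <= I\<close> by (simp add: ennreal_power ennreal_leI)
  also have "ennreal I = (\<integral>\<^sup>+y. ennreal (\<bar>w y\<bar> * mollifier j (x - y)) \<partial>lborel)"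
   unfolding I_def using nn_integral_eq_integral[OF i] by (simp add: nn_integral_completion mollifier_nonneg)
  also have "... = (\<integral>\<^sup>+y. ennreal (\<bar>w y\<bar> * sqrt (mollifier j (x - y))) * ennreal (sqrt (mollifier j (x - y))) \<partial>lborel)"
   by (intro nn_integral_cong) (simp add: mollifier_nonneg mult.assoc flip: ennreal_mult)
  also have "...^2 <= (\<integral>\<^sup>+y. (ennreal (\<bar>w y\<bar> * sqrt (mollifier j (x - y))))^2 \<partial>lborel)
    * (\<integral>\<^sup>+y. (ennreal (sqrt (mollifier j (x - y))))^2 \<partial>lborel)"
   by (rule Cauchy_Schwarz_nn_integral) measurable
  also have "(\<integral>\<^sup>+y. (ennreal (sqrt (mollifier j (x - y))))^2 \<partial>lborel) = 1"
   by (simp add: ennreal_power mollifier_nonneg nn_integral_mollifier_shift)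
  also have "(\<integral>\<^sup>+y. (ennreal (\<bar>w y\<bar> * sqrt (mollifier j (x - y))))^2 \<partial>lborel)
    = (\<integral>\<^sup>+y. ennreal ((w y)^2) * ennreal (mollifier j (x - y)) \<partial>lborel)"
   by (intro nn_integral_cong) (simp add: ennreal_power mollifier_nonneg power_mult_distrib flip: ennreal_mult)
  finally show ?thesis by simp
 qed
 have mm: "moll j w \<in> borel_measurable borel"
  by (intro borel_measurable_continuous_onI C1D C1_moll locint_sq sw)
 have "(\<integral>\<^sup>+x. ennreal ((moll j w x)^2) \<partial>lborel) <= (\<integral>\<^sup>+x. \<integral>\<^sup>+y. ennreal ((w y)^2) * ennreal (mollifier j (x - y)) \<partial>lborel \<partial>lborel)"
  by (intro nn_integral_mono pt)
 also have "... = (\<integral>\<^sup>+y. \<integral>\<^sup>+x. ennreal ((w y)^2) * ennreal (mollifier j (x - y)) \<partial>lborel \<partial>lborel)"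
  by (rule lborel_pair.Fubini'[symmetric]) measurable
 also have "... = (\<integral>\<^sup>+y. ennreal ((w y)^2) \<partial>lborel)"
  by (simp add: nn_integral_cmult nn_integral_mollifier_shift)
 also have "... = ennreal ((nrm2 leb w)^2)"
  unfolding nrm2_square using nn_integral_eq_integral[OF sq_int[OF sw]] by (simp add: nn_integral_completion)
 finally have le: "(\<integral>\<^sup>+x. ennreal ((moll j w x)^2) \<partial>leb) <= ennreal ((nrm2 leb w)^2)"
  by (simp add: nn_integral_completion)
 have ml: "moll j w \<in> borel_measurable leb" by (rule measurable_completion) (use mm in simp)
 have i: "integrable leb (%x. (norm (moll j w x))^2)"
  using ml le by (intro integrableI_bounded) (auto simp: le_less_trans)
 thus "sq leb (moll j v)" unfolding eq using ml by (simp add: sq_def)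
 have "ennreal ((nrm2 leb (moll j w))^2) <= ennreal ((nrm2 leb w)^2)"
  using le nn_integral_eq_integral[OF i] unfolding nrm2_square by simp
 hence "nrm2 leb (moll j w) <= nrm2 leb w"
  by (simp add: power2_le_iff_abs_le)
 also have "nrm2 leb w = nrm2 leb v"
  by (rule nrm2_cong_AE[OF wl sq_meas[OF v]]) (use ae' in eventually_elim, simp)
 finally show "nrm2 leb (moll j v) <= nrm2 leb v" unfolding eq .
qed

lemma sq_compact_support:
 fixes f :: "R2 => 'b::euclidean_space"
 assumes "continuous_on UNIV f" "compact K" "!!x. x ~: K ==> f x = 0"
 shows "sq leb f"
 unfolding sq_def
proof
 show "f \<in> borel_measurable leb" by (rule continuous_lebesgue_measurable[OF assms(1)])
 show "integrable leb (%x. (norm (f x))^2)"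
  by (rule integrable_compact_support[OF _ assms(2)]) (use assms in \<open>auto intro!: continuous_intros\<close>)
qed

text \<open>Cut off domain and range first, at a loss of e/2, so that afterwards mere almost
  everywhere approximation by continuous functions is enough for dominated convergence.\<close>

lemma L2_approx_continuous:
 fixes u :: "R2 => real"
 assumes u: "sq leb u" and e: "e > 0"
 shows "\<exists>g K. continuous_on UNIV g & compact K & (\<forall>x. x ~: K --> g x = 0) & nrm2 leb (%x. u x - g x) < e"
proof -
 note [measurable] = sq_meas[OF u] measurable_ident_lebesgue
 define b where "b N x = (if norm x <= real N & \<bar>u x\<bar> <= real N then 1 else 0 :: real)" for N :: nat and x
 have [measurable]: "b N \<in> borel_measurable leb" for N
  unfolding b_def by measurable
 have "L2lim leb (%N x. b N x *\<^sub>R u x) (%x. 1 *\<^sub>R u x)"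
 proof (rule L2lim_bounded_mult[OF L2lim_const[OF u], where C = 1])
  show "AE x in leb. (%N. b N x) \<longlonglongrightarrow> 1"
  proof (rule AE_I2)
   fix x
   obtain N0 :: nat where "max (norm x) \<bar>u x\<bar> <= real N0" using real_arch_simple by blast
   hence "\<forall>N\<ge>N0. b N x = 1" by (auto simp: b_def)
   hence "eventually (%N. 1 = b N x) sequentially"
    by (auto simp: eventually_sequentially intro!: exI[of _ N0])
   thus "(%N. b N x) \<longlonglongrightarrow> 1" by (rule Lim_transform_eventually[OF tendsto_const])
  qed
 qed (auto simp: b_def)
 hence "(%N. nrm2 leb (%x. b N x * u x - u x)) \<longlonglongrightarrow> 0"
  using L2limD(3) by fastforce
 hence "\<forall>\<^sub>F N in sequentially. nrm2 leb (%x. b N x * u x - u x) < e / 2"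
  using e by (auto dest!: order_tendstoD(2)[where a = "e / 2"])
 then obtain N where N: "nrm2 leb (%x. b N x * u x - u x) < e / 2"
  by (auto simp: eventually_sequentially)
 define v where "v x = b N x * u x" for x
 have vb: "\<bar>v x\<bar> <= real N" for x by (simp add: v_def b_def)
 have v0: "v x = 0" if "norm x > real N" for x using that by (simp add: v_def b_def)
 have [measurable]: "v \<in> borel_measurable leb" unfolding v_def by measurable
 have vs: "sq leb v"
  by (rule sq_dominated[OF u, where C = 1]) (auto simp: v_def b_def)
 \<comment> \<open>The notion \<open>measurable_on\<close> supplies continuous functions converging
   off a negligible set. Clipping them to [-N, N] and multiplying by the cut-off \<open>ct\<close>,
   which is 1 on the ball of radius N, makes them dominated without changing the limit.\<close>
 have "v measurable_on UNIV"
  by (rule lebesgue_measurable_imp_measurable_on_real) simp_all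
 then obtain Z g where Z: "negligible Z" and g: "!!n. continuous_on UNIV (g n)"
  "!!x. x ~: Z ==> (%n. g n x) \<longlonglongrightarrow> v x"
  unfolding measurable_on_def by auto
 define ct where "ct x = max 0 (min 1 (real N + 1 - norm x))" for x :: R2
 define h where "h n x = max (- real N) (min (real N) (g n x))" for n x
 have ctc: "continuous_on UNIV ct" unfolding ct_def by (intro continuous_intros)
 have ct0: "ct x = 0" if "x ~: cball 0 (real N + 1)" for x using that by (simp add: ct_def)
 have hc: "continuous_on UNIV (h n)" for n unfolding h_def by (intro continuous_intros g)
 have "L2lim leb (%n x. h n x *\<^sub>R ct x) (%x. v x *\<^sub>R ct x)"
 proof (rule L2lim_bounded_mult[OF L2lim_const, where C = "real N"])
  show "sq leb ct" by (rule sq_compact_support[OF ctc compact_cball ct0])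
  show "h n \<in> borel_measurable leb" for n by (rule continuous_lebesgue_measurable[OF hc])
  show "AE x in leb. \<bar>h n x\<bar> <= real N" for n by (auto simp: h_def)
  have "AE x in leb. x ~: Z"
   using Z by (simp add: AE_not_in negligible_iff_null_sets)
  thus "AE x in leb. (%n. h n x) \<longlonglongrightarrow> v x"
  proof eventually_elim
   case (elim x)
   have "(%n. h n x) \<longlonglongrightarrow> max (- real N) (min (real N) (v x))"
    unfolding h_def by (intro tendsto_intros g(2) elim)
   also have "max (- real N) (min (real N) (v x)) = v x" using vb[of x] by simp
   finally show ?case .
  qed
 qed measurable
 moreover have "(%x. v x *\<^sub>R ct x) = v"
  using v0 by (auto simp: fun_eq_iff ct_def not_less)
 ultimately have "(%n. nrm2 leb (%x. h n x * ct x - v x)) \<longlonglongrightarrow> 0"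
  and hs: "!!n. sq leb (%x. h n x * ct x)"
  using L2limD by fastforce+
 hence "\<forall>\<^sub>F n in sequentially. nrm2 leb (%x. h n x * ct x - v x) < e / 2"
  using e by (auto dest!: order_tendstoD(2)[where a = "e / 2"])
 then obtain n where n: "nrm2 leb (%x. h n x * ct x - v x) < e / 2"
  by (auto simp: eventually_sequentially)
 have "nrm2 leb (%x. u x - h n x * ct x) <= nrm2 leb (%x. u x - v x) + nrm2 leb (%x. v x - h n x * ct x)"
  using nrm2_triangle[OF sq_diff[OF u vs] sq_diff[OF vs hs]] by simp
 also have "... < e"
 proof -
  have "nrm2 leb (%x. u x - v x) < e / 2"
   using N unfolding v_def by (subst nrm2_commute)
  moreover have "nrm2 leb (%x. v x - h n x * ct x) < e / 2"
   using n by (subst nrm2_commute)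
  ultimately show ?thesis by linarith
 qed
 finally have "nrm2 leb (%x. u x - h n x * ct x) < e" .
 thus ?thesis
  using hc ctc ct0 by (intro exI[of _ "%x. h n x * ct x"] exI[of _ "cball 0 (real N + 1)"]) (auto intro: continuous_intros)
qed

lemma sq_indicator:
 "S \<in> lmeasurable ==> sq leb (indicator S :: 'a::euclidean_space => real)"
proof -
 assume S: "S \<in> lmeasurable"
 have "(%x. (norm (indicator S x :: real))^2) = indicator S"
  by (auto simp: indicator_def fun_eq_iff)
 thus ?thesis using S by (auto simp: sq_def lmeasurable_iff_integrable)
qed

lemma moll_outside:
 assumes "locint u" "!!y. y ~: cball a R ==> u y = 0" "x ~: cball a (R + 1 / real (j + 1))"
 shows "moll j u x = 0"
proof -
 have "\<bar>moll j u x - 0\<bar> <= 0"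
 proof (rule moll_near_const[OF assms(1)], rule AE_I2, rule impI)
  fix y assume y: "norm (x - y) < 1 / real (j + 1)"
  have "dist a x <= dist a y + norm (x - y)"
   by (metis dist_commute dist_norm dist_triangle)
  hence "y ~: cball a R" using y assms(3) by auto
  thus "\<bar>u y - 0\<bar> <= 0" using assms(2) by simp
 qed
 thus ?thesis by simp
qed

lemma moll_continuous_uniform:
 assumes g: "continuous_on UNIV g" "compact K" "!!x. x ~: K ==> g x = 0" and e: "e > 0"
 obtains J where "!!j x. j >= J ==> \<bar>moll j g x - g x\<bar> <= e"
proof -
 obtain d where d: "d > 0" "!!x x'. dist x' x < d ==> dist (g x') (g x) < e"
  using uniformly_continuous_compact_support[OF g(1,3,2)] e
  unfolding uniformly_continuous_on_def by (metis UNIV_I)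
 obtain J :: nat where J: "1 / real (J + 1) < d"
  using nat_approx_posE[OF d(1)] by (metis Suc_eq_plus1)
 show ?thesis
 proof (rule that)
  fix j x assume j: "J <= j"
  have "1 / real (j + 1) <= 1 / real (J + 1)" using j by (simp add: divide_simps)
  thus "\<bar>moll j g x - g x\<bar> <= e"
  proof (intro moll_near_const locint_continuous g(1) AE_I2 impI)
   fix y assume "norm (x - y) < 1 / real (j + 1)"
   hence "dist y x < d" using J \<open>1 / real (j + 1) <= 1 / real (J + 1)\<close>
    unfolding dist_norm norm_minus_commute[of y x] by linarith
   from d(2)[OF this] show "\<bar>g y - g x\<bar> <= e" by (simp add: dist_real_def)
  qed
 qed
qed

lemma L2lim_moll_continuous:
 assumes g: "continuous_on UNIV g" "compact K" "!!x. x ~: K ==> g x = 0"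
 shows "L2lim leb (%j. moll j g) g"
proof -
 obtain R where R: "K \<subseteq> cball 0 R"
  using bounded_subset_ballD[OF compact_imp_bounded[OF g(2)], of 0] ball_subset_cball by blast
 have gs: "sq leb g" by (rule sq_compact_support[OF g])
 let ?I = "indicator (cball 0 (R + 1)) :: R2 => real"
 have Is: "sq leb ?I"
  by (intro sq_indicator lmeasurable_cball)
 have 0: "norm (moll j g x - g x) <= e * norm (?I x)" if "\<bar>moll j g x - g x\<bar> <= e" for j x e
 proof (cases "x \<in> cball 0 (R + 1)")
  case False
  have "moll j g x = 0"
  proof (rule moll_outside[OF locint_continuous[OF g(1)], of 0 R])
   show "g y = 0" if "y ~: cball 0 R" for y using that R g(3) by blast
   have "1 / real (j + 1) <= 1" by simp
   thus "x ~: cball 0 (R + 1 / real (j + 1))" using False unfolding mem_cball by linarith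
  qed
  moreover have "g x = 0" using False R by (intro g(3)) auto
  ultimately show ?thesis using False by simp
 qed (use that in simp)
 have "(%j. nrm2 leb (%x. moll j g x - g x)) \<longlonglongrightarrow> 0"
 proof (rule LIMSEQ_I)
  fix r :: real assume r: "r > 0"
  define e where "e = r / (nrm2 leb ?I + 1)"
  have e: "e > 0" using r nrm2_nonneg[of leb ?I] by (simp add: e_def add_nonneg_pos)
  obtain J where J: "!!j x. j >= J ==> \<bar>moll j g x - g x\<bar> <= e"
   using moll_continuous_uniform[OF g e] by blast
  have "norm (nrm2 leb (%x. moll j g x - g x) - 0) < r" if "j >= J" for j
  proof -
   have "nrm2 leb (%x. moll j g x - g x) <= e * nrm2 leb ?I"
    by (rule nrm2_dominated[OF Is]) (use e 0[OF J[OF that]] sq_meas[OF sq_diff[OF sq_moll[OF gs] gs]] in auto)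
   also have "... < e * (nrm2 leb ?I + 1)" using e by simp
   also have "... = r" using nrm2_nonneg[of leb ?I] by (simp add: e_def add_nonneg_eq_0_iff)
   finally show ?thesis by simp
  qed
  thus "\<exists>J. \<forall>j\<ge>J. norm (nrm2 leb (%x. moll j g x - g x) - 0) < r" by blast
 qed
 thus ?thesis using gs sq_moll[OF gs] by (simp add: L2lim_def)
qed

text \<open>Density argument: by the contraction property, the mollification error of u exceeds that
  of a nearby continuous g by at most twice the distance of u from g.\<close>

lemma L2lim_moll:
 assumes u: "sq leb u" shows "L2lim leb (%j. moll j u) u"
proof -
 have "(%j. nrm2 leb (%x. moll j u x - u x)) \<longlonglongrightarrow> 0"
 proof (rule LIMSEQ_I)
  fix r :: real assume r: "r > 0"
  obtain g K where g: "continuous_on UNIV g" "compact K" "!!x. x ~: K ==> g x = 0"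
   and ug: "nrm2 leb (%x. u x - g x) < r / 4"
   using L2_approx_continuous[OF u, of "r / 4"] r by auto
  have gs: "sq leb g" by (rule sq_compact_support[OF g])
  note d = sq_diff[OF u gs]
  have "\<forall>\<^sub>F j in sequentially. nrm2 leb (%x. moll j g x - g x) < r / 4"
   using order_tendstoD(2)[OF L2limD(3)[OF L2lim_moll_continuous[OF g]], of "r / 4"] r by simp
  then obtain J where J: "!!j. j >= J ==> nrm2 leb (%x. moll j g x - g x) < r / 4"
   unfolding eventually_sequentially by blast
  have "norm (nrm2 leb (%x. moll j u x - u x) - 0) < r" if "j >= J" for j
  proof -
   have eq: "(%x. moll j u x - u x) = (%x. (moll j (%x. u x - g x) x + (moll j g x - g x)) + - (u x - g x))"
    by (simp add: moll_diff locint_sq u gs fun_eq_iff)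
   note s1 = sq_moll[OF d, of j] and s2 = sq_diff[OF sq_moll[OF gs, of j] gs]
   have "nrm2 leb (%x. moll j u x - u x) <= nrm2 leb (moll j (%x. u x - g x))
     + nrm2 leb (%x. moll j g x - g x) + nrm2 leb (%x. - (u x - g x))"
    unfolding eq
    by (rule order_trans[OF nrm2_triangle[OF sq_add[OF s1 s2] sq_uminus[OF d]]])
      (intro add_right_mono nrm2_triangle s1 s2)
   also have "nrm2 leb (%x. - (u x - g x)) = nrm2 leb (%x. u x - g x)"
    by (rule nrm2_uminus)
   finally show ?thesis
    using nrm2_moll_le[OF d, of j] ug J[OF that] r by (simp only: real_norm_def diff_0_right) (simp add: abs_of_nonneg)
  qed
  thus "\<exists>J. \<forall>j\<ge>J. norm (nrm2 leb (%x. moll j u x - u x) - 0) < r" by blast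
 qed
 thus ?thesis using u sq_moll[OF u] by (simp add: L2lim_def)
qed

section \<open>Uniqueness of weak gradients\<close>

lemma L1_loc_mult_integrable:
 fixes g :: "R2 => real"
 assumes U: "U \<in> sets leb" and g: "g \<in> L1_loc U" and K: "compact K" "K \<subseteq> U"
  and ph: "continuous_on UNIV ph" "!!x. x ~: K ==> ph x = 0"
 shows "integrable leb (%x. indicator K x * g x)"
  and "integrable leb (%x. indicator K x * g x * ph x)"
  and "integrable (lebesgue_on U) (%x. g x * ph x)"
  and "(LINT x|lebesgue_on U. g x * ph x) = (LINT x|leb. indicator K x * g x * ph x)"
proof -
 have Ks: "K \<in> sets leb" using K by (simp add: borel_compact)
 show 1: "integrable leb (%x. indicator K x * g x)"
 proof -
  have "integrable (lebesgue_on K) g" using g K by (auto simp: L1_loc_def)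
  thus ?thesis using Ks by (simp add: integrable_restrict_space)
 qed
 obtain B where B: "!!x. norm (ph x) <= B" using bounded_compact_support[OF ph K(1)] by metis
 show 2: "integrable leb (%x. indicator K x * g x * ph x)"
  by (rule integrable_mult_bounded[OF 1 continuous_lebesgue_measurable[OF ph(1)]]) (use B in simp)
 have eq: "indicator U x *\<^sub>R (g x * ph x) = indicator K x * g x * ph x" for x
  using K(2) ph(2)[of x] by (auto simp: indicator_def)
 show "integrable (lebesgue_on U) (%x. g x * ph x)"
  using 2 U by (simp only: integrable_restrict_space eq sets.Int_space_eq2 space_completion space_lborel space_borel Int_UNIV_right)
 show "(LINT x|lebesgue_on U. g x * ph x) = (LINT x|leb. indicator K x * g x * ph x)"
  using U by (simp only: integral_restrict_space eq sets.Int_space_eq2 space_completion space_lborel space_borel Int_UNIV_right)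
qed

text \<open>Fundamental lemma of the calculus of variations. The test functions are mollified signs
  of g on the smaller ball, bounded by 1 and supported in the doubled ball once the radius of
  mollification is below r; the limit of the pairings is the integral of |g| over the smaller
  ball.\<close>

lemma weak_zero_ball:
 fixes g :: "R2 => real"
 assumes U: "open U" and g: "g \<in> L1_loc U" and 0: "!!ph. ph \<in> test_functions U ==> (LINT x|lebesgue_on U. g x * ph x) = 0"
  and r: "r > 0" "cball a (2 * r) \<subseteq> U"
 shows "AE x in leb. x \<in> cball a r --> g x = 0"
proof -
 have Us: "U \<in> sets leb" using U by simp
 let ?K = "cball a (2 * r)"
 have cK: "compact ?K" by simp
 define h where "h x = indicator ?K x * g x" for x
 have hi: "integrable leb h"
  unfolding h_def by (rule L1_loc_mult_integrable(1)[OF Us g cK r(2), of "%x. 0"]) auto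
 note [measurable] = borel_measurable_integrable[OF hi] measurable_ball_lebesgue
 define s where "s x = (if x \<in> cball a r then sgn (h x) else 0)" for x
 have sm [measurable]: "s \<in> borel_measurable leb"
 proof -
  have "s = (%x. if x \<in> cball a r then (if h x > 0 then 1 else if h x < 0 then -1 else 0) else 0)"
   by (auto simp: s_def sgn_if fun_eq_iff)
  also have "... \<in> borel_measurable leb" by measurable
  finally show ?thesis .
 qed
 have sb: "\<bar>s x\<bar> <= 1" for x by (simp add: s_def sgn_if)
 have ss: "sq leb s"
 proof (rule sq_dominated[where C = 1 and g = "indicator (cball a r) :: R2 => real"])
  show "sq leb (indicator (cball a r) :: R2 => real)"
   by (intro sq_indicator lmeasurable_cball)
 qed (auto simp: s_def sgn_if)
 obtain k :: "nat => nat" where k: "strict_mono k" "AE x in leb. (%n. moll (k n) s x) \<longlonglongrightarrow> s x"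
  using L2lim_AE_subseq[OF L2lim_moll[OF ss]] by blast
 have mb: "\<bar>moll j s x\<bar> <= 1" for j x
 proof -
  have "\<bar>moll j s x - 0\<bar> <= 1"
   by (rule moll_near_const[OF locint_sq[OF ss]]) (simp add: sb)
  thus ?thesis by simp
 qed
 have mc: "continuous_on UNIV (moll j s)" for j
  by (intro C1D C1_moll locint_sq ss)
 obtain J :: nat where J: "1 / real (J + 1) < r"
  using nat_approx_posE[OF r(1)] by (metis Suc_eq_plus1)
 have z: "(LINT x|leb. h x * moll (k n) s x) = 0" if n: "n >= J" for n
 proof -
  have kn: "k n >= J" using seq_suble[OF k(1), of n] n by linarith
  have supp: "moll (k n) s x = 0" if "x ~: ?K" for x
  proof (rule moll_outside[OF locint_sq[OF ss], of a r])
   have "1 / real (k n + 1) <= 1 / real (J + 1)" using kn by (simp add: divide_simps)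
   thus "x ~: cball a (r + 1 / real (k n + 1))" 
    using that J unfolding mem_cball by linarith
  qed (simp add: s_def)
  have "moll (k n) s \<in> test_functions U"
   by (rule test_functionsI[OF C_k_moll[OF locint_sq[OF ss]] cK r(2) supp])
  from 0[OF this] show ?thesis
   using L1_loc_mult_integrable(4)[OF Us g cK r(2) mc supp] by (simp add: h_def)
 qed
 have "(%n. LINT x|leb. h x * moll (k n) s x) \<longlonglongrightarrow> (LINT x|leb. h x * s x)"
 proof (rule integral_dominated_convergence[where w = "%x. \<bar>h x\<bar>"])
  show "AE x in leb. (%n. h x * moll (k n) s x) \<longlonglongrightarrow> h x * s x"
   using k(2) by eventually_elim (intro tendsto_intros)
  have [measurable]: "moll j s \<in> borel_measurable leb" for j
   by (rule continuous_lebesgue_measurable[OF mc])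
  show "(%x. h x * moll (k n) s x) \<in> borel_measurable leb" for n by measurable
  show "AE x in leb. norm (h x * moll (k n) s x) <= \<bar>h x\<bar>" for n
  proof (rule AE_I2)
   fix x
   show "norm (h x * moll (k n) s x) <= \<bar>h x\<bar>"
    using mult_left_mono[OF mb[of "k n" x], of "\<bar>h x\<bar>"] by (simp add: abs_mult)
  qed
  show "(%x. h x * s x) \<in> borel_measurable leb"
   by (intro borel_measurable_times borel_measurable_integrable[OF hi] sm)
  show "integrable leb (%x. \<bar>h x\<bar>)" using hi by (rule integrable_abs)
 qed
 moreover have "(%n. LINT x|leb. h x * moll (k n) s x) \<longlonglongrightarrow> 0"
  by (rule Lim_transform_eventually[OF tendsto_const])
    (use z in \<open>auto simp: eventually_sequentially intro!: exI[of _ J]\<close>)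
 ultimately have "(LINT x|leb. h x * s x) = 0" using LIMSEQ_unique by blast
 moreover have "h x * s x >= 0" for x by (simp add: s_def sgn_if zero_le_mult_iff)
 ultimately have "AE x in leb. h x * s x = 0"
  using integrable_mult_bounded[OF hi sm sb] by (subst (asm) integral_nonneg_eq_0_iff_AE) auto
 thus ?thesis
 proof eventually_elim
  case (elim x)
  show ?case
  proof
   assume x: "x \<in> cball a r"
   hence "x \<in> ?K" using r(1) by auto
   hence "h x = g x" by (simp add: h_def)
   moreover have "s x = sgn (h x)" using x by (simp add: s_def)
   ultimately show "g x = 0" using elim by (simp add: sgn_zero_iff)
  qed
 qed
qed

lemma weak_zero_AE:
 fixes g :: "R2 => real"
 assumes U: "open U" and g: "g \<in> L1_loc U" and 0: "!!ph. ph \<in> test_functions U ==> (LINT x|lebesgue_on U. g x * ph x) = 0"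
 shows "AE x in leb. x \<in> U --> g x = 0"
proof -
 define F where "F = {B. \<exists>a r. B = ball a r & r > 0 & cball a (2 * r) \<subseteq> U}"
 have UF: "\<Union>F = U"
 proof safe
  fix x assume "x \<in> U"
  then obtain r where r: "r > 0" "cball x r \<subseteq> U" using U by (auto simp: open_contains_cball)
  have "ball x (r / 2) \<in> F" using r unfolding F_def by (auto intro!: exI[of _ x] exI[of _ "r / 2"])
  thus "x \<in> \<Union>F" using r(1) by (intro UnionI) auto
 next
  fix x B assume "x \<in> B" "B \<in> F"
  thus "x \<in> U" unfolding F_def by fastforce
 qed
 obtain F' where F': "F' \<subseteq> F" "countable F'" "\<Union>F' = \<Union>F"
  using Lindelof[of F] unfolding F_def by auto
 have "AE x in leb. x \<in> B --> g x = 0" if B: "B \<in> F'" for B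
 proof -
  obtain a r where ar: "B = ball a r" "r > 0" "cball a (2 * r) \<subseteq> U" using B F' unfolding F_def by auto
  have "AE x in leb. x \<in> cball a r --> g x = 0"
   by (rule weak_zero_ball[OF U g _ ar(2,3)]) (rule 0)
  thus ?thesis by eventually_elim (auto simp: ar(1))
 qed
 hence "AE x in leb. \<forall>B\<in>F'. x \<in> B --> g x = 0"
  unfolding AE_ball_countable[OF F'(2)] by blast
 thus ?thesis by eventually_elim (use F' UF in blast)
qed

lemma L1_loc_diff: "f \<in> L1_loc U ==> g \<in> L1_loc U ==> (%x. f x - g x) \<in> L1_loc U"
 by (auto simp: L1_loc_def)

lemma L1_loc_component: "G \<in> L1_loc U ==> (%x. (G x :: R2) $ i) \<in> L1_loc U"
 unfolding L1_loc_def
proof safe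
 fix K assume "\<forall>K. compact K --> K \<subseteq> U --> integrable (lebesgue_on K) G" "compact K" "K \<subseteq> U"
 hence i: "integrable (lebesgue_on K) G" by auto
 show "integrable (lebesgue_on K) (%x. G x $ i)"
  by (rule Bochner_Integration.integrable_bound[OF i measurable_vec_component[OF borel_measurable_integrable[OF i]]])
    (simp add: component_le_norm_cart)
qed

lemma weak_grad_unique:
 assumes U: "open U" and "is_weak_grad U u G" "is_weak_grad U u G'"
 shows "AE x in leb. x \<in> U --> G x = G' x"
proof -
 have Us: "U \<in> sets leb" using U by simp
 have L: "(%x. G x $ i) \<in> L1_loc U" "(%x. G' x $ i) \<in> L1_loc U" for i
  using assms by (auto simp: is_weak_grad_def intro: L1_loc_component)
 have "AE x in leb. x \<in> U --> G x $ i - G' x $ i = 0" for i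
 proof (rule weak_zero_AE[OF U L1_loc_diff[OF L]])
  fix ph assume ph: "ph \<in> test_functions U"
  obtain K where K: "compact K" "K \<subseteq> U" "!!x. x ~: K ==> ph x = 0" using test_functionsE[OF ph] by metis
  note i = L1_loc_mult_integrable(3)[OF Us L(1)[of i] K(1,2) C_k_continuous[OF test_functions_C_k[OF ph, of 0]] K(3)]
   L1_loc_mult_integrable(3)[OF Us L(2)[of i] K(1,2) C_k_continuous[OF test_functions_C_k[OF ph, of 0]] K(3)]
  have w: "(LINT x|lebesgue_on U. u x * grad ph x $ i) = - (LINT x|lebesgue_on U. H x $ i * ph x)"
   if "is_weak_grad U u H" for H
   using that ph unfolding is_weak_grad_def by simp
  have "- (LINT x|lebesgue_on U. G x $ i * ph x) = - (LINT x|lebesgue_on U. G' x $ i * ph x)"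
   using w[OF assms(2)] w[OF assms(3)] by linarith
  thus "(LINT x|lebesgue_on U. (G x $ i - G' x $ i) * ph x) = 0"
   using i by (simp add: left_diff_distrib)
 qed
 hence "AE x in leb. \<forall>i\<in>UNIV. x \<in> U --> G x $ i - G' x $ i = 0"
  by (subst AE_finite_all) auto
 thus ?thesis by eventually_elim (auto simp: vec_eq_iff)
qed

lemma wgrad_weak: "is_weak_grad U u G ==> is_weak_grad U u (wgrad U u)"
 unfolding wgrad_def by (rule someI[of "is_weak_grad U u"])

lemma wgrad_AE:
 "open U ==> is_weak_grad U u G ==> AE x in leb. x \<in> U --> wgrad U u x = G x"
 by (rule weak_grad_unique[OF _ wgrad_weak])

section \<open>Integration along coordinate lines\<close>

text \<open>Coordinate i comes first and the other one second. Carrying i as a parameter lets one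
  argument serve both coordinate directions, and all four sides of a square later on.\<close>

definition pt :: "2 => real => real => R2" where
 "pt i a b = (\<chi> j. if j = i then a else b)"

lemma pt_nth: "pt i a b $ j = (if j = i then a else b)"
 by (simp add: pt_def)

lemma other_index:
 fixes i :: 2
 obtains j where "j ~= i" "UNIV = {i, j}"
proof (cases "i = 1")
 case True
 thus ?thesis using that[of 2] UNIV_2 by simp
next
 case False
 hence "i = 2" using exhaust_2[of i] by simp
 thus ?thesis using that[of 1] UNIV_2 by auto
qed

lemma pt_swap: "i ~= j ==> pt i a b = pt j b a"
 using exhaust_2[of i] exhaust_2[of j] by (auto simp: vec_eq_iff pt_nth forall_2)

lemma pt_eta: "i ~= j ==> pt i (x $ i) (x $ j) = x"
 using exhaust_2[of i] exhaust_2[of j] by (auto simp: vec_eq_iff pt_nth forall_2)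

lemma pt_add: "pt i a b = pt i a 0 + b *\<^sub>R (1 - axis i 1)"
 by (auto simp: vec_eq_iff pt_nth axis_def)

lemma continuous_pt: "continuous_on UNIV (%p. pt i (fst p) (snd p))"
 unfolding pt_def
proof (rule continuous_on_vec_lambda)
 show "continuous_on UNIV (%p. if j = i then fst p else snd p)" for j
  by (cases "j = i") (auto intro: continuous_intros)
qed

lemma continuous_pt_line:
 "continuous_on UNIV (%b. pt i a b)" "continuous_on UNIV (%a. pt i a b)"
 by (auto intro!: continuous_on_compose2[OF continuous_pt, of UNIV "%b. (a, b)", simplified]
   continuous_on_compose2[OF continuous_pt, of UNIV "%a. (a, b)", simplified] continuous_intros)

lemma measurable_pt [measurable]: "(%(a, b). pt i a b) \<in> borel_measurable (lborel \<Otimes>\<^sub>M lborel)"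
proof -
 have "(%p. pt i (fst p) (snd p)) \<in> borel_measurable (borel :: (real \<times> real) measure)"
  by (rule borel_measurable_continuous_onI[OF continuous_pt])
 thus ?thesis
  by (simp add: lborel_prod case_prod_beta' measurable_lborel1)
qed

lemma lborel_pt: "(lborel :: R2 measure) = distr (lborel \<Otimes>\<^sub>M lborel) borel (%(a, b). pt i a b)"
proof (rule lborel_eqI)
 fix l u :: R2
 assume le: "!!b. b \<in> Basis ==> l \<bullet> b <= u \<bullet> b"
 obtain j where j: "j ~= i" "UNIV = {i, j}" by (rule other_index)
 have le': "l $ k <= u $ k" for k using le[of "axis k 1"] by (simp add: inner_axis)
 have "emeasure (distr (lborel \<Otimes>\<^sub>M lborel) borel (%(a, b). pt i a b)) (box l u)
  = emeasure (lborel \<Otimes>\<^sub>M lborel) ({l $ i<..<u $ i} \<times> {l $ j<..<u $ j})"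
 proof (subst emeasure_distr)
  have "(%(a, b). pt i a b) -` box l u = {l $ i<..<u $ i} \<times> {l $ j<..<u $ j}"
  proof -
   have all: "(\<forall>k. P k) \<longleftrightarrow> P i & P j" for P :: "2 => bool"
   using j(2) by fastforce
   have "pt i a b \<in> box l u \<longleftrightarrow> (l $ i < a & a < u $ i) & (l $ j < b & b < u $ j)" for a b
    unfolding mem_box_cart all[of "%k. l $ k < pt i a b $ k & pt i a b $ k < u $ k"]
    using j(1) by (simp add: pt_nth)
   thus ?thesis by auto
  qed
  thus "emeasure (lborel \<Otimes>\<^sub>M lborel) ((%(a, b). pt i a b) -` box l u \<inter> space (lborel \<Otimes>\<^sub>M lborel))
   = emeasure (lborel \<Otimes>\<^sub>M lborel) ({l $ i<..<u $ i} \<times> {l $ j<..<u $ j})"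
   by (simp add: space_pair_measure)
 qed auto
 also have "... = ennreal (u $ i - l $ i) * ennreal (u $ j - l $ j)"
  by (subst lborel.emeasure_pair_measure_Times) (auto simp: le')
 also have "... = ennreal (\<Prod>k\<in>UNIV. (u - l) $ k)"
  unfolding j(2) using j(1) le' by (simp add: ennreal_mult)
 also have "(\<Prod>k\<in>UNIV. (u - l) $ k) = (\<Prod>b\<in>Basis. (u - l) \<bullet> b)"
 proof -
  have B: "(Basis :: R2 set) = range (%k. axis k 1)" by (auto simp: Basis_vec_def)
  have "(\<Prod>b\<in>Basis. (u - l) \<bullet> b) = (\<Prod>b\<in>range (%k. axis k 1). (u - l) \<bullet> b)"
   by (simp only: B)
  also have "... = (\<Prod>k\<in>UNIV. (u - l) $ k)"
   by (subst prod.reindex) (auto simp: inj_on_def axis_eq_axis inner_axis)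
  finally show ?thesis by simp
 qed
 finally show "emeasure (distr (lborel \<Otimes>\<^sub>M lborel) borel (%(a, b). pt i a b)) (box l u) = (\<Prod>b\<in>Basis. (u - l) \<bullet> b)" .
qed simp

lemma nn_integral_pt:
 assumes [measurable]: "f \<in> borel_measurable borel"
 shows "(\<integral>\<^sup>+x. f x \<partial>lborel) = (\<integral>\<^sup>+a. \<integral>\<^sup>+b. f (pt i a b) \<partial>lborel \<partial>lborel)"
proof -
 have "(\<integral>\<^sup>+x. f x \<partial>lborel) = (\<integral>\<^sup>+p. f (case p of (a, b) => pt i a b) \<partial>(lborel \<Otimes>\<^sub>M lborel))"
  by (subst lborel_pt[of i]) (subst nn_integral_distr, auto)
 also have "... = (\<integral>\<^sup>+a. \<integral>\<^sup>+b. f (pt i a b) \<partial>lborel \<partial>lborel)"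
  by (subst lborel.nn_integral_fst[symmetric]) auto
 finally show ?thesis .
qed

lemma measurable_pt_line [measurable]:
 "(%b. pt i a b) \<in> borel_measurable borel" "(%a. pt i a b) \<in> borel_measurable borel"
 by (rule borel_measurable_continuous_onI[OF continuous_pt_line(1)])
   (rule borel_measurable_continuous_onI[OF continuous_pt_line(2)])

lemma measurable_nn_integral_pt:
 assumes [measurable]: "f \<in> borel_measurable borel"
 shows "(%a. \<integral>\<^sup>+b. f (pt i a b) \<partial>lborel) \<in> borel_measurable borel"
by simp

lemma line_difference_le:
 assumes ph: "C1 ph" and st: "s <= t"
 shows "ennreal \<bar>ph (pt i a t) - ph (pt i a s)\<bar>
  <= (\<integral>\<^sup>+r. indicator {s..t} r * ennreal (norm (grad ph (pt i a r))) \<partial>lborel)"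
proof -
 \<comment> \<open>The numeral 1 is the vector with all entries 1, so \<open>1 - axis i 1\<close> is
   the unit vector of the other coordinate, along which r runs.\<close>
 define D where "D r = (1 - axis i 1) \<bullet> grad ph (pt i a r)" for r
 have c: "continuous_on UNIV (%r. pt i a r)"
  by (rule continuous_pt_line)
 have gc: "continuous_on UNIV (%r. grad ph (pt i a r))"
  by (intro continuous_on_compose2[OF C1D(2)[OF ph] c]) auto
 have Dc: "continuous_on {s..t} D"
  unfolding D_def by (intro continuous_intros continuous_on_subset[OF gc]) auto
 have der: "((%r. ph (pt i a r)) has_vector_derivative D r) (at r within {s..t})" for r
 proof -
  have "((%r. pt i a r) has_derivative (%h. h *\<^sub>R (1 - axis i 1))) (at r)"
   by (subst pt_add) (auto intro!: derivative_eq_intros)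
  from has_derivative_compose[OF this, of ph "%h. h \<bullet> grad ph (pt i a r)"] C1D(1)[OF ph, of "pt i a r"]
  have "((%r. ph (pt i a r)) has_derivative (%h. h *\<^sub>R D r)) (at r)"
   by (simp add: gderiv_def D_def)
  hence "((%r. ph (pt i a r)) has_derivative (%h. h *\<^sub>R D r)) (at r within {s..t})"
   by (rule has_derivative_at_withinI)
  thus ?thesis by (simp add: has_vector_derivative_def)
 qed
 have Dn: "\<bar>D r\<bar> <= norm (grad ph (pt i a r))" for r
 proof -
  have n: "norm (1 - axis i 1 :: R2) = 1"
  proof -
   have "(1 - axis i 1 :: R2) = axis (if i = 1 then 2 else 1) 1"
    using exhaust_2[of i] by (auto simp: vec_eq_iff forall_2 axis_def)
   thus ?thesis by simp
  qed
  thus ?thesis unfolding D_def using Cauchy_Schwarz_ineq2[of "1 - axis i 1" "grad ph (pt i a r)"] by simp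
 qed
 have eq: "(LINT r|lborel. indicator {s..t} r *\<^sub>R D r) = ph (pt i a t) - ph (pt i a s)"
  by (rule integral_FTC_Icc[OF st der Dc])
 have I: "integrable lborel (%r. indicator {s..t} r *\<^sub>R norm (grad ph (pt i a r)))"
  by (rule borel_integrable_compact) (auto intro!: continuous_intros continuous_on_subset[OF gc])
 have "\<bar>ph (pt i a t) - ph (pt i a s)\<bar> <= (LINT r|lborel. \<bar>indicator {s..t} r *\<^sub>R D r\<bar>)"
  unfolding eq[symmetric] by (rule integral_abs_bound)
 also have "... <= (LINT r|lborel. indicator {s..t} r *\<^sub>R norm (grad ph (pt i a r)))"
 proof (rule integral_mono[OF integrable_abs I])
  show "integrable lborel (%r. indicator {s..t} r *\<^sub>R D r)"
   by (rule borel_integrable_compact) (auto intro: Dc)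
  show "\<bar>indicator {s..t} r *\<^sub>R D r\<bar> <= indicator {s..t} r *\<^sub>R norm (grad ph (pt i a r))" for r
   using Dn[of r] by (simp add: indicator_def)
 qed
 finally have "ennreal \<bar>ph (pt i a t) - ph (pt i a s)\<bar>
  <= ennreal (LINT r|lborel. indicator {s..t} r *\<^sub>R norm (grad ph (pt i a r)))"
  by (rule ennreal_leI)
 also have "... = (\<integral>\<^sup>+r. ennreal (indicator {s..t} r *\<^sub>R norm (grad ph (pt i a r))) \<partial>lborel)"
  by (rule nn_integral_eq_integral[symmetric, OF I]) auto
 also have "... = (\<integral>\<^sup>+r. indicator {s..t} r * ennreal (norm (grad ph (pt i a r))) \<partial>lborel)"
  by (intro nn_integral_cong) (simp add: indicator_def)
 finally show ?thesis .
qed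

lemma line_value_le:
 assumes ph: "C1 ph" and K: "compact K" "!!x. x ~: K ==> ph x = 0"
 shows "ennreal \<bar>ph (pt i a t)\<bar> <= (\<integral>\<^sup>+r. ennreal (norm (grad ph (pt i a r))) \<partial>lborel)"
proof -
 obtain R where R: "K \<subseteq> cball 0 R"
  using bounded_subset_ballD[OF compact_imp_bounded[OF K(1)], of 0] ball_subset_cball by blast
 \<comment> \<open>Since |s| > R, the starting point lies off \<open>K\<close> whatever the
   coordinate a is, and s <= t keeps the orientation of the line integral.\<close>
 define s where "s = min t (- \<bar>R\<bar> - 1)"
 obtain j where j: "j ~= i" by (rule other_index)
 have "\<bar>s\<bar> <= norm (pt i a s)" using component_le_norm_cart[of "pt i a s" j] j by (simp add: pt_nth)
 hence "pt i a s ~: K" using R by (auto simp: s_def)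
 hence "ph (pt i a s) = 0" by (rule K(2))
 hence "ennreal \<bar>ph (pt i a t)\<bar> <= (\<integral>\<^sup>+r. indicator {s..t} r * ennreal (norm (grad ph (pt i a r))) \<partial>lborel)"
  using line_difference_le[OF ph, of s t i a] by (simp add: s_def)
 also have "... <= (\<integral>\<^sup>+r. ennreal (norm (grad ph (pt i a r))) \<partial>lborel)"
  by (intro nn_integral_mono) (simp add: indicator_def)
 finally show ?thesis .
qed

text \<open>Gagliardo--Nirenberg--Sobolev in the plane: the square of the value at a point is bounded by the
  product of the integrals of the gradient along the two coordinate lines through the point.\<close>

lemma GNS_nn_integral:
 assumes ph: "C1 ph" and K: "compact K" "!!x. x ~: K ==> ph x = 0"
 shows "(\<integral>\<^sup>+x. ennreal ((ph x)^2) \<partial>lborel) <= (\<integral>\<^sup>+x. ennreal (norm (grad ph x)) \<partial>lborel)^2"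
proof -
 have [measurable]: "ph \<in> borel_measurable borel" "grad ph \<in> borel_measurable borel"
  using C1_measurable[OF ph] by auto
 define A where "A a = (\<integral>\<^sup>+b. ennreal (norm (grad ph (pt 1 a b))) \<partial>lborel)" for a
 define B where "B b = (\<integral>\<^sup>+a. ennreal (norm (grad ph (pt 2 b a))) \<partial>lborel)" for b
 have [measurable]: "A \<in> borel_measurable borel" "B \<in> borel_measurable borel"
  unfolding A_def B_def by (rule measurable_nn_integral_pt; measurable)+
 have "(\<integral>\<^sup>+x. ennreal ((ph x)^2) \<partial>lborel) = (\<integral>\<^sup>+a. \<integral>\<^sup>+b. ennreal ((ph (pt 1 a b))^2) \<partial>lborel \<partial>lborel)"
  by (rule nn_integral_pt) measurable
 also have "... <= (\<integral>\<^sup>+a. \<integral>\<^sup>+b. A a * B b \<partial>lborel \<partial>lborel)"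
 proof (intro nn_integral_mono)
  fix a b
  have "ennreal ((ph (pt 1 a b))^2) = ennreal \<bar>ph (pt 1 a b)\<bar> * ennreal \<bar>ph (pt 2 b a)\<bar>"
   using pt_swap[of 1 2 a b] by (simp add: power2_eq_square flip: ennreal_mult)
  also have "... <= A a * B b"
   unfolding A_def B_def by (intro mult_mono line_value_le[OF ph K]) auto
  finally show "ennreal ((ph (pt 1 a b))^2) <= A a * B b" .
 qed
 also have "... = (\<integral>\<^sup>+a. A a \<partial>lborel) * (\<integral>\<^sup>+b. B b \<partial>lborel)"
  by (simp add: nn_integral_cmult nn_integral_multc)
 also have "(\<integral>\<^sup>+a. A a \<partial>lborel) = (\<integral>\<^sup>+x. ennreal (norm (grad ph x)) \<partial>lborel)"
  unfolding A_def by (rule nn_integral_pt[symmetric]) measurable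
 also have "(\<integral>\<^sup>+b. B b \<partial>lborel) = (\<integral>\<^sup>+x. ennreal (norm (grad ph x)) \<partial>lborel)"
  unfolding B_def by (rule nn_integral_pt[symmetric]) measurable
 finally show ?thesis by (simp add: power2_eq_square)
qed

lemma C1c_support:
 assumes "ph \<in> C1c U"
 obtains K where "C1 ph" "compact K" "K \<subseteq> U" "!!x. x ~: K ==> ph x = 0" "!!x. x ~: K ==> grad ph x = 0"
using C1c_def assms grad_eq_0_outside by auto

lemma C1c_sq:
 assumes "ph \<in> C1c U"
 shows "sq leb ph" "sq leb (grad ph)"
proof -
 obtain K where K: "C1 ph" "compact K" "!!x. x ~: K ==> ph x = 0" "!!x. x ~: K ==> grad ph x = 0"
  by (rule C1c_support[OF assms]) blast
 show "sq leb ph" "sq leb (grad ph)"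
  using K C1D[OF K(1)] by (auto intro: sq_compact_support)
qed

text \<open>The embedding of W^{1,1} into L2, followed by Cauchy-Schwarz on the set carrying the
  gradient. The factor sqrt |S| is the gain that drives the level-set iteration; with S the whole
  domain this is the Poincare inequality.\<close>

lemma GNS:
 assumes ph: "ph \<in> C1c U" and S: "S \<in> lmeasurable" "!!x. x ~: S ==> grad ph x = 0"
 shows "nrm2 leb ph <= sqrt (measure leb S) * nrm2 leb (grad ph)"
proof -
 obtain K where K: "C1 ph" "compact K" "!!x. x ~: K ==> ph x = 0"
  by (rule C1c_support[OF ph]) blast
 note sq = C1c_sq[OF ph]
 have ind: "sq leb (indicator S :: R2 => real)" by (rule sq_indicator[OF S(1)])
 have eq: "norm (grad ph x) = norm (grad ph x) * norm (indicator S x :: real)" for x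
  using S(2)[of x] by (cases "x \<in> S") auto
 have i: "integrable leb (%x. norm (grad ph x))"
  by (subst eq) (rule sq_norm_mult_integrable[OF sq(2) ind])
 have "ennreal ((nrm2 leb ph)^2) = (\<integral>\<^sup>+x. ennreal ((ph x)^2) \<partial>lborel)"
  unfolding nrm2_square using nn_integral_eq_integral[OF sq_int[OF sq(1)]] by (simp add: nn_integral_completion)
 also have "... <= (\<integral>\<^sup>+x. ennreal (norm (grad ph x)) \<partial>lborel)^2"
  by (rule GNS_nn_integral[OF K])
 also have "(\<integral>\<^sup>+x. ennreal (norm (grad ph x)) \<partial>lborel) = ennreal (LINT x|leb. norm (grad ph x))"
  using nn_integral_eq_integral[OF i] by (simp add: nn_integral_completion)
 finally have "(nrm2 leb ph)^2 <= (LINT x|leb. norm (grad ph x))^2"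
  by (simp add: ennreal_power)
 hence "nrm2 leb ph <= (LINT x|leb. norm (grad ph x))"
  by (rule power2_le_imp_le) simp
 also have "... = (LINT x|leb. norm (grad ph x) * norm (indicator S x :: real))"
  by (subst eq) (rule refl)
 also have "... <= nrm2 leb (grad ph) * nrm2 leb (indicator S :: R2 => real)"
  by (rule Cauchy_Schwarz_nrm2[OF sq(2) ind])
 also have "nrm2 leb (indicator S :: R2 => real) = sqrt (measure leb S)"
 proof -
  have "(%x. (norm (indicator S x :: real))^2) = indicator S" by (auto simp: indicator_def fun_eq_iff)
  thus ?thesis by (simp add: nrm2_def)
 qed
 finally show ?thesis by (simp add: mult.commute)
qed

section \<open>Stampacchia's estimate\<close>

text \<open>The relation is superlinear in \<open>a\<close>, so along levels that increase by d /
  2^(j+1) the values decay geometrically, by a factor 2^(-1/be) per step. The offset e keeps the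
  first level strictly above M, where the relation is available.\<close>

lemma Stampacchia_iteration:
 fixes a :: "real => real"
 assumes anti: "!!k h. k <= h ==> a h <= a k" and a0: "!!k. 0 <= a k" and S: "!!k. a k <= S"
  and rel: "!!k h. M < k ==> k < h ==> (h - k) * a h <= Q * a k powr (1 + be)"
  and Q: "Q > 0" and be: "be > 0" and e: "e > 0"
 shows "a (M + e + 2 * 2 powr (1 / be) * Q * S powr be) = 0"
proof (cases "S = 0")
 case True
 thus ?thesis using S[of "M + e + 2 * 2 powr (1 / be) * Q * S powr be"] a0 by (auto intro: antisym)
next
 case False
 hence S0: "S > 0" using a0[of 0] S[of 0] by linarith
 \<comment> \<open>Exactly the value for which the bound \<open>S * 2 powr (- (real j / be))\<close>
   reproduces itself: the factor 2 compensates the halved gap between levels and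
   \<open>2 powr (1 / be)\<close> pays for the decay.\<close>
 define d where "d = 2 * 2 powr (1 / be) * Q * S powr be"
 have d: "d > 0" using S0 Q by (simp add: d_def)
 define k where "k j = M + e + d * (1 - 1 / 2 ^ j)" for j :: nat
 have bound: "a (k j) <= S * 2 powr (- (real j / be))" for j
 proof (induction j)
  case 0 thus ?case using S by simp
 next
  case (Suc j)
  have kk: "k (Suc j) - k j = d / 2 ^ Suc j" by (simp add: k_def field_simps)
  have kM: "M < k j" using e d by (simp add: k_def add_pos_nonneg less_add_same_cancel1 add.assoc)
  have "d / 2 ^ Suc j * a (k (Suc j)) <= Q * a (k j) powr (1 + be)"
   using rel[OF kM, of "k (Suc j)"] kk d by (metis diff_gt_0_iff_gt divide_pos_pos zero_less_numeral zero_less_power)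
  also have "... <= Q * (S * 2 powr (- (real j / be))) powr (1 + be)"
   using Suc Q a0 be by (intro mult_left_mono powr_mono2) auto
  also have "(S * 2 powr (- (real j / be))) powr (1 + be) = S * S powr be * (2 powr (- (real j / be)) / 2 ^ j)"
  proof -
   have "(2 powr (- (real j / be))) powr be = 2 powr (- real j)"
    using be by (simp add: powr_powr)
   also have "... = 1 / 2 ^ j" by (simp add: powr_minus powr_realpow divide_inverse)
   finally show ?thesis using S0 by (simp add: powr_mult powr_add)
  qed
  finally have 1: "d / 2 ^ Suc j * a (k (Suc j)) <= Q * (S * S powr be * (2 powr (- (real j / be)) / 2 ^ j))" .
  have 2: "Q * (S * S powr be * (2 powr (- (real j / be)) / 2 ^ j))
    = d / 2 ^ Suc j * (S * 2 powr (- (real (Suc j) / be)))"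
  proof -
   have "2 powr (- (real (Suc j) / be)) = 2 powr (- (real j / be)) / 2 powr (1 / be)"
   by (smt (verit, ccfv_threshold) add_divide_distrib of_nat_Suc powr_diff)
   thus ?thesis by (simp add: d_def field_simps)
  qed
  have "0 < d / 2 ^ Suc j" using d by simp
  thus ?case using 1[unfolded 2] by (rule mult_le_cancel_left_pos[THEN iffD1])
 qed
 have "a (M + e + d) <= S * 2 powr (- (real j / be))" for j
  using order_trans[OF anti bound, of j "M + e + d"] d by (simp add: k_def)
 moreover have "(%j. S * 2 powr (- (real j / be))) \<longlonglongrightarrow> S * 0"
 proof (intro tendsto_mult tendsto_const)
  have "(%j. (2 powr (- (1 / be))) ^ j) \<longlonglongrightarrow> 0"
   by (rule LIMSEQ_power_zero) (use be in \<open>simp add: powr_less_one\<close>)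
  thus "(%j. 2 powr (- (real j / be))) \<longlonglongrightarrow> (0::real)"
   by (simp add: powr_powr flip: powr_realpow)
 qed
 ultimately have "a (M + e + d) <= 0" by (intro LIMSEQ_le_const) auto
 thus ?thesis using a0 unfolding d_def by (intro antisym)
qed

text \<open>A C1 substitute for the positive part: for t > 0 it equals t^2 / (t + de). Its
  derivative stays in [0, 1] and it lies at most de below t, the properties the truncation argument
  uses.\<close>

definition bump_pos :: "real => real => real" where
 "bump_pos de t = (if t > 0 then t - de + de^2 / (t + de) else 0)"

definition bump_pos' :: "real => real => real" where
 "bump_pos' de t = 1 - de^2 / (max t 0 + de)^2"

lemma bump_pos_alt: "de > 0 ==> t > 0 ==> bump_pos de t = t^2 / (t + de)"
 by (simp add: bump_pos_def field_simps power2_eq_square)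

lemma DERIV_bump_pos:
 assumes "de > 0" shows "DERIV (bump_pos de) t :> bump_pos' de t"
proof -
 consider "t > 0" | "t < 0" | "t = 0" by linarith
 thus ?thesis
 proof cases
  case 1
  have "DERIV (%t. t - de + de^2 / (t + de)) t :> bump_pos' de t"
   using 1 assms by (auto intro!: derivative_eq_intros simp: bump_pos'_def max_def power2_eq_square)
  thus ?thesis
   by (rule has_field_derivative_transform_within_open[where S = "{0<..}"]) (use 1 in \<open>auto simp: bump_pos_def\<close>)
 next
  case 2
  have "DERIV (%t::real. 0::real) t :> bump_pos' de t" using 2 assms by (simp add: bump_pos'_def)
  thus ?thesis
   by (rule has_field_derivative_transform_within_open[where S = "{..<0}"]) (use 2 in \<open>auto simp: bump_pos_def\<close>)
 next
  case 3
  have "((%h. (bump_pos de h - bump_pos de 0) / h) \<longlongrightarrow> 0) (at 0)"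
  proof (rule Lim_null_comparison)
   show "\<forall>\<^sub>F h in at 0. norm ((bump_pos de h - bump_pos de 0) / h) <= \<bar>h\<bar> / de"
   proof (rule always_eventually, rule allI)
    fix h :: real
    show "norm ((bump_pos de h - bump_pos de 0) / h) <= \<bar>h\<bar> / de"
    proof (cases "h > 0")
     case True
     thus ?thesis using assms bump_pos_alt[OF assms True]
      by (simp add: bump_pos_def[of _ 0] power2_eq_square frac_le)
    next
     case False
     have "0 <= \<bar>h\<bar> / de" using assms by (intro divide_nonneg_pos) auto
     thus ?thesis using False by (simp add: bump_pos_def)
    qed
   qed
   show "((%h. \<bar>h\<bar> / de) \<longlongrightarrow> 0) (at 0)"
    using assms by (auto intro!: tendsto_eq_intros)
  qed
  thus ?thesis using 3 assms by (simp add: DERIV_def bump_pos'_def)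
 qed
qed

lemma bump_pos'_bounds:
 assumes "de > 0" shows "0 <= bump_pos' de t" "bump_pos' de t <= 1" "t <= 0 ==> bump_pos' de t = 0"
proof -
 have "de^2 <= (max t 0 + de)^2" using assms by (intro power_mono) auto
 thus "0 <= bump_pos' de t" using assms by (simp add: bump_pos'_def divide_simps)
qed (use assms in \<open>auto simp: bump_pos'_def\<close>)

lemma continuous_bump_pos': "de > 0 ==> continuous_on UNIV (bump_pos' de)"
proof -
 assume "de > 0"
 hence "max t 0 + de > 0" for t :: real by (intro add_nonneg_pos) auto
 hence "max t 0 + de ~= 0" for t :: real by (metis less_irrefl)
 thus ?thesis unfolding bump_pos'_def by (intro continuous_intros) auto
qed

lemma bump_pos_bounds:
 assumes "de > 0" shows "0 <= bump_pos de t" "t - de <= bump_pos de t" "t <= 0 ==> bump_pos de t = 0"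
proof -
 have "de^2 / (t + de) >= 0" if "t > 0" using that assms by simp
 thus "t - de <= bump_pos de t" using assms by (simp add: bump_pos_def)
 have "t^2 / (t + de) >= 0" if "t > 0" using that assms by simp
 thus "0 <= bump_pos de t"
  using bump_pos_alt[OF assms, of t] by (cases "t > 0") (simp_all add: bump_pos_def[of de t] del: bump_pos_alt)
 show "t <= 0 ==> bump_pos de t = 0" by (simp add: bump_pos_def)
qed

lemma bump_pos_Lipschitz:
 assumes "de > 0" shows "\<bar>bump_pos de s - bump_pos de t\<bar> <= \<bar>s - t\<bar>"
proof -
 have *: "\<bar>bump_pos de s - bump_pos de t\<bar> <= \<bar>s - t\<bar>" if ts: "t < s" for s t
 proof -
  obtain z where "bump_pos de s - bump_pos de t = (s - t) * bump_pos' de z"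
   using MVT2[OF ts, of "bump_pos de" "bump_pos' de"] DERIV_bump_pos[OF assms] by auto
  thus ?thesis
   using bump_pos'_bounds[OF assms, of z] ts by (simp add: abs_mult mult_left_le)
 qed
 show ?thesis using *[of s t] *[of t s] by (cases s t rule: linorder_cases) auto
qed

text \<open>The truncation \<open>(ph - k)\<^sup>+\<close> (smoothed), cut off outside \<open>V\<close>: the superlevel set is compact in \<open>V\<close>, so
  this is an admissible test function.\<close>

lemma truncation_C1c:
 assumes V: "open V" and ph: "C1 ph" and cpt: "compact {x \<in> V. ph x >= k}" and de: "de > 0"
 defines "z \<equiv> (%x. if x \<in> V then bump_pos de (ph x - k) else 0)"
 shows "z \<in> C1c V" "grad z = (%x. if x \<in> V then bump_pos' de (ph x - k) *\<^sub>R grad ph x else 0)"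
proof -
 let ?K = "{x \<in> V. ph x >= k}"
 let ?g = "%x. if x \<in> V then bump_pos' de (ph x - k) *\<^sub>R grad ph x else 0"
 have oK: "open (- ?K)" using compact_imp_closed[OF cpt] by blast
 have UN: "V \<union> - ?K = UNIV" by blast
 have shift: "C1 (%x. ph x - k)" "grad (%x. ph x - k) = grad ph"
  using C1_diff[OF ph C1_const] grad_diff[OF ph C1_const] by auto
 note comp = C1_compose_real[OF shift(1) DERIV_bump_pos[OF de] continuous_bump_pos'[OF de]]
  grad_compose_real[OF shift(1) DERIV_bump_pos[OF de] continuous_bump_pos'[OF de], unfolded shift(2)]
 have z0: "z x = 0" "?g x = 0" if "x ~: ?K" for x
  using that bump_pos_bounds(3)[OF de, of "ph x - k"] bump_pos'_bounds(3)[OF de, of "ph x - k"]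
  by (auto simp: z_def)
 have der: "GDERIV z x :> ?g x" for x
 proof (cases "x \<in> V")
  case True
  have "GDERIV (%x. bump_pos de (ph x - k)) x :> ?g x"
   using C1D(1)[OF comp(1), of x] True by (simp add: comp(2))
  thus ?thesis unfolding gderiv_def
   by (rule has_derivative_transform_within_open[OF _ V True]) (simp add: z_def)
 next
  case False
  hence x: "x \<in> - ?K" by blast
  have "((%x. 0) has_derivative (%h. h \<bullet> ?g x)) (at x)" using False by simp
  thus ?thesis unfolding gderiv_def
   by (rule has_derivative_transform_within_open[OF _ oK x]) (use z0 in auto)
 qed
 have "continuous_on (V \<union> - ?K) ?g"
 proof (rule continuous_on_open_Un[OF V oK])
  have "continuous_on V (%x. bump_pos' de (ph x - k) *\<^sub>R grad ph x)"
   using C1D(2)[OF comp(1)] by (auto simp: comp(2) intro: continuous_on_subset)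
  thus "continuous_on V ?g" by (rule continuous_on_eq) simp
  show "continuous_on (- ?K) ?g"
   by (rule continuous_on_eq[OF continuous_on_const[of _ 0]]) (use z0(2) in auto)
 qed
 hence c: "continuous_on UNIV ?g" unfolding UN .
 from C1I[OF der c] have C: "C1 z" and gr: "grad z = ?g" by auto
 show "grad z = ?g" by (rule gr)
 show "z \<in> C1c V" unfolding C1c_def
  by (intro CollectI conjI exI[of _ ?K] C cpt allI impI z0(1)) auto
qed

text \<open>A bound on the distribution -div F that improves with the measure of the set where the
  test function lives. For data in W^{-1,q} the exponent is 1/2 - 1/q; for a divergence-free field
  the pairing is 0 and any exponent will do. Applied to F = A G, it records the equation without any
  reference to the size of A.\<close>

definition dual_bound :: "R2 set => real => real => (R2 => R2) => bool" where
 "dual_bound U C be F \<longleftrightarrow> (\<forall>ze\<in>C1c U. \<forall>S\<in>lmeasurable. (\<forall>x. x ~: S --> ze x = 0 & grad ze x = 0) -->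
  \<bar>(LINT x|leb. F x \<bullet> grad ze x)\<bar> <= C * measure leb S powr be * nrm2 leb (grad ze))"

lemma dual_boundD:
 assumes "dual_bound U C be F" "ze \<in> C1c U" "S \<in> lmeasurable" "!!x. x ~: S ==> ze x = 0 & grad ze x = 0"
 shows "(LINT x|leb. F x \<bullet> grad ze x) <= C * measure leb S powr be * nrm2 leb (grad ze)"
 using assms unfolding dual_bound_def by (meson abs_le_D1)

lemma dual_bound_scaleR: "dual_bound U C be (%x. A x *v G x) ==> \<bar>s\<bar> = 1 ==> dual_bound U C be (%x. A x *v (s *\<^sub>R G x))"
 by (simp add: dual_bound_def matrix_vector_mult_scaleR abs_mult)

lemma dual_bound_subset: "dual_bound U C be F ==> V \<subseteq> U ==> dual_bound V C be F"
 unfolding dual_bound_def C1c_def by blast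

text \<open>Compactness of the superlevel sets of the approximants is the form in which
  \<open>u <= M\<close> on the boundary of V is given. Truncations of \<open>ph j\<close>, not of u,
  are tested, since these are genuine C1 functions of compact support. The bound B multiplies only
  \<open>grad (ph j) - G\<close>, which tends to 0, and is absent from the conclusion.\<close>

lemma Stampacchia:
 fixes A :: "R2 => real^2^2" and G :: "R2 => R2"
 assumes V: "open V" "bounded V"
  and ph: "!!j. C1 (ph j)" "L2lim (lebesgue_on V) ph u" "L2lim (lebesgue_on V) (%j. grad (ph j)) G"
  and A: "A \<in> borel_measurable leb" "AE x in leb. norm (A x) <= B"
  and coer: "AE x in leb. \<forall>xs. al * (norm xs)^2 <= (A x *v xs) \<bullet> xs" and al: "al > 0"
  and test: "dual_bound V C be (%x. A x *v G x)"
  and C: "C > 0" and be: "be > 0"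
  and cpt: "!!k j. k > M ==> compact {x \<in> V. ph j x >= k}"
 shows "AE x in leb. x \<in> V --> u x <= M + 2 * 2 powr (1 / be) * (C / al) * measure leb V powr be"
proof -
 have Vs [measurable]: "V \<in> sets leb" using V by simp
 have Vl: "V \<in> lmeasurable" using V by (simp add: lmeasurable_open)
 define v where "v x = indicator V x * u x" for x
 define p where "p j x = indicator V x * ph j x" for j x
 define g where "g j x = indicator V x *\<^sub>R grad (ph j) x" for j x
 define H where "H x = indicator V x *\<^sub>R G x" for x
 have pv: "L2lim leb p v" using ph(2) Vs by (simp add: L2lim_lebesgue_on p_def[abs_def] v_def[abs_def])
 have gH: "L2lim leb g H" using ph(3) Vs by (simp add: L2lim_lebesgue_on g_def[abs_def] H_def[abs_def])
 note P = L2limD[OF pv] and GH = L2limD[OF gH]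
 have [measurable]: "v \<in> borel_measurable leb" "p j \<in> borel_measurable leb" for j
  by (rule sq_meas[OF P(2)]) (rule sq_meas[OF P(1)])
 define a where "a k = measure leb {x \<in> V. v x > k}" for k
 have am: "{x \<in> V. v x > k} \<in> lmeasurable" for k
 proof (rule fmeasurableI2[OF Vl])
  show "{x \<in> V. v x > k} \<in> sets leb" by measurable
 qed auto
 have anti: "a h <= a k" if "k <= h" for k h
  unfolding a_def by (rule measure_mono_fmeasurable[OF _ fmeasurableD[OF am] am]) (use that in auto)
 have aV: "a k <= measure leb V" for k
  unfolding a_def by (rule measure_mono_fmeasurable[OF _ fmeasurableD[OF am] Vl]) auto
 \<comment> \<open>Three levels are needed because measures of superlevel sets need not converge
   under L2 convergence: {ph j > k} is compared with {u > l} for a strictly smaller l, and de is the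
   loss due to smoothing the positive part.\<close>
 have main: "(h - k - de) * a h <= C / al * a l powr (1 + be)"
  if Ml: "M < l" "l < k" and de: "0 < de" "k + de < h" for l k h de
 proof -
  define z where "z j x = (if x \<in> V then bump_pos de (ph j x - k) else 0)" for j x
  have kM: "M < k" using Ml by simp
  have zC: "z j \<in> C1c V" and zg: "grad (z j) = (%x. if x \<in> V then bump_pos' de (ph j x - k) *\<^sub>R grad (ph j) x else 0)" for j
   using truncation_C1c[OF V(1) ph(1) cpt[OF kM] de(1), of j] unfolding z_def by auto
  have z0: "0 <= z j x" for j x using bump_pos_bounds(1)[OF de(1)] by (simp add: z_def)
  note zs = C1c_sq[OF zC]
  define m where "m j = measure leb {x \<in> V. p j x > k}" for j
  have ml: "{x \<in> V. p j x > k} \<in> lmeasurable" for j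
  proof (rule fmeasurableI2[OF Vl])
   show "{x \<in> V. p j x > k} \<in> sets leb" by measurable
  qed auto
  have zoff: "z j x = 0 & grad (z j) x = 0" if "x ~: {x \<in> V. p j x > k}" for j x
   using that bump_pos_bounds(3)[OF de(1), of "ph j x - k"] bump_pos'_bounds(3)[OF de(1), of "ph j x - k"]
   by (auto simp: zg z_def p_def)
  define N where "N j = nrm2 leb (grad (z j))" for j
  define er where "er j = nrm2 leb (%x. g j x - H x)" for j
  define B' where "B' = max B 0"
  have AB: "AE x in leb. norm (A x) <= B'" using A(2) by eventually_elim (simp add: B'_def)
  \<comment> \<open>Testing with the truncation. As its slope b lies in [0, 1], b^2 <= b, and
    coercivity bounds the squared gradient by the pairing with the untruncated gradient. Replacing
    that gradient by the limit \<open>H\<close> costs \<open>B' * er j\<close>.\<close>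
  have Nb: "al * N j <= C * m j powr be + B' * er j" for j
  proof -
   have i1: "integrable leb (%x. (A x *v g j x) \<bullet> grad (z j) x)"
    by (rule sq_inner_integrable[OF sq_matvec[OF A GH(1)] zs(2)])
   have i2: "integrable leb (%x. (A x *v H x) \<bullet> grad (z j) x)"
    by (rule sq_inner_integrable[OF sq_matvec[OF A GH(2)] zs(2)])
   have "al * (N j)^2 = (LINT x|leb. al * (norm (grad (z j) x))^2)"
    by (simp add: N_def nrm2_square)
   also have "... <= (LINT x|leb. (A x *v g j x) \<bullet> grad (z j) x)"
   proof (rule integral_mono_AE)
    show "integrable leb (%x. al * (norm (grad (z j) x))^2)" using sq_int[OF zs(2)] by simp
    show "AE x in leb. al * (norm (grad (z j) x))^2 <= (A x *v g j x) \<bullet> grad (z j) x"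
     using coer
    proof eventually_elim
     case (elim x)
     show ?case
     proof (cases "x \<in> V")
      case True
      define b where "b = bump_pos' de (ph j x - k)"
      have b: "0 <= b" "b <= 1" unfolding b_def using bump_pos'_bounds[OF de(1)] by auto
      have gr: "grad (z j) x = b *\<^sub>R g j x" using True by (simp add: zg g_def b_def)
      have "al * (norm (grad (z j) x))^2 = b * b * (al * (norm (g j x))^2)"
       by (simp add: gr power_mult_distrib power2_eq_square)
      also have "... <= b * (al * (norm (g j x))^2)"
       using b al by (intro mult_right_mono) (auto intro: mult_left_le)
      also have "... <= b * ((A x *v g j x) \<bullet> g j x)"
       using b elim by (intro mult_left_mono) auto
      finally show ?thesis by (simp add: gr)
     qed (simp add: zg)
    qed
   qed (rule i1)
   also have "... = (LINT x|leb. (A x *v H x) \<bullet> grad (z j) x) + (LINT x|leb. (A x *v (g j x - H x)) \<bullet> grad (z j) x)"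
    using i1 i2 by (simp add: matrix_vector_mult_diff_distrib inner_diff_left)
   also have "... <= C * m j powr be * N j + B' * er j * N j"
   proof (rule add_mono)
    have "(LINT x|leb. (A x *v H x) \<bullet> grad (z j) x) = (LINT x|leb. (A x *v G x) \<bullet> grad (z j) x)"
     by (rule Bochner_Integration.integral_cong) (auto simp: H_def zg)
    thus "(LINT x|leb. (A x *v H x) \<bullet> grad (z j) x) <= C * m j powr be * N j"
     using dual_boundD[OF test zC ml zoff] by (simp add: m_def N_def)
    have d: "sq leb (%x. g j x - H x)" by (intro sq_diff GH)
    have "(LINT x|leb. (A x *v (g j x - H x)) \<bullet> grad (z j) x) <= nrm2 leb (%x. A x *v (g j x - H x)) * N j"
     using inner_nrm2_bound[OF sq_matvec[OF A d] zs(2)[of j]] unfolding N_def by linarith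
    also have "... <= B' * er j * N j"
     unfolding er_def N_def by (intro mult_right_mono nrm2_matvec[OF A(1) AB d]) (auto simp: B'_def)
    finally show "(LINT x|leb. (A x *v (g j x - H x)) \<bullet> grad (z j) x) <= B' * er j * N j" .
   qed
   finally have le: "(al * N j) * N j <= (C * m j powr be + B' * er j) * N j"
    by (simp add: power2_eq_square algebra_simps)
   show ?thesis
   proof (cases "N j = 0")
    case True
    thus ?thesis using C by (simp add: er_def B'_def)
   next
    case False
    hence "N j > 0" unfolding N_def using nrm2_nonneg[of leb "grad (z j)"] by linarith
    thus ?thesis using le by simp
   qed
  qed
  \<comment> \<open>Cauchy-Schwarz on the superlevel set gives one factor sqrt(m j), the Sobolev
    inequality the other.\<close>
  have zint: "(LINT x|leb. z j x) <= m j * N j" for j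
  proof -
   have I: "sq leb (indicator {x \<in> V. p j x > k} :: R2 => real)" by (rule sq_indicator[OF ml])
   have eq: "z j x = norm (z j x) * norm (indicator {x \<in> V. p j x > k} x :: real)" for x
    using z0[of j x] zoff[of x j] by (cases "x \<in> {x \<in> V. p j x > k}") auto
   have "(LINT x|leb. z j x) = (LINT x|leb. norm (z j x) * norm (indicator {x \<in> V. p j x > k} x :: real))"
    by (subst eq) (rule refl)
   also have "... <= nrm2 leb (z j) * nrm2 leb (indicator {x \<in> V. p j x > k} :: R2 => real)"
    by (rule Cauchy_Schwarz_nrm2[OF zs(1) I])
   also have "nrm2 leb (indicator {x \<in> V. p j x > k} :: R2 => real) = sqrt (m j)"
   proof -
    have "(%x. (norm (indicator S x :: real))^2) = indicator S" for S :: "R2 set" by (auto simp: indicator_def fun_eq_iff)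
    thus ?thesis by (simp add: nrm2_def m_def)
   qed
   also have "nrm2 leb (z j) * sqrt (m j) <= (sqrt (m j) * N j) * sqrt (m j)"
    using GNS[OF zC ml] zoff by (intro mult_right_mono) (auto simp: m_def N_def)
   also have "... = m j * N j" by (simp add: m_def)
   finally show ?thesis .
  qed
  define y where "y x = (if x \<in> V then bump_pos de (v x - k) else 0)" for x
  have ym [measurable]: "y \<in> borel_measurable leb"
  proof -
   have "bump_pos de \<in> borel_measurable borel"
    using DERIV_bump_pos[OF de(1)] by (intro borel_measurable_continuous_onI continuous_at_imp_continuous_on) (auto intro: DERIV_isCont)
   have "(%x. v x - k) \<in> borel_measurable leb" by measurable
   from measurable_compose[OF this \<open>bump_pos de \<in> borel_measurable borel\<close>]
   have [measurable]: "(%x. bump_pos de (v x - k)) \<in> borel_measurable leb" .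
   show ?thesis unfolding y_def by measurable
  qed
  have yz: "\<bar>z j x - y x\<bar> <= \<bar>p j x - v x\<bar>" for j x
   using bump_pos_Lipschitz[OF de(1), of "ph j x - k" "v x - k"] by (simp add: z_def y_def p_def)
  have ys: "sq leb y"
  proof -
   have "sq leb (%x. z 0 x - y x)"
   proof (rule sq_dominated[OF sq_diff[OF P(1,2)], where C = 1])
    show "(%x. z 0 x - y x) \<in> borel_measurable leb"
     by (intro borel_measurable_diff sq_meas[OF zs(1)] ym)
    show "AE x in leb. norm (z 0 x - y x) <= 1 * norm (p 0 x - v x)"
     by (rule AE_I2) (simp only: real_norm_def mult_1 yz)
   qed
   from sq_diff[OF zs(1)[of 0] this] show ?thesis by simp
  qed
  have VI: "sq leb (indicator V :: R2 => real)" by (rule sq_indicator[OF Vl])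
  have L2z: "L2lim leb z y"
  proof (rule L2lim_squeeze[OF zs(1) ys _ P(3)])
   show "nrm2 leb (%x. z n x - y x) <= nrm2 leb (%x. p n x - v x)" for n
   proof -
    have "nrm2 leb (%x. z n x - y x) <= 1 * nrm2 leb (%x. p n x - v x)"
    proof (rule nrm2_dominated[OF sq_diff[OF P(1,2)]])
     show "(%x. z n x - y x) \<in> borel_measurable leb"
      by (intro borel_measurable_diff sq_meas[OF zs(1)] ym)
     show "AE x in leb. norm (z n x - y x) <= 1 * norm (p n x - v x)"
      by (rule AE_I2) (simp only: real_norm_def mult_1 yz)
    qed simp
    thus ?thesis by simp
   qed
  qed
  have zlim: "(%j. LINT x|leb. z j x) \<longlonglongrightarrow> (LINT x|leb. y x)"
  proof -
   have "(%j. LINT x|leb. z j x \<bullet> indicator V x) \<longlonglongrightarrow> (LINT x|leb. y x \<bullet> indicator V x)"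
    by (rule L2lim_inner[OF L2z L2lim_const[OF VI]])
   moreover have "(%x. z j x \<bullet> indicator V x) = z j" "(%x. y x \<bullet> indicator V x) = y" for j
    by (auto simp: z_def y_def fun_eq_iff)
   ultimately show ?thesis by (simp only:)
  qed
  define et where "et = k - l"
  have et: "et > 0" using Ml by (simp add: et_def)
  \<comment> \<open>Where ph j > k but u <= l, the two differ by at least et = k - l; Chebyshev
    bounds the measure of that set.\<close>
  have mb: "m j <= a l + (nrm2 leb (%x. p j x - v x))^2 / et^2" for j
  proof -
   define E where "E = {x \<in> V. et <= \<bar>p j x - v x\<bar>}"
   have El: "E \<in> lmeasurable"
   proof (rule fmeasurableI2[OF Vl])
    show "E \<in> sets leb" unfolding E_def by measurable
   qed (auto simp: E_def)
   have "m j <= measure leb ({x \<in> V. v x > l} \<union> E)"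
    unfolding m_def
    by (rule measure_mono_fmeasurable[OF _ fmeasurableD[OF ml] fmeasurable.Un[OF am El]]) (auto simp: E_def et_def)
   also have "... <= a l + measure leb E"
    unfolding a_def by (rule measure_Un_le[OF fmeasurableD[OF am] fmeasurableD[OF El]])
   also have "measure leb E <= (nrm2 leb (%x. p j x - v x))^2 / et^2"
   proof -
    have "et^2 * measure leb E = (LINT x|leb. et^2 * indicator E x)" by simp
    also have "... <= (LINT x|leb. (norm (p j x - v x))^2)"
    proof (rule integral_mono)
     show "integrable leb (%x. et^2 * indicator E x)"
      using El by (simp add: lmeasurable_iff_integrable)
     show "integrable leb (%x. (norm (p j x - v x))^2)" by (rule sq_int[OF sq_diff[OF P(1,2)]])
     show "et^2 * indicator E x <= (norm (p j x - v x))^2" for x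
     proof (cases "x \<in> E")
      case True
      hence "et^2 <= \<bar>p j x - v x\<bar>^2" using et by (intro power_mono) (auto simp: E_def)
      thus ?thesis using True by simp
     qed simp
    qed
    finally show ?thesis using et by (simp add: nrm2_square field_simps)
   qed
   finally show ?thesis by simp
  qed
  have a0: "0 <= a l" by (simp add: a_def)
  have m0: "0 <= m j" for j by (simp add: m_def)
  define w where "w j = a l + (nrm2 leb (%x. p j x - v x))^2 / et^2" for j
  have wlim: "w \<longlonglongrightarrow> a l"
  proof -
   have "w \<longlonglongrightarrow> a l + 0^2 / et^2" unfolding w_def
    by (rule tendsto_add[OF tendsto_const tendsto_divide[OF tendsto_power[OF P(3)] tendsto_const]]) (use et in simp)
   thus ?thesis by simp
  qed
  have w0: "0 <= w j" for j unfolding w_def using a0 by (intro add_nonneg_nonneg) auto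
  have "(LINT x|leb. z j x) <= w j * ((C * w j powr be + B' * er j) / al)" for j
  proof -
   have "m j powr be <= w j powr be" using mb[of j] m0[of j] be by (intro powr_mono2) (auto simp: w_def)
   hence "C * m j powr be <= C * w j powr be" using C by (intro mult_left_mono) auto
   hence "al * N j <= C * w j powr be + B' * er j" using Nb[of j] by linarith
   hence "N j <= (C * w j powr be + B' * er j) / al" using al by (simp add: field_simps)
   moreover have "m j <= w j" using mb[of j] by (simp add: w_def)
   ultimately have "m j * N j <= w j * ((C * w j powr be + B' * er j) / al)"
    using m0[of j] w0[of j] by (intro mult_mono) (auto simp: N_def)
   thus ?thesis using zint[of j] by linarith
  qed
  moreover have "(%j. w j * ((C * w j powr be + B' * er j) / al)) \<longlonglongrightarrow> a l * ((C * a l powr be + B' * 0) / al)"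
  proof -
   have "(%j. w j powr be) \<longlonglongrightarrow> a l powr be"
    using tendsto_powr2[OF wlim tendsto_const, of be] be w0 by simp
   moreover have "er \<longlonglongrightarrow> 0" unfolding er_def by (rule GH(3))
   ultimately show ?thesis using al
    by (intro tendsto_mult[OF wlim] tendsto_divide tendsto_add tendsto_mult[OF tendsto_const] tendsto_const) auto
  qed
  ultimately have "(LINT x|leb. y x) <= a l * ((C * a l powr be + B' * 0) / al)"
   by (intro LIMSEQ_le[OF zlim]) auto
  also have "... = C / al * a l powr (1 + be)"
  by (simp add: a0 powr_mult_base)
  finally have up: "(LINT x|leb. y x) <= C / al * a l powr (1 + be)" .
  have "(h - k - de) * a h = (LINT x|leb. (h - k - de) * indicator {x \<in> V. v x > h} x)"
   by (simp add: a_def)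
  also have "... <= (LINT x|leb. y x)"
  proof (rule integral_mono)
   show "integrable leb (%x. (h - k - de) * indicator {x \<in> V. v x > h} x)"
    using am[of h] by (simp add: lmeasurable_iff_integrable)
   have "integrable leb (%x. y x * indicator V x)"
    by (rule sq_mult_integrable[OF ys VI])
   moreover have "y x * indicator V x = y x" for x by (simp add: y_def)
   ultimately show "integrable leb y" by simp
   show "(h - k - de) * indicator {x \<in> V. v x > h} x <= y x" for x
    using bump_pos_bounds(1,2)[OF de(1), of "v x - k"] by (auto simp: y_def indicator_def)
  qed
  finally show ?thesis using up by linarith
 qed
 \<comment> \<open>Here k plays the part of the lowest level of \<open>main\<close>; the middle
   level is k + 1/(n+1), the smoothing parameter is 1/(n+1), and n tends to infinity.\<close>
 have rel: "(h - k) * a h <= C / al * a k powr (1 + be)" if "M < k" "k < h" for k h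
 proof -
  have "(%n. (h - (k + inverse (real (Suc n))) - inverse (real (Suc n))) * a h) \<longlonglongrightarrow> (h - (k + 0) - 0) * a h"
   by (intro tendsto_intros LIMSEQ_inverse_real_of_nat)
  moreover have "\<forall>\<^sub>F n in sequentially. (h - (k + inverse (real (Suc n))) - inverse (real (Suc n))) * a h <= C / al * a k powr (1 + be)"
  proof -
   have "\<forall>\<^sub>F n in sequentially. inverse (real (Suc n)) < (h - k) / 2"
    using LIMSEQ_inverse_real_of_nat that by (intro order_tendstoD(2)[OF LIMSEQ_inverse_real_of_nat]) auto
   thus ?thesis
    by eventually_elim (intro main, use that in \<open>auto simp: field_simps\<close>)
  qed
  ultimately show ?thesis using tendsto_upperbound[of _ _ sequentially] by fastforce
 qed
 define D where "D = 2 * 2 powr (1 / be) * (C / al) * measure leb V powr be"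
 have "AE x in leb. x \<in> V --> u x <= M + inverse (real (Suc n)) + D" for n
 proof -
  have "a (M + inverse (real (Suc n)) + D) = 0"
   unfolding D_def
   by (rule Stampacchia_iteration[OF anti _ aV rel]) (use C al be in \<open>auto simp: a_def\<close>)
  hence "{x \<in> V. v x > M + inverse (real (Suc n)) + D} \<in> null_sets leb"
   unfolding a_def using am emeasure_eq_measure2[OF am] by (intro null_setsI) (auto dest: fmeasurableD)
  hence "AE x in leb. x ~: {x \<in> V. v x > M + inverse (real (Suc n)) + D}" by (rule AE_not_in)
  thus ?thesis by eventually_elim (auto simp: v_def not_less)
 qed
 hence "AE x in leb. \<forall>n. x \<in> V --> u x <= M + inverse (real (Suc n)) + D"
  unfolding AE_all_countable by blast
 thus ?thesis
 proof eventually_elim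
  case (elim x)
  show ?case
  proof
   assume "x \<in> V"
   have "(%n. M + inverse (real (Suc n)) + D) \<longlonglongrightarrow> M + 0 + D"
    by (intro tendsto_intros LIMSEQ_inverse_real_of_nat)
   hence "u x <= M + 0 + D" by (rule LIMSEQ_le_const) (use elim \<open>x \<in> V\<close> in auto)
   thus "u x <= M + 2 * 2 powr (1 / be) * (C / al) * measure leb V powr be" by (simp add: D_def)
  qed
 qed
qed

section \<open>Squares with small boundary oscillation\<close>

text \<open>Squares replace the discs of the classical Courant--Lebesgue argument: their sides are
  segments of coordinate lines, so Tonelli in Cartesian coordinates suffices.\<close>

definition sqr :: "R2 => real => R2 set" where
 "sqr c r = {x. \<forall>i. \<bar>x $ i - c $ i\<bar> < r}"

definition csqr :: "R2 => real => R2 set" where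
 "csqr c r = {x. \<forall>i. \<bar>x $ i - c $ i\<bar> <= r}"

definition annulus :: "R2 => real => R2 set" where
 "annulus c r = csqr c (2 * r) - csqr c r"

lemma csqr_cbox: "csqr c r = cbox (\<chi> i. c $ i - r) (\<chi> i. c $ i + r)"
 by (auto simp: csqr_def mem_box_cart abs_le_iff algebra_simps)

lemma sqr_box: "sqr c r = box (\<chi> i. c $ i - r) (\<chi> i. c $ i + r)"
 by (auto simp: sqr_def mem_box_cart abs_less_iff algebra_simps)

lemma open_sqr: "open (sqr c r)" and compact_csqr: "compact (csqr c r)" and bounded_sqr: "bounded (sqr c r)"
 by (auto simp: sqr_box csqr_cbox)

lemma sqr_subset_csqr: "sqr c r \<subseteq> csqr c r"
 by (auto simp: sqr_def csqr_def less_imp_le)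

lemma csqr_lebesgue [measurable]: "csqr c r \<in> sets leb" and sqr_lebesgue [measurable]: "sqr c r \<in> sets leb"
 by (auto simp: csqr_cbox sqr_box)

lemma annulus_borel: "annulus c r \<in> sets borel"
 by (auto simp: annulus_def csqr_cbox)

lemma annulus_lebesgue [measurable]: "annulus c r \<in> sets leb"
 by (auto simp: annulus_def)

lemma measure_sqr: "r >= 0 ==> measure leb (sqr c r) <= (2 * r)^2"
proof -
 assume r: "r >= 0"
 have "measure leb (sqr c r) <= measure leb (csqr c r)"
  by (rule measure_mono_fmeasurable[OF sqr_subset_csqr]) (auto simp: csqr_cbox)
 also have "... = (\<Prod>i\<in>UNIV. (\<chi> i. c $ i + r) $ i - (\<chi> i. c $ i - r) $ i)"
  unfolding csqr_cbox using r by (subst content_cbox_cart[symmetric]) (auto simp: interval_ne_empty_cart)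
 also have "... = (2 * r)^2" by (simp add: UNIV_2 power2_eq_square)
 finally show ?thesis .
qed

definition oth :: "2 => 2" where "oth i = (if i = 1 then 2 else 1)"

lemma oth: "oth i ~= i" "oth (oth i) = i" "j ~= i ==> j = oth i"
 using exhaust_2[of i] exhaust_2[of j] by (auto simp: oth_def)

lemma all_oth: "(\<forall>k. P k) \<longleftrightarrow> P i & P (oth i)"
 using oth(3) by metis

text \<open>As rh runs through (r, 2r), one side of the square, given by the coordinate i and the
  sign s, sweeps part of the annulus; the integral over the side is dominated by Tonelli.\<close>

lemma side_integral_le:
 assumes f [measurable]: "f \<in> borel_measurable borel" and s: "\<bar>s\<bar> = (1::real)" and r: "r > 0"
 shows "(\<integral>\<^sup>+rh. indicator {r<..<2 * r} rh * (\<integral>\<^sup>+t. indicator {c $ oth i - 2 * r..c $ oth i + 2 * r} t * f (pt i (c $ i + s * rh) t) \<partial>lborel) \<partial>lborel)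
  <= (\<integral>\<^sup>+x. indicator (annulus c r) x * f x \<partial>lborel)"
proof -
 note [measurable] = annulus_borel
 have "(\<integral>\<^sup>+x. indicator (annulus c r) x * f x \<partial>lborel)
   = (\<integral>\<^sup>+a. \<integral>\<^sup>+b. indicator (annulus c r) (pt i a b) * f (pt i a b) \<partial>lborel \<partial>lborel)"
  by (rule nn_integral_pt) measurable
 also have "... = (\<integral>\<^sup>+rh. \<integral>\<^sup>+b. indicator (annulus c r) (pt i (c $ i + s * rh) b) * f (pt i (c $ i + s * rh) b) \<partial>lborel \<partial>lborel)"
 proof (subst nn_integral_real_affine[where t = "c $ i" and c = s])
  show "(%a. \<integral>\<^sup>+b. indicator (annulus c r) (pt i a b) * f (pt i a b) \<partial>lborel) \<in> borel_measurable borel"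
   by (rule measurable_nn_integral_pt) measurable
 qed (use s in auto)
 also have "... >= (\<integral>\<^sup>+rh. indicator {r<..<2 * r} rh * (\<integral>\<^sup>+t. indicator {c $ oth i - 2 * r..c $ oth i + 2 * r} t * f (pt i (c $ i + s * rh) t) \<partial>lborel) \<partial>lborel)"
 proof (rule nn_integral_mono)
  fix rh :: real
  show "indicator {r<..<2 * r} rh * (\<integral>\<^sup>+t. indicator {c $ oth i - 2 * r..c $ oth i + 2 * r} t * f (pt i (c $ i + s * rh) t) \<partial>lborel)
   <= (\<integral>\<^sup>+b. indicator (annulus c r) (pt i (c $ i + s * rh) b) * f (pt i (c $ i + s * rh) b) \<partial>lborel)"
  proof (cases "rh \<in> {r<..<2 * r}")
   case True
   \<comment> \<open>Segments of the full length 4 r are admissible for every rh: coordinate i alone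
     already puts the point outside the inner square.\<close>
   have "pt i (c $ i + s * rh) t \<in> annulus c r" if "t \<in> {c $ oth i - 2 * r..c $ oth i + 2 * r}" for t
   proof -
    have a: "\<bar>s * rh\<bar> = rh" using True r s by (simp add: abs_mult)
    have t: "\<bar>t - c $ oth i\<bar> <= 2 * r" using that by (auto simp: abs_le_iff)
    have 1: "pt i (c $ i + s * rh) t \<in> csqr c (2 * r)"
     unfolding csqr_def mem_Collect_eq all_oth[of _ i] using a t True oth(1)[of i] by (simp add: pt_nth)
    have 2: "pt i (c $ i + s * rh) t ~: csqr c r"
     unfolding csqr_def mem_Collect_eq all_oth[of _ i] using a True by (simp add: pt_nth)
    show ?thesis using 1 2 by (simp add: annulus_def)
   qed
   thus ?thesis using True by (auto intro!: nn_integral_mono simp: indicator_def)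
  qed simp
 qed
 finally show ?thesis .
qed

lemma nn_integral_square_eq:
 fixes f :: "R2 => 'b::euclidean_space"
 assumes "A \<in> sets leb" "sq (lebesgue_on A) f" 
 shows "(\<integral>\<^sup>+x. indicator A x * ennreal ((norm (f x))^2) \<partial>leb) = ennreal ((nrm2 (lebesgue_on A) f)^2)"
proof -
 have i: "integrable leb (%x. indicator A x *\<^sub>R (norm (f x))^2)"
  using assms by (simp add: sq_def integrable_restrict_space)
 have "(\<integral>\<^sup>+x. indicator A x * ennreal ((norm (f x))^2) \<partial>leb) = (\<integral>\<^sup>+x. ennreal (indicator A x *\<^sub>R (norm (f x))^2) \<partial>leb)"
  by (intro nn_integral_cong) (simp add: indicator_def)
 also have "... = ennreal (LINT x|leb. indicator A x *\<^sub>R (norm (f x))^2)"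
  by (rule nn_integral_eq_integral[OF i]) auto
 also have "(LINT x|leb. indicator A x *\<^sub>R (norm (f x))^2) = (nrm2 (lebesgue_on A) f)^2"
  using assms(1) by (simp add: nrm2_square integral_restrict_space)
 finally show ?thesis .
qed

text \<open>Cauchy-Schwarz on the segment: the squared difference of values is at most the length
  times the energy on it.\<close>

lemma line_oscillation:
 assumes ph: "C1 ph" and st: "s \<in> {l..u}" "t \<in> {l..u}"
  and b: "(\<integral>\<^sup>+r. indicator {l..u} r * ennreal ((norm (grad ph (pt i a r)))^2) \<partial>lborel) <= ennreal b" "b >= 0"
 shows "(ph (pt i a t) - ph (pt i a s))^2 <= (u - l) * b"
proof -
 have *: "(ph (pt i a t) - ph (pt i a s))^2 <= (u - l) * b" if "s <= t" "l <= s" "t <= u" for s t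
 proof -
  have [measurable]: "(%r. norm (grad ph (pt i a r))) \<in> borel_measurable borel"
   by (intro borel_measurable_continuous_onI continuous_intros continuous_on_compose2[OF C1D(2)[OF ph] continuous_pt_line(1)]) auto
  have "ennreal ((ph (pt i a t) - ph (pt i a s))^2) = (ennreal \<bar>ph (pt i a t) - ph (pt i a s)\<bar>)^2"
   by (simp add: ennreal_power)
  also have "... <= (\<integral>\<^sup>+r. indicator {s..t} r * ennreal (norm (grad ph (pt i a r))) \<partial>lborel)^2"
   by (intro power_mono line_difference_le[OF ph that(1)]) simp
  also have "... <= (\<integral>\<^sup>+r. (indicator {l..u} r * ennreal (norm (grad ph (pt i a r)))) * indicator {l..u} r \<partial>lborel)^2"
   using that by (intro power_mono nn_integral_mono) (auto simp: indicator_def)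
  also have "... <= (\<integral>\<^sup>+r. (indicator {l..u} r * ennreal (norm (grad ph (pt i a r))))^2 \<partial>lborel) * (\<integral>\<^sup>+r. (indicator {l..u} r)^2 \<partial>lborel)"
   by (rule Cauchy_Schwarz_nn_integral) measurable
  also have "(\<integral>\<^sup>+r. (indicator {l..u} r * ennreal (norm (grad ph (pt i a r))))^2 \<partial>lborel)
    = (\<integral>\<^sup>+r. indicator {l..u} r * ennreal ((norm (grad ph (pt i a r)))^2) \<partial>lborel)"
   by (intro nn_integral_cong) (simp add: indicator_def ennreal_power)
  also have "(\<integral>\<^sup>+r. (indicator {l..u} r :: ennreal)^2 \<partial>lborel) = (\<integral>\<^sup>+r. indicator {l..u} r \<partial>lborel)"
   by (intro nn_integral_cong) (simp add: indicator_def)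
  also have "... = ennreal (u - l)" using that by simp
  also have "(\<integral>\<^sup>+r. indicator {l..u} r * ennreal ((norm (grad ph (pt i a r)))^2) \<partial>lborel) * ennreal (u - l) <= ennreal b * ennreal (u - l)"
   by (intro mult_right_mono b) simp
  also have "... = ennreal ((u - l) * b)" using b(2) that by (simp add: mult.commute flip: ennreal_mult)
  finally show ?thesis using that b(2) by (simp add: ennreal_le_iff)
 qed
 show ?thesis
 proof (cases "s <= t")
  case True
  thus ?thesis using *[of s t] st by auto
 next
  case False
  thus ?thesis using *[of t s] st by (auto simp: power2_commute)
 qed
qed

text \<open>Courant--Lebesgue: by Fatou's lemma some square of the annulus carries, along a subsequence, little
  energy on its boundary. The term \<open>ka * ph^2\<close> in the proof only keeps the boundary values bounded.\<close>

lemma good_square: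
 assumes ph: "!!j. C1 (ph j)" and S: "S \<in> sets leb" "annulus c r \<subseteq> S"
  and L: "L2lim (lebesgue_on S) ph u" "L2lim (lebesgue_on S) (%j. grad (ph j)) G"
  and r: "r > 0" and de: "de > 0" "16 * (nrm2 (lebesgue_on (annulus c r)) G)^2 < de^2" and et: "et > 0"
 obtains rh k m where "r < rh" "rh < 2 * r" "strict_mono (k :: nat => nat)"
  "!!j x. x \<in> csqr c rh - sqr c rh ==> \<bar>ph (k j) x - m\<bar> <= 2 * de + et"
proof -
 let ?A = "annulus c r"
 note LA = L2lim_subset[OF S(1) annulus_lebesgue S(2) L(1)] L2lim_subset[OF S(1) annulus_lebesgue S(2) L(2)]
 define e where "e = (nrm2 (lebesgue_on ?A) G)^2"
 define U where "U = (nrm2 (lebesgue_on ?A) u)^2"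
 have U0: "U >= 0" "e >= 0" by (auto simp: U_def e_def)
 \<comment> \<open>Small enough for \<open>16 * (e + ka * U) < de^2\<close> to survive the added
   term; U + 1 avoids a division by 0.\<close>
 define ka where "ka = (de^2 / 16 - e) / (2 * (U + 1))"
 have ka: "ka > 0" using de(2) U0 by (simp add: ka_def e_def)
 have kaU: "16 * (e + ka * U) < de^2"
 proof -
  have "ka * U <= ka * (U + 1)" using ka by simp
  also have "... = (de^2 / 16 - e) / 2" using U0 by (simp add: ka_def field_simps)
  also have "... < de^2 / 16 - e" using de(2) by (simp add: e_def)
  finally show ?thesis by simp
 qed
 \<comment> \<open>A segment of length 4 r with energy at most b has oscillation at most sqrt(4 r b)
   = de.\<close>
 define b where "b = de^2 / (4 * r)"
 have b: "b > 0" using de r by (simp add: b_def)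
 define f where "f j x = ennreal ((norm (grad (ph j) x))^2) + ennreal ka * ennreal ((norm (ph j x))^2)" for j x
 have [measurable]: "ph j \<in> borel_measurable borel" "grad (ph j) \<in> borel_measurable borel" for j
  using C1_measurable[OF ph] by auto
 have fm [measurable]: "f j \<in> borel_measurable borel" for j
  unfolding f_def by measurable
 define sd where "sd j i s rh = (\<integral>\<^sup>+t. indicator {c $ oth i - 2 * r..c $ oth i + 2 * r} t * f j (pt i (c $ i + s * rh) t) \<partial>lborel)" for j i s rh
 have sdm [measurable]: "sd j i s \<in> borel_measurable borel" for j i s
 proof -
  have "(%a. \<integral>\<^sup>+t. (%x. indicator {x. c $ oth i - 2 * r <= x $ oth i & x $ oth i <= c $ oth i + 2 * r} x * f j x) (pt i a t) \<partial>lborel) \<in> borel_measurable borel"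
   by (rule measurable_nn_integral_pt) measurable
  also have "(%a. \<integral>\<^sup>+t. (%x. indicator {x. c $ oth i - 2 * r <= x $ oth i & x $ oth i <= c $ oth i + 2 * r} x * f j x) (pt i a t) \<partial>lborel)
   = (%a. \<integral>\<^sup>+t. indicator {c $ oth i - 2 * r..c $ oth i + 2 * r} t * f j (pt i a t) \<partial>lborel)"
   using oth(1)[of i] by (intro ext nn_integral_cong) (simp add: indicator_def pt_nth)
  finally have "(%a. \<integral>\<^sup>+t. indicator {c $ oth i - 2 * r..c $ oth i + 2 * r} t * f j (pt i a t) \<partial>lborel) \<in> borel_measurable borel" .
  from measurable_compose[OF _ this, of "%rh. c $ i + s * rh" borel] show ?thesis unfolding sd_def by simp
 qed
 define h where "h j rh = sd j 1 1 rh + sd j 1 (-1) rh + sd j 2 1 rh + sd j 2 (-1) rh" for j rh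
 have [measurable]: "h j \<in> borel_measurable borel" for j unfolding h_def by measurable
 define E where "E j = (nrm2 (lebesgue_on ?A) (grad (ph j)))^2 + ka * (nrm2 (lebesgue_on ?A) (ph j))^2" for j
 have Elim: "E \<longlonglongrightarrow> e + ka * U"
  unfolding E_def e_def U_def
  by (rule tendsto_add[OF tendsto_power[OF L2lim_norm[OF LA(2)]] tendsto_mult[OF tendsto_const tendsto_power[OF L2lim_norm[OF LA(1)]]]])
 have fE: "(\<integral>\<^sup>+x. indicator ?A x * f j x \<partial>lborel) = ennreal (E j)" for j
 proof -
  have "(\<integral>\<^sup>+x. indicator ?A x * f j x \<partial>lborel) = (\<integral>\<^sup>+x. indicator ?A x * ennreal ((norm (grad (ph j) x))^2) + ennreal ka * (indicator ?A x * ennreal ((norm (ph j x))^2)) \<partial>lborel)"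
   by (intro nn_integral_cong) (simp add: f_def algebra_simps)
  also have "... = (\<integral>\<^sup>+x. indicator ?A x * ennreal ((norm (grad (ph j) x))^2) \<partial>lborel) + ennreal ka * (\<integral>\<^sup>+x. indicator ?A x * ennreal ((norm (ph j x))^2) \<partial>lborel)"
   using annulus_borel[of c r] by (subst nn_integral_add, measurable, subst nn_integral_cmult, measurable)
  also have "... = ennreal (E j)"
   using nn_integral_square_eq[OF annulus_lebesgue L2limD(1)[OF LA(2)], of j] nn_integral_square_eq[OF annulus_lebesgue L2limD(1)[OF LA(1)], of j] ka
   unfolding E_def by (subst ennreal_plus) (simp_all add: nn_integral_completion ennreal_mult)
  finally show ?thesis .
 qed
 have hE: "(\<integral>\<^sup>+rh. indicator {r<..<2 * r} rh * h j rh \<partial>lborel) <= ennreal (4 * E j)" for j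
 proof -
  have E0: "0 <= E j" using ka by (simp add: E_def)
  have s: "(\<integral>\<^sup>+rh. indicator {r<..<2 * r} rh * sd j i s rh \<partial>lborel) <= ennreal (E j)" if "\<bar>s\<bar> = 1" for i s
   using side_integral_le[OF fm[of j] that r, of c i] unfolding fE sd_def .
  have "(\<integral>\<^sup>+rh. indicator {r<..<2 * r} rh * h j rh \<partial>lborel) =
    (\<integral>\<^sup>+rh. indicator {r<..<2 * r} rh * sd j 1 1 rh \<partial>lborel) + (\<integral>\<^sup>+rh. indicator {r<..<2 * r} rh * sd j 1 (-1) rh \<partial>lborel)
    + (\<integral>\<^sup>+rh. indicator {r<..<2 * r} rh * sd j 2 1 rh \<partial>lborel) + (\<integral>\<^sup>+rh. indicator {r<..<2 * r} rh * sd j 2 (-1) rh \<partial>lborel)"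
   unfolding h_def by (simp add: distrib_left nn_integral_add)
  also have "... <= ennreal (E j) + ennreal (E j) + ennreal (E j) + ennreal (E j)"
   by (intro add_mono s) auto
  also have "... = ennreal (4 * E j)" using E0 by (simp flip: ennreal_plus)
  finally show ?thesis .
 qed
 \<comment> \<open>If the liminf were at least b for every rh, Fatou would give b r <= 4 (e + ka U),
   four being the number of sides; but b r = de^2 / 4, against the choice of ka.\<close>
 have "\<exists>rh. r < rh & rh < 2 * r & liminf (%j. h j rh) < ennreal b"
 proof (rule ccontr)
  assume neg: "\<not> ?thesis"
  have ge: "ennreal b <= liminf (%j. h j rh)" if "r < rh" "rh < 2 * r" for rh
   using neg that by (auto simp: not_less dest!: spec[of _ rh])
  have "ennreal (b * r) = (\<integral>\<^sup>+rh. ennreal b * indicator {r<..<2 * r} rh \<partial>lborel)"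
   using r b by (simp add: nn_integral_cmult ennreal_mult)
  also have "... <= (\<integral>\<^sup>+rh. liminf (%j. indicator {r<..<2 * r} rh * h j rh) \<partial>lborel)"
   by (intro nn_integral_mono) (auto simp: indicator_def ge)
  also have "... <= liminf (%j. \<integral>\<^sup>+rh. indicator {r<..<2 * r} rh * h j rh \<partial>lborel)"
   by (rule nn_integral_liminf) measurable
  also have "... <= liminf (%j. ennreal (4 * E j))"
   by (intro Liminf_mono always_eventually allI hE)
  also have "... = ennreal (4 * (e + ka * U))"
   by (intro lim_imp_Liminf tendsto_ennrealI tendsto_mult tendsto_const Elim) simp
  finally have "b * r <= 4 * (e + ka * U)"
   using U0 ka by (subst (asm) ennreal_le_iff) auto
  moreover have "b * r = de^2 / 4" using r by (simp add: b_def)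
  ultimately show False using kaU by simp
 qed
 then obtain rh where rh: "r < rh" "rh < 2 * r" "liminf (%j. h j rh) < ennreal b" by blast
 have "infinite {j. h j rh < ennreal b}"
 proof
  assume "finite {j. h j rh < ennreal b}"
  hence "\<forall>\<^sub>F j in cofinite. \<not> h j rh < ennreal b" by (simp add: eventually_cofinite)
  hence "\<forall>\<^sub>F j in sequentially. ennreal b <= h j rh"
   by (simp add: cofinite_eq_sequentially not_less)
  hence "ennreal b <= liminf (%j. h j rh)" by (rule Liminf_bounded)
  with rh(3) show False by simp
 qed
 then obtain k0 :: "nat => nat" where k0: "strict_mono k0" "!!n. h (k0 n) rh < ennreal b"
  using infinite_enumerate by blast
 have sdb: "sd (k0 n) i s rh <= ennreal b" if "s = 1 \<or> s = -1" for n i s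
 proof -
  have "sd (k0 n) i s rh <= h (k0 n) rh"
   using exhaust_2[of i] that unfolding h_def by (auto intro: add_increasing add_increasing2)
  thus ?thesis using k0(2)[of n] by simp
 qed
 have osc: "\<bar>ph (k0 n) (pt i (c $ i + s * rh) t) - ph (k0 n) (pt i (c $ i + s * rh) t')\<bar> <= de"
  if s: "s = 1 \<or> s = -1" and t: "\<bar>t - c $ oth i\<bar> <= 2 * r" "\<bar>t' - c $ oth i\<bar> <= 2 * r" for n i s t t'
 proof -
  let ?l = "c $ oth i - 2 * r" and ?u = "c $ oth i + 2 * r"
  have "(\<integral>\<^sup>+r'. indicator {?l..?u} r' * ennreal ((norm (grad (ph (k0 n)) (pt i (c $ i + s * rh) r')))^2) \<partial>lborel) <= sd (k0 n) i s rh"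
   unfolding sd_def f_def by (intro nn_integral_mono mult_left_mono) auto
  also have "... <= ennreal b" by (rule sdb[OF s])
  finally have *: "(\<integral>\<^sup>+r'. indicator {?l..?u} r' * ennreal ((norm (grad (ph (k0 n)) (pt i (c $ i + s * rh) r')))^2) \<partial>lborel) <= ennreal b" .
  have "(ph (k0 n) (pt i (c $ i + s * rh) t) - ph (k0 n) (pt i (c $ i + s * rh) t'))^2 <= (?u - ?l) * b"
   by (rule line_oscillation[OF ph _ _ *]) (use t b in \<open>auto simp: abs_le_iff\<close>)
  also have "... = de^2" using r by (simp add: b_def)
  finally show ?thesis using de(1) by (simp add: abs_le_square_iff[symmetric] power2_le_iff_abs_le)
 qed
 define p where "p = pt 1 (c $ 1 + rh) (c $ 2 + rh)"
 \<comment> \<open>Every boundary point reaches the corner p along at most two sides: along its own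
   side to the end where the other coordinate is maximal, then along the adjacent side. Each side
   costs de.\<close>
 have bdry: "\<bar>ph (k0 n) x - ph (k0 n) p\<bar> <= 2 * de" if x: "x \<in> csqr c rh - sqr c rh" for n x
 proof -
  obtain i where i: "\<not> \<bar>x $ i - c $ i\<bar> < rh" using x by (auto simp: sqr_def)
  have le: "\<bar>x $ l - c $ l\<bar> <= rh" for l using x by (auto simp: csqr_def)
  define s where "s = (if x $ i - c $ i >= 0 then 1 else -1 :: real)"
  have xi: "x $ i = c $ i + s * rh" using i le[of i] by (auto simp: s_def abs_if split: if_splits)
  have xe: "x = pt i (c $ i + s * rh) (x $ oth i)" using pt_eta[of i "oth i" x] oth(1)[of i] xi by auto
  let ?q = "pt i (c $ i + s * rh) (c $ oth i + rh)"
  have 1: "\<bar>ph (k0 n) x - ph (k0 n) ?q\<bar> <= de"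
   by (subst xe, rule osc) (use le[of "oth i"] rh r in \<open>auto simp: s_def\<close>)
  have q: "?q = pt (oth i) (c $ oth i + 1 * rh) (c $ i + s * rh)" using oth(1)[of i] by (simp add: pt_swap)
  have p: "p = pt (oth i) (c $ oth i + 1 * rh) (c $ i + rh)"
   using exhaust_2[of i] pt_swap[of 1 2] by (auto simp: p_def oth_def)
  have 2: "\<bar>ph (k0 n) ?q - ph (k0 n) p\<bar> <= de"
   unfolding q p by (rule osc) (use rh r in \<open>auto simp: s_def oth(2)\<close>)
  show ?thesis using 1 2 by linarith
 qed
 \<comment> \<open>Some point of the line x_1 = c_1 + rh has value at most sqrt(b / (r ka));
   otherwise the zeroth-order term alone would contribute (b / r) (4 r) = 4 b there, more than the
   total b.\<close>
 have pb: "\<bar>ph (k0 n) p\<bar> <= sqrt (b / (r * ka)) + de" for n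
 proof -
  have "\<exists>t. \<bar>t - c $ 2\<bar> <= 2 * r & (ph (k0 n) (pt 1 (c $ 1 + rh) t))^2 <= b / (r * ka)"
  proof (rule ccontr)
   assume neg: "\<not> ?thesis"
   have big: "b / (r * ka) <= (ph (k0 n) (pt 1 (c $ 1 + rh) t))^2" if "\<bar>t - c $ 2\<bar> <= 2 * r" for t
    using neg that by (auto simp: not_le dest!: spec[of _ t])
   have "ennreal (4 * b) = (\<integral>\<^sup>+t. ennreal (b / r) * indicator {c $ 2 - 2 * r..c $ 2 + 2 * r} t \<partial>lborel)"
    using r b by (subst nn_integral_cmult) (auto simp flip: ennreal_mult)
   also have "... <= (\<integral>\<^sup>+t. indicator {c $ 2 - 2 * r..c $ 2 + 2 * r} t * f (k0 n) (pt 1 (c $ 1 + 1 * rh) t) \<partial>lborel)"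
   proof (rule nn_integral_mono)
    fix t
    show "ennreal (b / r) * indicator {c $ 2 - 2 * r..c $ 2 + 2 * r} t <= indicator {c $ 2 - 2 * r..c $ 2 + 2 * r} t * f (k0 n) (pt 1 (c $ 1 + 1 * rh) t)"
    proof (cases "t \<in> {c $ 2 - 2 * r..c $ 2 + 2 * r}")
     case True
     hence "b / (r * ka) <= (ph (k0 n) (pt 1 (c $ 1 + rh) t))^2" by (intro big) (auto simp: abs_le_iff)
     hence "ka * (b / (r * ka)) <= ka * (ph (k0 n) (pt 1 (c $ 1 + rh) t))^2" using ka by (intro mult_left_mono) auto
     hence "b / r <= ka * (ph (k0 n) (pt 1 (c $ 1 + rh) t))^2" using ka by simp
     hence "ennreal (b / r) <= ennreal ka * ennreal ((ph (k0 n) (pt 1 (c $ 1 + rh) t))^2)"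
      using ka by (simp add: ennreal_leI flip: ennreal_mult)
     also have "... <= f (k0 n) (pt 1 (c $ 1 + 1 * rh) t)" unfolding f_def by (simp add: add_increasing)
     finally show ?thesis using True by simp
    qed simp
   qed
   also have "... <= ennreal b" using sdb[of 1 n 1] unfolding sd_def oth_def by simp
   finally show False using b by (simp add: ennreal_le_iff)
  qed
  then obtain t where t: "\<bar>t - c $ 2\<bar> <= 2 * r" "(ph (k0 n) (pt 1 (c $ 1 + rh) t))^2 <= b / (r * ka)" by blast
  have "\<bar>ph (k0 n) (pt 1 (c $ 1 + rh) t)\<bar> <= sqrt (b / (r * ka))"
   using real_le_rsqrt[of "\<bar>ph (k0 n) (pt 1 (c $ 1 + rh) t)\<bar>"] t(2) by simp
  moreover have "\<bar>ph (k0 n) p - ph (k0 n) (pt 1 (c $ 1 + rh) t)\<bar> <= de"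
   using osc[of 1 "c $ 2 + rh" 1 t n] t(1) rh r by (simp add: p_def oth_def)
  ultimately show ?thesis by linarith
 qed
 \<comment> \<open>A further subsequence makes the corner values converge, which yields one constant
   m for all remaining indices.\<close>
 have "bounded (range (%n. ph (k0 n) p))"
  unfolding bounded_iff using pb by auto
 then obtain m k1 where k1: "strict_mono (k1 :: nat => nat)" "(%n. ph (k0 (k1 n)) p) \<longlonglongrightarrow> m"
  using bounded_imp_convergent_subsequence[of "%n. ph (k0 n) p"] by (auto simp: o_def)
 then obtain J where J: "!!n. n >= J ==> \<bar>ph (k0 (k1 n)) p - m\<bar> < et"
  using et by (metis LIMSEQ_D real_norm_def)
 show ?thesis
 proof (rule that[OF rh(1,2)])
  show "strict_mono (%n. k0 (k1 (n + J)))"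
   using k0(1) k1(1) by (simp add: strict_mono_def)
  fix n x assume "x \<in> csqr c rh - sqr c rh"
  thus "\<bar>ph (k0 (k1 (n + J))) x - m\<bar> <= 2 * de + et"
   using bdry[of x "k1 (n + J)"] J[of "n + J"] by simp
 qed
qed

lemma csqr_mono: "r <= rh ==> csqr c r \<subseteq> csqr c rh"
 by (auto simp: csqr_def intro: order_trans)

lemma csqr_subset_sqr: "r < rh ==> csqr c r \<subseteq> sqr c rh"
 by (auto simp: csqr_def sqr_def intro: le_less_trans)

text \<open>Provides the compact superlevel sets required by \<open>Stampacchia\<close> in two
  situations. In an interior square, a level above the boundary values keeps the set off the
  boundary of the square. Near the boundary of \<open>Om\<close>, a level above M >= 0 also keeps it
  inside the support of the approximant.\<close>

lemma upper_bound_on_square: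
 fixes A :: "R2 => real^2^2"
 assumes Om: "open Om" and ph: "!!j. C1 (ph j)"
  and S: "S \<in> sets leb" "sqr c rh \<subseteq> S"
  and L: "L2lim (lebesgue_on S) ph u" "L2lim (lebesgue_on S) (%j. grad (ph j)) G"
  and A: "A \<in> borel_measurable leb" "AE x in leb. norm (A x) <= B"
  and coer: "AE x in leb. \<forall>xs. al * (norm xs)^2 <= (A x *v xs) \<bullet> xs" and al: "al > 0"
  and test: "dual_bound Om C be (%x. A x *v G x)"
  and C: "C > 0" "be > 0"
  and bdry: "!!j x. x \<in> csqr c rh - sqr c rh ==> ph j x <= M"
  and alt: "csqr c rh \<subseteq> Om \<or> 0 <= M & (\<forall>j. ph j \<in> C1c Om)"
 shows "AE x in leb. x \<in> sqr c rh \<inter> Om -->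
  u x <= M + 2 * 2 powr (1 / be) * (C / al) * measure leb (sqr c rh \<inter> Om) powr be"
proof -
 let ?V = "sqr c rh \<inter> Om"
 have V: "open ?V" "bounded ?V" using Om open_sqr bounded_sqr by auto
 have Vs: "?V \<in> sets leb" using V by simp
 have VS: "?V \<subseteq> S" using S(2) by blast
 show ?thesis
 proof (rule Stampacchia[OF V ph L2lim_subset[OF S(1) Vs VS L(1)] L2lim_subset[OF S(1) Vs VS L(2)] A coer al dual_bound_subset[OF test Int_lower2] C])
  fix k j assume k: "M < k"
  have cl: "closed {x. ph j x >= k}"
   using continuous_closed_vimage[of "{k..}" "ph j"] C1D(3)[OF ph]
   by (auto simp: vimage_def continuous_on_eq_continuous_at)
  have c1: "compact (csqr c rh \<inter> {x. ph j x >= k})" by (rule compact_Int_closed[OF compact_csqr cl])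
  have nb: "x \<in> sqr c rh" if "x \<in> csqr c rh" "ph j x >= k" for x
   using bdry[of x j] that k by fastforce
  show "compact {x \<in> ?V. ph j x >= k}"
   using alt
  proof
   assume "csqr c rh \<subseteq> Om"
   hence "{x \<in> ?V. ph j x >= k} = csqr c rh \<inter> {x. ph j x >= k}"
    using nb sqr_subset_csqr by blast
   thus ?thesis using c1 by simp
  next
   assume a: "0 <= M & (\<forall>j. ph j \<in> C1c Om)"
   then obtain K where K: "compact K" "K \<subseteq> Om" "!!x. x ~: K ==> ph j x = 0"
    using C1c_support[of "ph j" Om] by metis
   have "x \<in> K" if "ph j x >= k" for x using K(3)[of x] that a k by fastforce
   hence "{x \<in> ?V. ph j x >= k} = K \<inter> (csqr c rh \<inter> {x. ph j x >= k})"
    using nb K(2) sqr_subset_csqr by blast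
   thus ?thesis using compact_Int[OF K(1) c1] by simp
  qed
 qed
qed

text \<open>Bound u and -u on the good square by its boundary values. The term 3 de is the boundary
  oscillation 2 de plus the tolerance de in m; the last term is the Stampacchia bound for a square
  of half side below 2 r. At the boundary of the domain, the hypothesis that every intermediate
  square leaves \<open>Om\<close> on its boundary is what pins m down.\<close>

lemma local_oscillation:
 fixes A :: "R2 => real^2^2"
 assumes Om: "open Om" and ph: "!!j. C1 (ph j)"
  and S: "S \<in> sets leb" "csqr c (2 * r) \<subseteq> S"
  and L: "L2lim (lebesgue_on S) ph u" "L2lim (lebesgue_on S) (%j. grad (ph j)) G"
  and A: "A \<in> borel_measurable leb" "AE x in leb. norm (A x) <= B"
  and coer: "AE x in leb. \<forall>xs. al * (norm xs)^2 <= (A x *v xs) \<bullet> xs" and al: "al > 0"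
  and test: "dual_bound Om C be (%x. A x *v G x)"
  and C: "C > 0" "be > 0" and r: "r > 0"
  and de: "de > 0" "16 * (nrm2 (lebesgue_on (annulus c r)) G)^2 < de^2"
  and alt: "csqr c (2 * r) \<subseteq> Om \<or> (\<forall>j. ph j \<in> C1c Om) & (\<forall>x. x ~: Om --> u x = 0) &
    (\<forall>rh. r < rh & rh < 2 * r --> (\<exists>x\<in>csqr c rh - sqr c rh. x ~: Om))"
 shows "\<exists>m. AE x in leb. x \<in> csqr c r -->
  \<bar>u x - m\<bar> <= 3 * de + 2 * 2 powr (1 / be) * (C / al) * ((4 * r)^2) powr be"
proof -
 have "annulus c r \<subseteq> S" using S(2) by (auto simp: annulus_def)
 then obtain rh k m where rh: "r < rh" "rh < 2 * r" and k: "strict_mono (k :: nat => nat)"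
  and m: "!!j x. x \<in> csqr c rh - sqr c rh ==> \<bar>ph (k j) x - m\<bar> <= 2 * de + de"
  using good_square[OF ph S(1) _ L r de de(1)] by blast
 have m3: "\<bar>ph (k j) x - m\<bar> <= 3 * de" if "x \<in> csqr c rh - sqr c rh" for j x using m[OF that, of j] by simp
 define D where "D = 2 * 2 powr (1 / be) * (C / al) * ((4 * r)^2) powr be"
 have D0: "D >= 0" using C al by (simp add: D_def)
 have Dle: "2 * 2 powr (1 / be) * (C / al) * measure leb (sqr c rh \<inter> Om) powr be <= D"
  unfolding D_def
 proof (intro mult_left_mono powr_mono2)
  have "measure leb (sqr c rh \<inter> Om) <= measure leb (sqr c rh)"
   by (rule measure_mono_fmeasurable) (use Om in \<open>auto simp: sqr_box\<close>)
  also have "... <= (2 * rh)^2" using rh r by (intro measure_sqr) auto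
  also have "... <= (4 * r)^2" using rh r by (intro power_mono) auto
  finally show "measure leb (sqr c rh \<inter> Om) <= (4 * r)^2" .
 qed (use C al in auto)
 have sub: "csqr c rh \<subseteq> csqr c (2 * r)" using rh by (intro csqr_mono) auto
 have qS: "sqr c rh \<subseteq> S" using sub sqr_subset_csqr[of c rh] S(2) by blast
 note Lk = L2lim_subseq[OF L(1) k] L2lim_subseq[OF L(2) k]
 \<comment> \<open>A boundary point of the good square outside \<open>Om\<close> has approximant
   value 0, so m lies within 3 de of 0; hence both m + 3 de and -m + 3 de are nonnegative
   levels.\<close>
 have alt': "csqr c rh \<subseteq> Om \<or> (\<bar>m\<bar> <= 3 * de & (\<forall>j. ph j \<in> C1c Om) & (\<forall>x. x ~: Om --> u x = 0))"
  using alt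
 proof
  assume "csqr c (2 * r) \<subseteq> Om" thus ?thesis using sub by blast
 next
  assume a: "(\<forall>j. ph j \<in> C1c Om) & (\<forall>x. x ~: Om --> u x = 0) &
    (\<forall>rh. r < rh & rh < 2 * r --> (\<exists>x\<in>csqr c rh - sqr c rh. x ~: Om))"
  then obtain x where x: "x \<in> csqr c rh - sqr c rh" "x ~: Om" using rh by blast
  obtain K where "K \<subseteq> Om" "!!x. x ~: K ==> ph (k 0) x = 0"
   using a C1c_support[of "ph (k 0)" Om] by metis
  hence "ph (k 0) x = 0" using x(2) by blast
  thus ?thesis using m3[OF x(1), of 0] a by simp
 qed
 have up: "AE x in leb. x \<in> sqr c rh \<inter> Om --> u x <= (m + 3 * de) + 2 * 2 powr (1 / be) * (C / al) * measure leb (sqr c rh \<inter> Om) powr be"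
 proof (rule upper_bound_on_square[OF Om ph S(1) qS Lk A coer al test C])
  show "csqr c rh \<subseteq> Om \<or> 0 <= m + 3 * de & (\<forall>j. ph (k j) \<in> C1c Om)" using alt' by auto
  show "ph (k j) x <= m + 3 * de" if "x \<in> csqr c rh - sqr c rh" for j x using m3[OF that, of j] by linarith
 qed
 have lo: "AE x in leb. x \<in> sqr c rh \<inter> Om --> - u x <= (- m + 3 * de) + 2 * 2 powr (1 / be) * (C / al) * measure leb (sqr c rh \<inter> Om) powr be"
 proof (rule upper_bound_on_square[where ph = "%j x. - ph (k j) x" and G = "%x. - G x", OF Om C1_uminus[OF ph] S(1) qS L2lim_uminus[OF Lk(1)] _ A coer al _ C])
  show "L2lim (lebesgue_on S) (%j. grad (%x. - ph (k j) x)) (%x. - G x)"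
   using L2lim_uminus[OF Lk(2)] by (simp add: grad_uminus[OF ph])
  show "csqr c rh \<subseteq> Om \<or> 0 <= - m + 3 * de & (\<forall>j. (%x. - ph (k j) x) \<in> C1c Om)"
   using alt'
  proof
   assume a: "\<bar>m\<bar> <= 3 * de & (\<forall>j. ph j \<in> C1c Om) & (\<forall>x. x ~: Om --> u x = 0)"
   have "(%x. - ph (k j) x) \<in> C1c Om" for j
   proof -
    have "ph (k j) \<in> C1c Om" using a by blast
    then obtain K where K: "compact K" "K \<subseteq> Om" "!!x. x ~: K ==> ph (k j) x = 0"
     using C1c_support by metis
    show ?thesis unfolding C1c_def
     by (intro CollectI conjI exI[of _ K] C1_uminus ph K(1,2)) (use K(3) in simp)
   qed
   thus ?thesis using a by auto
  qed simp
  show "- ph (k j) x <= - m + 3 * de" if "x \<in> csqr c rh - sqr c rh" for j x using m3[OF that, of j] by linarith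
  show "dual_bound Om C be (%x. A x *v - G x)" using dual_bound_scaleR[OF test, of "-1"] by simp
 qed
 have "AE x in leb. x \<in> csqr c r --> \<bar>u x - m\<bar> <= 3 * de + D"
  using up lo
 proof eventually_elim
  case (elim x)
  show ?case
  proof
   assume x: "x \<in> csqr c r"
   hence xq: "x \<in> sqr c rh" "x \<in> csqr c rh" using csqr_subset_sqr[OF rh(1)] sqr_subset_csqr by blast+
   show "\<bar>u x - m\<bar> <= 3 * de + D"
   proof (cases "x \<in> Om")
    case True
    thus ?thesis using elim xq Dle by auto
   next
    case False
    thus ?thesis using alt' xq D0 by auto
   qed
  qed
 qed
 thus ?thesis unfolding D_def by blast
qed

section \<open>Integration by parts\<close>

lemma compact_lebesgue: "compact K ==> K \<in> sets (leb :: 'a::euclidean_space measure)"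
 by (simp add: borel_compact)

lemma emeasure_compact_lebesgue_on: "compact K ==> emeasure (lebesgue_on K) (space (lebesgue_on K)) < \<infinity>" for K :: "'a::euclidean_space set"
 using lmeasurable_compact[of K] by (simp add: emeasure_restrict_space fmeasurable_def compact_lebesgue)

lemma sq_continuous_compact:
 fixes f :: "R2 => 'b::euclidean_space"
 assumes "continuous_on UNIV f" "compact K"
 shows "sq (lebesgue_on K) f"
 unfolding sq_def
proof
 show "f \<in> borel_measurable (lebesgue_on K)"
  by (rule measurable_restrict_space1[OF continuous_lebesgue_measurable[OF assms(1)]])
 have "integrable lborel (%x. indicator K x *\<^sub>R (norm (f x))^2)"
  by (rule borel_integrable_compact[OF assms(2)]) (intro continuous_intros continuous_on_subset[OF assms(1)] subset_UNIV)
 hence "integrable leb (%x. indicator K x *\<^sub>R (norm (f x))^2)"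
  by (subst integrable_completion) (auto dest: borel_measurable_integrable)
 thus "integrable (lebesgue_on K) (%x. (norm (f x))^2)"
  by (simp add: integrable_restrict_space compact_lebesgue[OF assms(2)])
qed

lemma L2_loc_iff: "f \<in> L2_loc U \<longleftrightarrow> (\<forall>K. compact K --> K \<subseteq> U --> sq (lebesgue_on K) f)"
 by (auto simp: L2_loc_def L2_def sq_def)

lemma L2_loc_imp_L1_loc: "f \<in> L2_loc U ==> f \<in> L1_loc U"
 unfolding L2_loc_iff L1_loc_def by (auto intro!: sq_imp_integrable_finite emeasure_compact_lebesgue_on)

lemma continuous_L2_loc:
 fixes f :: "R2 => 'b::euclidean_space"
 shows "continuous_on UNIV f ==> f \<in> L2_loc U"
 unfolding L2_loc_iff by (auto intro: sq_continuous_compact)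

text \<open>Translation invariance makes the integral of h (x + k) - h x vanish, while the uniform
  first-order estimate shows that it differs from t times the integral of the partial derivative by
  o(t).\<close>

lemma integral_grad_zero:
 assumes h: "h \<in> C1c U"
 shows "(LINT x|leb. grad h x $ i) = 0"
proof -
 obtain K where K: "C1 h" "compact K" "!!x. x ~: K ==> h x = 0" "!!x. x ~: K ==> grad h x = 0"
  by (rule C1c_support[OF h]) blast
 obtain R where R: "K \<subseteq> cball 0 R"
  using bounded_subset_ballD[OF compact_imp_bounded[OF K(2)], of 0] ball_subset_cball by blast
 define m where "m = measure leb (cball (0::R2) (R + 1))"
 have m0: "m >= 0" by (simp add: m_def)
 have gi: "integrable leb (%x. grad h x $ i)"
  by (rule integrable_compact_support[OF _ K(2)]) (use K(4) C1D(2)[OF K(1)] in \<open>auto intro: continuous_intros\<close>)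
 have hi: "integrable leb h"
  by (rule integrable_compact_support[OF C1D(3)[OF K(1)] K(2,3)])
 have "\<bar>(LINT x|leb. grad h x $ i)\<bar> <= e" if e: "e > 0" for e
 proof -
  obtain d where d: "d > 0" "!!z k. norm k < d ==> \<bar>h (z + k) - h z - k \<bullet> grad h z\<bar> <= e / (m + 1) * norm k"
   using C1_uniform_first_order[OF K(1,2,3), of "e / (m + 1)"] e m0 by (auto simp: divide_simps)
  define t where "t = min d 1 / 2"
  have t: "0 < t" "t < d" "t < 1" using d(1) by (auto simp: t_def)
  define k where "k = t *\<^sub>R axis i (1::real)"
  have nk: "norm k = t" using t by (simp add: k_def)
  have ki: "k \<bullet> v = t * v $ i" for v by (simp add: k_def inner_axis')
  have hs: "integrable leb (%x. h (x + k))"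
   using integrable_scale_shift[OF _ hi, of 1 k] by (simp add: add.commute)
  have eq: "(LINT x|leb. h (x + k)) = (LINT x|leb. h x)"
   using integral_scale_shift[of 1 h k] by (simp add: add.commute)
  have eq2: "t * (LINT x|leb. grad h x $ i) = - (LINT x|leb. h (x + k) - h x - k \<bullet> grad h x)"
   using hs hi gi eq by (simp add: ki)
  have "norm (LINT x|leb. h (x + k) - h x - k \<bullet> grad h x) <= (LINT x|leb. e / (m + 1) * t * indicator (cball (0::R2) (R + 1)) x)"
  proof (rule Bochner_Integration.integral_norm_bound_integral)
   show "integrable leb (%x. h (x + k) - h x - k \<bullet> grad h x)"
    unfolding ki using hs hi gi by auto
   show "integrable leb (%x. e / (m + 1) * t * indicator (cball (0::R2) (R + 1)) x)"
    using lmeasurable_cball[of "0::R2" "R + 1"] by (simp add: lmeasurable_iff_integrable)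
   fix x
   show "norm (h (x + k) - h x - k \<bullet> grad h x) <= e / (m + 1) * t * indicator (cball (0::R2) (R + 1)) x"
   proof (cases "x \<in> cball 0 (R + 1)")
    case True
    thus ?thesis using d(2)[of k x] nk t by simp
   next
    case False
    hence x: "norm x > R + 1" by simp
    have "norm (x + k) > R" using x norm_triangle_ineq2[of x "- k"] nk t by simp
    hence "x + k ~: K" "x ~: K" using x R by auto
    thus ?thesis using K False by simp
   qed
  qed
  also have "... = e / (m + 1) * t * m" by (simp add: m_def)
  finally have "\<bar>t * (LINT x|leb. grad h x $ i)\<bar> <= e / (m + 1) * t * m"
   unfolding eq2 by simp
  hence "t * \<bar>(LINT x|leb. grad h x $ i)\<bar> <= t * (e / (m + 1) * m)"
   using t(1) by (simp add: abs_mult mult_ac)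
  hence "\<bar>(LINT x|leb. grad h x $ i)\<bar> <= e / (m + 1) * m" using t(1) by (rule mult_left_le_imp_le)
  also have "... <= e" using e m0 by (simp add: divide_simps)
  finally show ?thesis .
 qed
 hence "\<bar>(LINT x|leb. grad h x $ i)\<bar> <= 0" by (rule field_le_epsilon[of _ 0, simplified])
 thus ?thesis by simp
qed

lemma C1_mult_C1c:
 assumes "C1 f" "ze \<in> C1c U" shows "(%x. f x * ze x) \<in> C1c U"
proof -
 obtain K where K: "C1 ze" "compact K" "K \<subseteq> U" "!!x. x ~: K ==> ze x = 0"
  by (rule C1c_support[OF assms(2)]) blast
 show ?thesis unfolding C1c_def
  by (intro CollectI conjI exI[of _ K] K C1_mult assms(1)) (simp add: K(4))
qed

lemma integration_by_parts:
 assumes f: "C1 f" and ze: "ze \<in> C1c U"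
 shows "(LINT x|leb. f x * grad ze x $ i) = - (LINT x|leb. grad f x $ i * ze x)"
proof -
 obtain K where K: "C1 ze" "compact K" "!!x. x ~: K ==> ze x = 0" "!!x. x ~: K ==> grad ze x = 0"
  by (rule C1c_support[OF ze]) blast
 note c = C1D(2,3)[OF f] C1D(2,3)[OF K(1)]
 have i: "integrable leb (%x. f x * grad ze x $ i)" "integrable leb (%x. ze x * grad f x $ i)"
  by (rule integrable_compact_support[OF _ K(2)], intro continuous_intros c, simp add: K)+
 have "(LINT x|leb. grad (%x. f x * ze x) x $ i) = 0"
  by (rule integral_grad_zero[OF C1_mult_C1c[OF f ze]])
 hence "(LINT x|leb. f x * grad ze x $ i) + (LINT x|leb. ze x * grad f x $ i) = 0"
  using i by (simp add: grad_mult[OF f K(1)])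
 thus ?thesis by (simp add: mult.commute)
qed

lemma C1_weak_grad:
 assumes "C1 f" shows "is_weak_grad UNIV f (grad f)"
 unfolding is_weak_grad_def lebesgue_on_UNIV_eq
proof (intro conjI ballI allI)
 show "f \<in> L1_loc UNIV" "grad f \<in> L1_loc UNIV"
  by (intro L2_loc_imp_L1_loc continuous_L2_loc C1D[OF assms])+
 fix ph i assume "ph \<in> test_functions UNIV"
 thus "(LINT x|leb. f x * grad ph x $ i) = - (LINT x|leb. grad f x $ i * ph x)"
  by (intro integration_by_parts[OF assms] test_functions_C1c)
qed

lemma weak_grad_add:
 assumes U: "open U" and u: "is_weak_grad U u G" and v: "is_weak_grad U v H"
 shows "is_weak_grad U (%x. u x + v x) (%x. G x + H x)"
 unfolding is_weak_grad_def
proof (intro conjI ballI allI)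
 have L: "u \<in> L1_loc U" "v \<in> L1_loc U" "G \<in> L1_loc U" "H \<in> L1_loc U"
  using u v by (auto simp: is_weak_grad_def)
 show "(%x. u x + v x) \<in> L1_loc U" "(%x. G x + H x) \<in> L1_loc U"
  using L by (auto simp: L1_loc_def)
 fix ph i assume ph: "ph \<in> test_functions U"
 have Us: "U \<in> sets leb" using U by simp
 obtain K where K: "compact K" "K \<subseteq> U" "!!x. x ~: K ==> ph x = 0" using test_functionsE[OF ph] by metis
 have c: "continuous_on UNIV ph" "continuous_on UNIV (%x. grad ph x $ i)"
  using C1D[OF test_functions_C1[OF ph]] by (auto intro: continuous_intros)
 have g0: "grad ph x $ i = 0" if "x ~: K" for x using grad_eq_0_outside[OF K(1,3) that] by simp
 note I = L1_loc_mult_integrable(3)[OF Us _ K(1,2) c(1) K(3)] L1_loc_mult_integrable(3)[OF Us _ K(1,2) c(2) g0]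
 have "(LINT x|lebesgue_on U. (u x + v x) * grad ph x $ i) = (LINT x|lebesgue_on U. u x * grad ph x $ i) + (LINT x|lebesgue_on U. v x * grad ph x $ i)"
  using I(2)[OF L(1)] I(2)[OF L(2)] by (simp add: distrib_right)
 also have "... = - (LINT x|lebesgue_on U. G x $ i * ph x) - (LINT x|lebesgue_on U. H x $ i * ph x)"
  using u v ph unfolding is_weak_grad_def by simp
 also have "... = - (LINT x|lebesgue_on U. (G x + H x) $ i * ph x)"
  using I(1)[OF L1_loc_component[OF L(3)], of i] I(1)[OF L1_loc_component[OF L(4)], of i] by (simp add: distrib_right)
 finally show "(LINT x|lebesgue_on U. (u x + v x) * grad ph x $ i) = - (LINT x|lebesgue_on U. (G x + H x) $ i * ph x)" .
qed

lemma locint_scale_shift: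
 assumes u: "locint u" and s: "s ~= 0"
 shows "locint (%x. u (a + s *\<^sub>R x))"
 unfolding locint_def
proof
 fix R
 let ?S = "norm a + \<bar>s\<bar> * R"
 have "integrable leb (%x. indicator (cball 0 ?S) x *\<^sub>R u x)"
  using u by (simp add: locint_def integrable_restrict_space)
 from integrable_scale_shift[OF s this, of a]
 have i: "integrable leb (%x. indicator (cball 0 ?S) (a + s *\<^sub>R x) *\<^sub>R u (a + s *\<^sub>R x))" .
 have "integrable leb (%x. indicator (cball 0 ?S) (a + s *\<^sub>R x) *\<^sub>R u (a + s *\<^sub>R x) * indicator (cball 0 R) x)"
  by (rule integrable_mult_bounded[OF i, where C = 1]) (rule borel_measurable_indicator, simp, simp add: indicator_def)
 also have "(%x. indicator (cball 0 ?S) (a + s *\<^sub>R x) *\<^sub>R u (a + s *\<^sub>R x) * indicator (cball 0 R) x)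
  = (%x. indicator (cball 0 R) x *\<^sub>R u (a + s *\<^sub>R x))"
 proof
  fix x
  have "norm (a + s *\<^sub>R x) <= ?S" if "norm x <= R"
   using norm_triangle_ineq[of a "s *\<^sub>R x"] mult_left_mono[OF that, of "\<bar>s\<bar>"] by simp
  thus "indicator (cball 0 ?S) (a + s *\<^sub>R x) *\<^sub>R u (a + s *\<^sub>R x) * indicator (cball 0 R) x
   = indicator (cball 0 R) x *\<^sub>R u (a + s *\<^sub>R x)" by (auto simp: indicator_def)
 qed
 finally show "integrable (lebesgue_on (cball 0 R)) (%x. u (a + s *\<^sub>R x))"
  by (simp add: integrable_restrict_space)
qed

lemma L1_loc_vec: "(!!i. locint (%x. G x $ i)) ==> (G :: R2 => R2) \<in> L1_loc UNIV"
 unfolding L1_loc_def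
proof safe
 fix K :: "R2 set" assume G: "!!i. locint (%x. G x $ i)" and "compact K"
 hence i: "integrable (lebesgue_on K) (%x. G x $ i)" for i
  by (auto simp: locint_L1_loc L1_loc_def)
 have "integrable (lebesgue_on K) (%x. \<Sum>i\<in>UNIV. G x $ i *\<^sub>R (axis i 1 :: R2))"
  using i by auto
 also have "(%x. \<Sum>i\<in>UNIV. G x $ i *\<^sub>R (axis i 1 :: R2)) = G"
  using basis_expansion[of "G _"] by (auto simp: scalar_mult_eq_scaleR)
 finally show "integrable (lebesgue_on K) G" .
qed

lemma weak_grad_affine:
 assumes u: "is_weak_grad UNIV u G" and s: "s ~= 0"
 shows "is_weak_grad UNIV (%x. u (a + s *\<^sub>R x)) (%x. s *\<^sub>R G (a + s *\<^sub>R x))"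
 unfolding is_weak_grad_def lebesgue_on_UNIV_eq
proof (intro conjI ballI allI)
 have L: "locint u" "!!i. locint (%x. G x $ i)"
  using u L1_loc_component by (auto simp: is_weak_grad_def locint_L1_loc)
 show "(%x. u (a + s *\<^sub>R x)) \<in> L1_loc UNIV"
  using locint_scale_shift[OF L(1) s] by (simp add: locint_L1_loc)
 show "(%x. s *\<^sub>R G (a + s *\<^sub>R x)) \<in> L1_loc UNIV"
  using locint_cmult[OF locint_scale_shift[OF L(2) s]] by (intro L1_loc_vec) simp
 fix ph :: "R2 => real" and i assume ph: "ph \<in> test_functions UNIV"
 define b where "b = - (1 / s) *\<^sub>R a"
 define ps where "ps y = ph (b + (1 / s) *\<^sub>R y)" for y
 have inv: "b + (1 / s) *\<^sub>R (a + s *\<^sub>R x) = x" for x using s by (simp add: b_def scaleR_add_right)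
 obtain K where K: "compact K" "!!x. x ~: K ==> ph x = 0" using test_functionsE[OF ph] by metis
 have ps: "ps \<in> test_functions UNIV"
 proof (rule test_functionsI)
  show "C_k k ps" for k unfolding ps_def[abs_def] by (rule C_k_affine[OF test_functions_C_k[OF ph]])
  show "compact ((%x. a + s *\<^sub>R x) ` K)" by (intro compact_continuous_image K continuous_intros)
  show "ps y = 0" if "y ~: (%x. a + s *\<^sub>R x) ` K" for y
  proof -
   have "a + s *\<^sub>R (b + (1 / s) *\<^sub>R y) = y" using s by (simp add: b_def scaleR_add_right scaleR_diff_right)
   hence "b + (1 / s) *\<^sub>R y ~: K" using that by (metis imageI)
   thus ?thesis by (simp add: ps_def K(2))
  qed
 qed simp
 have gr: "grad ps y = (1 / s) *\<^sub>R grad ph (b + (1 / s) *\<^sub>R y)" for y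
  unfolding ps_def[abs_def] by (simp add: grad_affine[OF test_functions_C1[OF ph]])
 have "(LINT x|leb. u (a + s *\<^sub>R x) * grad ph x $ i) = (LINT x|leb. s * (u (a + s *\<^sub>R x) * grad ps (a + s *\<^sub>R x) $ i))"
  using s by (simp add: gr inv)
 also have "... = s * (1 / s^2 * (LINT x|leb. u x * grad ps x $ i))"
  using integral_scale_shift[OF s, of "%x. u x * grad ps x $ i" a] by simp
 also have "(LINT x|leb. u x * grad ps x $ i) = - (LINT x|leb. G x $ i * ps x)"
  using u ps by (simp add: is_weak_grad_def lebesgue_on_UNIV_eq)
 also have "s * (1 / s^2 * - (LINT x|leb. G x $ i * ps x)) = - (s * (LINT x|leb. G (a + s *\<^sub>R x) $ i * ps (a + s *\<^sub>R x)))"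
  using integral_scale_shift[OF s, of "%x. G x $ i * ps x" a] by simp
 also have "... = - (LINT x|leb. (s *\<^sub>R G (a + s *\<^sub>R x)) $ i * ph x)"
  by (simp add: ps_def inv mult.assoc)
 finally show "(LINT x|leb. u (a + s *\<^sub>R x) * grad ph x $ i) = - (LINT x|leb. (s *\<^sub>R G (a + s *\<^sub>R x)) $ i * ph x)" .
qed

section \<open>Periodic functions\<close>

definition lat :: "int => (int \<times> int) set" where "lat N = {-N..N} \<times> {-N..N}"

text \<open>Lattice vectors are indexed by pairs of integers: countable, so almost everywhere
  statements hold for all translates at once, and with finite blocks \<open>lat N\<close> for
  sums.\<close>

definition lv :: "int \<times> int => R2" where "lv p = pt 1 (of_int (fst p)) (of_int (snd p))"

lemma finite_lat [simp]: "finite (lat N)" by (simp add: lat_def)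

lemma card_lat: "N >= 0 ==> real (card (lat N)) = (2 * of_int N + 1)^2"
 by (simp add: lat_def power2_eq_square)

lemma lv_nth: "lv p $ 1 = of_int (fst p)" "lv p $ 2 = of_int (snd p)"
 by (auto simp: lv_def pt_nth)

lemma lv_add: "lv p + lv q = lv (p + q)" and lv_diff: "lv p - lv q = lv (p - q)"
 by (auto simp: vec_eq_iff forall_2 lv_nth)

lemma lv_surj: "(\<forall>i. k $ i \<in> \<int>) ==> \<exists>p. k = lv p"
proof -
 assume "\<forall>i. k $ i \<in> \<int>"
 hence "k $ 1 \<in> \<int>" "k $ 2 \<in> \<int>" by auto
 then obtain a b where "k $ 1 = of_int a" "k $ 2 = of_int b" by (auto elim!: Ints_cases)
 hence "k = lv (a, b)" by (simp add: vec_eq_iff forall_2 lv_nth)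
 thus ?thesis by blast
qed

lemma lv_Ints: "lv p $ i \<in> \<int>"
 using exhaust_2[of i] by (auto simp: lv_nth)

lemma Y_periodic_lv: "Y_periodic f \<longleftrightarrow> (\<forall>p. AE y in leb. f (y + lv p) = f y)"
proof
 assume "Y_periodic f"
 thus "\<forall>p. AE y in leb. f (y + lv p) = f y" unfolding Y_periodic_def by (simp add: lv_Ints)
next
 assume a: "\<forall>p. AE y in leb. f (y + lv p) = f y"
 show "Y_periodic f" unfolding Y_periodic_def
 proof (intro allI impI)
  fix k :: R2 assume "\<forall>i. k $ i \<in> \<int>"
  then obtain p where "k = lv p" using lv_surj by blast
  thus "AE y in leb. f (y + k) = f y" using a by blast
 qed
qed

lemma lv_in_lat: "norm (lv p) <= of_int N ==> p \<in> lat N"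
proof -
 assume n: "norm (lv p) <= of_int N"
 have "\<bar>of_int (fst p)\<bar> <= (of_int N :: real)" "\<bar>of_int (snd p)\<bar> <= (of_int N :: real)"
  using component_le_norm_cart[of "lv p" 1] component_le_norm_cart[of "lv p" 2] n by (auto simp: lv_nth)
 hence "\<bar>fst p\<bar> <= N" "\<bar>snd p\<bar> <= N" by linarith+
 thus ?thesis by (cases p) (auto simp: lat_def)
qed

lemma Y_box: "Y = box 0 1"
 by (auto simp: Y_def mem_box_cart)

lemma Y_lebesgue [measurable]: "Y \<in> sets leb" and Y_lmeasurable: "Y \<in> lmeasurable"
 by (auto simp: Y_box)

lemma measure_Y: "measure leb Y = 1"
proof -
 have "measure leb (box 0 1 :: R2 set) = measure leb (cbox 0 1 :: R2 set)"
  by (simp add: measure_lborel_box_eq measure_lborel_cbox_eq)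
 also have "... = (\<Prod>i\<in>UNIV. (1::R2) $ i - (0::R2) $ i)"
  by (subst content_cbox_cart[symmetric]) (auto simp: interval_ne_empty_cart)
 finally show ?thesis by (simp add: Y_box)
qed

text \<open>The half-open cell: its integer translates partition the plane exactly, and it differs
  from \<open>Y\<close> by a null set only.\<close>

definition Y' :: "R2 set" where "Y' = {y. \<forall>i. 0 <= y $ i & y $ i < 1}"

lemma Y'_lebesgue [measurable]: "Y' \<in> sets leb"
proof -
 have "Y' = (\<Inter>i. {y. 0 <= y $ i} \<inter> {y. y $ i < 1})" by (auto simp: Y'_def)
 also have "... \<in> sets borel"
  by (intro sets.countable_INT' borel_closed borel_open sets.Int) 
    (auto intro!: closed_Collect_le open_Collect_less continuous_intros)
 finally show ?thesis by simp
qed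

lemma AE_Y': "AE y in leb. y \<in> Y' \<longleftrightarrow> y \<in> Y"
proof -
 have "negligible (cbox 0 1 - box 0 1 :: R2 set)" by (rule negligible_frontier_interval)
 hence "AE y in leb. y ~: (cbox 0 1 - box 0 1 :: R2 set)"
  by (intro AE_not_in) (simp add: negligible_iff_null_sets)
 thus ?thesis
  by eventually_elim (auto simp: Y'_def Y_box mem_box_cart less_imp_le)
qed

lemma Y'_cell: "\<exists>!p. x - lv p \<in> Y'"
proof (rule ex1I[of _ "(\<lfloor>x $ 1\<rfloor>, \<lfloor>x $ 2\<rfloor>)"])
 show "x - lv (\<lfloor>x $ 1\<rfloor>, \<lfloor>x $ 2\<rfloor>) \<in> Y'"
  by (auto simp: Y'_def forall_2 lv_nth) linarith+
 fix p assume "x - lv p \<in> Y'"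
 hence "0 <= x $ 1 - of_int (fst p)" "x $ 1 - of_int (fst p) < 1" "0 <= x $ 2 - of_int (snd p)" "x $ 2 - of_int (snd p) < 1"
  by (auto simp: Y'_def forall_2 lv_nth)
 hence "fst p = \<lfloor>x $ 1\<rfloor>" "snd p = \<lfloor>x $ 2\<rfloor>" by linarith+
 thus "p = (\<lfloor>x $ 1\<rfloor>, \<lfloor>x $ 2\<rfloor>)" by (simp add: prod_eq_iff)
qed

lemma Y'_norm: "y \<in> Y' ==> norm y <= 2"
proof -
 assume y: "y \<in> Y'"
 have "\<bar>y $ i\<bar> <= 1" for i
 proof -
  have "0 <= y $ i" "y $ i < 1" using y by (auto simp: Y'_def)
  thus ?thesis by simp
 qed
 hence "(\<Sum>i\<in>UNIV. \<bar>y $ i\<bar>) <= (\<Sum>i\<in>(UNIV::2 set). 1)" by (intro sum_mono) auto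
 thus ?thesis using norm_le_l1_cart[of y] by simp
qed

lemma Y_subset_Y': "Y \<subseteq> Y'" by (auto simp: Y_def Y'_def less_imp_le)

text \<open>Cutting the plane into lattice cells. The surplus 2 in the size of the block is the
  bound on the norm of points of the cell, so every cell meeting the ball of radius R is
  counted.\<close>

lemma integral_unfold:
 fixes f :: "R2 => real"
 assumes f: "integrable leb f" and R: "!!x. R < norm x ==> f x = 0" and N: "R + 2 <= of_int N"
 shows "(LINT x|leb. f x) = (\<Sum>p\<in>lat N. LINT y|lebesgue_on Y. f (y + lv p))"
  and "integrable (lebesgue_on Y) (%y. f (y + lv p))"
proof -
 have split: "f x = (\<Sum>p\<in>lat N. f x * indicator Y' (x - lv p))" for x
 proof (cases "R < norm x")
  case True thus ?thesis by (simp add: R)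
 next
  case False
  obtain q where q: "x - lv q \<in> Y'" "!!p. x - lv p \<in> Y' ==> p = q" using Y'_cell[of x] by blast
  have "norm (lv q) <= norm x + norm (x - lv q)" using norm_triangle_ineq4[of x "x - lv q"] by simp
  hence "q \<in> lat N" using Y'_norm[OF q(1)] False N by (intro lv_in_lat) linarith
  have "(\<Sum>p\<in>lat N. f x * indicator Y' (x - lv p)) = (\<Sum>p\<in>lat N. if p = q then f x else 0)"
  by (metis indicator_eq_0_iff indicator_eq_1_iff mult_cancel_left1 mult_zero_right q(1,2))
  thus ?thesis using \<open>q \<in> lat N\<close> by simp
 qed
 have sh: "integrable leb (%y. f (y + lv p))" for p
  using integrable_scale_shift[OF _ f, of 1 "lv p"] by (simp add: add.commute)
 have iY': "integrable leb (%y. f (y + lv p) * indicator Y' y)" for p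
  by (rule integrable_mult_bounded[OF sh, where C = 1]) (auto simp: indicator_def)
 have iY: "integrable leb (%y. f (y + lv p) * indicator Y y)" for p
  by (rule integrable_mult_bounded[OF sh, where C = 1]) (auto simp: indicator_def)
 have i': "integrable leb (%x. f x * indicator Y' (x - lv p))" for p
  using integrable_scale_shift[OF _ iY'[of p], of 1 "- lv p"] by simp
 have "(LINT x|leb. f x) = (\<Sum>p\<in>lat N. LINT x|leb. f x * indicator Y' (x - lv p))"
 proof -
  have "(LINT x|leb. f x) = (LINT x|leb. (\<Sum>p\<in>lat N. f x * indicator Y' (x - lv p)))"
   by (intro Bochner_Integration.integral_cong refl split)
  thus ?thesis by (simp only: Bochner_Integration.integral_sum[OF i'])
 qed
 also have "... = (\<Sum>p\<in>lat N. LINT y|leb. f (y + lv p) * indicator Y' y)"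
 proof (rule sum.cong[OF refl])
  fix p
  show "(LINT x|leb. f x * indicator Y' (x - lv p)) = (LINT y|leb. f (y + lv p) * indicator Y' y)"
   using integral_scale_shift[of 1 "%x. f x * indicator Y' (x - lv p)" "lv p"] by (simp add: add.commute)
 qed
 also have "... = (\<Sum>p\<in>lat N. LINT y|lebesgue_on Y. f (y + lv p))"
 proof (rule sum.cong[OF refl])
  fix p
  have "(LINT y|leb. f (y + lv p) * indicator Y' y) = (LINT y|leb. f (y + lv p) * indicator Y y)"
  proof (rule integral_cong_AE)
   show "AE y in leb. f (y + lv p) * indicator Y' y = f (y + lv p) * indicator Y y"
    using AE_Y' by eventually_elim (auto simp: indicator_def)
  qed (use iY iY' in auto)
  thus "(LINT y|leb. f (y + lv p) * indicator Y' y) = (LINT y|lebesgue_on Y. f (y + lv p))"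
   by (simp add: integral_restrict_space mult.commute)
 qed
 finally show "(LINT x|leb. f x) = (\<Sum>p\<in>lat N. LINT y|lebesgue_on Y. f (y + lv p))" .
 show "integrable (lebesgue_on Y) (%y. f (y + lv p))"
  using iY by (simp add: integrable_restrict_space mult.commute)
qed

text \<open>The sum over all translates is locally finite, hence C1 and periodic. It turns a
  compactly supported test function into one admissible in the cell problem, so that the equation on
  one period gives the equation in the whole plane.\<close>

lemma periodization:
 assumes ze: "ze \<in> C1c UNIV"
 obtains Z where "C1 Z" "!!q y. Z (y + lv q) = Z y"
  "!!R. \<exists>N0. \<forall>N\<ge>N0. \<forall>y. norm y < R --> Z y = (\<Sum>p\<in>lat N. ze (y + lv p)) & grad Z y = (\<Sum>p\<in>lat N. grad ze (y + lv p))"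
proof -
 obtain K where K: "C1 ze" "compact K" "!!x. x ~: K ==> ze x = 0" "!!x. x ~: K ==> grad ze x = 0"
  by (rule C1c_support[OF ze]) blast
 obtain Rze where Rze: "K \<subseteq> cball 0 Rze"
  using bounded_subset_ballD[OF compact_imp_bounded[OF K(2)], of 0] ball_subset_cball by blast
 define I where "I y = {p. y + lv p \<in> cball 0 Rze}" for y
 have Ilat: "I y \<subseteq> lat N" if "norm y + Rze <= of_int N" for y N
 proof
  fix p assume "p \<in> I y"
  hence "norm (lv p) <= norm y + Rze" using norm_triangle_ineq4[of "y + lv p" y] by (simp add: I_def)
  thus "p \<in> lat N" using that by (intro lv_in_lat) linarith
 qed
 define Z where "Z y = (\<Sum>p\<in>I y. ze (y + lv p))" for y
 define GZ where "GZ y = (\<Sum>p\<in>I y. grad ze (y + lv p))" for y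
 have fin: "Z y = (\<Sum>p\<in>lat N. ze (y + lv p))" "GZ y = (\<Sum>p\<in>lat N. grad ze (y + lv p))"
  if "norm y + Rze <= of_int N" for y N
 proof -
  have out: "y + lv p ~: K" if "p \<in> lat N - I y" for p using that Rze by (auto simp: I_def)
  show "Z y = (\<Sum>p\<in>lat N. ze (y + lv p))" "GZ y = (\<Sum>p\<in>lat N. grad ze (y + lv p))"
   unfolding Z_def GZ_def
   by (rule sum.mono_neutral_left[OF finite_lat Ilat[OF that]]; use out K(3,4) in blast)+
 qed
 have loc: "\<exists>N0. \<forall>N\<ge>N0. \<forall>y. norm y < R --> Z y = (\<Sum>p\<in>lat N. ze (y + lv p)) & GZ y = (\<Sum>p\<in>lat N. grad ze (y + lv p))" for R
 proof (intro exI[of _ "\<lceil>R + Rze\<rceil>"] allI impI)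
  fix N and y :: R2 assume "\<lceil>R + Rze\<rceil> <= N" "norm y < R"
  hence "norm y + Rze <= of_int N" by linarith
  thus "Z y = (\<Sum>p\<in>lat N. ze (y + lv p)) & GZ y = (\<Sum>p\<in>lat N. grad ze (y + lv p))"
   using fin by simp
 qed
 have sh: "C1 (%y. ze (y + lv p))" "grad (%y. ze (y + lv p)) = (%y. grad ze (y + lv p))" for p
  using C1_affine[OF K(1), of "lv p" 1] grad_affine[OF K(1), of "lv p" 1] by (simp_all add: add.commute)
 have S: "C1 (%y. \<Sum>p\<in>lat N. ze (y + lv p))" "grad (%y. \<Sum>p\<in>lat N. ze (y + lv p)) = (%y. \<Sum>p\<in>lat N. grad ze (y + lv p))" for N
  using C1_sum[of "lat N" "%p y. ze (y + lv p)"] sh by auto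
 have der: "GDERIV Z x :> GZ x" for x
 proof -
  obtain N where N: "!!y. norm y < norm x + 1 ==> Z y = (\<Sum>p\<in>lat N. ze (y + lv p)) & GZ y = (\<Sum>p\<in>lat N. grad ze (y + lv p))"
   using loc[of "norm x + 1"] by blast
  have "GDERIV (%y. \<Sum>p\<in>lat N. ze (y + lv p)) x :> GZ x"
   using C1D(1)[OF S(1)[of N], of x] N[of x] by (simp add: S(2))
  thus ?thesis unfolding gderiv_def
   by (rule has_derivative_transform_within_open[OF _ open_ball[of 0 "norm x + 1"]]) (use N in auto)
 qed
 have cont: "continuous_on UNIV GZ"
 proof (intro continuous_at_imp_continuous_on ballI)
  fix x :: R2
  obtain N where N: "!!y. norm y < norm x + 1 ==> Z y = (\<Sum>p\<in>lat N. ze (y + lv p)) & GZ y = (\<Sum>p\<in>lat N. grad ze (y + lv p))"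
   using loc[of "norm x + 1"] by blast
  have "continuous_on UNIV (%y. \<Sum>p\<in>lat N. grad ze (y + lv p))"
   using C1D(2)[OF S(1)[of N]] by (simp add: S(2))
  hence "continuous_on (ball 0 (norm x + 1)) GZ"
   by (rule continuous_on_eq[OF continuous_on_subset]) (use N in auto)
  thus "isCont GZ x" by (auto simp: continuous_on_eq_continuous_at)
 qed
 note C = C1I[OF der cont]
 have per: "Z (y + lv q) = Z y" for q y
  unfolding Z_def
 proof (rule sum.reindex_bij_witness[of _ "%p. p - q" "%p. p + q"])
  have *: "y + lv q + lv p = y + lv (p + q)" for p by (simp add: add.assoc lv_add add.commute)
  fix p assume "p \<in> I (y + lv q)"
  thus "p + q \<in> I y" "ze (y + lv (p + q)) = ze (y + lv q + lv p)" by (auto simp: I_def *)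
 next
  have *: "y + lv q + lv p = y + lv (p + q)" for p by (simp add: add.assoc lv_add add.commute)
  fix p assume "p \<in> I y"
  thus "p - q \<in> I (y + lv q)" by (simp add: I_def *)
 qed auto
 show ?thesis
  by (rule that[OF C(1) per]) (use loc in \<open>simp add: C(2)\<close>)
qed

text \<open>Completeness of Lebesgue measure. It transfers measurability from a known gradient to
  the arbitrary representative \<open>wgrad\<close>.\<close>

lemma measurable_AE_lebesgue:
 fixes f g :: "R2 => 'b::euclidean_space"
 assumes f: "f \<in> borel_measurable leb" and ae: "AE x in leb. g x = f x"
 shows "g \<in> borel_measurable leb"
proof (rule borel_measurableI)
 fix S :: "'b set" assume S: "open S"
 obtain N where N: "N \<in> null_sets leb" "{x. g x ~= f x} \<subseteq> N"
  using ae unfolding eventually_ae_filter by auto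
 have sub: "B \<in> sets leb" if "B \<subseteq> N" for B
  using negligible_subset[of N B] that N(1) by (simp add: negligible_iff_null_sets null_setsD2)
 have "g -` S \<inter> space leb = ((f -` S \<inter> space leb) - N) \<union> (g -` S \<inter> N)"
  using N(2) by auto
 also have "... \<in> sets leb"
  using measurable_sets[OF f, of S] S sub[of "g -` S \<inter> N"] N(1) by (intro sets.Un sets.Diff) auto
 finally show "g -` S \<inter> space leb \<in> sets leb" .
qed

lemma measurable_from_cballs:
 fixes f :: "R2 => 'b::euclidean_space"
 assumes "!!R. (%x. indicator (cball 0 R) x *\<^sub>R f x) \<in> borel_measurable leb"
 shows "f \<in> borel_measurable leb"
proof (rule borel_measurable_LIMSEQ_metric[where f = "%n x. indicator (cball 0 (real n)) x *\<^sub>R f x"])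
 fix x :: R2
 obtain n0 :: nat where "norm x <= real n0" using real_arch_simple by blast
 hence "\<forall>n\<ge>n0. f x = indicator (cball 0 (real n)) x *\<^sub>R f x" by (auto simp: indicator_def)
 hence "eventually (%n. f x = indicator (cball 0 (real n)) x *\<^sub>R f x) sequentially"
  by (auto simp: eventually_sequentially intro!: exI[of _ n0])
 thus "(%n. indicator (cball 0 (real n)) x *\<^sub>R f x) \<longlonglongrightarrow> f x"
  by (rule Lim_transform_eventually[OF tendsto_const])
qed (rule assms)

lemma L2_loc_measurable:
 fixes f :: "R2 => 'b::euclidean_space"
 assumes "f \<in> L2_loc UNIV" shows "f \<in> borel_measurable leb"
proof (rule measurable_from_cballs)
 fix R
 have "sq (lebesgue_on (cball 0 R)) f" using assms by (simp add: L2_loc_iff)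
 thus "(%x. indicator (cball 0 R) x *\<^sub>R f x) \<in> borel_measurable leb"
  by (simp add: sq_lebesgue_on sq_meas)
qed

lemma L2_loc_add: "f \<in> L2_loc U ==> g \<in> L2_loc U ==> (%x. f x + g x) \<in> L2_loc U"
 unfolding L2_loc_iff by (auto intro: sq_add)

lemma AE_lebesgue_on_I:
 "S \<in> sets leb ==> AE x in leb. x \<in> S --> P x ==> AE x in lebesgue_on S. P x"
 by (simp add: AE_restrict_space_iff)

lemma weak_grad_linear: "is_weak_grad UNIV (%y. xs \<bullet> y) (%_. xs)"
proof -
 have "GDERIV (%y. xs \<bullet> y) x :> xs" for x
  unfolding gderiv_def by (auto intro!: derivative_eq_intros simp: inner_commute)
 from C1I[OF this continuous_on_const] C1_weak_grad[of "%y. xs \<bullet> y"] show ?thesis by simp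
qed

text \<open>A countable dense set of vectors allows the quantifiers to be exchanged, and continuity
  extends the inequality to all vectors. This order is required because the vectors inserted later
  depend on the point.\<close>

lemma coercive_all:
 assumes "!!xs. AE x in leb. (A x *v xs) \<bullet> xs >= al * (norm (xs::real^2))^2"
 shows "AE x in leb. \<forall>xs. al * (norm xs)^2 <= ((A x :: real^2^2) *v xs) \<bullet> xs"
proof -
 obtain D :: "R2 set" where D: "countable D" "closure D = UNIV"
  using separable[of "UNIV :: R2 set"] by (auto simp: top.extremum_unique)
 have "AE x in leb. \<forall>xs\<in>D. al * (norm xs)^2 <= (A x *v xs) \<bullet> xs"
  unfolding AE_ball_countable[OF D(1)] using assms by blast
 thus ?thesis
 proof eventually_elim
  case (elim x)
  have cl: "closed {xs. al * (norm xs)^2 <= (A x *v xs) \<bullet> xs}"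
   by (intro closed_Collect_le continuous_intros matrix_vector_mult_linear_continuous_on)
  have "closure D \<subseteq> {xs. al * (norm xs)^2 <= (A x *v xs) \<bullet> xs}"
   by (rule closure_minimal[OF _ cl]) (use elim in auto)
  thus ?case using D(2) by auto
 qed
qed

text \<open>Radii of mollification are at most 1, so on the ball of radius R a cut-off outside the
  ball of radius R + 1 is not noticed.\<close>

lemma L2lim_moll_loc:
 assumes "u \<in> L2_loc UNIV"
 shows "L2lim (lebesgue_on (cball 0 R)) (%j. moll j u) u"
proof -
 let ?B = "cball (0::R2) (R + 1)"
 define v where "v x = indicator ?B x * u x" for x
 have u: "locint u" using L2_loc_imp_L1_loc[OF assms] by (simp add: locint_L1_loc)
 have "sq (lebesgue_on ?B) u" using assms by (simp add: L2_loc_iff)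
 hence v: "sq leb v" by (simp add: sq_lebesgue_on v_def[abs_def])
 have L: "L2lim (lebesgue_on (cball 0 R)) (%j. moll j v) v"
  by (rule L2lim_subset[of UNIV]) (use L2lim_moll[OF v] in \<open>auto simp: lebesgue_on_UNIV_eq\<close>)
 have eq: "moll j v x = moll j u x" if x: "x \<in> cball 0 R" for j x
 proof (rule moll_cong_AE[OF locint_sq[OF v] u], rule AE_I2, rule impI)
  fix y assume y: "norm (x - y) < 1 / real (j + 1)"
  have "1 / real (j + 1) <= 1" by simp
  hence "norm (x - y) < 1" using y by linarith
  moreover have "norm y <= norm x + norm (x - y)" using norm_triangle_ineq4[of x "x - y"] by simp
  ultimately have "y \<in> ?B" using x by simp
  thus "v y = u y" by (simp add: v_def)
 qed
 have vu: "v x = u x" if "x \<in> cball 0 R" for x using that by (simp add: v_def)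
 have ind: "indicator (cball 0 R) x *\<^sub>R f x = (indicator (cball 0 R) x *\<^sub>R g x :: real)" if "x \<in> cball 0 R --> f x = g x" for f g and x :: R2
  using that by (simp add: indicator_def)
 have "(%n x. indicator (cball 0 R) x *\<^sub>R moll n v x) = (%n x. indicator (cball 0 R) x *\<^sub>R moll n u x)"
  by (intro ext ind) (simp add: eq)
 moreover have "(%x. indicator (cball 0 R) x *\<^sub>R v x) = (%x. indicator (cball 0 R) x *\<^sub>R u x)"
  by (intro ext ind) (simp add: vu)
 ultimately show ?thesis using L by (simp add: L2lim_lebesgue_on)
qed

lemma L2lim_grad_moll_loc:
 assumes "is_weak_grad UNIV u G" "G \<in> L2_loc UNIV"
 shows "L2lim (lebesgue_on (cball 0 R)) (%j. grad (moll j u)) G"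
proof (rule L2lim_vec)
 fix i
 have "(%x. G x $ i) \<in> L2_loc UNIV" using assms(2) unfolding L2_loc_iff by (auto intro: sq_component)
 from L2lim_moll_loc[OF this] show "L2lim (lebesgue_on (cball 0 R)) (%n x. grad (moll n u) x $ i) (%x. G x $ i)"
  by (simp add: grad_moll_weak[OF assms(1)])
qed

lemma Linf_bound:
 assumes "A \<in> L_inf"
 obtains B where "A \<in> borel_measurable leb" "AE x in leb. norm (A x) <= B"
 using assms by (auto simp: L_inf_def)

lemma Y_periodic_AE: "Y_periodic f ==> AE y in leb. \<forall>p. f (y + lv p) = f y"
 unfolding Y_periodic_lv AE_all_countable by blast

lemma Y_periodic_comb2: "Y_periodic f ==> Y_periodic g ==> Y_periodic (%y. h (f y) (g y))"
 unfolding Y_periodic_lv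
proof
 fix p assume "\<forall>p. AE y in leb. f (y + lv p) = f y" "\<forall>p. AE y in leb. g (y + lv p) = g y"
 hence "AE y in leb. f (y + lv p) = f y" "AE y in leb. g (y + lv p) = g y" by blast+
 thus "AE y in leb. h (f (y + lv p)) (g (y + lv p)) = h (f y) (g y)"
  by eventually_elim simp
qed

lemma periodic_sup_bound:
 assumes per: "Y_periodic f" and b: "AE y in leb. y \<in> Y --> \<bar>f y :: real\<bar> <= b"
 shows "AE y in leb. \<bar>f y\<bar> <= b"
proof -
 have "AE y in leb. y - lv p \<in> Y' --> \<bar>f y\<bar> <= b" for p
 proof -
  have "AE y in leb. y \<in> Y' --> \<bar>f (y + lv p)\<bar> <= b"
   using b AE_Y' Y_periodic_AE[OF per]
  proof eventually_elim
   case (elim y)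
   thus ?case using elim(3)[THEN spec, of p] by simp
  qed
  from AE_scale_shift[OF this, of 1 "- lv p"] show ?thesis by simp
 qed
 hence "AE y in leb. \<forall>p. y - lv p \<in> Y' --> \<bar>f y\<bar> <= b"
  unfolding AE_all_countable by blast
 thus ?thesis by eventually_elim (use Y'_cell in blast)
qed

lemma measure_on_Y: "measure (lebesgue_on Y) Y = 1"
 by (subst measure_restrict_space) (auto simp: measure_Y)

lemma integrable_const_Y: "integrable (lebesgue_on Y) (%y. k :: real)"
 using Y_lmeasurable by (simp add: integrable_restrict_space lmeasurable_iff_integrable)

lemma locint_integrable_Y:
 assumes "locint g" shows "integrable (lebesgue_on Y) g"
proof -
 have "integrable (lebesgue_on (cball 0 2)) g" using assms by (simp add: locint_def)
 hence "set_integrable leb (cball 0 2) g"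
  by (simp add: integrable_restrict_space set_integrable_def)
 hence "set_integrable leb Y g"
  by (rule set_integrable_subset) (use Y_subset_Y' Y'_norm in auto)
 thus ?thesis by (simp add: integrable_restrict_space set_integrable_def)
qed

text \<open>The cell solution is mean-free up to the linear part, so a bound on its oscillation over a square
  containing the cell (through the maximum principle on a good square) is a bound in \<open>L\<^sup>\<infinity>\<close>.\<close>

lemma cell_solution_facts:
 fixes A :: "R2 => real^2^2"
 assumes A: "A \<in> L_inf" "Y_periodic A" and al: "al > 0"
  and coer: "!!xs. AE x in leb. (A x *v xs) \<bullet> xs >= al * (norm xs)^2"
  and W: "cell_solution A xs W"
 obtains P where "W \<in> L2_loc UNIV" "P \<in> L2_loc UNIV" "is_weak_grad UNIV W P" "Y_periodic P"
  "AE y in leb. wgrad UNIV W y = P y"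
  "!!ze. ze \<in> C1c UNIV ==> (LINT x|leb. (A x *v P x) \<bullet> grad ze x) = 0"
  "!!E. nrm2 (lebesgue_on Y) P <= E ==>
    AE y in leb. \<bar>W y - xs \<bullet> y\<bar> <= 2 * (3 * (60 * E + 1) + 64 / al + 2 * norm xs)"
proof -
 define X where "X y = W y - xs \<bullet> y" for y
 have X: "X \<in> H1_per" "(LINT y|lebesgue_on Y. X y) = 0"
  and cell: "!!ph. ph \<in> H1_per ==> (LINT y|lebesgue_on Y. (A y *v wgrad UNIV W y) \<bullet> wgrad UNIV ph y) = 0"
  using W unfolding cell_solution_def X_def by auto
 then obtain GX where GX: "X \<in> L2_loc UNIV" "GX \<in> L2_loc UNIV" "is_weak_grad UNIV X GX" and Xper: "Y_periodic X"
  unfolding H1_per_def H1_loc_def by auto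
 define P where "P y = GX y + xs" for y
 have WX: "W = (%y. X y + xs \<bullet> y)" by (simp add: X_def fun_eq_iff)
 have lin: "(%y. xs \<bullet> y) \<in> L2_loc UNIV" by (intro continuous_L2_loc continuous_intros)
 have W2: "W \<in> L2_loc UNIV" unfolding WX by (rule L2_loc_add[OF GX(1) lin])
 have P2: "P \<in> L2_loc UNIV" unfolding P_def[abs_def]
  by (rule L2_loc_add[OF GX(2)]) (intro continuous_L2_loc continuous_intros)
 have WP: "is_weak_grad UNIV W P" unfolding WX P_def[abs_def]
  by (rule weak_grad_add[OF open_UNIV GX(3) weak_grad_linear])
 \<comment> \<open>The translate of X by a lattice vector equals X almost everywhere, so the
   translated gradient is again a weak gradient of X, and uniqueness applies.\<close>
 have Pper: "Y_periodic P" unfolding Y_periodic_lv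
 proof
  fix p
  have 1: "is_weak_grad UNIV (%y. X (lv p + 1 *\<^sub>R y)) (%y. 1 *\<^sub>R GX (lv p + 1 *\<^sub>R y))"
   by (rule weak_grad_affine[OF GX(3)]) simp
  have ae: "AE y in leb. X (lv p + y) = X y"
   using Xper[unfolded Y_periodic_lv, THEN spec, of p] by (simp add: add.commute)
  have "is_weak_grad UNIV X (%y. GX (lv p + y))"
   unfolding is_weak_grad_def lebesgue_on_UNIV_eq
  proof (intro conjI ballI allI)
   show "X \<in> L1_loc UNIV" using GX(3) by (simp add: is_weak_grad_def)
   show "(%y. GX (lv p + y)) \<in> L1_loc UNIV" using 1 by (simp add: is_weak_grad_def)
   fix ph :: "R2 => real" and i assume ph: "ph \<in> test_functions UNIV"
   have [measurable]: "X \<in> borel_measurable leb" by (rule L2_loc_measurable[OF GX(1)])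
   have [measurable]: "(%x. grad ph x $ i) \<in> borel_measurable leb"
    by (intro continuous_lebesgue_measurable continuous_intros C1D test_functions_C1[OF ph])
   have [measurable]: "(%y. X (lv p + y)) \<in> borel_measurable leb"
    using measurable_scale_shift[of 1 X "lv p"] by simp
   have "(LINT x|leb. X x * grad ph x $ i) = (LINT x|leb. X (lv p + x) * grad ph x $ i)"
   proof (rule integral_cong_AE)
    show "AE x in leb. X x * grad ph x $ i = X (lv p + x) * grad ph x $ i"
     using ae by eventually_elim simp
    show "(%x. X x * grad ph x $ i) \<in> borel_measurable leb"
     "(%x. X (lv p + x) * grad ph x $ i) \<in> borel_measurable leb"
     by (intro borel_measurable_times; fact)+
   qed
   also have "... = - (LINT x|leb. GX (lv p + x) $ i * ph x)"
    using 1 ph by (simp add: is_weak_grad_def lebesgue_on_UNIV_eq)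
   finally show "(LINT x|leb. X x * grad ph x $ i) = - (LINT x|leb. GX (lv p + x) $ i * ph x)" .
  qed
  from weak_grad_unique[OF open_UNIV this GX(3)]
  show "AE y in leb. P (y + lv p) = P y" by (simp add: P_def add.commute)
 qed
 have wP: "AE y in leb. wgrad UNIV W y = P y"
  using wgrad_AE[OF open_UNIV WP] by simp
 obtain B where Am: "A \<in> borel_measurable leb" "AE x in leb. norm (A x) <= B"
  by (rule Linf_bound[OF A(1)])
 have Pm [measurable]: "P \<in> borel_measurable leb" by (rule L2_loc_measurable[OF P2])
 have wPm [measurable]: "wgrad UNIV W \<in> borel_measurable leb" by (rule measurable_AE_lebesgue[OF Pm wP])
 note [measurable] = Am(1)
 \<comment> \<open>Unfold the integral over lattice cells; by periodicity of A and P the sum over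
   translates becomes the cell equation tested with the periodization of \<open>ze\<close>.\<close>
 have test: "(LINT x|leb. (A x *v P x) \<bullet> grad ze x) = 0" if ze: "ze \<in> C1c UNIV" for ze
 proof -
  obtain Z where Z: "C1 Z" "!!q y. Z (y + lv q) = Z y"
   "!!R. \<exists>N0. \<forall>N\<ge>N0. \<forall>y. norm y < R --> Z y = (\<Sum>p\<in>lat N. ze (y + lv p)) & grad Z y = (\<Sum>p\<in>lat N. grad ze (y + lv p))"
   using periodization[OF ze] by metis
  have Zw: "is_weak_grad UNIV Z (grad Z)" by (rule C1_weak_grad[OF Z(1)])
  have ZH: "Z \<in> H1_per"
   unfolding H1_per_def H1_loc_def Y_periodic_lv
   using Zw Z(2) continuous_L2_loc[OF C1D(2)[OF Z(1)]] continuous_L2_loc[OF C1D(3)[OF Z(1)]] by auto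
  have gZm [measurable]: "grad Z \<in> borel_measurable leb"
   by (rule continuous_lebesgue_measurable[OF C1D(2)[OF Z(1)]])
  have wZ: "AE y in leb. wgrad UNIV Z y = grad Z y" using wgrad_AE[OF open_UNIV Zw] by simp
  have [measurable]: "wgrad UNIV Z \<in> borel_measurable leb" by (rule measurable_AE_lebesgue[OF gZm wZ])
  have "0 = (LINT y|lebesgue_on Y. (A y *v wgrad UNIV W y) \<bullet> wgrad UNIV Z y)" using cell[OF ZH] by simp
  also have "... = (LINT y|lebesgue_on Y. (A y *v P y) \<bullet> grad Z y)"
  proof (rule integral_cong_AE)
   show "(%y. (A y *v wgrad UNIV W y) \<bullet> wgrad UNIV Z y) \<in> borel_measurable (lebesgue_on Y)"
    "(%y. (A y *v P y) \<bullet> grad Z y) \<in> borel_measurable (lebesgue_on Y)"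
    by (rule measurable_restrict_space1, measurable)+
   show "AE y in lebesgue_on Y. (A y *v wgrad UNIV W y) \<bullet> wgrad UNIV Z y = (A y *v P y) \<bullet> grad Z y"
    by (rule AE_lebesgue_on_I[OF Y_lebesgue]) (use wP wZ in eventually_elim, simp)
  qed
  finally have z0: "(LINT y|lebesgue_on Y. (A y *v P y) \<bullet> grad Z y) = 0" by simp
  obtain K where K: "C1 ze" "compact K" "!!x. x ~: K ==> grad ze x = 0"
   by (rule C1c_support[OF ze]) blast
  obtain R where R: "K \<subseteq> cball 0 R"
   using bounded_subset_ballD[OF compact_imp_bounded[OF K(2)], of 0] ball_subset_cball by blast
  obtain N0 where N0: "!!N y. N >= N0 ==> norm y < 3 ==> grad Z y = (\<Sum>p\<in>lat N. grad ze (y + lv p))"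
   using Z(3)[of 3] by blast
  define N where "N = max N0 \<lceil>R + 2\<rceil>"
  have N: "R + 2 <= of_int N" "N0 <= N" unfolding N_def by linarith+
  define F where "F x = (A x *v P x) \<bullet> grad ze x" for x
  have F0: "F x = 0" if "R < norm x" for x
  proof -
   have "x ~: K" using that R by auto
   thus ?thesis using K(3) by (simp add: F_def)
  qed
  have Fi: "integrable leb F"
  proof -
   have cb: "cball (0::R2) R \<in> sets leb" by simp
   have s: "sq leb (%x. indicator (cball 0 R) x *\<^sub>R P x)"
    using P2 by (simp add: L2_loc_iff flip: sq_lebesgue_on[OF cb])
   have "integrable leb (%x. (A x *v (indicator (cball 0 R) x *\<^sub>R P x)) \<bullet> grad ze x)"
    by (rule sq_inner_integrable[OF sq_matvec[OF Am s] C1c_sq(2)[OF ze]])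
   also have "(%x. (A x *v (indicator (cball 0 R) x *\<^sub>R P x)) \<bullet> grad ze x) = F"
   proof
    fix x show "(A x *v (indicator (cball 0 R) x *\<^sub>R P x)) \<bullet> grad ze x = F x"
     using F0[of x] by (cases "x \<in> cball 0 R") (auto simp: F_def)
   qed
   finally show ?thesis .
  qed
  have AP: "AE y in leb. \<forall>p. A (y + lv p) *v P (y + lv p) = A y *v P y"
   using Y_periodic_AE[OF A(2)] Y_periodic_AE[OF Pper] by eventually_elim simp
  note u = integral_unfold[OF Fi F0 N(1)]
  have "(LINT x|leb. F x) = (\<Sum>p\<in>lat N. LINT y|lebesgue_on Y. F (y + lv p))" by (rule u(1))
  also have "... = (LINT y|lebesgue_on Y. (\<Sum>p\<in>lat N. F (y + lv p)))"
   by (rule Bochner_Integration.integral_sum[symmetric]) (rule u(2))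
  also have "... = (LINT y|lebesgue_on Y. (A y *v P y) \<bullet> grad Z y)"
  proof (rule integral_cong_AE)
   show "(%y. \<Sum>p\<in>lat N. F (y + lv p)) \<in> borel_measurable (lebesgue_on Y)"
    by (intro borel_measurable_sum borel_measurable_integrable u(2))
   show "(%y. (A y *v P y) \<bullet> grad Z y) \<in> borel_measurable (lebesgue_on Y)"
    by (rule measurable_restrict_space1, measurable)
   show "AE y in lebesgue_on Y. (\<Sum>p\<in>lat N. F (y + lv p)) = (A y *v P y) \<bullet> grad Z y"
   proof (rule AE_lebesgue_on_I[OF Y_lebesgue])
    show "AE y in leb. y \<in> Y --> (\<Sum>p\<in>lat N. F (y + lv p)) = (A y *v P y) \<bullet> grad Z y"
     using AP
    proof eventually_elim
     case (elim y)
     show ?case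
     proof
      assume "y \<in> Y"
      hence "norm y < 3" using Y_subset_Y' Y'_norm[of y] by fastforce
      thus "(\<Sum>p\<in>lat N. F (y + lv p)) = (A y *v P y) \<bullet> grad Z y"
       unfolding N0[OF N(2) \<open>norm y < 3\<close>] F_def inner_sum_right
       by (intro sum.cong refl) (simp only: elim[THEN spec])
     qed
    qed
   qed
  qed
  finally show ?thesis using z0 by (simp add: F_def)
 qed
 have bound: "AE y in leb. \<bar>W y - xs \<bullet> y\<bar> <= 2 * (3 * (60 * E + 1) + 64 / al + 2 * norm xs)"
  if E: "nrm2 (lebesgue_on Y) P <= E" for E
 proof -
  define c :: R2 where "c = (\<chi> i. 1 / 2)"
  \<comment> \<open>The annulus lies in the ball of radius 5, covered by the 15^2 = 225 cells of
    \<open>lat 7\<close>, so its energy is at most 225 E^2, and 60 is the square root of 16 * 225.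
    The added 1 makes the inequality strict.\<close>
  define de where "de = 60 * E + 1"
  have E0: "E >= 0" using E nrm2_nonneg[of "lebesgue_on Y" P] by linarith
  have cn: "norm x <= 5" if "x \<in> csqr c 2" for x
  proof -
   have "\<bar>x $ i\<bar> <= 5 / 2" for i
   proof -
    have "\<bar>x $ i - c $ i\<bar> <= 2" using that by (auto simp: csqr_def)
    thus ?thesis by (simp add: c_def)
   qed
   hence "(\<Sum>i\<in>UNIV. \<bar>x $ i\<bar>) <= (\<Sum>i\<in>(UNIV::2 set). 5 / 2)" by (intro sum_mono) auto
   thus ?thesis using norm_le_l1_cart[of x] by simp
  qed
  let ?S = "cball (0::R2) 5"
  have S: "?S \<in> sets leb" "csqr c (2 * 1) \<subseteq> ?S" using cn by auto
  have annS: "annulus c 1 \<subseteq> ?S" using S(2) by (auto simp: annulus_def)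
  have PS: "sq (lebesgue_on ?S) P" using P2 by (simp add: L2_loc_iff)
  have "(nrm2 (lebesgue_on (annulus c 1)) P)^2 <= 225 * E^2"
  proof -
   define f where "f x = indicator ?S x * (norm (P x))^2" for x
   have fi: "integrable leb f" using sq_int[OF PS] by (simp add: integrable_restrict_space f_def[abs_def])
   have f0: "f x = 0" if "5 < norm x" for x using that by (simp add: f_def)
   have N7: "(5::real) + 2 <= real_of_int 7" by simp
   note u = integral_unfold[OF fi f0 N7]
   have "nrm2 (lebesgue_on (annulus c 1)) P <= nrm2 (lebesgue_on ?S) P"
    by (rule nrm2_subset[OF S(1) annulus_lebesgue annS PS])
   hence "(nrm2 (lebesgue_on (annulus c 1)) P)^2 <= (nrm2 (lebesgue_on ?S) P)^2" by (intro power_mono) auto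
   also have "... = (LINT x|leb. f x)" by (simp add: nrm2_square integral_restrict_space f_def[abs_def])
   also have "... = (\<Sum>p\<in>lat 7. LINT y|lebesgue_on Y. f (y + lv p))" by (rule u(1))
   also have "... <= (\<Sum>p\<in>lat 7. (nrm2 (lebesgue_on Y) P)^2)"
   proof (rule sum_mono)
    fix p
    have "sq (lebesgue_on (cball 0 2)) P" using P2 by (simp add: L2_loc_iff)
    hence PY: "sq (lebesgue_on Y) P"
     by (rule sq_subset[rotated 3]) (use Y_subset_Y' Y'_norm in auto)
    show "(LINT y|lebesgue_on Y. f (y + lv p)) <= (nrm2 (lebesgue_on Y) P)^2"
     unfolding nrm2_square
    proof (rule integral_mono_AE[OF u(2) sq_int[OF PY]])
     show "AE y in lebesgue_on Y. f (y + lv p) <= (norm (P y))^2"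
      by (rule AE_lebesgue_on_I[OF Y_lebesgue])
        (use Pper[unfolded Y_periodic_lv, THEN spec, of p] in eventually_elim, simp add: f_def indicator_def)
    qed
   qed
   also have "... = 225 * (nrm2 (lebesgue_on Y) P)^2" by (simp add: card_lat)
   also have "... <= 225 * E^2" using E by (intro mult_left_mono power_mono) auto
   finally show ?thesis .
  qed
  hence "16 * (nrm2 (lebesgue_on (annulus c 1)) P)^2 <= (60 * E)^2" by (simp add: power2_eq_square)
  also have "... < de^2" unfolding de_def using E0 by (intro power_strict_mono) auto
  finally have small: "16 * (nrm2 (lebesgue_on (annulus c 1)) P)^2 < de^2" .
  have Wl: "locint W" using L2_loc_imp_L1_loc[OF W2] by (simp add: locint_L1_loc)
  \<comment> \<open>The flux is divergence-free, so \<open>dual_bound\<close> holds with C = be = 1;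
    the Stampacchia term is then 2 * 2 * (1 / al) * 16 = 64 / al.\<close>
  have "\<exists>m. AE x in leb. x \<in> csqr c 1 -->
   \<bar>W x - m\<bar> <= 3 * de + 2 * 2 powr (1 / 1) * (1 / al) * ((4 * 1)^2) powr 1"
  proof (rule local_oscillation[OF open_UNIV C1_moll[OF Wl] S L2lim_moll_loc[OF W2] L2lim_grad_moll_loc[OF WP P2] Am coercive_all[OF coer] al _ _ _ _ _ small])
   show "dual_bound UNIV 1 1 (%x. A x *v P x)" using test by (simp add: dual_bound_def)
   show "de > 0" using E0 by (simp add: de_def)
  qed auto
  then obtain m where m: "AE x in leb. x \<in> csqr c 1 --> \<bar>W x - m\<bar> <= 3 * de + 64 / al"
   by auto
  define b where "b = 3 * de + 64 / al + 2 * norm xs"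
  have mX: "AE y in leb. y \<in> Y --> \<bar>X y - m\<bar> <= b"
   using m
  proof eventually_elim
   case (elim y)
   show ?case
   proof
    assume y: "y \<in> Y"
    have "\<bar>y $ i - c $ i\<bar> <= 1" for i
    proof -
     have "0 < y $ i" "y $ i < 1" using y by (auto simp: Y_def)
     thus ?thesis by (simp add: c_def abs_le_iff)
    qed
    hence "\<bar>W y - m\<bar> <= 3 * de + 64 / al" using elim by (auto simp: csqr_def)
    moreover have "\<bar>xs \<bullet> y\<bar> <= norm xs * 2"
     using Cauchy_Schwarz_ineq2[of xs y] mult_left_mono[of "norm y" 2 "norm xs"] Y'_norm[of y] y Y_subset_Y' by fastforce
    ultimately show "\<bar>X y - m\<bar> <= b" unfolding X_def b_def by linarith
   qed
  qed
  have YC: "(LINT y|lebesgue_on Y. k) = k" for k :: real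
   using measure_on_Y by simp
  have XI: "integrable (lebesgue_on Y) X"
  proof -
   have "sq (lebesgue_on (cball 0 2)) X" using GX(1) by (simp add: L2_loc_iff)
   hence "sq (lebesgue_on Y) X"
    by (rule sq_subset[rotated 3]) (use Y_subset_Y' Y'_norm in auto)
   thus ?thesis
    by (rule sq_imp_integrable_finite) (use Y_lmeasurable in \<open>simp add: emeasure_restrict_space fmeasurable_def\<close>)
  qed
  \<comment> \<open>X has mean 0 over the cell, which has measure 1. Hence m is bounded by the
    deviation b, and X by 2 b.\<close>
  have "\<bar>m\<bar> = \<bar>(LINT y|lebesgue_on Y. X y - m)\<bar>"
  proof -
   have "(LINT y|lebesgue_on Y. X y - m) = (LINT y|lebesgue_on Y. X y) - (LINT y|lebesgue_on Y. m)"
    using XI integrable_const_Y[of m] by (rule Bochner_Integration.integral_diff)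
   thus ?thesis using X(2) measure_on_Y by simp
  qed
  also have "... <= (LINT y|lebesgue_on Y. \<bar>X y - m\<bar>)" by (rule integral_abs_bound)
  also have "... <= (LINT y|lebesgue_on Y. b)"
   by (rule integral_mono_AE) (use XI integrable_const_Y mX in \<open>auto intro!: AE_lebesgue_on_I\<close>)
  also have "... = b" by (rule YC)
  finally have mb: "\<bar>m\<bar> <= b" .
  have "AE y in leb. \<bar>X y\<bar> <= 2 * b"
  proof (rule periodic_sup_bound[OF Xper])
   show "AE y in leb. y \<in> Y --> \<bar>X y\<bar> <= 2 * b"
    using mX by eventually_elim (use mb in auto)
  qed
  thus ?thesis by (simp add: X_def b_def de_def)
 qed
 show ?thesis by (rule that[OF W2 P2 WP Pper wP test bound])
qed

lemma weak_grad_cmult: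
 assumes u: "is_weak_grad U u G" and U: "open U"
 shows "is_weak_grad U (%x. c * u x) (%x. c *\<^sub>R G x)"
proof -
 have "(%x. c * u x) \<in> L1_loc U" "(%x. c *\<^sub>R G x) \<in> L1_loc U"
  using u by (auto simp: is_weak_grad_def L1_loc_def)
 moreover have "(LINT x|lebesgue_on U. c * u x * grad ph x $ i) = - (LINT x|lebesgue_on U. (c *\<^sub>R G x) $ i * ph x)"
  if "ph \<in> test_functions U" for ph i
 proof -
  have "(LINT x|lebesgue_on U. u x * grad ph x $ i) = - (LINT x|lebesgue_on U. G x $ i * ph x)"
   using u that by (auto simp: is_weak_grad_def)
  thus ?thesis by (simp add: mult.assoc)
 qed
 ultimately show ?thesis by (simp add: is_weak_grad_def)
qed

section \<open>Symmetry of the Hessian\<close>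

lemma C1_mean_value:
 assumes f: "C1 f" and h: "h > 0"
 obtains s where "0 < s" "s < h" "f (x + h *\<^sub>R axis i 1) - f x = h * grad f (x + s *\<^sub>R axis i 1) $ i"
proof -
 have D: "DERIV (%t. f (x + t *\<^sub>R axis i 1)) t :> grad f (x + t *\<^sub>R axis i 1) $ i" for t
 proof -
  have "((%t. x + t *\<^sub>R axis i 1) has_derivative (%h. h *\<^sub>R axis i 1)) (at t)"
   by (auto intro!: derivative_eq_intros)
  moreover have "(f has_derivative (%h. h \<bullet> grad f (x + t *\<^sub>R axis i 1))) (at (x + t *\<^sub>R axis i 1))"
   using C1D(1)[OF f] by (simp add: gderiv_def)
  ultimately have "((%t. f (x + t *\<^sub>R axis i 1)) has_derivative (%h. (h *\<^sub>R axis i 1) \<bullet> grad f (x + t *\<^sub>R axis i 1))) (at t)"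
   by (rule has_derivative_compose)
  thus ?thesis
   by (simp add: has_field_derivative_def inner_axis' mult.commute[of _ "grad f _ $ _"])
 qed
 obtain s where "0 < s" "s < h" "f (x + h *\<^sub>R axis i 1) - f (x + 0 *\<^sub>R axis i 1) = (h - 0) * grad f (x + s *\<^sub>R axis i 1) $ i"
  using MVT2[OF h, of "%t. f (x + t *\<^sub>R axis i 1)" "%t. grad f (x + t *\<^sub>R axis i 1) $ i"] D by auto
 thus ?thesis using that[of s] by simp
qed

text \<open>Two applications of the mean value theorem, first in direction i to the increment of Ph
  in direction l, then in direction l.\<close>

lemma second_difference:
 assumes Ph: "C1 Ph" "C1 (%x. grad Ph x $ i)" and h: "h > 0"
 obtains y where "norm (y - x) <= 2 * h"
  "Ph (x + h *\<^sub>R axis i 1 + h *\<^sub>R axis l 1) - Ph (x + h *\<^sub>R axis i 1) - Ph (x + h *\<^sub>R axis l 1) + Ph x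
   = h^2 * grad (%x. grad Ph x $ i) y $ l"
proof -
 define g where "g = (%x. Ph (h *\<^sub>R axis l 1 + 1 *\<^sub>R x) - Ph x)"
 have g: "C1 g" unfolding g_def by (rule C1_diff[OF C1_affine[OF Ph(1)] Ph(1)])
 have gg: "grad g x = grad Ph (x + h *\<^sub>R axis l 1) - grad Ph x" for x
  unfolding g_def by (subst grad_diff[OF C1_affine[OF Ph(1)] Ph(1)], subst grad_affine[OF Ph(1)]) (simp add: add.commute)
 obtain s where s: "0 < s" "s < h" "g (x + h *\<^sub>R axis i 1) - g x = h * grad g (x + s *\<^sub>R axis i 1) $ i"
  using C1_mean_value[OF g h] by metis
 obtain t where t: "0 < t" "t < h" "grad Ph (x + s *\<^sub>R axis i 1 + h *\<^sub>R axis l 1) $ i - grad Ph (x + s *\<^sub>R axis i 1) $ i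
   = h * grad (%x. grad Ph x $ i) (x + s *\<^sub>R axis i 1 + t *\<^sub>R axis l 1) $ l"
  using C1_mean_value[OF Ph(2) h] by metis
 show ?thesis
 proof (rule that)
  show "norm (x + s *\<^sub>R axis i 1 + t *\<^sub>R axis l 1 - x) <= 2 * h"
   using norm_triangle_ineq[of "s *\<^sub>R axis i (1::real)" "t *\<^sub>R axis l 1"] s t by simp
  show "Ph (x + h *\<^sub>R axis i 1 + h *\<^sub>R axis l 1) - Ph (x + h *\<^sub>R axis i 1) - Ph (x + h *\<^sub>R axis l 1) + Ph x
   = h^2 * grad (%x. grad Ph x $ i) (x + s *\<^sub>R axis i 1 + t *\<^sub>R axis l 1) $ l"
   using s(3)[unfolded gg] t(3) by (simp add: g_def power2_eq_square add.assoc add.commute[of "h *\<^sub>R axis l 1"] add.commute[of "axis l h"])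
 qed
qed

text \<open>The second difference is symmetric in the two directions, while its quotient by h^2 is a
  mixed derivative of either order at a nearby point; continuity of both forces equality.\<close>

lemma grad_grad_commute:
 assumes Ph: "C1 Ph" "!!i. C1 (%x. grad Ph x $ i)"
 shows "grad (%x. grad Ph x $ i) x $ l = grad (%x. grad Ph x $ l) x $ i"
proof (rule ccontr)
 define F where "F = (%i l y. grad (%x. grad Ph x $ i) y $ l)"
 assume "grad (%x. grad Ph x $ i) x $ l ~= grad (%x. grad Ph x $ l) x $ i"
 hence d: "\<bar>F i l x - F l i x\<bar> > 0" (is "?d > 0") by (simp add: F_def)
 have cont: "continuous_on UNIV (F i l)" for i l
  unfolding F_def by (intro continuous_intros C1D(2) Ph)
 have ex: "\<exists>r>0. \<forall>y. norm (y - x) <= r --> \<bar>F i l y - F i l x\<bar> < ?d / 2" for i l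
 proof -
  have "\<exists>r>0. \<forall>y. dist y x < r --> dist (F i l y) (F i l x) < ?d / 2"
   using cont[of i l] d unfolding continuous_on_iff by (metis UNIV_I half_gt_zero)
  then obtain r where "r > 0" "!!y. dist y x < r ==> dist (F i l y) (F i l x) < ?d / 2" by blast
  thus ?thesis by (intro exI[of _ "r / 2"]) (auto simp: dist_norm)
 qed
 from ex[of i l] obtain r1 where r1: "r1 > 0" "!!y. norm (y - x) <= r1 ==> \<bar>F i l y - F i l x\<bar> < ?d / 2" by blast
 from ex[of l i] obtain r2 where r2: "r2 > 0" "!!y. norm (y - x) <= r2 ==> \<bar>F l i y - F l i x\<bar> < ?d / 2" by blast
 define h where "h = min r1 r2 / 2"
 have h: "h > 0" "2 * h <= r1" "2 * h <= r2" using r1 r2 by (auto simp: h_def)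
 obtain y where y: "norm (y - x) <= 2 * h"
  "Ph (x + h *\<^sub>R axis i 1 + h *\<^sub>R axis l 1) - Ph (x + h *\<^sub>R axis i 1) - Ph (x + h *\<^sub>R axis l 1) + Ph x = h^2 * F i l y"
  unfolding F_def using second_difference[OF Ph(1) Ph(2) h(1)] by metis
 obtain y' where y': "norm (y' - x) <= 2 * h"
  "Ph (x + h *\<^sub>R axis l 1 + h *\<^sub>R axis i 1) - Ph (x + h *\<^sub>R axis l 1) - Ph (x + h *\<^sub>R axis i 1) + Ph x = h^2 * F l i y'"
  unfolding F_def using second_difference[OF Ph(1) Ph(2) h(1)] by metis
 have "h^2 * F i l y = h^2 * F l i y'"
  unfolding y(2)[symmetric] y'(2)[symmetric] by (simp add: add_ac)
 hence "F i l y = F l i y'" using h(1) by simp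
 moreover have "\<bar>F i l y - F i l x\<bar> < ?d / 2" by (rule r1) (use y h in linarith)
 moreover have "\<bar>F l i y' - F l i x\<bar> < ?d / 2" by (rule r2) (use y' h in linarith)
 moreover have "?d <= \<bar>F i l x - F i l y\<bar> + \<bar>F i l y - F l i x\<bar>" by linarith
 ultimately show False by (simp add: abs_minus_commute)
qed

text \<open>On a cell of size ep both weights are close to the value of h at the lattice corner.
  Replacing them costs 2 K de per rescaled cell; there are about ((2 R + 7) / ep)^2 cells of area
  ep^2. Only the L1 norm of the periodic factor enters, which is all that is known of the energy
  densities.\<close>

lemma periodic_average:
 fixes g h h' :: "R2 => real"
 assumes g: "Y_periodic g" "locint g" and K: "(LINT y|lebesgue_on Y. \<bar>g y\<bar>) <= K"
  and ep: "0 < ep" "ep <= 1" and R: "R > 0"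
  and h: "continuous_on UNIV h" "!!x. R < norm x ==> h x = 0"
  and h': "h' \<in> borel_measurable leb" "!!x. \<bar>h' x\<bar> <= C" "!!x. R < norm x ==> h' x = 0"
  and de: "!!x y. norm (x - y) <= 2 * ep ==> \<bar>h' x - h y\<bar> <= de & \<bar>h x - h y\<bar> <= de"
 shows "integrable leb (%x. h' x * g (x /\<^sub>R ep))"
  and "\<bar>(LINT x|leb. h' x * g (x /\<^sub>R ep)) - (LINT y|lebesgue_on Y. g y) * (LINT x|leb. h x)\<bar> <= 2 * K * de * (2 * R + 7)^2"
proof -
 let ?Y = "lebesgue_on Y"
 define m where "m = (LINT y|?Y. g y)"
 \<comment> \<open>The 2 is the surplus demanded by \<open>integral_unfold\<close>. The upper bound
   R / ep + 3 gives 2 N + 1 <= 2 R / ep + 7, the source of the constant 7.\<close>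
 define N where "N = \<lceil>R / ep\<rceil> + 2"
 have N: "R / ep + 2 <= of_int N" "of_int N <= R / ep + 3" unfolding N_def by linarith+
 have N0: "N >= 0" 
 proof -
  have "R / ep > 0" using R ep by simp
  hence "real_of_int N > 0" using N(1) by linarith
  thus ?thesis by simp
 qed
 have de0: "de >= 0" 
 proof -
  have "\<bar>h' 0 - h 0\<bar> <= de" using de[of 0 0] ep by simp
  thus ?thesis by linarith
 qed
 have scl: "norm (ep *\<^sub>R x) > R" if "R / ep < norm x" for x :: R2
  using that ep by (simp add: divide_less_eq mult.commute)
 have meas: "(%x. h' (ep *\<^sub>R x)) \<in> borel_measurable leb"
  using measurable_scale_shift[of ep h' 0] h'(1) ep by simp
 have F: "integrable leb (%x. h' (ep *\<^sub>R x) * g x)"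
  using locint_integrable_mult[OF g(2) meas, of C "R / ep"] h' scl by (simp add: mult.commute)
 show "integrable leb (%x. h' x * g (x /\<^sub>R ep))"
  using integrable_scale_shift[of "1 / ep" "%x. h' (ep *\<^sub>R x) * g x" 0] F ep by (simp add: divide_inverse)
 have H: "integrable leb (%x. h (ep *\<^sub>R x))"
 proof (rule integrable_compact_support)
  show "continuous_on UNIV (%x. h (ep *\<^sub>R x))"
   by (rule continuous_on_compose2[OF h(1)]) (auto intro!: continuous_intros)
  show "compact (cball (0::R2) (R / ep))" by simp
  show "!!x. x ~: cball 0 (R / ep) ==> h (ep *\<^sub>R x) = 0" using h(2) scl by auto
 qed
 have gY: "integrable ?Y g" by (rule locint_integrable_Y[OF g(2)])
 have e1: "(LINT x|leb. h' x * g (x /\<^sub>R ep)) = ep^2 * (LINT x|leb. h' (ep *\<^sub>R x) * g x)"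
  using integral_scale_shift[of ep "%x. h' x * g (x /\<^sub>R ep)" 0] ep by simp
 have e2: "(LINT x|leb. h x) = ep^2 * (LINT x|leb. h (ep *\<^sub>R x))"
  using integral_scale_shift[of ep h 0] ep by simp
 note u1 = integral_unfold[OF F _ N(1)]
 have z1: "!!x. R / ep < norm x ==> h' (ep *\<^sub>R x) * g x = 0" using h'(3) scl by simp
 note u2 = integral_unfold[OF H _ N(1)]
 have z2: "!!x. R / ep < norm x ==> h (ep *\<^sub>R x) = 0" using h(2) scl by simp
 have perg: "AE y in leb. \<forall>p. g (y + lv p) = g y" by (rule Y_periodic_AE[OF g(1)])

 have mK: "\<bar>m\<bar> <= K" unfolding m_def using integral_abs_bound[of ?Y g] K by linarith
 have K0: "K >= 0" using mK by linarith
 \<comment> \<open>Both integrals are compared with the value of h at the corner times the mean of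
   g; each comparison costs K de.\<close>
 have cell: "\<bar>(LINT y|?Y. h' (ep *\<^sub>R (y + lv p)) * g (y + lv p)) - m * (LINT y|?Y. h (ep *\<^sub>R (y + lv p)))\<bar> <= 2 * K * de" for p
 proof -
  have I1: "integrable ?Y (%y. h' (ep *\<^sub>R (y + lv p)) * g (y + lv p))" by (rule u1(2)[OF z1])
  have I2: "integrable ?Y (%y. h (ep *\<^sub>R (y + lv p)))" by (rule u2(2)[OF z2])
  let ?c = "h (ep *\<^sub>R lv p)"
  have near: "norm (ep *\<^sub>R (y + lv p) - ep *\<^sub>R lv p) <= 2 * ep" if "y \<in> Y" for y
   using Y'_norm[of y] Y_subset_Y' that ep by (auto simp: scaleR_add_right mult.commute)
  have "\<bar>(LINT y|?Y. h' (ep *\<^sub>R (y + lv p)) * g (y + lv p)) - ?c * m\<bar> = \<bar>(LINT y|?Y. h' (ep *\<^sub>R (y + lv p)) * g (y + lv p) - ?c * g y)\<bar>"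
   unfolding m_def using I1 gY by simp
  also have "... <= (LINT y|?Y. \<bar>h' (ep *\<^sub>R (y + lv p)) * g (y + lv p) - ?c * g y\<bar>)" by (rule integral_abs_bound)
  also have "... <= (LINT y|?Y. de * \<bar>g y\<bar>)"
  proof (rule integral_mono_AE)
   show "AE y in ?Y. \<bar>h' (ep *\<^sub>R (y + lv p)) * g (y + lv p) - ?c * g y\<bar> <= de * \<bar>g y\<bar>"
   proof (rule AE_lebesgue_on_I[OF Y_lebesgue], use perg in eventually_elim, intro impI)
    fix y assume a: "\<forall>p. g (y + lv p) = g y" and y: "y \<in> Y"
    have "\<bar>h' (ep *\<^sub>R (y + lv p)) * g (y + lv p) - ?c * g y\<bar> = \<bar>h' (ep *\<^sub>R (y + lv p)) - ?c\<bar> * \<bar>g y\<bar>"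
     using spec[OF a, of p] by (simp add: abs_mult[symmetric] left_diff_distrib)
    also have "... <= de * \<bar>g y\<bar>" by (intro mult_right_mono) (use de near y in auto)
    finally show "\<bar>h' (ep *\<^sub>R (y + lv p)) * g (y + lv p) - ?c * g y\<bar> <= de * \<bar>g y\<bar>" .
   qed
  qed (use I1 gY in auto)
  also have "... <= de * K" using K de0 by (simp add: mult_left_mono)
  finally have a: "\<bar>(LINT y|?Y. h' (ep *\<^sub>R (y + lv p)) * g (y + lv p)) - ?c * m\<bar> <= de * K" .
  have "\<bar>?c - (LINT y|?Y. h (ep *\<^sub>R (y + lv p)))\<bar> = \<bar>(LINT y|?Y. ?c - h (ep *\<^sub>R (y + lv p)))\<bar>"
   using I2 integrable_const_Y[of ?c] measure_on_Y by simp
  also have "... <= (LINT y|?Y. \<bar>?c - h (ep *\<^sub>R (y + lv p))\<bar>)" by (rule integral_abs_bound)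
  also have "... <= (LINT y|?Y. de)"
  proof (rule integral_mono)
   fix y assume "y \<in> space ?Y" hence "y \<in> Y" by simp
   thus "\<bar>?c - h (ep *\<^sub>R (y + lv p))\<bar> <= de" using de[OF near, of y] de[of "ep *\<^sub>R lv p" "ep *\<^sub>R (y + lv p)"] near[of y] norm_minus_commute by metis
  qed (use I2 integrable_const_Y in auto)
  also have "... = de" using measure_on_Y by simp
  finally have "\<bar>m\<bar> * \<bar>?c - (LINT y|?Y. h (ep *\<^sub>R (y + lv p)))\<bar> <= K * de"
   using mK K0 de0 by (intro mult_mono) auto
  hence "\<bar>?c * m - m * (LINT y|?Y. h (ep *\<^sub>R (y + lv p)))\<bar> <= K * de"
   by (simp add: abs_mult[symmetric] right_diff_distrib mult.commute)
  moreover have "\<bar>X - Z\<bar> <= 2 * K * de" if "\<bar>X - U\<bar> <= de * K" "\<bar>U - Z\<bar> <= K * de" for X U Z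
  proof -
   have "de * K = K * de" by simp
   thus ?thesis using that by linarith
  qed
  ultimately show ?thesis using a by blast
 qed
 have lat: "ep^2 * real (card (lat N)) <= (2 * R + 7)^2"
 proof -
  have "ep * (2 * of_int N + 1) <= ep * (2 * (R / ep) + 7)" using N(2) ep by (intro mult_left_mono) auto
  also have "... = 2 * R + 7 * ep" using ep by (simp add: field_simps)
  also have "... <= 2 * R + 7" using ep by simp
  finally have "(ep * (2 * of_int N + 1))^2 <= (2 * R + 7)^2"
   using ep N0 by (intro power_mono) auto
  thus ?thesis by (simp add: card_lat[OF N0] power_mult_distrib)
 qed
 have "(LINT x|leb. h' x * g (x /\<^sub>R ep)) - m * (LINT x|leb. h x) =
   ep^2 * (\<Sum>p\<in>lat N. (LINT y|?Y. h' (ep *\<^sub>R (y + lv p)) * g (y + lv p)) - m * (LINT y|?Y. h (ep *\<^sub>R (y + lv p))))"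
 proof -
  have "(LINT x|leb. h' (ep *\<^sub>R x) * g x) = (\<Sum>p\<in>lat N. LINT y|?Y. h' (ep *\<^sub>R (y + lv p)) * g (y + lv p))"
   by (rule u1(1)[OF z1])
  moreover have "(LINT x|leb. h (ep *\<^sub>R x)) = (\<Sum>p\<in>lat N. LINT y|?Y. h (ep *\<^sub>R (y + lv p)))"
   by (rule u2(1)[OF z2])
  ultimately show ?thesis unfolding e1 e2 by (simp only: sum_subtractf sum_distrib_left[symmetric] right_diff_distrib mult.left_commute)
 qed
 also have "\<bar>...\<bar> <= ep^2 * (\<Sum>p\<in>lat N. 2 * K * de)"
  unfolding abs_mult abs_power2 by (intro mult_left_mono order_trans[OF sum_abs] sum_mono cell) auto
 also have "... = (ep^2 * real (card (lat N))) * (2 * K * de)" by simp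
 also have "... <= (2 * R + 7)^2 * (2 * K * de)" by (rule mult_right_mono[OF lat]) (use K0 de0 in auto)
 finally show "\<bar>(LINT x|leb. h' x * g (x /\<^sub>R ep)) - (LINT y|lebesgue_on Y. g y) * (LINT x|leb. h x)\<bar> <= 2 * K * de * (2 * R + 7)^2"
  by (simp add: m_def mult_ac)
qed


lemma L2_loc_UNIV_iff:
 fixes f :: "R2 => 'b::euclidean_space"
 shows "f \<in> L2_loc UNIV \<longleftrightarrow> f \<in> borel_measurable leb & locint (%x. (norm (f x))^2)"
proof
 assume f: "f \<in> L2_loc UNIV"
 hence "sq (lebesgue_on (cball 0 R)) f" for R by (simp add: L2_loc_iff)
 thus "f \<in> borel_measurable leb & locint (%x. (norm (f x))^2)"
  using L2_loc_measurable[OF f] by (auto simp: locint_def dest: sq_int)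
next
 assume f: "f \<in> borel_measurable leb & locint (%x. (norm (f x))^2)"
 show "f \<in> L2_loc UNIV" unfolding L2_loc_iff
 proof (intro allI impI)
  fix K :: "R2 set" assume K: "compact K"
  then obtain R where R: "K \<subseteq> cball 0 R" using compact_imp_bounded[OF K] unfolding bounded_iff by (metis mem_cball_0 subsetI)
  have "sq (lebesgue_on (cball 0 R)) f"
   using f by (auto simp: sq_def locint_def intro: measurable_restrict_space1)
  thus "sq (lebesgue_on K) f"
   by (rule sq_subset[rotated 3]) (use R compact_lebesgue[OF K] in auto)
 qed
qed

lemma L2_loc_scale:
 fixes f :: "R2 => 'b::euclidean_space"
 assumes f: "f \<in> L2_loc UNIV" and s: "s ~= 0"
 shows "(%x. f (s *\<^sub>R x)) \<in> L2_loc UNIV"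
 using f measurable_scale_shift[OF s, of f 0] locint_scale_shift[of "%x. (norm (f x))^2" s 0] s
 by (simp add: L2_loc_UNIV_iff)

lemma L2_loc_cmult:
 "f \<in> L2_loc UNIV ==> (%x. c * f x :: real) \<in> L2_loc UNIV"
 by (auto simp: L2_loc_iff intro: sq_mult)

lemma L2_loc_matvec:
 assumes A: "A \<in> borel_measurable leb" "AE x in leb. norm (A x) <= B" and f: "f \<in> L2_loc UNIV"
 shows "(%x. (A x :: real^2^2) *v f x) \<in> L2_loc UNIV"
 unfolding L2_loc_iff
proof (intro allI impI)
 fix K :: "R2 set" assume K: "compact K"
 show "sq (lebesgue_on K) (%x. A x *v f x)"
 proof (rule sq_matvec)
  show "A \<in> borel_measurable (lebesgue_on K)" using A(1) by (rule measurable_restrict_space1)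
  show "AE x in lebesgue_on K. norm (A x) <= B"
   using A(2) compact_lebesgue[OF K] by (intro AE_lebesgue_on_I) auto
  show "sq (lebesgue_on K) f" using f K by (simp add: L2_loc_iff)
 qed
qed

lemma L2_loc_inner: "f \<in> L2_loc UNIV ==> g \<in> L2_loc UNIV ==> locint (%x. f x \<bullet> g x)"
 by (auto simp: L2_loc_iff locint_def intro: sq_inner_integrable)

text \<open>Nonnegativity at a + b and at a - b. The antisymmetric part of A drops out of the
  left-hand side, so no upper bound on A is involved.\<close>

lemma coercive_polarisation:
 fixes A :: "real^2^2"
 assumes "!!xs. 0 <= (A *v xs) \<bullet> xs"
 shows "\<bar>(A *v a) \<bullet> b + (A *v b) \<bullet> a\<bar> <= (A *v a) \<bullet> a + (A *v b) \<bullet> b"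
 using assms[of "a + b"] assms[of "a - b"]
 by (simp add: matrix_vector_right_distrib matrix_vector_mult_diff_distrib inner_add_left inner_add_right inner_diff_left inner_diff_right)

definition energy_density :: "(R2 => real^2^2) => (2 => R2 => R2) => 2 => 2 => R2 => real" where
 "energy_density A P i l y = (A y *v P i y) \<bullet> P l y + (A y *v P l y) \<bullet> P i y"

text \<open>Collects what is used of a rescaled cell solution. The gradient P is kept in the
  unscaled variable, where periodicity is by integer vectors; the quantities K and ka are meant to
  be the same for all n.\<close>

definition corrector_gradients ::
 "(R2 => real^2^2) => real => real => real => (2 => R2 => real) => (2 => R2 => R2) => bool" where
 "corrector_gradients A ep ka K w P \<longleftrightarrow>
  (\<forall>i. w i \<in> L2_loc UNIV & (%x. P i (x /\<^sub>R ep)) \<in> L2_loc UNIV & is_weak_grad UNIV (w i) (%x. P i (x /\<^sub>R ep)) &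
   (AE x in leb. \<bar>w i x - x $ i\<bar> <= ep * ka) &
   (\<forall>ze\<in>C1c UNIV. (LINT x|leb. (A (x /\<^sub>R ep) *v P i (x /\<^sub>R ep)) \<bullet> grad ze x) = 0) &
   Y_periodic (%y. (norm (P i y))^2) & locint (%y. (norm (P i y))^2) & (LINT y|lebesgue_on Y. (norm (P i y))^2) <= K) &
  (\<forall>i l. Y_periodic (energy_density A P i l) & locint (energy_density A P i l) &
   (LINT y|lebesgue_on Y. \<bar>energy_density A P i l y\<bar>) <= K)"

text \<open>Diagonal entries of the effective matrix are the energies of the cell solutions, so b /
  al bounds the squared gradients and, by polarisation, 2 b bounds the L1 norms of the symmetrised
  densities. The long constant is the sup bound of the cell solution for E = sqrt(b / al) and a unit
  vector.\<close>

lemma rescaled_cell: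
 fixes A :: "R2 => real^2^2"
 assumes A: "A \<in> L_inf" "Y_periodic A" and al: "al > 0"
  and coer: "!!xs. AE x in leb. (A x *v xs) \<bullet> xs >= al * (norm xs)^2"
  and W: "!!xs. cell_solution A xs (W xs)" and B: "effective_matrix A W B"
  and ep: "ep > 0" and b: "!!i. B $ i $ i <= b" and K: "2 * b <= K" "b / al <= K"
 obtains P where
  "corrector_gradients A ep (2 * (3 * (60 * sqrt (b / al) + 1) + 64 / al + 2)) K (%i. rescale ep (W (axis i 1))) P"
  "!!i l. (LINT y|lebesgue_on Y. energy_density A P i l y) = B $ l $ i + B $ i $ l"
proof -
 define cell where "cell = (%(i::2) P. W (axis i 1) \<in> L2_loc UNIV & P \<in> L2_loc UNIV &
  is_weak_grad UNIV (W (axis i 1)) P & Y_periodic P & (AE y in leb. wgrad UNIV (W (axis i 1)) y = P y) &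
  (\<forall>ze\<in>C1c UNIV. (LINT x|leb. (A x *v P x) \<bullet> grad ze x) = 0) &
  (\<forall>E. nrm2 (lebesgue_on Y) P <= E -->
    (AE y in leb. \<bar>W (axis i 1) y - axis i 1 \<bullet> y\<bar> <= 2 * (3 * (60 * E + 1) + 64 / al + 2 * norm (axis i 1 :: R2)))))"
 have "\<exists>P. cell i P" for i
  by (rule cell_solution_facts[OF A al coer W[of "axis i 1"]]) (auto simp: cell_def)
 then obtain P where P0: "cell i (P i)" for i by metis
 have P: "W (axis i 1) \<in> L2_loc UNIV" "P i \<in> L2_loc UNIV" "is_weak_grad UNIV (W (axis i 1)) (P i)" "Y_periodic (P i)"
  "AE y in leb. wgrad UNIV (W (axis i 1)) y = P i y" for i
  using P0[of i] unfolding cell_def by auto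
 have P6: "!!i ze. ze \<in> C1c UNIV ==> (LINT x|leb. (A x *v P i x) \<bullet> grad ze x) = 0"
  using P0 unfolding cell_def by blast
 have P7: "!!i E. nrm2 (lebesgue_on Y) (P i) <= E ==>
    AE y in leb. \<bar>W (axis i 1) y - axis i 1 \<bullet> y\<bar> <= 2 * (3 * (60 * E + 1) + 64 / al + 2 * norm (axis i 1 :: R2))"
  using P0 unfolding cell_def by blast
 obtain BB where BB: "A \<in> borel_measurable leb" "AE x in leb. norm (A x) <= BB" using Linf_bound[OF A(1)] .
 define g where "g = (%i l y. (A y *v P i y) \<bullet> P l y)"
 have gl: "locint (g i l)" for i l
  unfolding g_def by (intro L2_loc_inner L2_loc_matvec[OF BB] P)
 have gper: "Y_periodic (g i l)" for i l
 proof -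
  have "Y_periodic (%y. A y *v P i y)" by (rule Y_periodic_comb2[OF A(2) P(4), of "%a b. a *v b"])
  thus ?thesis unfolding g_def by (rule Y_periodic_comb2[OF _ P(4), of _ "%a b. a \<bullet> b"])
 qed
 \<comment> \<open>The indices are transposed: the entry in row l and column i is the pairing of the
   image of the i-th basis vector with the l-th.\<close>
 have gI: "(LINT y|lebesgue_on Y. g i l y) = B $ l $ i" for i l
 proof -
  have "B $ l $ i = (B *v axis i 1) \<bullet> axis l 1"
   by (simp add: inner_axis matrix_vector_mul_component)
  also have "... = (LINT y|lebesgue_on Y. (A y *v wgrad UNIV (W (axis i 1)) y) \<bullet> wgrad UNIV (W (axis l 1)) y)"
   using B by (simp add: effective_matrix_def)
  also have "... = (LINT y|lebesgue_on Y. g i l y)"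
  proof (rule integral_cong_AE)
   show m: "g i l \<in> borel_measurable (lebesgue_on Y)" using locint_integrable_Y[OF gl] by auto
   have w: "wgrad UNIV (W (axis i 1)) \<in> borel_measurable leb" for i
    by (rule measurable_AE_lebesgue[OF L2_loc_measurable[OF P(2)] P(5)])
   show "(%y. (A y *v wgrad UNIV (W (axis i 1)) y) \<bullet> wgrad UNIV (W (axis l 1)) y) \<in> borel_measurable (lebesgue_on Y)"
    by (rule measurable_restrict_space1) (intro borel_measurable_inner measurable_matvec w BB)
   show "AE y in lebesgue_on Y. (A y *v wgrad UNIV (W (axis i 1)) y) \<bullet> wgrad UNIV (W (axis l 1)) y = g i l y"
    by (rule AE_lebesgue_on_I[OF Y_lebesgue], use P(5)[of i] P(5)[of l] in eventually_elim) (simp add: g_def)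
  qed
  finally show ?thesis ..
 qed
 have ca: "AE x in leb. \<forall>xs. al * (norm xs)^2 <= (A x *v xs) \<bullet> xs" by (rule coercive_all[OF coer])
 have gY: "integrable (lebesgue_on Y) (g i l)" for i l by (rule locint_integrable_Y[OF gl])
 have nl: "locint (%y. (norm (P i y))^2)" for i using P(2)[of i] by (simp add: L2_loc_UNIV_iff)
 have nI: "(LINT y|lebesgue_on Y. (norm (P i y))^2) <= b / al" for i
 proof -
  have "(LINT y|lebesgue_on Y. al * (norm (P i y))^2) <= (LINT y|lebesgue_on Y. g i i y)"
  proof (rule integral_mono_AE)
   show "integrable (lebesgue_on Y) (%y. al * (norm (P i y))^2)"
    using locint_integrable_Y[OF nl[of i]] by simp
   show "AE y in lebesgue_on Y. al * (norm (P i y))^2 <= g i i y"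
    by (rule AE_lebesgue_on_I[OF Y_lebesgue], use ca in eventually_elim) (simp add: g_def)
  qed (rule gY)
  hence "al * (LINT y|lebesgue_on Y. (norm (P i y))^2) <= b" using b[of i] gI[of i i] by simp
  thus ?thesis using al by (simp add: field_simps)
 qed
 have el: "energy_density A P i l = (%y. g i l y + g l i y)" for i l
  by (simp add: energy_density_def g_def fun_eq_iff)
 show ?thesis
 proof (rule that)
  show "(LINT y|lebesgue_on Y. energy_density A P i l y) = B $ l $ i + B $ i $ l" for i l
   using gY gI by (simp add: el)
  show "corrector_gradients A ep (2 * (3 * (60 * sqrt (b / al) + 1) + 64 / al + 2)) K (%i. rescale ep (W (axis i 1))) P"
   unfolding corrector_gradients_def
  proof (intro conjI allI ballI)
   fix i l
   let ?w = "rescale ep (W (axis i 1))"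
   have weq: "?w = (%x. ep * W (axis i 1) (0 + (1 / ep) *\<^sub>R x))" by (rule ext) (simp add: rescale_def divide_inverse)
   show "?w \<in> L2_loc UNIV"
    unfolding weq using L2_loc_cmult[OF L2_loc_scale[OF P(1)[of i], of "1 / ep"]] ep by simp
   show "(%x. P i (x /\<^sub>R ep)) \<in> L2_loc UNIV"
    using L2_loc_scale[OF P(2)[of i], of "1 / ep"] ep by (simp add: divide_inverse)
   have "is_weak_grad UNIV ?w (%x. ep *\<^sub>R ((1 / ep) *\<^sub>R P i (0 + (1 / ep) *\<^sub>R x)))"
    unfolding weq by (rule weak_grad_cmult[OF weak_grad_affine[OF P(3)]]) (use ep in auto)
   thus "is_weak_grad UNIV ?w (%x. P i (x /\<^sub>R ep))" using ep by (simp add: divide_inverse)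
   have "nrm2 (lebesgue_on Y) (P i) <= sqrt (b / al)" unfolding nrm2_def using nI[of i] by simp
   from AE_scale_shift[OF P7[OF this], of "1 / ep" 0] ep
   have "AE x in leb. \<bar>W (axis i 1) (0 + (1 / ep) *\<^sub>R x) - axis i 1 \<bullet> (0 + (1 / ep) *\<^sub>R x)\<bar>
     <= 2 * (3 * (60 * sqrt (b / al) + 1) + 64 / al + 2 * norm (axis i 1 :: R2))" by simp
   thus "AE x in leb. \<bar>?w x - x $ i\<bar> <= ep * (2 * (3 * (60 * sqrt (b / al) + 1) + 64 / al + 2))"
   proof eventually_elim
    case (elim x)
    have "?w x - x $ i = ep * (W (axis i 1) (0 + (1 / ep) *\<^sub>R x) - axis i 1 \<bullet> (0 + (1 / ep) *\<^sub>R x))"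
     using ep by (simp add: weq right_diff_distrib inner_axis')
    thus ?case using elim ep by (simp only: abs_mult abs_of_pos norm_axis_1 mult_1_right mult_le_cancel_left_pos)
   qed
   show "Y_periodic (energy_density A P i l)" unfolding el by (rule Y_periodic_comb2[OF gper gper])
   show gll: "locint (energy_density A P i l)" unfolding el by (rule locint_add[OF gl gl])
   have "(LINT y|lebesgue_on Y. \<bar>energy_density A P i l y\<bar>) <= (LINT y|lebesgue_on Y. g i i y + g l l y)"
   proof (rule integral_mono_AE)
    show "AE y in lebesgue_on Y. \<bar>energy_density A P i l y\<bar> <= g i i y + g l l y"
    proof (rule AE_lebesgue_on_I[OF Y_lebesgue], use ca in eventually_elim, intro impI)
     fix y assume c: "\<forall>xs. al * (norm xs)^2 <= (A y *v xs) \<bullet> xs"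
     have "0 <= (A y *v xs) \<bullet> xs" for xs using c al by (meson mult_nonneg_nonneg order_trans less_imp_le zero_le_power2)
     thus "\<bar>energy_density A P i l y\<bar> <= g i i y + g l l y"
      unfolding g_def energy_density_def by (rule coercive_polarisation)
    qed
   qed (use gY in \<open>simp_all add: el\<close>)
   also have "... <= K" using gY gI b[of i] b[of l] K(1) by simp
   finally show "(LINT y|lebesgue_on Y. \<bar>energy_density A P i l y\<bar>) <= K" .
   show "Y_periodic (%y. (norm (P i y))^2)" using Y_periodic_comb2[OF P(4) P(4), of "%a b. (norm a)^2"] .
   show "locint (%y. (norm (P i y))^2)" by (rule nl)
   show "(LINT y|lebesgue_on Y. (norm (P i y))^2) <= K" by (rule order_trans[OF nI K(2)])
  next
   fix i ze assume ze: "ze \<in> C1c UNIV"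
   obtain S where S: "C1 ze" "compact S" "!!x. x ~: S ==> ze x = 0" using C1c_support[OF ze] by metis
   let ?z = "%x. ze (0 + ep *\<^sub>R x)"
   have "?z x = 0" if "x ~: (%x. (1 / ep) *\<^sub>R x) ` S" for x
   proof -
    have "ep *\<^sub>R x ~: S" using ep that by (auto simp: image_iff dest!: bspec[of _ _ "ep *\<^sub>R x"])
    thus ?thesis using S(3) by simp
   qed
   hence "?z \<in> C1c UNIV"
    unfolding C1c_def using C1_affine[OF S(1)] compact_scaling[OF S(2)] by blast
   from P6[OF this, of i] have 0: "(LINT x|leb. (A x *v P i x) \<bullet> (ep *\<^sub>R grad ze (0 + ep *\<^sub>R x))) = 0"
    by (subst (asm) grad_affine[OF S(1)])
   show "(LINT x|leb. (A (x /\<^sub>R ep) *v P i (x /\<^sub>R ep)) \<bullet> grad ze x) = 0"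
    using integral_scale_shift[of ep "%x. (A (x /\<^sub>R ep) *v P i (x /\<^sub>R ep)) \<bullet> grad ze x" 0] 0 ep by simp
  qed
 qed
qed

lemma integral_lebesgue_on_vanish:
 fixes f :: "R2 => real"
 assumes "S \<in> sets leb" "!!x. x ~: S ==> f x = 0"
 shows "(LINT x|lebesgue_on S. f x) = (LINT x|leb. f x)"
proof -
 have "(LINT x|lebesgue_on S. f x) = (LINT x|leb. indicator S x *\<^sub>R f x)"
  by (rule Bochner_Integration.integral_restrict_space) (use assms(1) in auto)
 also have "(%x. indicator S x *\<^sub>R f x) = f" using assms(2) by (intro ext) (auto simp: indicator_def)
 finally show ?thesis .
qed

section \<open>The energy identity for the corrected gradient\<close>

text \<open>A C1 clipping: the identity on [-M, M], and with values at most M + 1 in modulus since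
  \<open>bump_pos 1\<close> lags at most 1 behind the positive part.\<close>

definition truncate :: "real => real => real" where
 "truncate M t = t - bump_pos 1 (t - M) + bump_pos 1 (- t - M)"

definition truncate' :: "real => real => real" where
 "truncate' M t = 1 - bump_pos' 1 (t - M) - bump_pos' 1 (- t - M)"

lemma DERIV_truncate: "DERIV (truncate M) t :> truncate' M t"
 unfolding truncate_def[abs_def] truncate'_def
 by (rule derivative_eq_intros DERIV_chain2[OF DERIV_bump_pos] refl | simp)+

lemma continuous_truncate': "continuous_on UNIV (truncate' M)"
 unfolding truncate'_def[abs_def]
 by (intro continuous_intros continuous_on_compose2[OF continuous_bump_pos'[of 1]]) auto

lemma truncate_eq: "\<bar>t\<bar> <= M ==> truncate M t = t"
 using bump_pos_bounds(3)[of 1 "t - M"] bump_pos_bounds(3)[of 1 "- t - M"] by (auto simp: truncate_def)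

lemma truncate'_eq: "\<bar>t\<bar> <= M ==> truncate' M t = 1"
 using bump_pos'_bounds(3)[of 1 "t - M"] bump_pos'_bounds(3)[of 1 "- t - M"] by (auto simp: truncate'_def)

lemma truncate'_bound: "\<bar>truncate' M t\<bar> <= 2"
 using bump_pos'_bounds(1,2)[of 1 "t - M"] bump_pos'_bounds(1,2)[of 1 "- t - M"] by (auto simp: truncate'_def)

lemma truncate_bound:
 assumes "M >= 0" shows "\<bar>truncate M t\<bar> <= M + 1"
proof -
 have b: "s - 1 <= bump_pos 1 s" "0 <= bump_pos 1 s" "s <= 0 ==> bump_pos 1 s = 0" "s >= 0 ==> bump_pos 1 s <= s" for s :: real
  using bump_pos_bounds[of 1 s] bump_pos_Lipschitz[of 1 s 0] bump_pos_bounds(3)[of 1 0] by auto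
 show ?thesis
  using b[of "t - M"] b[of "- t - M"] assms unfolding truncate_def by linarith
qed

lemma truncate_Lipschitz: "\<bar>truncate M s - truncate M t\<bar> <= 3 * \<bar>s - t\<bar>"
proof -
 have "\<bar>bump_pos 1 (s - M) - bump_pos 1 (t - M)\<bar> <= \<bar>s - t\<bar>"
  "\<bar>bump_pos 1 (- s - M) - bump_pos 1 (- t - M)\<bar> <= \<bar>s - t\<bar>"
  using bump_pos_Lipschitz[of 1 "s - M" "t - M"] bump_pos_Lipschitz[of 1 "- s - M" "- t - M"] by auto
 thus ?thesis using abs_ge_self[of "s - t"] abs_ge_minus_self[of "s - t"]
  unfolding truncate_def abs_le_iff by (elim conjE, intro conjI; linarith)
qed

text \<open>Approximants in the H1 sense need not be bounded, but the product with a gradient in the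
  cell equation passes to the limit only if they are. The sup bound of u lets them be clipped
  without changing the limit; a subsequence gives convergence almost everywhere.\<close>

lemma bounded_approximants:
 assumes ph: "!!j. ph j \<in> C1c U" and L: "L2lim leb ph u" "L2lim leb (%j. grad (ph j)) G"
  and M: "M >= 0" "AE x in leb. \<bar>u x\<bar> <= M"
 obtains ps where "!!j. ps j \<in> C1c U" "!!j x. \<bar>ps j x\<bar> <= M + 1" "L2lim leb ps u" "L2lim leb (%j. grad (ps j)) G"
  "AE x in leb. (%j. ps j x) \<longlonglongrightarrow> u x"
proof -
 obtain r :: "nat => nat" where r: "strict_mono r" "AE x in leb. (%n. ph (r n) x) \<longlonglongrightarrow> u x"
  using L2lim_AE_subseq[OF L(1)] by blast
 define ps where "ps = (%j x. truncate M (ph (r j) x))"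
 have C: "C1 (ph j)" for j using ph[of j] by (simp add: C1c_def)
 have g: "C1 (ps j)" "grad (ps j) = (%x. truncate' M (ph (r j) x) *\<^sub>R grad (ph (r j)) x)" for j
  unfolding ps_def
  by (rule C1_compose_real[OF C DERIV_truncate continuous_truncate'] grad_compose_real[OF C DERIV_truncate continuous_truncate'])+
 have um: "u \<in> borel_measurable leb" using L2limD(2)[OF L(1)] by (rule sq_meas)
 have pm: "ph j \<in> borel_measurable leb" for j using L2limD(1)[OF L(1)] by (rule sq_meas)
 show ?thesis
 proof (rule that[of ps])
  fix j
  obtain K where K: "compact K" "K \<subseteq> U" "!!x. x ~: K ==> ph (r j) x = 0" using C1c_support[OF ph] by metis
  have "ps j x = 0" if "x ~: K" for x using K(3)[OF that] M(1) by (simp add: ps_def truncate_eq)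
  thus "ps j \<in> C1c U" using g(1) K(1,2) unfolding C1c_def by blast
  show "\<bar>ps j x\<bar> <= M + 1" for x unfolding ps_def by (rule truncate_bound[OF M(1)])
 next
  show "L2lim leb ps u"
  proof (rule L2lim_squeeze)
   show s: "sq leb (ps j)" for j
   proof (rule sq_dominated[OF L2limD(1)[OF L(1), of "r j"]])
    show "ps j \<in> borel_measurable leb" using C1_measurable(1)[OF g(1)] by (simp add: measurable_completion)
    have "\<bar>ps j x\<bar> <= 3 * \<bar>ph (r j) x\<bar>" for x
     using truncate_Lipschitz[of M "ph (r j) x" 0] M(1) by (simp add: ps_def truncate_eq)
    thus "AE x in leb. norm (ps j x) <= 3 * norm (ph (r j) x)" by simp
   qed
   show u: "sq leb u" by (rule L2limD(2)[OF L(1)])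
   show "nrm2 leb (%x. ps j x - u x) <= 3 * nrm2 leb (%x. ph (r j) x - u x)" for j
   proof (rule nrm2_dominated)
    show "sq leb (%x. ph (r j) x - u x)" by (intro sq_diff L2limD(1)[OF L(1)] u)
    show "(%x. ps j x - u x) \<in> borel_measurable leb" using s[of j] um by (auto simp: sq_def)
    show "AE x in leb. norm (ps j x - u x) <= 3 * norm (ph (r j) x - u x)"
     using M(2)
    proof eventually_elim
     case (elim x)
     show ?case using truncate_Lipschitz[of M "ph (r j) x" "u x"] truncate_eq[OF elim] by (simp add: ps_def)
    qed
   qed simp
   show "(%j. 3 * nrm2 leb (%x. ph (r j) x - u x)) \<longlonglongrightarrow> 0"
    using tendsto_mult_right_zero[OF L2limD(3)[OF L2lim_subseq[OF L(1) r(1)]], of 3] by simp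
  qed
  have "L2lim leb (%j x. truncate' M (ph (r j) x) *\<^sub>R grad (ph (r j)) x) (%x. 1 *\<^sub>R G x)"
  proof (rule L2lim_bounded_mult[OF L2lim_subseq[OF L(2) r(1)]])
   have "truncate' M \<in> borel_measurable borel" by (rule borel_measurable_continuous_onI[OF continuous_truncate'])
   from measurable_compose[OF pm this] show "(%x. truncate' M (ph (r n) x)) \<in> borel_measurable leb" for n .
   show "AE x in leb. \<bar>truncate' M (ph (r n) x)\<bar> <= 2" for n by (simp add: truncate'_bound)
   show "AE x in leb. (%n. truncate' M (ph (r n) x)) \<longlonglongrightarrow> 1"
    using r(2) M(2)
   proof eventually_elim
    case (elim x)
    have "isCont (truncate' M) (u x)" using continuous_truncate' by (simp add: continuous_on_eq_continuous_at)
    from isCont_tendsto_compose[OF this elim(1)] show ?case by (simp add: truncate'_eq[OF elim(2)])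
   qed
  qed simp
  thus "L2lim leb (%j. grad (ps j)) G" by (simp add: g(2))
  show "AE x in leb. (%j. ps j x) \<longlonglongrightarrow> u x"
   using r(2) M(2)
  proof eventually_elim
   case (elim x)
   have "isCont (truncate M) (u x)" using DERIV_truncate DERIV_isCont by blast
   from isCont_tendsto_compose[OF this elim(1)] show ?case by (simp add: truncate_eq[OF elim(2)] ps_def)
  qed
 qed
qed

text \<open>Mollify the bounded part w - x_i instead of w and add the coordinate back: averages then
  keep the bound \<open>de\<close> exactly, at every point and for every j.\<close>

lemma smooth_corrector:
 fixes i :: 2
 assumes w: "is_weak_grad UNIV w P" "w \<in> L2_loc UNIV" "P \<in> L2_loc UNIV"
  and de: "AE x in leb. \<bar>w x - x $ i\<bar> <= de"
 obtains om where "!!j. C1 (om j)" "!!j x. \<bar>om j x - x $ i\<bar> <= de"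
  "!!R. L2lim (lebesgue_on (cball 0 R)) om w" "!!R. L2lim (lebesgue_on (cball 0 R)) (%j. grad (om j)) P"
proof -
 let ?e = "axis i (1::real)"
 define X where "X = (%x. w x + (- ?e) \<bullet> x)"
 have lin: "C1 (%x. xs \<bullet> x)" "grad (%x. xs \<bullet> x) = (%_. xs)" for xs :: R2
 proof -
  have "GDERIV (%x. xs \<bullet> x) x :> xs" for x
   using bounded_linear_imp_has_derivative[OF bounded_linear_inner_right[of xs]] by (simp add: gderiv_def inner_commute)
  from C1I[of "%x. xs \<bullet> x" "%_. xs", OF this continuous_on_const] show "C1 (%x. xs \<bullet> x)" "grad (%x. xs \<bullet> x) = (%_. xs)" .
 qed
 have X: "is_weak_grad UNIV X (%x. P x + (- ?e))"
  unfolding X_def by (rule weak_grad_add[OF _ w(1) weak_grad_linear]) simp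
 have X2: "X \<in> L2_loc UNIV" unfolding X_def by (intro L2_loc_add w continuous_L2_loc continuous_intros)
 have G2: "(%x. P x + (- ?e)) \<in> L2_loc UNIV" by (intro L2_loc_add w continuous_L2_loc continuous_intros)
 have Xl: "locint X" using L2_loc_imp_L1_loc[OF X2] by (simp add: locint_L1_loc)
 define om where "om = (%j x. moll j X x + ?e \<bullet> x)"
 have c: "sq (lebesgue_on (cball 0 R)) (%x. ?e \<bullet> x)" "sq (lebesgue_on (cball 0 R)) (%x::R2. ?e)" for R
  by (rule sq_continuous_compact, intro continuous_intros, rule compact_cball)+
 show ?thesis
 proof (rule that[of om])
  show "C1 (om j)" for j unfolding om_def by (rule C1_add[OF C1_moll[OF Xl] lin(1)])
  have gw: "grad (om j) = (%x. grad (moll j X) x + ?e)" for j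
   unfolding om_def by (simp add: grad_add[OF C1_moll[OF Xl] lin(1)] lin(2))
  have ex: "?e \<bullet> x = x $ i" for x :: R2 by (simp add: inner_axis')
  have ae: "AE y in leb. \<bar>X y - 0\<bar> <= de"
   using de by eventually_elim (simp add: X_def ex)
  have "\<bar>moll j X x - 0\<bar> <= de" for j x
   by (rule moll_near_const[OF Xl]) (use ae in \<open>eventually_elim, simp\<close>)
  thus "\<bar>om j x - x $ i\<bar> <= de" for j x by (simp add: om_def ex)
  show "L2lim (lebesgue_on (cball 0 R)) om w" for R
  proof -
   have "(%x. X x + ?e \<bullet> x) = w" by (simp add: X_def)
   thus ?thesis using L2lim_add[OF L2lim_moll_loc[OF X2] L2lim_const[OF c(1)], of R] by (simp only: om_def)
  qed
  show "L2lim (lebesgue_on (cball 0 R)) (%j. grad (om j)) P" for R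
  proof -
   have "(%x. P x + - ?e + ?e) = P" by simp
   thus ?thesis using L2lim_add[OF L2lim_grad_moll_loc[OF X G2] L2lim_const[OF c(2)], of R] by (simp only: gw)
  qed
 qed
qed

lemma L2lim_compose_bounded:
 fixes f :: "R2 => real" and om :: "nat => 'a => R2"
 assumes F: "L2lim M F h" and f: "continuous_on UNIV f" "!!x. \<bar>f x\<bar> <= C"
  and om: "!!j. om j \<in> borel_measurable M" "w \<in> borel_measurable M" "AE x in M. (%j. om j x) \<longlonglongrightarrow> w x"
 shows "L2lim M (%j x. f (om j x) *\<^sub>R F j x) (%x. f (w x) *\<^sub>R h x)"
proof (rule L2lim_bounded_mult[OF F])
 have "f \<in> borel_measurable borel" by (rule borel_measurable_continuous_onI[OF f(1)])
 from measurable_compose[OF om(1) this] measurable_compose[OF om(2) this]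
 show "(%x. f (om n x)) \<in> borel_measurable M" "(%x. f (w x)) \<in> borel_measurable M" for n .
 show "AE x in M. \<bar>f (om n x)\<bar> <= C" for n using f(2) by simp
 show "AE x in M. (%n. f (om n x)) \<longlonglongrightarrow> f (w x)"
  using om(3)
 proof eventually_elim
  case (elim x)
  have "isCont f (w x)" using f(1) by (simp add: continuous_on_eq_continuous_at)
  from isCont_tendsto_compose[OF this elim] show ?case .
 qed
qed


text \<open>Expand the form \<open>si Z . Z\<close>. The equation of u converts
  \<open>si G . Z\<close> into \<open>sis H . Z\<close>; the cell equations, tested with the i-th
  partial derivative of Ph at v times z, convert \<open>si P_i . Z\<close> into terms with second
  derivatives of Ph; integration by parts gives the matching terms with \<open>sis\<close>. What
  remains is their difference, symmetrised in the two indices.\<close>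

lemma corrector_estimate:
 fixes si :: "R2 => real^2^2" and sis :: "real^2^2" and w :: "2 => R2 => real" and P :: "2 => R2 => R2"
  and u :: "R2 => real" and G H :: "R2 => R2" and Ph :: "R2 => real" and R :: real
 defines "M \<equiv> lebesgue_on (cball (0::R2) R)"
  and "D \<equiv> %i l. grad (%x. grad Ph x $ i)"
  and "v \<equiv> %x. \<chi> i. w i x"
 defines "z \<equiv> %x. u x - Ph (v x)" and "Z \<equiv> %x. G x - (\<Sum>i\<in>UNIV. grad Ph (v x) $ i *\<^sub>R P i x)"
 assumes U: "open U" "U \<subseteq> cball 0 R"
  and ph: "!!j. ph j \<in> C1c U" "L2lim leb ph u" "L2lim leb (%j. grad (ph j)) G"
  and bu: "b >= 0" "AE x in leb. \<bar>u x\<bar> <= b"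
  and si: "si \<in> borel_measurable leb" "AE x in leb. norm (si x) <= B"
  and coer: "AE x in leb. \<forall>xs. al * (norm xs)^2 <= (si x *v xs) \<bullet> xs" and al: "al > 0"
  and w: "!!i. is_weak_grad UNIV (w i) (P i)" "!!i. w i \<in> L2_loc UNIV" "!!i. P i \<in> L2_loc UNIV"
  and de: "!!i. AE x in leb. \<bar>w i x - x $ i\<bar> <= de"
  and cell: "!!i ze. ze \<in> C1c UNIV ==> (LINT x|leb. (si x *v P i x) \<bullet> grad ze x) = 0"
  and Ph: "Ph \<in> test_functions UNIV" "compact K" "K \<subseteq> U" 
   "!!x y. x ~: K ==> (!!i. \<bar>y $ i - x $ i\<bar> <= de) ==> Ph y = 0"
  and H: "sq leb H" and eq: "!!ze. ze \<in> C1c U ==> 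
   (LINT x|leb. (si x *v G x) \<bullet> grad ze x) = (LINT x|leb. (sis *v H x) \<bullet> grad ze x)"
 shows "sq M z" "sq M Z" "nrm2 M z <= sqrt (measure leb U) * nrm2 M Z"
  "al * (nrm2 M Z)^2 <= (LINT x|M. (sis *v (H x - grad Ph x)) \<bullet> Z x)
   + (\<Sum>i\<in>UNIV. \<Sum>l\<in>UNIV. (LINT x|M. z x * D i l (v x) $ l * ((si x *v P i x) \<bullet> P l x + (si x *v P l x) \<bullet> P i x))
     - (sis $ l $ i + sis $ i $ l) * (LINT x|M. z x * D i l x $ l)) / 2" (is "?L <= ?h + ?E")
proof -
 let ?B = "cball (0::R2) R"
 have B: "?B \<in> sets leb" "compact ?B" by (auto intro: compact_lebesgue)
 have Mfin: "emeasure M (space M) < \<infinity>" unfolding M_def by (rule emeasure_compact_lebesgue_on[OF B(2)])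
 have sqc: "sq M (%x. k :: real)" for k unfolding M_def by (rule sq_continuous_compact[OF _ B(2)]) auto
 have onM: "AE x in M. Q x" if "AE x in leb. Q x" for Q
  unfolding M_def by (rule AE_lebesgue_on_I[OF B(1)], use that in eventually_elim) simp
 have sub: "L2lim leb F f ==> L2lim M F f" for F :: "nat => R2 => 'b::euclidean_space" and f
  unfolding M_def using L2lim_subset[of UNIV ?B F f] B(1) by (simp add: lebesgue_on_UNIV_eq)
 obtain ps where ps: "!!j. ps j \<in> C1c U" "!!j x. \<bar>ps j x\<bar> <= b + 1" "L2lim leb ps u" "L2lim leb (%j. grad (ps j)) G"
  "AE x in leb. (%j. ps j x) \<longlonglongrightarrow> u x"
  by (rule bounded_approximants[OF ph bu]) (rule that; simp)
 define good where "good = (%i om. (\<forall>j. C1 (om j)) & (\<forall>j x. \<bar>om j x - x $ i\<bar> <= de) & L2lim M om (w i) & L2lim M (%j. grad (om j)) (P i))"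
 have "\<exists>om. good i om" for i
  by (rule smooth_corrector[OF w(1-3)[of i] de[of i]]) (unfold good_def M_def, blast)
 then obtain om0 where om0: "good i (om0 i)" for i by metis
 have "L2lim M (%j x. \<chi> i. om0 i j x) v"
  by (rule L2lim_vec) (use om0 in \<open>simp add: good_def v_def\<close>)
 then obtain r :: "nat => nat" where r: "strict_mono r" "AE x in M. (%j. \<chi> i. om0 i (r j) x) \<longlonglongrightarrow> v x"
  by (blast dest: L2lim_AE_subseq)
 define om where "om = (%i j. om0 i (r j))"
 define V where "V = (%j x. \<chi> i. om i j x)"
 have om: "C1 (om i j)" "\<bar>om i j x - x $ i\<bar> <= de" "L2lim M (om i) (w i)" "L2lim M (%j. grad (om i j)) (P i)" for i j x
  using om0[of i] L2lim_subseq[OF _ r(1)] by (auto simp: good_def om_def)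
 have VL: "L2lim M V v" unfolding V_def by (rule L2lim_vec) (use om(3) in \<open>simp add: v_def\<close>)
 have Vae: "AE x in M. (%j. V j x) \<longlonglongrightarrow> v x" using r(2) by (simp add: V_def om_def)
 have Vm: "V j \<in> borel_measurable M" "v \<in> borel_measurable M" for j using L2limD(1,2)[OF VL] by (auto simp: sq_meas)
 note comp = L2lim_compose_bounded[OF _ _ _ Vm Vae]
 have Phi: "(%x. grad Ph x $ i) \<in> test_functions UNIV" for i by (rule test_functions_grad[OF Ph(1)])
 have Phil: "(%x. D i l x $ l) \<in> test_functions UNIV" for i l unfolding D_def by (rule test_functions_grad[OF Phi])
 have bd: "\<exists>C. (\<forall>x. \<bar>ps x\<bar> <= C) & continuous_on UNIV ps" if ps: "ps \<in> test_functions UNIV" for ps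
 proof -
  obtain K where "compact K" "!!x. x ~: K ==> ps x = 0" using test_functionsE[OF ps] by metis
  moreover have c: "continuous_on UNIV ps" using C1D(3)[OF test_functions_C1[OF ps]] .
  ultimately show ?thesis using bounded_compact_support[OF c] by (metis real_norm_def)
 qed
 have CPh: "C1 Ph" "C1 (%x. grad Ph x $ i)" for i using Ph(1) Phi by (auto intro: test_functions_C1)
 \<comment> \<open>All identities are proved for these C1 functions and then j tends to infinity.
   The subsequence r was chosen so that the smoothed corrector maps V j converge almost everywhere,
   as needed to compose them with derivatives of Ph.\<close>
 define ze where "ze = (%j x. ps j x - Ph (V j x))"
 have V_nth: "(%x. V j x $ i) = om i j" for j i by (simp add: V_def)
 have CV: "C1 (%x. V j x $ i)" for j i by (simp add: V_nth om(1))
 have Cps: "C1 (ps j)" for j using ps(1)[of j] by (simp add: C1c_def)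
 have gze: "grad (ze j) = (%x. grad (ps j) x - (\<Sum>i\<in>UNIV. grad Ph (V j x) $ i *\<^sub>R grad (om i j) x))" for j
  unfolding ze_def by (subst grad_diff[OF Cps C1_compose[OF CPh(1) CV]]) (simp only: grad_compose[OF CPh(1) CV] V_nth)
 have zeC: "ze j \<in> C1c U" for j
 proof -
  obtain K' where K': "compact K'" "K' \<subseteq> U" "!!x. x ~: K' ==> ps j x = 0" using C1c_support[OF ps(1)] by metis
  \<comment> \<open>V j moves no coordinate by more than \<open>de\<close>, so Ph composed with it
    still vanishes off the compact set K inside U. This makes \<open>ze j\<close> admissible in the
    equation with zero boundary values.\<close>
  have "Ph (V j x) = 0" if "x ~: K" for x by (rule Ph(4)[OF that]) (simp add: V_def om(2))
  hence "\<forall>x. x ~: K \<union> K' --> ze j x = 0" using K'(3) by (simp add: ze_def)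
  moreover have "C1 (ze j)" unfolding ze_def by (rule C1_diff[OF Cps C1_compose[OF CPh(1) CV]])
  moreover have "compact (K \<union> K')" "K \<union> K' \<subseteq> U" using K' Ph by auto
  ultimately show ?thesis unfolding C1c_def by blast
 qed
 have ze0: "ze j x = 0" "grad (ze j) x = 0" if "x ~: U" for j x
 proof -
  obtain K' where "K' \<subseteq> U" "!!x. x ~: K' ==> ze j x = 0" "!!x. x ~: K' ==> grad (ze j) x = 0" using C1c_support[OF zeC] by metis
  thus "ze j x = 0" "grad (ze j) x = 0" using that by auto
 qed
 have toM: "(LINT x|M. f x) = (LINT x|leb. f x)" if "!!x. x ~: U ==> f x = 0" for f :: "R2 => real"
  unfolding M_def by (rule integral_lebesgue_on_vanish[OF B(1)], rule that) (use U(2) in blast)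
 obtain C0 where C0: "!!x. \<bar>Ph x\<bar> <= C0" "continuous_on UNIV Ph" using bd[OF Ph(1)] by blast
 have LPh: "L2lim M (%j x. Ph (V j x)) (%x. Ph (v x))"
  using comp[OF L2lim_const[OF sqc[of 1]] C0(2,1)] by simp
 have Lze: "L2lim M ze z" unfolding ze_def z_def by (rule L2lim_diff[OF sub[OF ps(3)] LPh])
 have Li: "L2lim M (%j x. grad Ph (V j x) $ i *\<^sub>R F j x) (%x. grad Ph (v x) $ i *\<^sub>R f x)"
  if "L2lim M F f" for F :: "nat => R2 => R2" and f i
 proof -
  obtain C where "!!x. \<bar>grad Ph x $ i\<bar> <= C" "continuous_on UNIV (%x. grad Ph x $ i)" using bd[OF Phi] by blast
  from comp[OF that this(2,1)] show ?thesis .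
 qed
 have LZ: "L2lim M (%j. grad (ze j)) Z"
  unfolding gze Z_def by (intro L2lim_diff sub[OF ps(4)] L2lim_sum Li om(4))
 show z2: "sq M z" and Z2: "sq M Z" using L2limD(2)[OF Lze] L2limD(2)[OF LZ] .
 have nM: "nrm2 M f = nrm2 leb f" if "!!x. x ~: U ==> f x = 0" for f :: "R2 => 'b::euclidean_space"
  unfolding nrm2_def using toM[of "%x. (norm (f x))^2"] that by simp
 have Um: "U \<in> lmeasurable" using U bounded_subset[OF bounded_cball] by (metis lmeasurable_open)
 have "nrm2 M (ze j) <= sqrt (measure leb U) * nrm2 M (grad (ze j))" for j
  using GNS[OF zeC Um, of j] ze0 by (simp add: nM)
 thus "nrm2 M z <= sqrt (measure leb U) * nrm2 M Z"
  by (intro LIMSEQ_le[OF L2lim_norm[OF Lze] tendsto_mult_left[OF L2lim_norm[OF LZ]]]) auto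
 have siM: "si \<in> borel_measurable M" unfolding M_def by (rule measurable_restrict_space1[OF si(1)])
 have siB: "AE x in M. norm (si x) <= B" by (rule onM[OF si(2)])
 have G2: "sq M G" using L2limD(2)[OF sub[OF ps(4)]] .
 have H2: "sq M H" using sq_subset[of UNIV ?B H] B(1) H by (simp add: lebesgue_on_UNIV_eq M_def)
 have P2: "sq M (P i)" for i using L2limD(2)[OF om(4)] .
 note ssi = sq_matvec[OF siM siB]
 have ss: "sq M (%x. sis *v f x)" if "sq M f" for f
  by (rule sq_matvec[of "%_. sis" M "norm sis", OF _ _ that]) auto
 have e1: "(LINT x|M. (si x *v G x) \<bullet> Z x) = (LINT x|M. (sis *v H x) \<bullet> Z x)"
 proof -
  have "(LINT x|M. (si x *v G x) \<bullet> grad (ze j) x) = (LINT x|M. (sis *v H x) \<bullet> grad (ze j) x)" for j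
   using eq[OF zeC, of j] toM ze0 by simp
  thus ?thesis
   using LIMSEQ_unique[OF L2lim_inner[OF L2lim_const[OF ssi[OF G2]] LZ]] L2lim_inner[OF L2lim_const[OF ss[OF H2]] LZ] by simp
 qed
 define zD where "zD = (%i l x. z x * D i l (v x) $ l)"
 \<comment> \<open>A product of three factors: the gradients converge in L2, the second derivatives
   are bounded, and \<open>ze j\<close> is bounded thanks to the clipped approximants.\<close>
 have LD: "L2lim M (%j x. (ze j x * D i l (V j x) $ l) *\<^sub>R grad (om l j) x) (%x. zD i l x *\<^sub>R P l x)" for i l
 proof -
  obtain C where C: "!!x. \<bar>D i l x $ l\<bar> <= C" "continuous_on UNIV (%x. D i l x $ l)" using bd[OF Phil] by blast
  have "L2lim M (%j x. ze j x *\<^sub>R (D i l (V j x) $ l *\<^sub>R grad (om l j) x)) (%x. z x *\<^sub>R (D i l (v x) $ l *\<^sub>R P l x))"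
  proof (rule L2lim_bounded_mult[OF comp[OF om(4) C(2,1)]])
   show "ze n \<in> borel_measurable M" "z \<in> borel_measurable M" for n using L2limD(1,2)[OF Lze] by (auto simp: sq_meas)
   show "AE x in M. \<bar>ze n x\<bar> <= b + 1 + C0" for n
   proof (intro AE_I2)
    fix x
    have "\<bar>ze n x\<bar> <= \<bar>ps n x\<bar> + \<bar>Ph (V n x)\<bar>" unfolding ze_def by (rule abs_triangle_ineq4)
    thus "\<bar>ze n x\<bar> <= b + 1 + C0" using ps(2)[of n x] C0(1)[of "V n x"] by linarith
   qed
   show "AE x in M. (%n. ze n x) \<longlonglongrightarrow> z x"
    using Vae onM[OF ps(5)]
   proof eventually_elim
    case (elim x)
    have "isCont Ph (v x)" using C0(2) by (simp add: continuous_on_eq_continuous_at)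
    from tendsto_diff[OF elim(2) isCont_tendsto_compose[OF this elim(1)]] show ?case by (simp add: ze_def z_def)
   qed
  qed
  thus ?thesis by (simp add: zD_def)
 qed
 \<comment> \<open>The cell equation tested with \<open>th j\<close>. The product rule yields the
   gradient of \<open>ze j\<close>, which tends to Z, plus the second derivatives of Ph contracted
   with the corrector gradients.\<close>
 have e2: "(LINT x|M. (si x *v P i x) \<bullet> (grad Ph (v x) $ i *\<^sub>R Z x + (\<Sum>l\<in>UNIV. zD i l x *\<^sub>R P l x))) = 0" for i
 proof -
  define th where "th = (%j x. grad Ph (V j x) $ i * ze j x)"
  have C: "C1 (%x. grad Ph (V j x) $ i)" for j by (rule C1_compose[OF CPh(2) CV])
  have thC: "th j \<in> C1c UNIV" for j
  proof -
   have "ze j \<in> C1c UNIV" using zeC[of j] unfolding C1c_def by blast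
   thus ?thesis unfolding th_def by (rule C1_mult_C1c[OF C])
  qed
  have "C1 (ze j)" for j using zeC[of j] by (simp add: C1c_def)
  note gm = grad_mult[OF C this]
  have gg: "grad (%x. grad Ph (V j x) $ i) = (%x. \<Sum>l\<in>UNIV. D i l (V j x) $ l *\<^sub>R grad (om l j) x)" for j
   using grad_compose[OF CPh(2) CV] by (simp add: D_def V_nth)
  have gth: "grad (th j) = (%x. grad Ph (V j x) $ i *\<^sub>R grad (ze j) x + (\<Sum>l\<in>UNIV. (ze j x * D i l (V j x) $ l) *\<^sub>R grad (om l j) x))" for j
   unfolding th_def gm gg by (simp add: scaleR_sum_right)
  have Lth: "L2lim M (%j. grad (th j)) (%x. grad Ph (v x) $ i *\<^sub>R Z x + (\<Sum>l\<in>UNIV. zD i l x *\<^sub>R P l x))"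
   unfolding gth by (intro L2lim_add L2lim_sum LD Li LZ)
  have "(LINT x|M. (si x *v P i x) \<bullet> grad (th j) x) = 0" for j
  proof -
   have "grad (th j) x = 0" if "x ~: U" for x unfolding gth using ze0[OF that] by simp
   thus ?thesis using cell[OF thC, of i j] toM by simp
  qed
  thus ?thesis
   using LIMSEQ_unique[OF L2lim_inner[OF L2lim_const[OF ssi[OF P2[of i]]] Lth]] by (simp add: LIMSEQ_const_iff)
 qed
 define S where "S = (%i l x. (si x *v P i x) \<bullet> P l x)"
 have zDP: "sq M (%x. zD i l x *\<^sub>R P l x)" for i l using L2limD(2)[OF LD] .
 have bZ: "sq M (%x. grad Ph (v x) $ i *\<^sub>R Z x)" for i using L2limD(2)[OF Li[OF LZ]] .
 have SI: "integrable M (%x. zD i l x * S i l x)" for i l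
  using sq_inner_integrable[OF ssi[OF P2[of i]] zDP[of i l]] by (simp add: S_def)
 have e2': "(LINT x|M. (si x *v (grad Ph (v x) $ i *\<^sub>R P i x)) \<bullet> Z x) = - (\<Sum>l\<in>UNIV. (LINT x|M. zD i l x * S i l x))" for i
  using e2[of i] SI[of i] sq_inner_integrable[OF ssi[OF P2[of i]] bZ[of i]]
  by (simp add: inner_add_right inner_sum_right S_def matrix_vector_mult_scaleR add_eq_0_iff2)
 \<comment> \<open>The same structure for the constant matrix, where Ph is composed with the
   identity; here a plain integration by parts is enough.\<close>
 have e3: "(LINT x|M. (sis *v grad Ph x) \<bullet> Z x) = - (\<Sum>i\<in>UNIV. \<Sum>l\<in>UNIV. sis $ l $ i * (LINT x|M. z x * D i l x $ l))"
 proof -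
  define F where "F = (%i l j x. ze j x * D i l x $ l)"
  have gi: "integrable M (%x. f x * grad (ze j) x $ k)" if "continuous_on UNIV f" for f j k
   unfolding M_def
   by (intro sq_mult_integrable sq_continuous_compact that B continuous_intros C1D(2)) (use zeC in \<open>auto simp: C1c_def\<close>)
  have a: "(LINT x|M. (sis *v grad Ph x) \<bullet> grad (ze j) x) = - (\<Sum>i\<in>UNIV. \<Sum>l\<in>UNIV. sis $ l $ i * (LINT x|M. ze j x * D i l x $ l))" for j
  proof -
   have ibp: "(LINT x|M. grad Ph x $ i * grad (ze j) x $ l) = - (LINT x|M. ze j x * D i l x $ l)" for i l
    using integration_by_parts[OF CPh(2) zeC, of i j l] toM ze0 by (simp add: D_def mult.commute)
   have "(LINT x|M. (sis *v grad Ph x) \<bullet> grad (ze j) x) = (LINT x|M. (\<Sum>i\<in>UNIV. \<Sum>l\<in>UNIV. sis $ l $ i * (grad Ph x $ i * grad (ze j) x $ l)))"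
    by (subst sum.swap) (simp add: inner_vec_def matrix_vector_mult_def sum_distrib_right mult.assoc)
   also have "... = (\<Sum>i\<in>UNIV. \<Sum>l\<in>UNIV. sis $ l $ i * (LINT x|M. grad Ph x $ i * grad (ze j) x $ l))"
    using gi[OF C1D(3)[OF CPh(2)]] by (simp add: Bochner_Integration.integral_sum)
   finally show ?thesis unfolding ibp by (simp add: sum_negf)
  qed
  have "(%j. - (\<Sum>i\<in>UNIV. \<Sum>l\<in>UNIV. sis $ l $ i * (LINT x|M. ze j x * D i l x $ l)))
    \<longlonglongrightarrow> - (\<Sum>i\<in>UNIV. \<Sum>l\<in>UNIV. sis $ l $ i * (LINT x|M. z x * D i l x $ l))"
  proof (intro tendsto_minus tendsto_sum tendsto_mult_left)
   fix i l :: 2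
   have "continuous_on UNIV (%x. D i l x $ l)" using C1D(3)[OF test_functions_C1[OF Phil]] .
   hence "sq M (%x. D i l x $ l)" unfolding M_def by (rule sq_continuous_compact[OF _ B(2)])
   from L2lim_inner[OF Lze L2lim_const[OF this]]
   show "(%j. LINT x|M. ze j x * D i l x $ l) \<longlonglongrightarrow> (LINT x|M. z x * D i l x $ l)" by simp
  qed
  moreover have "sq M (%x. sis *v grad Ph x)" unfolding M_def by (intro sq_continuous_compact B ss[unfolded M_def] C1D(2) CPh)
  note L2lim_inner[OF L2lim_const[OF this] LZ]
  ultimately show ?thesis unfolding a by (rule LIMSEQ_unique[rotated])
 qed
 have gP: "sq M (%x. grad Ph (v x) $ i *\<^sub>R P i x)" for i using L2limD(2)[OF Li[OF om(4)]] .
 have gPh: "sq M (grad Ph)" unfolding M_def by (intro sq_continuous_compact B C1D(2) CPh)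
 have "al * (nrm2 M Z)^2 = (LINT x|M. al * (norm (Z x))^2)" by (simp add: nrm2_square)
 also have "... <= (LINT x|M. (si x *v Z x) \<bullet> Z x)"
 proof (rule integral_mono_AE)
  show "integrable M (%x. al * (norm (Z x))^2)" using sq_int[OF Z2] by simp
  show "integrable M (%x. (si x *v Z x) \<bullet> Z x)" by (intro sq_inner_integrable ssi Z2)
  show "AE x in M. al * (norm (Z x))^2 <= (si x *v Z x) \<bullet> Z x" using onM[OF coer] by eventually_elim simp
 qed
 also have "(LINT x|M. (si x *v Z x) \<bullet> Z x) = (LINT x|M. (si x *v G x) \<bullet> Z x) - (\<Sum>i\<in>UNIV. (LINT x|M. (si x *v (grad Ph (v x) $ i *\<^sub>R P i x)) \<bullet> Z x))"
 proof -
  have "si x *v Z x = si x *v G x - (\<Sum>i\<in>UNIV. si x *v (grad Ph (v x) $ i *\<^sub>R P i x))" for x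
   by (simp add: Z_def matrix_vector_mult_diff_distrib linear_sum[OF matrix_vector_mul_linear])
  thus ?thesis by (simp add: inner_diff_left inner_sum_left sq_inner_integrable[OF ssi Z2] G2 gP)
 qed
 also have "(LINT x|M. (si x *v G x) \<bullet> Z x) = (LINT x|M. (sis *v (H x - grad Ph x)) \<bullet> Z x) + (LINT x|M. (sis *v grad Ph x) \<bullet> Z x)"
  by (simp add: e1 matrix_vector_mult_diff_distrib inner_diff_left sq_inner_integrable[OF ss Z2] H2 gPh)
 finally have est: "?L <= ?h + ((\<Sum>i\<in>UNIV. \<Sum>l\<in>UNIV. (LINT x|M. zD i l x * S i l x)) - (\<Sum>i\<in>UNIV. \<Sum>l\<in>UNIV. sis $ l $ i * (LINT x|M. z x * D i l x $ l)))"
  unfolding e2' e3 by (simp add: sum_negf)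
 \<comment> \<open>Averaging the double sum with its transpose now replaces each
   \<open>S i l\<close> by half of \<open>S i l + S l i\<close>, the only combination with an L1
   bound that is independent of the size of the coefficients.\<close>
 have sym: "D i l x $ l = D l i x $ i" for i l x unfolding D_def by (rule grad_grad_commute[OF CPh])
 have Ssym: "(LINT x|M. z x * D i l (v x) $ l * ((si x *v P i x) \<bullet> P l x + (si x *v P l x) \<bullet> P i x))
   = (LINT x|M. zD i l x * S i l x) + (LINT x|M. zD l i x * S l i x)" for i l
  using SI[of i l] SI[of l i] by (simp add: zD_def S_def sym[of l i] distrib_left)
 have half: "(\<Sum>i\<in>(UNIV::2 set). \<Sum>l\<in>(UNIV::2 set). (a i l + a l i) / 2) = (\<Sum>i\<in>UNIV. \<Sum>l\<in>UNIV. a i l)" for a :: "2 => 2 => real"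
  by (simp add: sum_2 field_simps)
 let ?a = "%i l. (LINT x|M. zD i l x * S i l x) - sis $ l $ i * (LINT x|M. z x * D i l x $ l)"
 have "?E = (\<Sum>i\<in>UNIV. \<Sum>l\<in>UNIV. (?a i l + ?a l i) / 2)"
  unfolding Ssym sum_divide_distrib by (intro sum.cong refl) (simp add: sym algebra_simps)
 also have "... = (\<Sum>i\<in>UNIV. \<Sum>l\<in>UNIV. (LINT x|M. zD i l x * S i l x)) - (\<Sum>i\<in>UNIV. \<Sum>l\<in>UNIV. sis $ l $ i * (LINT x|M. z x * D i l x $ l))"
  unfolding half by (simp add: sum_subtractf)
 finally show "?L <= ?h + ?E"
  using est by (simp only:)
qed

lemma uniform_L2lim:
 fixes f :: "R2 => 'b::euclidean_space"
 assumes s: "!!j. sq leb (F j)" "sq leb f" and K: "compact K" "!!j x. x ~: K ==> F j x = f x"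
  and u: "!!e. e > 0 ==> \<exists>J. \<forall>j\<ge>J. \<forall>x. norm (F j x - f x) <= e"
 shows "L2lim leb F f"
 unfolding L2lim_def
proof (intro conjI allI s LIMSEQ_I)
 fix r :: real assume r: "r > 0"
 let ?I = "indicator K :: R2 => real"
 have K2: "K \<in> lmeasurable" using K(1) by (rule lmeasurable_compact)
 define e where "e = r / (nrm2 leb ?I + 1)"
 have e: "e > 0" "e * nrm2 leb ?I < r"
  using r nrm2_nonneg[of leb ?I] by (auto simp: e_def field_simps add_pos_nonneg add_nonneg_pos)
 obtain J where J: "\<forall>j\<ge>J. \<forall>x. norm (F j x - f x) <= e" using u[OF e(1)] by blast
 have "norm (nrm2 leb (%x. F j x - f x) - 0) < r" if "j >= J" for j
 proof -
  have "nrm2 leb (%x. F j x - f x) <= e * nrm2 leb ?I"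
  proof (rule nrm2_dominated[OF sq_indicator[OF K2]])
   show "(%x. F j x - f x) \<in> borel_measurable leb" using sq_diff[OF s] by (rule sq_meas)
   show "AE x in leb. norm (F j x - f x) <= e * norm (?I x)"
    using J that K(2) by (intro AE_I2) (simp add: indicator_def)
  qed (use e in simp)
  thus ?thesis using e(2) by simp
 qed
 thus "\<exists>J. \<forall>j\<ge>J. norm (nrm2 leb (%x. F j x - f x) - 0) < r" by blast
qed

section \<open>Functionals in \<open>W\<^sup>-\<^sup>1\<^sup>,\<^sup>q\<close>\<close>

text \<open>The Minkowski sum of K0 with a small closed ball. It leaves room for mollification and
  for the displacement by the correctors.\<close>

lemma compact_neighbourhood:
 assumes K: "compact K0" "K0 \<subseteq> U" and U: "open (U :: R2 set)"
 obtains d K where "d > 0" "compact K" "K \<subseteq> U" "K0 \<subseteq> K" "!!x y. x ~: K ==> norm (y - x) <= d ==> y ~: K0"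
proof -
 obtain d where d: "d > 0" "(\<Union>x\<in>K0. cball x d) \<subseteq> U"
  by (rule compact_subset_open_imp_cball_epsilon_subset[OF K(1) U K(2)])
 define K where "K = {x + y |x y. x \<in> K0 & y \<in> cball 0 d}"
 have eq: "v \<in> K \<longleftrightarrow> (\<exists>x\<in>K0. norm (x - v) <= d)" for v
 proof
  assume "v \<in> K"
  then obtain x y where "v = x + y" "x \<in> K0" "norm y <= d" unfolding K_def by auto
  thus "\<exists>x\<in>K0. norm (x - v) <= d" by (intro bexI[of _ x]) auto
 next
  assume "\<exists>x\<in>K0. norm (x - v) <= d"
  then obtain x where "x \<in> K0" "norm (x - v) <= d" by blast
  moreover have "v = x + (v - x)" by simp
  ultimately show "v \<in> K" unfolding K_def by (simp add: norm_minus_commute) (metis norm_minus_commute add.commute diff_add_cancel)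
 qed
 show ?thesis
 proof (rule that[of d K])
  show "d > 0" by (rule d(1))
  show "compact K" unfolding K_def by (rule compact_sums[OF K(1) compact_cball])
  show "K \<subseteq> U" using d(2) by (auto simp: eq dist_norm)
  show "K0 \<subseteq> K" using d(1) by (force simp: eq)
  show "y ~: K0" if "x ~: K" "norm (y - x) <= d" for x y using that by (auto simp: eq)
 qed
qed

definition C1_converge :: "R2 set => (nat => R2 => real) => (R2 => real) => bool" where
 "C1_converge K ps ze \<longleftrightarrow> compact K & (\<forall>j x. x ~: K --> ps j x = 0 & grad (ps j) x = 0) &
  (\<forall>x. x ~: K --> ze x = 0 & grad ze x = 0) &
  (\<forall>e>0. \<exists>J. \<forall>j\<ge>J. \<forall>x. \<bar>ps j x - ze x\<bar> <= e & norm (grad (ps j) x - grad ze x) <= e)"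

lemma C1c_approx_test:
 assumes U: "open U" and ze: "ze \<in> C1c U"
 obtains ps :: "nat => R2 => real" and K where "!!j. ps j \<in> test_functions U" "C1_converge K ps ze"
proof -
 obtain K0 where K0: "C1 ze" "compact K0" "K0 \<subseteq> U" "!!x. x ~: K0 ==> ze x = 0" "!!x. x ~: K0 ==> grad ze x = 0"
  using C1c_support[OF ze] by blast
 obtain d K where d: "d > 0" and K: "compact K" and KU: "K \<subseteq> U" and K0K: "K0 \<subseteq> K" and far: "!!x y. x ~: K ==> norm (y - x) <= d ==> y ~: K0"
  using compact_neighbourhood[OF K0(2,3) U] by blast
 \<comment> \<open>Starting the sequence at J0 keeps all radii of mollification below d, hence all
   supports in K.\<close>
 obtain J0 where J0: "1 / real (J0 + 1) < d" using reals_Archimedean[OF d] by (auto simp: inverse_eq_divide)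
 define ps where "ps = (%j. moll (j + J0) ze)"
 have zel: "locint ze" by (rule locint_continuous[OF C1D(3)[OF K0(1)]])
 have off: "ps j x = 0" if x: "x ~: K" for j x
 proof -
  have "\<bar>moll (j + J0) ze x - 0\<bar> <= 0"
  proof (rule moll_near_const[OF zel], intro AE_I2 impI)
   fix y assume y: "norm (x - y) < 1 / real (j + J0 + 1)"
   have "1 / real (j + J0 + 1) <= 1 / real (J0 + 1)" by (simp add: field_simps)
   hence "norm (y - x) <= d" using y J0 by (simp add: norm_minus_commute)
   hence "y ~: K0" by (rule far[OF x])
   thus "\<bar>ze y - 0\<bar> <= 0" using K0(4) by simp
  qed
  thus ?thesis by (simp add: ps_def)
 qed
 have Cps: "C_k k (ps j)" for k j unfolding ps_def by (rule C_k_moll[OF zel])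
 have gps: "grad (ps j) x $ i = moll (j + J0) (%y. grad ze y $ i) x" for i j x
  unfolding ps_def by (rule grad_moll_weak[OF C1_weak_grad[OF K0(1)]])
 show ?thesis
 proof (rule that[of ps K], goal_cases)
  case (1 j)
  show ?case by (rule test_functionsI[OF Cps K KU off])
 next
  case 2
  have off': "ps j x = 0 & grad (ps j) x = 0" if "x ~: K" for j x
   using off[OF that] grad_eq_0_outside[OF K, of "ps j" x] off that by blast
  have z: "ze x = 0 & grad ze x = 0" if "x ~: K" for x using that K0K K0(4,5) by blast
  have "\<exists>J. \<forall>j\<ge>J. \<forall>x. \<bar>ps j x - ze x\<bar> <= e & norm (grad (ps j) x - grad ze x) <= e" if e: "e > 0" for e
  proof -
  have gc: "continuous_on UNIV (%x. grad ze x $ i)" for i by (intro continuous_intros C1D(2) K0)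
  have g0: "grad ze x $ i = 0" if "x ~: K0" for i x using K0(5)[OF that] by simp
  have "\<exists>J. \<forall>j x. j >= J --> \<bar>moll j ze x - ze x\<bar> <= e"
   by (rule moll_continuous_uniform[OF C1D(3)[OF K0(1)] K0(2) _ e]) (use K0(4) in auto)
  then obtain Ja where Ja: "!!j x. j >= Ja ==> \<bar>moll j ze x - ze x\<bar> <= e" by blast
  have "\<exists>J. \<forall>j x. j >= J --> \<bar>moll j (%y. grad ze y $ i) x - grad ze x $ i\<bar> <= e / 2" for i
   by (rule moll_continuous_uniform[OF gc[of i] K0(2) g0, of "e / 2"]) (use e in auto)
  then obtain Jb where Jb: "!!i j x. j >= Jb i ==> \<bar>moll j (%y. grad ze y $ i) x - grad ze x $ i\<bar> <= e / 2" by metis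
  have "\<bar>ps j x - ze x\<bar> <= e & norm (grad (ps j) x - grad ze x) <= e" if j: "j >= max Ja (max (Jb 1) (Jb 2))" for j x
  proof
   show "\<bar>ps j x - ze x\<bar> <= e" unfolding ps_def by (rule Ja) (use j in simp)
   have "norm (grad (ps j) x - grad ze x) <= (\<Sum>i\<in>UNIV. \<bar>(grad (ps j) x - grad ze x) $ i\<bar>)" by (rule norm_le_l1_cart)
   also have "... <= e / 2 + e / 2"
    unfolding sum_2 vector_minus_component gps by (intro add_mono Jb) (use j in auto)
   finally show "norm (grad (ps j) x - grad ze x) <= e" by simp
  qed
  thus ?thesis by blast
  qed
  with K off' z show ?case unfolding C1_converge_def by blast
 qed
qed

text \<open>Below the threshold t the second term dominates, above it the first. Integrated and
  optimised in t, this gives the required case of the Hoelder inequality up to a factor 2.\<close>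

lemma powr_le_interpolation:
 fixes X p t :: real
 assumes "X >= 0" "0 < p" "p < 2" "t > 0"
 shows "X powr p <= t powr (p - 2) * X^2 + t powr p"
proof (cases "X <= t")
 case True
 hence "X powr p <= t powr p" using assms by (intro powr_mono2) auto
 thus ?thesis by (smt (verit) mult_nonneg_nonneg powr_ge_zero zero_le_power2)
next
 case False
 hence X: "X > 0" using assms by linarith
 have "X powr p = X powr (p - 2) * X^2" using X by (simp add: powr_diff powr_numeral)
 also have "X powr (p - 2) <= t powr (p - 2)" using False assms by (intro powr_mono2') auto
 finally show ?thesis by (smt (verit) mult_right_mono powr_ge_zero zero_le_power2)
qed

lemma integral_powr_le:
 fixes f :: "R2 => 'b::euclidean_space"
 assumes f: "sq leb f" and S: "S \<in> lmeasurable" "!!x. x ~: S ==> f x = 0" and p: "0 < p" "p < 2"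
 shows "integrable leb (%x. norm (f x) powr p)"
  "(LINT x|leb. norm (f x) powr p) <= 2 * nrm2 leb f powr p * measure leb S powr (1 - p / 2)"
proof -
 let ?a = "(nrm2 leb f)^2" and ?m = "measure leb S"
 have [measurable]: "f \<in> borel_measurable leb" using f by (rule sq_meas)
 have b: "norm (f x) powr p <= t powr (p - 2) * (norm (f x))^2 + t powr p * indicator S x" if "t > 0" for t x
  using powr_le_interpolation[OF norm_ge_zero[of "f x"] p that] S(2)[of x] p by (cases "x \<in> S") auto
 have I: "integrable leb (%x. t powr (p - 2) * (norm (f x))^2 + t powr p * indicator S x)" for t
  using sq_int[OF f] S(1) by (intro Bochner_Integration.integrable_add integrable_mult_right) (auto simp: lmeasurable_iff_integrable)
 show J: "integrable leb (%x. norm (f x) powr p)"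
  by (rule Bochner_Integration.integrable_bound[OF I[of 1]]) (use b[of 1] in auto)
 have le: "(LINT x|leb. norm (f x) powr p) <= t powr (p - 2) * ?a + t powr p * ?m" if "t > 0" for t
 proof -
  have "(LINT x|leb. norm (f x) powr p) <= (LINT x|leb. t powr (p - 2) * (norm (f x))^2 + t powr p * indicator S x)"
   by (rule integral_mono[OF J I]) (use b[OF that] in auto)
  also have "... = t powr (p - 2) * ?a + t powr p * ?m"
   using sq_int[OF f] S(1) by (subst Bochner_Integration.integral_add) (auto simp: lmeasurable_iff_integrable nrm2_square)
  finally show ?thesis .
 qed
 show "(LINT x|leb. norm (f x) powr p) <= 2 * nrm2 leb f powr p * ?m powr (1 - p / 2)"
 proof (cases "?a = 0 \<or> ?m = 0")
  case True
  have "AE x in leb. f x = 0"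
  proof (cases "?a = 0")
   case True thus ?thesis using nrm2_zero_iff[OF f] by simp
  next
   case False
   with True have "?m = 0" by blast
   hence "S \<in> null_sets leb" using S(1) negligible_iff_measure negligible_iff_null_sets by blast
   hence "AE x in leb. x ~: S" by (rule AE_not_in)
   thus ?thesis by eventually_elim (rule S(2))
  qed
  hence "(LINT x|leb. norm (f x) powr p) = (LINT x|(leb :: R2 measure). 0)"
   by (intro integral_cong_AE) auto
  thus ?thesis by simp
 next
  case False
  hence a: "nrm2 leb f > 0" and m: "?m > 0"
   using nrm2_nonneg[of leb f] by (auto simp: less_le measure_nonneg)
  \<comment> \<open>This threshold makes the two terms equal.\<close>
  define t where "t = nrm2 leb f * ?m powr (- 1 / 2)"
  have tp: "t powr s = nrm2 leb f powr s * ?m powr (- s / 2)" for s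
   using a m by (simp add: t_def powr_mult powr_powr)
  have "t powr (p - 2) * ?a = (nrm2 leb f powr (p - 2) * nrm2 leb f powr 2) * ?m powr (- (p - 2) / 2)"
   using a by (simp add: tp powr_numeral)
  also have "... = nrm2 leb f powr p * ?m powr (1 - p / 2)"
   unfolding powr_add[symmetric] by (simp add: diff_divide_distrib)
  finally have "t powr (p - 2) * ?a = nrm2 leb f powr p * ?m powr (1 - p / 2)" .
  moreover have "t powr p * ?m = nrm2 leb f powr p * (?m powr (- p / 2) * ?m powr 1)"
   using m by (simp add: tp)
  moreover have "?m powr (- p / 2) * ?m powr 1 = ?m powr (1 - p / 2)"
   unfolding powr_add[symmetric] by (rule arg_cong[of _ _ "%s. ?m powr s"]) simp
  moreover have tpos: "t > 0" unfolding t_def by (rule mult_pos_pos[OF a]) (use m in simp)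
  ultimately show ?thesis using le[OF tpos] by (simp only: mult_2 distrib_right)
 qed
qed


lemma bounded_open_lmeasurable: "open U ==> bounded U ==> (U :: R2 set) \<in> lmeasurable"
 by (rule lmeasurable_open)

text \<open>The conjugate exponent p = q / (q - 1) lies in (1, 2), so passing from L^p to L2 on S
  gains |S|^(1/p - 1/2), and 1/p - 1/2 = 1/2 - 1/q. The zeroth-order term is absorbed through the
  Poincare inequality on U.\<close>

lemma W1_norm_le:
 assumes U: "open U" "bounded U" and ze: "ze \<in> C1c U" and q: "q > 2"
  and S: "S \<in> lmeasurable" "!!x. x ~: S ==> ze x = 0 & grad ze x = 0"
 shows "W1_norm U (q / (q - 1)) ze \<le>
  (2 * (sqrt (measure leb U) powr (q / (q - 1)) + 1)) powr ((q - 1) / q) * measure leb S powr (1 / 2 - 1 / q) * nrm2 leb (grad ze)"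
proof -
 define p where "p = q / (q - 1)"
 have p: "1 < p" "p < 2" using q by (auto simp: p_def field_simps)
 have ip: "1 / p = (q - 1) / q" by (simp add: p_def)
 let ?N = "nrm2 leb (grad ze)" and ?m = "measure leb S" and ?M = "sqrt (measure leb U)"
 obtain K where K: "K \<subseteq> U" "!!x. x ~: K ==> ze x = 0" "!!x. x ~: K ==> grad ze x = 0" using C1c_support[OF ze] by metis
 have Um: "U \<in> lmeasurable" using U by (rule bounded_open_lmeasurable)
 have off: "ze x = 0" "grad ze x = 0" if "x ~: U" for x using K that by blast+
 note s = C1c_sq[OF ze]
 have N0: "nrm2 leb ze <= ?M * ?N" by (rule GNS[OF ze Um]) (use K in blast)
 have "(LINT x|lebesgue_on U. \<bar>ze x\<bar> powr p + norm (grad ze x) powr p) = (LINT x|leb. \<bar>ze x\<bar> powr p + norm (grad ze x) powr p)"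
  by (rule integral_lebesgue_on_vanish) (use off U p in auto)
 also have "... = (LINT x|leb. norm (ze x) powr p) + (LINT x|leb. norm (grad ze x) powr p)"
  using integral_powr_le(1)[OF s(1) S(1), of p] integral_powr_le(1)[OF s(2) S(1), of p] S(2) p by simp
 also have "... <= 2 * (?M * ?N) powr p * ?m powr (1 - p / 2) + 2 * ?N powr p * ?m powr (1 - p / 2)"
 proof (rule add_mono)
  have "(LINT x|leb. norm (ze x) powr p) <= 2 * nrm2 leb ze powr p * ?m powr (1 - p / 2)"
   by (rule integral_powr_le(2)[OF s(1) S(1)]) (use S(2) p in auto)
  also have "... <= 2 * (?M * ?N) powr p * ?m powr (1 - p / 2)"
   using N0 p by (intro mult_right_mono mult_left_mono powr_mono2) auto
  finally show "(LINT x|leb. norm (ze x) powr p) <= 2 * (?M * ?N) powr p * ?m powr (1 - p / 2)" .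
  show "(LINT x|leb. norm (grad ze x) powr p) <= 2 * ?N powr p * ?m powr (1 - p / 2)"
   by (rule integral_powr_le(2)[OF s(2) S(1)]) (use S(2) p in auto)
 qed
 also have "... = 2 * (?M powr p + 1) * ?m powr (1 - p / 2) * ?N powr p"
  by (simp add: powr_mult algebra_simps)
 finally have I: "(LINT x|lebesgue_on U. \<bar>ze x\<bar> powr p + norm (grad ze x) powr p) <= 2 * (?M powr p + 1) * ?m powr (1 - p / 2) * ?N powr p" .
 have "W1_norm U p ze <= (2 * (?M powr p + 1) * ?m powr (1 - p / 2) * ?N powr p) powr (1 / p)"
  unfolding W1_norm_def by (rule powr_mono2[OF _ _ I]) (use p in auto)
 also have "... = (2 * (?M powr p + 1)) powr (1 / p) * (?m powr (1 - p / 2)) powr (1 / p) * (?N powr p) powr (1 / p)"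
  by (simp only: powr_mult)
 also have "(?m powr (1 - p / 2)) powr (1 / p) = ?m powr (1 / 2 - 1 / q)"
 proof -
  have "(1 - p / 2) * (1 / p) = 1 / p - 1 / 2" using p by (simp add: field_simps)
  also have "... = 1 / 2 - 1 / q" unfolding ip using q by (simp add: field_simps)
  finally show ?thesis by (simp only: powr_powr)
 qed
 also have "(?N powr p) powr (1 / p) = ?N" using p by (simp add: powr_powr)
 finally show ?thesis by (simp only: p_def[symmetric] ip[symmetric])
qed

lemma C1c_integral_limit:
 assumes F: "sq leb F" and ps: "!!j. ps j \<in> C1c U" and ze: "ze \<in> C1c U" and c: "C1_converge K ps ze"
 shows "(%j. LINT x|leb. F x \<bullet> grad (ps j) x) \<longlonglongrightarrow> (LINT x|leb. F x \<bullet> grad ze x)"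
proof -
 have "L2lim leb (%j. grad (ps j)) (grad ze)"
 proof (rule uniform_L2lim[OF C1c_sq(2)[OF ps] C1c_sq(2)[OF ze]])
  show "compact K" using c by (simp add: C1_converge_def)
  show "grad (ps j) x = grad ze x" if "x ~: K" for j x using c that unfolding C1_converge_def by simp
  show "\<exists>J. \<forall>j\<ge>J. \<forall>x. norm (grad (ps j) x - grad ze x) <= e" if "e > 0" for e
   using c that unfolding C1_converge_def by blast
 qed
 from L2lim_inner[OF L2lim_const[OF F] this] show ?thesis .
qed

lemma test_functions_extend_eq:
 assumes U: "open U" and F: "sq leb F" "sq leb F'"
  and eq: "!!ph. ph \<in> test_functions U ==> (LINT x|leb. F x \<bullet> grad ph x) = (LINT x|leb. F' x \<bullet> grad ph x)"
  and ze: "ze \<in> C1c U"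
 shows "(LINT x|leb. F x \<bullet> grad ze x) = (LINT x|leb. F' x \<bullet> grad ze x)"
proof -
 obtain ps :: "nat => R2 => real" and K where ps: "!!j. ps j \<in> test_functions U" "C1_converge K ps ze"
  using C1c_approx_test[OF U ze] by blast
 note l = C1c_integral_limit[OF _ test_functions_C1c[OF ps(1)] ze ps(2)]
 show ?thesis using LIMSEQ_unique[OF l[OF F(1)]] l[OF F(2)] eq[OF ps(1)] by simp
qed

text \<open>The functional is given on smooth test functions only, whereas truncations are merely
  C1; a square-integrable field F representing it extends the bound by approximation. C depends on
  f, q and U but not on F, so it serves all coefficients at once.\<close>

lemma W_minus1_bound:
 assumes U: "open U" "bounded U" and q: "q > 2" and f: "f \<in> W_minus1 U q"
 obtains C where "C > 0"
  "!!F. sq leb F ==> (!!ph. ph \<in> test_functions U ==> (LINT x|leb. F x \<bullet> grad ph x) = f ph) ==>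
   dual_bound U C (1 / 2 - 1 / q) F"
proof -
 let ?p = "q / (q - 1)"
 have p: "?p > 0" using q by simp
 obtain C0 where C0: "!!ph. ph \<in> test_functions U ==> \<bar>f ph\<bar> <= C0 * W1_norm U ?p ph"
  using f unfolding W_minus1_def by blast
 define Q where "Q = (2 * (sqrt (measure leb U) powr ?p + 1)) powr ((q - 1) / q)"
 have Q: "Q > 0" unfolding Q_def by (simp add: add_nonneg_pos less_imp_neq[symmetric])
 define C where "C = (\<bar>C0\<bar> + 1) * Q"
 show ?thesis
 proof (rule that[of C])
  show "C > 0" using Q by (simp add: C_def)
  fix F :: "R2 => R2"
  assume F: "sq leb F" "!!ph. ph \<in> test_functions U ==> (LINT x|leb. F x \<bullet> grad ph x) = f ph"
  show "dual_bound U C (1 / 2 - 1 / q) F"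
   unfolding dual_bound_def
  proof (intro ballI impI)
   fix ze S assume ze: "ze \<in> C1c U" and S: "S \<in> lmeasurable" "\<forall>x. x ~: S --> ze x = 0 & grad ze x = 0"
   obtain ps :: "nat => R2 => real" and K where ps3: "!!j. ps j \<in> test_functions U" and c: "C1_converge K ps ze"
    using C1c_approx_test[OF U(1) ze] by blast
   have ps6: "!!e. e > 0 ==> \<exists>J. \<forall>j\<ge>J. \<forall>x. \<bar>ps j x - ze x\<bar> <= e & norm (grad (ps j) x - grad ze x) <= e"
    and ps5: "!!x. x ~: K ==> ze x = 0" "!!x. x ~: K ==> grad ze x = 0" and ps1: "compact K"
    using c unfolding C1_converge_def by blast+
   have l1: "(%j. \<bar>(LINT x|leb. F x \<bullet> grad (ps j) x)\<bar>) \<longlonglongrightarrow> \<bar>(LINT x|leb. F x \<bullet> grad ze x)\<bar>"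
    by (rule tendsto_rabs[OF C1c_integral_limit[OF F(1) test_functions_C1c[OF ps3] ze c]])
   obtain J where J: "!!j x. j >= J ==> \<bar>ps j x - ze x\<bar> <= 1 & norm (grad (ps j) x - grad ze x) <= 1"
    using ps6[of 1] by auto
   have cont: "continuous_on UNIV ze" "continuous_on UNIV (grad ze)" using ze C1D(2,3) by (auto simp: C1c_def)
   obtain B1 where B1: "!!x. \<bar>ze x\<bar> <= B1" using bounded_compact_support[OF cont(1) ps5(1) ps1] by auto
   obtain B2 where B2: "!!x. norm (grad ze x) <= B2" using bounded_compact_support[OF cont(2) ps5(2) ps1] by auto
   let ?h = "%ze x. \<bar>ze x\<bar> powr ?p + norm (grad ze x) powr ?p"
   have pt: "(%j. ps j x) \<longlonglongrightarrow> ze x" "(%j. grad (ps j) x) \<longlonglongrightarrow> grad ze x" for x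
   proof -
    have "\<exists>J. \<forall>j\<ge>J. norm (ps j x - ze x) < e & norm (grad (ps j) x - grad ze x) < e" if "e > 0" for e
    proof -
     obtain J where "\<forall>j\<ge>J. \<forall>x. \<bar>ps j x - ze x\<bar> <= e / 2 & norm (grad (ps j) x - grad ze x) <= e / 2"
      using ps6[of "e / 2"] \<open>e > 0\<close> by auto
     hence "\<forall>j\<ge>J. norm (ps j x - ze x) < e & norm (grad (ps j) x - grad ze x) < e"
      using \<open>e > 0\<close> by (auto intro: le_less_trans[of _ "e / 2"])
     thus ?thesis by blast
    qed
    thus "(%j. ps j x) \<longlonglongrightarrow> ze x" "(%j. grad (ps j) x) \<longlonglongrightarrow> grad ze x"
     unfolding LIMSEQ_iff by blast+
   qed
   \<comment> \<open>The W^{1,p} norms converge by dominated convergence on the bounded set U: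
     beyond J the approximants and their gradients exceed the bounds of the limit by at most
     1.\<close>
   have "(%j. LINT x|lebesgue_on U. ?h (ps (j + J)) x) \<longlonglongrightarrow> (LINT x|lebesgue_on U. ?h ze x)"
   proof (rule integral_dominated_convergence[where w = "%x. (B1 + 1) powr ?p + (B2 + 1) powr ?p"])
    have m: "?h ze \<in> borel_measurable (lebesgue_on U)" if "C1 ze" for ze
    proof -
     have "ze \<in> borel_measurable leb" "grad ze \<in> borel_measurable leb"
      using C1_measurable[OF that] by (auto simp: measurable_completion)
     hence "?h ze \<in> borel_measurable leb" by measurable
     thus ?thesis by (rule measurable_restrict_space1)
    qed
    show "?h ze \<in> borel_measurable (lebesgue_on U)" using ze by (intro m) (simp add: C1c_def)
    show "?h (ps (j + J)) \<in> borel_measurable (lebesgue_on U)" for j by (rule m[OF test_functions_C1[OF ps3]])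
    have "integrable (lebesgue_on U) (%x. k)" for k :: real
     using bounded_open_lmeasurable[OF U] borel_open[OF U(1)] by (simp add: integrable_restrict_space lmeasurable_iff_integrable)
    thus "integrable (lebesgue_on U) (%x. (B1 + 1) powr ?p + (B2 + 1) powr ?p)" .
    show "AE x in lebesgue_on U. (%j. ?h (ps (j + J)) x) \<longlonglongrightarrow> ?h ze x"
    proof (rule AE_I2)
     fix x
     have "(%j. \<bar>ps j x\<bar> powr ?p) \<longlonglongrightarrow> \<bar>ze x\<bar> powr ?p"
      by (rule tendsto_powr'[OF tendsto_rabs[OF pt(1)] tendsto_const]) (use p in simp)
     moreover have "(%j. norm (grad (ps j) x) powr ?p) \<longlonglongrightarrow> norm (grad ze x) powr ?p"
      by (rule tendsto_powr'[OF tendsto_norm[OF pt(2)] tendsto_const]) (use p in simp)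
     ultimately have "(%j. ?h (ps j) x) \<longlonglongrightarrow> ?h ze x" by (rule tendsto_add)
     from LIMSEQ_ignore_initial_segment[OF this, of J]
     show "(%j. ?h (ps (j + J)) x) \<longlonglongrightarrow> ?h ze x" .
    qed
    show "AE x in lebesgue_on U. norm (?h (ps (j + J)) x) <= (B1 + 1) powr ?p + (B2 + 1) powr ?p" for j
    proof (rule AE_I2)
     fix x
     have "\<bar>ps (j + J) x\<bar> <= B1 + 1" using J[of "j + J" x] B1[of x] by auto
     moreover have "norm (grad (ps (j + J)) x) <= B2 + 1" using J[of "j + J" x] B2[of x] norm_triangle_sub[of "grad (ps (j + J)) x" "grad ze x"] by auto
     ultimately have "?h (ps (j + J)) x <= (B1 + 1) powr ?p + (B2 + 1) powr ?p" using p by (intro add_mono powr_mono2) auto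
     thus "norm (?h (ps (j + J)) x) <= (B1 + 1) powr ?p + (B2 + 1) powr ?p" by simp
    qed
   qed
   hence "(%j. W1_norm U ?p (ps (j + J))) \<longlonglongrightarrow> W1_norm U ?p ze"
    unfolding W1_norm_def using q by (intro tendsto_powr' tendsto_const) auto
   hence l2: "(%j. C0 * W1_norm U ?p (ps (j + J))) \<longlonglongrightarrow> C0 * W1_norm U ?p ze" by (rule tendsto_mult_left)
   have "\<bar>(LINT x|leb. F x \<bullet> grad ze x)\<bar> <= C0 * W1_norm U ?p ze"
    by (rule LIMSEQ_le[OF LIMSEQ_ignore_initial_segment[OF l1, of J] l2]) (intro exI[of _ 0] allI impI, simp only: F(2)[OF ps3] C0[OF ps3])
   also have "... <= (\<bar>C0\<bar> + 1) * W1_norm U ?p ze" by (rule mult_right_mono) (auto simp: W1_norm_def)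
   also have "... <= (\<bar>C0\<bar> + 1) * (Q * measure leb S powr (1 / 2 - 1 / q) * nrm2 leb (grad ze))"
   proof (rule mult_left_mono)
    show "W1_norm U ?p ze <= Q * measure leb S powr (1 / 2 - 1 / q) * nrm2 leb (grad ze)"
     unfolding Q_def by (rule W1_norm_le[OF U ze q S(1)]) (use S(2) in blast)
   qed simp
   finally show "\<bar>(LINT x|leb. F x \<bullet> grad ze x)\<bar> <= C * measure leb S powr (1 / 2 - 1 / q) * nrm2 leb (grad ze)"
    unfolding C_def mult.assoc .
  qed
 qed
qed

lemma sq_L2: "f \<in> L2 U \<longleftrightarrow> sq (lebesgue_on U) f"
 by (simp add: L2_def sq_def)

text \<open>Extension by 0 makes estimates on squares crossing the boundary possible. The
  approximating test functions vanish off U, so they converge on the whole plane to the extended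
  function and gradient.\<close>

lemma H1_0_extension:
 assumes U: "open U" and u: "u \<in> H1_0 U"
 obtains ph where "!!j. ph j \<in> test_functions U" "L2lim leb ph (%x. indicator U x *\<^sub>R u x)"
  "L2lim leb (%j. grad (ph j)) (%x. indicator U x *\<^sub>R wgrad U u x)" "is_weak_grad U u (wgrad U u)"
proof -
 have Um: "U \<in> sets leb" using U by simp
 obtain G' where G': "sq (lebesgue_on U) G'" "is_weak_grad U u G'" and u2: "sq (lebesgue_on U) u"
  using u by (auto simp: H1_0_def H1_def sq_L2)
 obtain ph where ph: "!!k::nat. ph k \<in> test_functions U"
  "(%k. LINT x|lebesgue_on U. (u x - ph k x)^2 + (norm (wgrad U u x - grad (ph k) x))^2) \<longlonglongrightarrow> 0"
  using u by (auto simp: H1_0_def)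
 have ae: "AE x in leb. x \<in> U --> wgrad U u x = G' x" by (rule wgrad_AE[OF U G'(2)])
 have s: "sq leb (%x. indicator U x *\<^sub>R G' x)" using G'(1) Um by (simp add: sq_lebesgue_on)
 have ae': "AE x in leb. indicator U x *\<^sub>R wgrad U u x = indicator U x *\<^sub>R G' x"
  using ae by eventually_elim (auto simp: indicator_def)
 have wm: "sq leb (%x. indicator U x *\<^sub>R wgrad U u x)"
  by (rule sq_cong_AE[OF s measurable_AE_lebesgue[OF sq_meas[OF s] ae'] ae'])
 hence w2: "sq (lebesgue_on U) (wgrad U u)" using Um by (simp add: sq_lebesgue_on)
 have us: "sq leb (%x. indicator U x *\<^sub>R u x)" using u2 Um by (simp add: sq_lebesgue_on)
 let ?I = "%k. LINT x|lebesgue_on U. (u x - ph k x)^2 + (norm (wgrad U u x - grad (ph k) x))^2"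
 have cs: "sq leb (ph k)" "sq leb (grad (ph k))" for k
  using C1c_sq[OF test_functions_C1c[OF ph(1)]] by auto
 have cU: "sq (lebesgue_on U) (ph k)" "sq (lebesgue_on U) (grad (ph k))" for k
  using sq_subset[of UNIV U "ph k"] sq_subset[of UNIV U "grad (ph k)"] cs Um by (auto simp: lebesgue_on_UNIV_eq)
 have ph0: "ph k x = 0" "grad (ph k) x = 0" if "x ~: U" for k x
 proof -
  obtain K where "K \<subseteq> U" "!!x. x ~: K ==> ph k x = 0" "!!x. x ~: K ==> grad (ph k) x = 0"
   using C1c_support[OF test_functions_C1c[OF ph(1)]] by metis
  thus "ph k x = 0" "grad (ph k) x = 0" using that by auto
 qed
 have split: "?I k = (nrm2 (lebesgue_on U) (%x. u x - ph k x))^2 + (nrm2 (lebesgue_on U) (%x. wgrad U u x - grad (ph k) x))^2" for k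
  using sq_int[OF sq_diff[OF u2 cU(1)[of k]]] sq_int[OF sq_diff[OF w2 cU(2)[of k]]] by (simp add: nrm2_square)
 have r: "(%k. sqrt (?I k)) \<longlonglongrightarrow> 0" using tendsto_real_sqrt[OF ph(2)] by simp
 have ext: "nrm2 leb (%x. f x - indicator U x *\<^sub>R g x) = nrm2 (lebesgue_on U) (%x. g x - f x)"
  if "!!x. x ~: U ==> f x = 0" for f g :: "R2 => 'b::euclidean_space"
 proof -
  have "(%x. indicator U x *\<^sub>R (g x - f x)) = (%x. - (f x - indicator U x *\<^sub>R g x))"
   using that by (auto simp: indicator_def)
  thus ?thesis unfolding nrm2_lebesgue_on[OF Um] by (simp only: nrm2_uminus)
 qed
 show ?thesis
 proof (rule that[OF ph(1)])
  show "L2lim leb ph (%x. indicator U x *\<^sub>R u x)"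
  proof (rule L2lim_squeeze[OF cs(1) us _ r])
   show "nrm2 leb (%x. ph k x - indicator U x *\<^sub>R u x) <= sqrt (?I k)" for k
    by (subst ext, erule ph0(1), unfold split, rule real_le_rsqrt, simp)
  qed
  show "L2lim leb (%j. grad (ph j)) (%x. indicator U x *\<^sub>R wgrad U u x)"
  proof (rule L2lim_squeeze[OF cs(2) wm _ r])
   show "nrm2 leb (%x. grad (ph k) x - indicator U x *\<^sub>R wgrad U u x) <= sqrt (?I k)" for k
    by (subst ext, erule ph0(2), unfold split, rule real_le_rsqrt, simp)
  qed
  show "is_weak_grad U u (wgrad U u)" by (rule wgrad_weak[OF G'(2)])
 qed
qed

text \<open>Each inner square is the outer square of the next annulus, so the energies telescope and
  their sum over N annuli is at most the total. The selected annulus may depend on G, but never lies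
  deeper than the scale R / 2^N.\<close>

lemma annuli_energy:
 assumes G: "sq leb G" and N: "N > 0" and R: "R >= 0"
 obtains l where "l < N" "real N * (nrm2 (lebesgue_on (annulus x (R * (1 / 2) ^ l))) G)^2 <= (nrm2 leb G)^2"
proof -
 let ?r = "%l. R * (1 / 2) ^ l"
 define a where "a = (%l. (nrm2 (lebesgue_on (csqr x (2 * ?r l))) G)^2)"
 have sqS: "sq (lebesgue_on S) G" if "S \<in> sets leb" for S
  using sq_subset[of UNIV S G] G that by (simp add: lebesgue_on_UNIV_eq)
 have sI: "(nrm2 (lebesgue_on S) G)^2 = (LINT x|leb. indicator S x * (norm (G x))^2)" if "S \<in> sets leb" for S
  unfolding nrm2_square using that by (subst integral_restrict_space) auto
 have I: "integrable leb (%x. indicator S x * (norm (G x))^2)" if "S \<in> sets leb" for S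
  using integrable_mult_indicator[OF that sq_int[OF G]] by simp
 have step: "(nrm2 (lebesgue_on (annulus x (?r l))) G)^2 <= a l - a (Suc l)" for l
 proof -
  have e: "csqr x (2 * ?r (Suc l)) = csqr x (?r l)" by simp
  have "(nrm2 (lebesgue_on (annulus x (?r l))) G)^2 + a (Suc l) =
    (LINT y|leb. indicator (annulus x (?r l)) y * (norm (G y))^2 + indicator (csqr x (?r l)) y * (norm (G y))^2)"
   unfolding a_def e sI[OF annulus_lebesgue] sI[OF csqr_lebesgue]
   by (rule Bochner_Integration.integral_add[symmetric]) (intro I annulus_lebesgue csqr_lebesgue)+
  also have "... <= (LINT y|leb. indicator (csqr x (2 * ?r l)) y * (norm (G y))^2)"
  proof (rule integral_mono)
   fix y
   show "indicator (annulus x (?r l)) y * (norm (G y))^2 + indicator (csqr x (?r l)) y * (norm (G y))^2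
    <= indicator (csqr x (2 * ?r l)) y * (norm (G y))^2"
    using csqr_mono[of "?r l" "2 * ?r l" x] R by (auto simp: annulus_def indicator_def)
  qed (intro I annulus_lebesgue csqr_lebesgue Bochner_Integration.integrable_add)+
  also have "... = a l" unfolding a_def by (rule sI[OF csqr_lebesgue, symmetric])
  finally show ?thesis by linarith
 qed
 have "(\<Sum>l<N. (nrm2 (lebesgue_on (annulus x (?r l))) G)^2) <= (\<Sum>l<N. a l - a (Suc l))" by (rule sum_mono) (rule step)
 also have "... = a 0 - a N" by (induction N) auto
 also have "... <= a 0" by (simp add: a_def)
 also have "... <= (nrm2 leb G)^2"
  unfolding a_def using nrm2_subset[of UNIV "csqr x (2 * ?r 0)" G] G
  by (intro power_mono) (auto simp: lebesgue_on_UNIV_eq csqr_lebesgue)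
 finally have le: "(\<Sum>l<N. (nrm2 (lebesgue_on (annulus x (?r l))) G)^2) <= (nrm2 leb G)^2" .
 note that0 = that
 show ?thesis
 proof (rule ccontr)
  assume n: "\<not> thesis"
  have "(nrm2 leb G)^2 / real N < (nrm2 (lebesgue_on (annulus x (?r l))) G)^2" if l: "l < N" for l
  proof (rule ccontr)
   assume "\<not> (nrm2 leb G)^2 / real N < (nrm2 (lebesgue_on (annulus x (?r l))) G)^2"
   hence "real N * (nrm2 (lebesgue_on (annulus x (?r l))) G)^2 <= (nrm2 leb G)^2" using N by (simp add: field_simps)
   with l have thesis by (rule that0)
   with n show False by blast
  qed
  hence "(\<Sum>l<N. (nrm2 leb G)^2 / real N) < (\<Sum>l<N. (nrm2 (lebesgue_on (annulus x (?r l))) G)^2)"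
   using N by (intro sum_strict_mono) auto
  thus False using le N by simp
 qed
qed

lemma csqr_ball:
 assumes "r > 0" obtains R where "R > 0" "csqr x R \<subseteq> ball x r"
proof (rule that[of "r / 3"])
 show "r / 3 > 0" using assms by simp
 show "csqr x (r / 3) \<subseteq> ball x r"
 proof
  fix y assume y: "y \<in> csqr x (r / 3)"
  have "norm (y - x) <= (\<Sum>i\<in>UNIV. \<bar>(y - x) $ i\<bar>)" by (rule norm_le_l1_cart)
  also have "... <= r / 3 + r / 3" unfolding sum_2 vector_minus_component
   using y by (intro add_mono) (auto simp: csqr_def)
  also have "... < r" using assms by simp
  finally show "y \<in> ball x r" by (simp add: dist_norm norm_minus_commute)
 qed
qed

section \<open>Equicontinuity of the solutions\<close>

text \<open>The upper bound B of A is existentially quantified, separately for each solution;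
  \<open>al\<close>, \<open>C\<close> and \<open>be\<close> are the uniform data. The functions u
  and G are the extensions by 0.\<close>

definition bounded_solution ::
 "R2 set => real => real => real => (R2 => real^2^2) => (nat => R2 => real) => (R2 => real) => (R2 => R2) => bool" where
 "bounded_solution U al C be A ph u G \<longleftrightarrow>
   A \<in> borel_measurable leb & (\<exists>B. AE x in leb. norm (A x) <= B) &
   (AE x in leb. \<forall>xs. al * (norm xs)^2 <= (A x *v xs) \<bullet> xs) &
   (\<forall>j. ph j \<in> C1c U) & L2lim leb ph u & L2lim leb (%j. grad (ph j)) G & (\<forall>x. x ~: U --> u x = 0 & G x = 0) &
   dual_bound U C be (%x. A x *v G x)"

context
 fixes U :: "R2 set" and al C be :: real
 assumes U: "open U" "bounded U" and pos: "al > 0" "C > 0" "be > 0"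
begin

text \<open>Stampacchia's estimate on all of U with M = 0: the compact supports of the approximants
  express the zero boundary values. Applying it to s u for s = 1 and s = -1 gives both
  signs.\<close>

lemma solution_sup_bound:
 assumes b: "bounded_solution U al C be A ph u G"
 shows "AE x in leb. \<bar>u x\<bar> <= 2 * 2 powr (1 / be) * (C / al) * measure leb U powr be" (is "AE x in _. _ <= ?M")
proof -
 have A: "A \<in> borel_measurable leb" "AE x in leb. \<forall>xs. al * (norm xs)^2 <= (A x *v xs) \<bullet> xs"
  and ph: "!!j. ph j \<in> C1c U" "L2lim leb ph u" "L2lim leb (%j. grad (ph j)) G"
  and u0: "!!x. x ~: U ==> u x = 0" "!!x. x ~: U ==> G x = 0"
  and test: "dual_bound U C be (%x. A x *v G x)"
  using b unfolding bounded_solution_def by auto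
 obtain B where B: "AE x in leb. norm (A x) <= B" using b unfolding bounded_solution_def by blast
 have Um: "U \<in> sets leb" using U(1) by simp
 have onU: "L2lim leb F f ==> L2lim (lebesgue_on U) F f" for F and f :: "R2 => 'b::euclidean_space"
  using L2lim_subset[of UNIV U F f] Um by (simp add: lebesgue_on_UNIV_eq)
 have C: "C1 (ph j)" for j using ph(1)[of j] by (simp add: C1c_def)
 have cpt: "compact {x \<in> U. s * ph j x >= k}" if "k > 0" for k j s
 proof -
  obtain K where K: "compact K" "K \<subseteq> U" "!!x. x ~: K ==> ph j x = 0" using C1c_support[OF ph(1)] by metis
  have "{x \<in> U. s * ph j x >= k} = K \<inter> {x. s * ph j x >= k}"
  using K(2,3) that by fastforce
  moreover have "closed {x. s * ph j x >= k}"
   by (intro closed_Collect_le continuous_intros C1D(3) C)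
  ultimately show ?thesis using K(1) by (simp add: compact_Int_closed)
 qed
 have up: "AE x in leb. x \<in> U --> s * u x <= 0 + ?M" if s: "\<bar>s\<bar> = 1" for s :: real
 proof (rule Stampacchia[OF U, of "%j x. s * ph j x" _ "%x. s *\<^sub>R G x" A B])
  show "C1 (%x. s * ph j x)" for j by (rule C1_cmult[OF C])
  have "(%j. s * ph j x) = (%j. s *\<^sub>R ph j x)" for x by simp
  show "L2lim (lebesgue_on U) (%j x. s * ph j x) (%x. s * u x)"
   using L2lim_bmult[OF onU[OF ph(2)], of "%_. s" "\<bar>s\<bar>"] by simp
  show "L2lim (lebesgue_on U) (%j. grad (%x. s * ph j x)) (%x. s *\<^sub>R G x)"
   using L2lim_bmult[OF onU[OF ph(3)], of "%_. s" "\<bar>s\<bar>"] by (simp add: grad_cmult[OF C])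
  show "dual_bound U C be (%x. A x *v (s *\<^sub>R G x))" by (rule dual_bound_scaleR[OF test s])
 qed (fact A B pos cpt)+
 show ?thesis
  using up[of 1, simplified] up[of "-1", simplified]
 proof eventually_elim
  case (elim x)
  have "?M >= 0" using pos by simp
  thus ?case using elim u0(1)[of x] by (cases "x \<in> U") (simp_all add: abs_le_iff)
 qed
qed

text \<open>The approximants themselves are tested, with S = U, and the limit yields the flux paired
  with G; one factor of the norm is then cancelled.\<close>

lemma solution_energy_bound:
 assumes b: "bounded_solution U al C be A ph u G"
 shows "nrm2 leb G <= C * measure leb U powr be / al"
proof -
 have A: "A \<in> borel_measurable leb" "AE x in leb. \<forall>xs. al * (norm xs)^2 <= (A x *v xs) \<bullet> xs"
  and ph: "!!j. ph j \<in> C1c U" "L2lim leb ph u" "L2lim leb (%j. grad (ph j)) G"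
  and test: "dual_bound U C be (%x. A x *v G x)"
  using b unfolding bounded_solution_def by auto
 obtain B where B: "AE x in leb. norm (A x) <= B" using b unfolding bounded_solution_def by blast
 have G: "sq leb G" using L2limD(2)[OF ph(3)] .
 have AG: "sq leb (%x. A x *v G x)" by (rule sq_matvec[OF A(1) B G])
 have Um: "U \<in> lmeasurable" using U by (rule bounded_open_lmeasurable)
 let ?N = "nrm2 leb G" and ?c = "C * measure leb U powr be"
 have "al * ?N^2 = (LINT x|leb. al * (norm (G x))^2)" by (simp add: nrm2_square)
 also have "... <= (LINT x|leb. (A x *v G x) \<bullet> G x)"
  by (rule integral_mono_AE) (use sq_int[OF G] sq_inner_integrable[OF AG G] A(2) in auto)
 also have "... <= ?c * ?N"
 proof (rule LIMSEQ_le[OF L2lim_inner[OF L2lim_const[OF AG] ph(3)] tendsto_mult_left[OF L2lim_norm[OF ph(3)]]], intro exI allI impI)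
  fix j
  obtain K where "K \<subseteq> U" "!!x. x ~: K ==> ph j x = 0" "!!x. x ~: K ==> grad (ph j) x = 0" using C1c_support[OF ph(1)] by metis
  hence "!!x. x ~: U ==> ph j x = 0 & grad (ph j) x = 0" by blast
  from dual_boundD[OF test ph(1) Um this] show "(LINT x|leb. (A x *v G x) \<bullet> grad (ph j) x) <= ?c * nrm2 leb (grad (ph j))" .
 qed
 finally have le: "al * ?N^2 <= ?c * ?N" .
 have "al * ?N <= ?c"
 proof (cases "?N = 0")
  case False
  hence "?N > 0" using nrm2_nonneg[of leb G] by linarith
  thus ?thesis using le by (simp add: power2_eq_square)
 qed (use pos in simp)
 thus ?thesis using pos(1) by (simp add: field_simps)
qed

text \<open>In the local chart a boundary point lies on or below the graph, so the ray pointing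
  straight down from it stays outside U and crosses the boundary of every small concentric
  square.\<close>

lemma boundary_ray:
 assumes L: "lipschitz_boundary U" and x0: "x0 \<in> frontier U"
 obtains R where "R > 0" "!!rh. 0 < rh ==> rh < R ==> \<exists>x\<in>csqr x0 rh - sqr x0 rh. x ~: U"
proof -
 obtain r T \<gamma> where r: "r > 0" and T: "orthogonal_transformation T"
  and ch: "!!x. x \<in> ball x0 r ==> x \<in> U \<longleftrightarrow> \<gamma> ((T :: R2 => R2) x $ 1) < T x $ 2"
  using L x0 unfolding lipschitz_boundary_def by blast
 have lin: "linear T" and bT: "bij T" using T by (auto simp: orthogonal_transformation_linear orthogonal_transformation_bij)
 define d where "d = inv T (axis 2 1)"
 have Td: "T d = axis 2 1" unfolding d_def using bT by (simp add: bij_is_surj surj_f_inv_f)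
 have nd: "norm d = 1"
 by (metis T Td norm_axis_1 orthogonal_transformation_norm)
 \<comment> \<open>The max norm of the downward direction: it converts Euclidean length t along the
   ray into the half side t mu of the square just reached.\<close>
 define mu where "mu = max \<bar>d $ 1\<bar> \<bar>d $ 2\<bar>"
 have mu: "\<bar>d $ i\<bar> <= mu" for i using exhaust_2[of i] by (auto simp: mu_def)
 have mu0: "mu > 0"
 proof (rule ccontr)
  assume "\<not> mu > 0"
  hence "d $ 1 = 0" "d $ 2 = 0" using mu[of 1] mu[of 2] by auto
  hence "d = 0" by (simp add: vec_eq_iff forall_2)
  with nd show False by simp
 qed
 have nU: "x0 ~: U" using x0 U(1) by (simp add: frontier_def interior_open)
 have \<gamma>0: "T x0 $ 2 <= \<gamma> (T x0 $ 1)" using ch[of x0] nU r by auto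
 show ?thesis
 proof (rule that[of "r * mu"])
  show "r * mu > 0" using r mu0 by simp
  fix rh :: real assume rh: "0 < rh" "rh < r * mu"
  define t where "t = rh / mu"
  have t: "0 < t" "t < r" "t * mu = rh" using rh mu0 by (auto simp: t_def field_simps)
  let ?x = "x0 - t *\<^sub>R d"
  have Tx: "T ?x = T x0 - t *\<^sub>R axis 2 1" using lin by (simp add: linear_diff linear_cmul Td)
  have "?x \<in> ball x0 r" using t nd by (simp add: dist_norm)
  moreover have "T ?x $ 1 = T x0 $ 1" "T ?x $ 2 = T x0 $ 2 - t" unfolding Tx by (auto simp: axis_def)
  ultimately have "?x ~: U" using ch[of ?x] \<gamma>0 t(1) by auto
  moreover have "?x \<in> csqr x0 rh"
   unfolding csqr_def using mu t by (auto simp: abs_mult t(3)[symmetric] intro!: mult_left_mono)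
  moreover have "?x ~: sqr x0 rh"
  proof -
   obtain i where "\<bar>d $ i\<bar> = mu" unfolding mu_def by (metis max_def)
   hence "\<bar>?x $ i - x0 $ i\<bar> = rh" using t by (simp add: abs_mult)
   thus ?thesis unfolding sqr_def by (metis (mono_tags, lifting) less_irrefl mem_Collect_eq)
  qed
  ultimately show "\<exists>x\<in>csqr x0 rh - sqr x0 rh. x ~: U" by blast
 qed
qed

text \<open>Equicontinuity at x0: the radius is found before the solution is given. Points outside
  the closure are trivial; otherwise small squares either lie in U or, by
  \<open>boundary_ray\<close>, keep meeting the complement on their boundary.\<close>

lemma solution_oscillation:
 assumes L: "lipschitz_boundary U" and et: "et > 0"
 obtains R where "R > 0"
  "!!A ph u G. bounded_solution U al C be A ph u G ==> \<exists>m. AE x in leb. x \<in> csqr x0 R --> \<bar>u x - m\<bar> <= et"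
proof (cases "x0 \<in> closure U")
 case False
 then obtain r where r: "r > 0" "ball x0 r \<subseteq> - closure U" using open_contains_ball[of "- closure U"] by auto
 obtain R where R: "R > 0" "csqr x0 R \<subseteq> ball x0 r" by (rule csqr_ball[OF r(1)])
 have "x ~: U" if "x \<in> csqr x0 R" for x using that R(2) r(2) closure_subset by blast
 hence "\<exists>m. AE x in leb. x \<in> csqr x0 R --> \<bar>u x - m\<bar> <= et" if "bounded_solution U al C be A ph u G" for A ph u G
  using that et by (intro exI[of _ 0] AE_I2) (auto simp: bounded_solution_def)
 thus ?thesis using that[OF R(1)] by blast
next
 case True
 define Q where "Q = 2 * 2 powr (1 / be) * (C / al)"
 have Q: "Q > 0" using pos by (simp add: Q_def)
 have "\<exists>R>0. csqr x0 (2 * R) \<subseteq> U \<or> (\<forall>rh. 0 < rh & rh < 2 * R --> (\<exists>x\<in>csqr x0 rh - sqr x0 rh. x ~: U))"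
 proof (cases "x0 \<in> U")
  case True
  then obtain r where r: "r > 0" "ball x0 r \<subseteq> U" using U(1) open_contains_ball by blast
  obtain R where "R > 0" "csqr x0 R \<subseteq> ball x0 r" by (rule csqr_ball[OF r(1)])
  thus ?thesis using r(2) by (intro exI[of _ "R / 2"]) auto
 next
  case False
  hence "x0 \<in> frontier U" using True U(1) by (simp add: frontier_def interior_open)
  from boundary_ray[OF L this] obtain R where "R > 0" "!!rh. 0 < rh ==> rh < R ==> \<exists>x\<in>csqr x0 rh - sqr x0 rh. x ~: U" by blast
  thus ?thesis by (intro exI[of _ "R / 2"]) auto
 qed
 then obtain R1 where R1: "R1 > 0" "csqr x0 (2 * R1) \<subseteq> U \<or> (\<forall>rh. 0 < rh & rh < 2 * R1 --> (\<exists>x\<in>csqr x0 rh - sqr x0 rh. x ~: U))" by blast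
 \<comment> \<open>Chosen so that the Stampacchia term \<open>Q * ((4 * r)^2) powr be\<close> is at
   most et / 2 for all r up to R0.\<close>
 define R0 where "R0 = min R1 ((et / (2 * Q)) powr (1 / (2 * be)) / 4)"
 have R0: "R0 > 0" "R0 <= R1" using R1(1) et Q by (auto simp: R0_def)
 have small: "Q * ((4 * r)^2) powr be <= et / 2" if r: "0 < r" "r <= R0" for r
 proof -
  let ?s = "(et / (2 * Q)) powr (1 / (2 * be))"
  have "4 * r <= ?s" using r by (simp add: R0_def)
  hence "(4 * r) powr (2 * be) <= ?s powr (2 * be)" using r pos by (intro powr_mono2) auto
  also have "... = et / (2 * Q)" using pos et Q by (simp add: powr_powr)
  also have "(4 * r) powr (2 * be) = ((4 * r)^2) powr be" using r by (simp add: powr_powr[symmetric] powr_numeral)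
  finally show ?thesis using Q by (simp add: field_simps)
 qed
 define E where "E = C * measure leb U powr be / al"
 \<comment> \<open>Enough annuli for one of them to have 16 times its energy below (et / 6)^2; the
   boundary oscillation 3 (et / 6) is then the other half of et.\<close>
 obtain N :: nat where N: "16 * E^2 / (et / 6)^2 < real N" using reals_Archimedean2 by blast
 have N0: "N > 0" using N by (rule contrapos_pp) (use et in \<open>auto simp: not_less\<close>)
 show ?thesis
 \<comment> \<open>The good annulus depends on the solution, so the smallest of the scales
   considered is taken: it lies inside the square of every one of them.\<close>
 proof (rule that[of "R0 * (1 / 2) ^ N"])
  show "R0 * (1 / 2) ^ N > 0" using R0 by simp
  fix A ph u G assume b: "bounded_solution U al C be A ph u G"
  have A: "A \<in> borel_measurable leb" "AE x in leb. \<forall>xs. al * (norm xs)^2 <= (A x *v xs) \<bullet> xs"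
   and ph: "!!j. ph j \<in> C1c U" "L2lim leb ph u" "L2lim leb (%j. grad (ph j)) G"
   and u0: "!!x. x ~: U ==> u x = 0"
   and test: "dual_bound U C be (%x. A x *v G x)"
   using b unfolding bounded_solution_def by auto
  obtain B where B: "AE x in leb. norm (A x) <= B" using b unfolding bounded_solution_def by blast
  have G: "sq leb G" using L2limD(2)[OF ph(3)] .
  obtain l where l: "l < N" "real N * (nrm2 (lebesgue_on (annulus x0 (R0 * (1 / 2) ^ l))) G)^2 <= (nrm2 leb G)^2"
   by (rule annuli_energy[OF G N0 less_imp_le[OF R0(1)]])
  define r where "r = R0 * (1 / 2) ^ l"
  have r: "0 < r" "r <= R0" using R0 by (auto simp: r_def mult_le_cancel_left1 power_le_one)
  have rN: "R0 * (1 / 2) ^ N <= r" unfolding r_def using R0 l(1) by (intro mult_left_mono power_decreasing) auto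
  have "(nrm2 leb G)^2 <= E^2" unfolding E_def by (intro power_mono solution_energy_bound[OF b]) simp
  with l(2) have "real N * (nrm2 (lebesgue_on (annulus x0 r)) G)^2 <= E^2" by (simp add: r_def)
  moreover have "16 * E^2 < (et / 6)^2 * real N" using N et by (simp add: field_simps)
  ultimately have "real N * (16 * (nrm2 (lebesgue_on (annulus x0 r)) G)^2) < real N * (et / 6)^2" by (simp add: mult.commute)
  hence small2: "16 * (nrm2 (lebesgue_on (annulus x0 r)) G)^2 < (et / 6)^2" using N0 by simp
  have alt: "csqr x0 (2 * r) \<subseteq> U \<or> (\<forall>j. ph j \<in> C1c U) & (\<forall>x. x ~: U --> u x = 0) &
    (\<forall>rh. r < rh & rh < 2 * r --> (\<exists>x\<in>csqr x0 rh - sqr x0 rh. x ~: U))"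
   using R1(2)
  proof
   assume "csqr x0 (2 * R1) \<subseteq> U"
   moreover have "csqr x0 (2 * r) \<subseteq> csqr x0 (2 * R1)" using r R0 by (intro csqr_mono) auto
   ultimately show ?thesis by blast
  next
   assume a: "\<forall>rh. 0 < rh & rh < 2 * R1 --> (\<exists>x\<in>csqr x0 rh - sqr x0 rh. x ~: U)"
   have "\<exists>x\<in>csqr x0 rh - sqr x0 rh. x ~: U" if "r < rh" "rh < 2 * r" for rh
   proof -
    have "0 < rh" "rh < 2 * R1" using that r R0 by auto
    thus ?thesis using a by blast
   qed
   thus ?thesis using ph(1) u0 by blast
  qed
  have C: "C1 (ph j)" for j using ph(1)[of j] by (simp add: C1c_def)
  have "\<exists>m. AE x in leb. x \<in> csqr x0 r --> \<bar>u x - m\<bar> <= 3 * (et / 6) + 2 * 2 powr (1 / be) * (C / al) * ((4 * r)^2) powr be"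
  proof (rule local_oscillation[OF U(1) C, where S = UNIV and A = A and G = G and B = B])
   show "L2lim (lebesgue_on UNIV) ph u" "L2lim (lebesgue_on UNIV) (%j. grad (ph j)) G" using ph by (auto simp: lebesgue_on_UNIV_eq)
  qed (use A B test pos r small2 alt et in auto)
  then obtain m where m: "AE x in leb. x \<in> csqr x0 r --> \<bar>u x - m\<bar> <= 3 * (et / 6) + Q * ((4 * r)^2) powr be"
   unfolding Q_def by blast
  have "AE x in leb. x \<in> csqr x0 (R0 * (1 / 2) ^ N) --> \<bar>u x - m\<bar> <= et"
   using m
  proof eventually_elim
   case (elim x)
   thus ?case using csqr_mono[OF rN, of x0] small[OF r] by auto
  qed
  thus "\<exists>m. AE x in leb. x \<in> csqr x0 (R0 * (1 / 2) ^ N) --> \<bar>u x - m\<bar> <= et" by blast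
 qed
qed

end

section \<open>Continuous representatives and weak-* limits\<close>

text \<open>The value at every point of the continuous representative, if there is one.\<close>

definition rep :: "(R2 => real) => R2 => real" where
 "rep u x = lim (%j. moll j u x)"

lemma moll_eventually_near:
 assumes u: "locint u" and c: "AE y in leb. y \<in> csqr a R --> \<bar>u y - m\<bar> <= et" and x: "x \<in> sqr a R"
 shows "\<exists>J. \<forall>j\<ge>J. \<bar>moll j u x - m\<bar> <= et"
proof -
 obtain e where e: "e > 0" "ball x e \<subseteq> sqr a R" using open_sqr x open_contains_ball by blast
 obtain J :: nat where J: "1 / real (J + 1) < e" using reals_Archimedean[OF e(1)] by (auto simp: inverse_eq_divide)
 have "\<bar>moll j u x - m\<bar> <= et" if j: "j >= J" for j
 proof (rule moll_near_const[OF u], use c in eventually_elim, intro impI)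
  fix y assume y: "y \<in> csqr a R --> \<bar>u y - m\<bar> <= et" "norm (x - y) < 1 / real (j + 1)"
  have "1 / real (j + 1) <= 1 / real (J + 1)" using j by (simp add: field_simps)
  hence "y \<in> ball x e" using y(2) J by (simp add: dist_norm)
  thus "\<bar>u y - m\<bar> <= et" using y(1) e(2) sqr_subset_csqr by blast
 qed
 thus ?thesis by blast
qed

lemma rep_eq_continuous:
 assumes v: "continuous_on UNIV v" shows "rep v x = v x"
proof -
 have "(%j. moll j v x) \<longlonglongrightarrow> v x"
 proof (rule LIMSEQ_I)
  fix e :: real assume e: "e > 0"
  obtain d where d: "d > 0" "!!y. dist y x < d ==> dist (v y) (v x) < e / 2"
   using v e unfolding continuous_on_iff by (metis UNIV_I half_gt_zero)
  obtain R where R: "R > 0" "csqr x R \<subseteq> ball x d" by (rule csqr_ball[OF d(1)])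
  have "AE y in leb. y \<in> csqr x R --> \<bar>v y - v x\<bar> <= e / 2"
   using R(2) d(2) by (intro AE_I2) (force simp: dist_commute dist_real_def intro: less_imp_le)
  from moll_eventually_near[OF locint_continuous[OF v] this, of x]
  obtain J where "\<forall>j\<ge>J. \<bar>moll j v x - v x\<bar> <= e / 2" using R(1) by (auto simp: sqr_def)
  thus "\<exists>J. \<forall>j\<ge>J. norm (moll j v x - v x) < e" using e by (intro exI[of _ J]) (force intro: le_less_trans)
 qed
 thus ?thesis unfolding rep_def by (rule limI)
qed

lemma rep_cong_AE:
 assumes "locint u" "locint v" "AE x in leb. u x = v x" shows "rep u = rep v"
proof -
 have "moll j u x = moll j v x" for j x
  by (rule moll_cong_AE[OF assms(1,2)]) (use assms(3) in \<open>eventually_elim, simp\<close>)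
 thus ?thesis by (simp add: rep_def fun_eq_iff)
qed

text \<open>If u oscillates by at most et on a square, the mollifications at an interior point are
  eventually within et of the same constant. They therefore form a Cauchy sequence, and the limit
  inherits every such bound at every point of the open square; continuity follows.\<close>

lemma
 assumes u: "sq leb u"
  and osc: "!!x et. et > 0 ==> \<exists>R>0. \<exists>m. AE y in leb. y \<in> csqr x R --> \<bar>u y - m\<bar> <= et"
 shows rep_near: "AE y in leb. y \<in> csqr a R --> \<bar>u y - m\<bar> <= et ==> x \<in> sqr a R ==> \<bar>rep u x - m\<bar> <= et"
  and rep_AE: "AE x in leb. rep u x = u x" and continuous_rep: "continuous_on UNIV (rep u)"
proof -
 have l: "locint u" by (rule locint_sq[OF u])
 have mid: "x \<in> sqr x R" if "R > 0" for x R using that by (simp add: sqr_def)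
 have lim: "(%j. moll j u x) \<longlonglongrightarrow> rep u x" for x
 proof -
  have "Cauchy (%j. moll j u x)"
  proof (rule metric_CauchyI)
   fix e :: real assume e: "e > 0"
   obtain R m where R: "R > 0" "AE y in leb. y \<in> csqr x R --> \<bar>u y - m\<bar> <= e / 3" using osc[of "e / 3" x] e by auto
   from moll_eventually_near[OF l R(2) mid[OF R(1)]] obtain J where J: "!!j. j >= J ==> \<bar>moll j u x - m\<bar> <= e / 3" by blast
   have "dist (moll j u x) (moll k u x) < e" if "j >= J" "k >= J" for j k
    unfolding dist_real_def using J[OF that(1)] J[OF that(2)] e by linarith
   thus "\<exists>J. \<forall>j\<ge>J. \<forall>k\<ge>J. dist (moll j u x) (moll k u x) < e" by blast
  qed
  thus ?thesis unfolding rep_def by (simp add: Cauchy_convergent_iff convergent_LIMSEQ_iff)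
 qed
 show near: "\<bar>rep u x - m\<bar> <= et" if c: "AE y in leb. y \<in> csqr a R --> \<bar>u y - m\<bar> <= et" "x \<in> sqr a R" for a R m et x
 proof -
  obtain J where "\<forall>j\<ge>J. \<bar>moll j u x - m\<bar> <= et" using moll_eventually_near[OF l c] by blast
  thus ?thesis
   by (intro LIMSEQ_le_const2[OF tendsto_rabs[OF tendsto_diff[OF lim tendsto_const]]]) blast
 qed
 obtain r where r: "strict_mono (r :: nat => nat)" "AE x in leb. (%n. moll (r n) u x) \<longlonglongrightarrow> u x"
  using L2lim_AE_subseq[OF L2lim_moll[OF u]] by blast
 show "AE x in leb. rep u x = u x"
  using r(2)
 proof eventually_elim
  case (elim x)
  have "(%n. moll (r n) u x) \<longlonglongrightarrow> rep u x" using LIMSEQ_subseq_LIMSEQ[OF lim r(1)] by (simp add: o_def)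
  thus ?case using elim by (rule LIMSEQ_unique)
 qed
 show "continuous_on UNIV (rep u)"
  unfolding continuous_on_iff
 proof (intro ballI allI impI)
  fix x :: R2 and e :: real assume e: "e > 0"
  obtain R m where R: "R > 0" "AE y in leb. y \<in> csqr x R --> \<bar>u y - m\<bar> <= e / 3" using osc[of "e / 3" x] e by auto
  obtain d where d: "d > 0" "ball x d \<subseteq> sqr x R" using open_sqr mid[OF R(1)] open_contains_ball by blast
  have "dist (rep u y) (rep u x) < e" if "dist y x < d" for y
  proof -
   have "y \<in> sqr x R" using that d(2) by (auto simp: dist_commute)
   from near[OF R(2) this] near[OF R(2) mid[OF R(1)]] show ?thesis unfolding dist_real_def using e by linarith
  qed
  thus "\<exists>d>0. \<forall>y\<in>UNIV. dist y x < d --> dist (rep u y) (rep u x) < e" using d(1) by blast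
 qed
qed

text \<open>Uniform convergence off null sets: the solutions and correctors are given only up to
  such sets, while the limits are functions continuous on the plane.\<close>

definition unif_AE :: "(nat => R2 => real) => (R2 => real) => bool" where
 "unif_AE h' h \<longleftrightarrow> (\<forall>e>0. eventually (%n. AE x in leb. \<bar>h' n x - h x\<bar> <= e) sequentially)"

lemma unif_AED: "unif_AE h' h ==> e > 0 ==> eventually (%n. AE x in leb. \<bar>h' n x - h x\<bar> <= e) sequentially"
 by (simp add: unif_AE_def)

lemma unif_AE_diff:
 assumes "unif_AE h' h" "unif_AE g' g"
 shows "unif_AE (%n x. h' n x - g' n x) (%x. h x - g x)"
 unfolding unif_AE_def
proof (intro allI impI)
 fix e :: real assume "e > 0"
 hence "e / 2 > 0" by simp
 from unif_AED[OF assms(1) this] unif_AED[OF assms(2) this] show "eventually (%n. AE x in leb. \<bar>h' n x - g' n x - (h x - g x)\<bar> <= e) sequentially"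
 proof eventually_elim
  case (elim n)
  thus ?case by eventually_elim linarith
 qed
qed

lemma unif_AE_mult:
 assumes "unif_AE h' h" "unif_AE g' g" and B: "!!x. \<bar>h x\<bar> <= B" "!!x. \<bar>g x\<bar> <= B"
 shows "unif_AE (%n x. h' n x * g' n x) (%x. h x * g x)"
 unfolding unif_AE_def
proof (intro allI impI)
 fix e :: real assume e: "e > 0"
 have B0: "B >= 0" using B(1)[of 0] by linarith
 define t where "t = min 1 (e / (1 + 2 * B))"
 have t: "t > 0" "t <= 1" "t * (1 + 2 * B) <= e"
 proof -
  show "t > 0" "t <= 1" using e B0 by (auto simp: t_def)
  have "t * (1 + 2 * B) <= e / (1 + 2 * B) * (1 + 2 * B)" by (rule mult_right_mono) (use B0 in \<open>auto simp: t_def\<close>)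
  thus "t * (1 + 2 * B) <= e" using B0 by simp
 qed
 from t(1) assms(1,2) have "eventually (%n. AE x in leb. \<bar>h' n x - h x\<bar> <= t) sequentially"
  "eventually (%n. AE x in leb. \<bar>g' n x - g x\<bar> <= t) sequentially" by (auto simp: unif_AE_def)
 thus "eventually (%n. AE x in leb. \<bar>h' n x * g' n x - h x * g x\<bar> <= e) sequentially"
 proof eventually_elim
  case (elim n)
  thus ?case
  proof eventually_elim
   case (elim x)
   let ?a = "h' n x - h x" and ?b = "g' n x - g x"
   have "h' n x * g' n x - h x * g x = ?a * ?b + h x * ?b + g x * ?a" by (simp add: algebra_simps)
   hence "\<bar>h' n x * g' n x - h x * g x\<bar> <= \<bar>?a\<bar> * \<bar>?b\<bar> + \<bar>h x\<bar> * \<bar>?b\<bar> + \<bar>g x\<bar> * \<bar>?a\<bar>"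
    unfolding abs_mult[symmetric] by linarith
   also have "... <= t * 1 + B * t + B * t"
    using elim B[of x] t B0 by (intro add_mono mult_mono) auto
   also have "... <= e" using t(3) by (simp add: algebra_simps)
   finally show ?case .
  qed
 qed
qed

lemma unif_AE_const: "unif_AE (%n. h) h"
 by (simp add: unif_AE_def)

lemma unif_AE_indicator:
 assumes "unif_AE h' h" "!!x. x ~: S ==> h x = 0"
 shows "unif_AE (%n x. indicator S x * h' n x) h"
 unfolding unif_AE_def
proof (intro allI impI)
 fix e :: real assume e: "e > 0"
 with assms(1) have "eventually (%n. AE x in leb. \<bar>h' n x - h x\<bar> <= e) sequentially" by (auto simp: unif_AE_def)
 thus "eventually (%n. AE x in leb. \<bar>indicator S x * h' n x - h x\<bar> <= e) sequentially"
 proof eventually_elim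
  case (elim n)
  thus ?case by eventually_elim (use assms(2) e in \<open>auto simp: indicator_def\<close>)
 qed
qed

lemma unif_AE_compose:
 fixes w :: "nat => 2 => R2 => real"
 assumes w: "!!i. unif_AE (%n. w n i) (%x. x $ i)" and f: "uniformly_continuous_on UNIV f"
 shows "unif_AE (%n x. f (\<chi> i. w n i x)) f"
 unfolding unif_AE_def
proof (intro allI impI)
 fix e :: real assume e: "e > 0"
 obtain d where d: "d > 0" "!!x y. dist x y < d ==> dist (f x) (f y) < e"
  using f e unfolding uniformly_continuous_on_def by (metis UNIV_I)
 have "eventually (%n. AE x in leb. \<bar>w n i x - x $ i\<bar> <= d / 3) sequentially" for i
  by (rule unif_AED[OF w]) (use d(1) in simp)
 from this[of 1] this[of 2]
 show "eventually (%n. AE x in leb. \<bar>f (\<chi> i. w n i x) - f x\<bar> <= e) sequentially"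
 proof eventually_elim
  case (elim n)
  thus ?case
  proof eventually_elim
   case (elim x)
   have "norm ((\<chi> i. w n i x) - x) <= (\<Sum>i\<in>UNIV. \<bar>((\<chi> i. w n i x) - x) $ i\<bar>)" by (rule norm_le_l1_cart)
   also have "... <= d / 3 + d / 3" unfolding sum_2 using elim by (intro add_mono) auto
   also have "... < d" using d(1) by simp
   finally have "dist (\<chi> i. w n i x) x < d" by (simp add: dist_norm)
   thus ?case using d(2) by (force simp: dist_real_def intro: less_imp_le)
  qed
 qed
qed

lemma locint_measurable:
 assumes "locint f" shows "f \<in> borel_measurable leb"
proof (rule measurable_from_cballs)
 fix R
 have "integrable (lebesgue_on (cball 0 R)) f" using assms by (simp add: locint_def)
 hence "integrable leb (%x. indicator (cball 0 R) x *\<^sub>R f x)" by (simp add: integrable_restrict_space)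
 thus "(%x. indicator (cball 0 R) x *\<^sub>R f x) \<in> borel_measurable leb" by auto
qed

text \<open>The rescaled periodic densities converge weakly-* as measures, tested here even with
  weights that vary with n, provided they converge uniformly to a continuous one. Uniformity is
  indispensable as the densities are bounded in L1 only.\<close>

lemma weak_star_limit:
 fixes g h' :: "nat => R2 => real"
 assumes g: "!!n. Y_periodic (g n)" "!!n. locint (g n)" "!!n. (LINT y|lebesgue_on Y. \<bar>g n y\<bar>) <= K"
  and m: "(%n. LINT y|lebesgue_on Y. g n y) \<longlonglongrightarrow> m"
  and ep: "!!n. ep n > 0" "ep \<longlonglongrightarrow> 0" and R: "R > 0"
  and h: "continuous_on UNIV h" "!!x. R < norm x ==> h x = 0"
  and h': "!!n. h' n \<in> borel_measurable leb" "unif_AE h' h" "!!n x. R < norm x ==> h' n x = 0"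
 shows "(%n. LINT x|leb. h' n x * g n (x /\<^sub>R ep n)) \<longlonglongrightarrow> m * (LINT x|leb. h x)"
proof -
 let ?I = "%n. LINT x|leb. h' n x * g n (x /\<^sub>R ep n)" and ?m = "%n. LINT y|lebesgue_on Y. g n y" and ?h = "LINT x|leb. h x"
 have K0: "K >= 0"
 proof -
  have "(LINT y|lebesgue_on Y. \<bar>g 0 y\<bar>) >= 0" by simp
  thus ?thesis using g(3)[of 0] by linarith
 qed
 have h0: "!!x. x ~: cball 0 R ==> h x = 0" using h(2) by simp
 have uc: "uniformly_continuous_on UNIV h" by (rule uniformly_continuous_compact_support[OF h(1) h0 compact_cball])
 have "\<exists>B. \<forall>x. norm (h x) <= B"
  by (rule bounded_compact_support[of h "cball 0 R", OF h(1) _ compact_cball]) (use h0 in auto)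
 then obtain B where B: "!!x. norm (h x) <= B" by blast
 define c where "c = 2 * K * (2 * R + 7)^2"
 have c: "c >= 0" using K0 by (simp add: c_def)
 have est: "eventually (%n. \<bar>?I n - ?m n * ?h\<bar> <= c * (2 * e)) sequentially" if e: "e > 0" for e
 proof -
  obtain d where d: "d > 0" "!!x y. dist x y < d ==> dist (h x) (h y) < e"
   using uc e unfolding uniformly_continuous_on_def by (metis UNIV_I)
  have "eventually (%n. ep n < min 1 (d / 3)) sequentially" by (rule order_tendstoD(2)[OF ep(2)]) (use d in auto)
  moreover have "eventually (%n. AE x in leb. \<bar>h' n x - h x\<bar> <= e) sequentially"
   using h'(2) e by (simp add: unif_AE_def)
  ultimately show ?thesis
  proof eventually_elim
   case (elim n)
   \<comment> \<open>The averaging estimate asks for closeness at every point, so the weight is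
     corrected on the null set where it fails; the integral is unaffected.\<close>
   define k where "k = (%x. if \<bar>h' n x - h x\<bar> <= e then h' n x else h x)"
   have kae: "AE x in leb. k x = h' n x" using elim(2) by eventually_elim (simp add: k_def)
   have km: "k \<in> borel_measurable leb" by (rule measurable_AE_lebesgue[OF h'(1) kae])
   have kh: "\<bar>k x - h x\<bar> <= e" for x using e by (simp add: k_def)
   have "\<bar>(LINT x|leb. k x * g n (x /\<^sub>R ep n)) - ?m n * ?h\<bar> <= 2 * K * (2 * e) * (2 * R + 7)^2"
   proof (rule periodic_average(2)[OF g(1,2,3) ep(1) _ R h km])
    show "ep n <= 1" using elim by simp
    show "\<bar>k x\<bar> <= B + e" for x using kh[of x] B[of x] by simp
    show "k x = 0" if "R < norm x" for x using h(2)[OF that] h'(3)[OF that] by (simp add: k_def)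
    fix x y :: R2 assume "norm (x - y) <= 2 * ep n"
    hence "dist x y < d" using elim ep(1)[of n] by (simp add: dist_norm)
    hence "\<bar>h x - h y\<bar> < e" using d(2) by (simp add: dist_real_def)
    thus "\<bar>k x - h y\<bar> <= 2 * e & \<bar>h x - h y\<bar> <= 2 * e" using kh[of x] elim e by linarith
   qed
   moreover have "(LINT x|leb. k x * g n (x /\<^sub>R ep n)) = ?I n"
   proof (rule integral_cong_AE)
    have "(%x. g n (x /\<^sub>R ep n)) \<in> borel_measurable leb"
    proof -
     have "g n \<in> borel_measurable leb" by (rule locint_measurable[OF g(2)])
     thus ?thesis using measurable_scale_shift[of "1 / ep n" "g n" 0] ep(1)[of n] by (simp add: divide_inverse)
    qed
    thus "(%x. k x * g n (x /\<^sub>R ep n)) \<in> borel_measurable leb" "(%x. h' n x * g n (x /\<^sub>R ep n)) \<in> borel_measurable leb"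
     using km h'(1) by auto
    show "AE x in leb. k x * g n (x /\<^sub>R ep n) = h' n x * g n (x /\<^sub>R ep n)" using kae by eventually_elim simp
   qed
   ultimately show ?case by (simp add: c_def mult_ac)
  qed
 qed
 have "(%n. ?I n - ?m n * ?h) \<longlonglongrightarrow> 0"
 proof (rule LIMSEQ_I)
  fix e :: real assume e: "e > 0"
  have "e / (4 * (c + 1)) > 0" using e c by simp
  from est[OF this] obtain N where N: "!!n. n >= N ==> \<bar>?I n - ?m n * ?h\<bar> <= c * (2 * (e / (4 * (c + 1))))"
   unfolding eventually_sequentially by blast
  have "c * (2 * (e / (4 * (c + 1)))) < e" using e c by (simp add: field_simps add_pos_nonneg)
  thus "\<exists>N. \<forall>n\<ge>N. norm (?I n - ?m n * ?h - 0) < e" using N by (intro exI[of _ N]) (auto intro: le_less_trans)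
 qed
 from tendsto_add[OF this tendsto_mult_right[OF m, of ?h]] show ?thesis by simp
qed

text \<open>Applied with a the derivatives of Ph at the corrector map, b those of Ph at x, and h
  those of the limit u: the first difference is uniformly small, the second small in L2.\<close>

lemma corrector_split:
 fixes P :: "2 => R2"
 assumes "!!i. \<bar>a i - b i\<bar> <= et"
 shows "norm (g - (\<Sum>i\<in>UNIV. h i *\<^sub>R P i)) \<le>
  norm (g - (\<Sum>i\<in>UNIV. a i *\<^sub>R P i)) + (\<Sum>i\<in>UNIV. et * norm (P i) + \<bar>b i - h i\<bar> * norm (P i))"
proof -
 have d: "(\<Sum>i\<in>UNIV. a i *\<^sub>R P i) - (\<Sum>i\<in>UNIV. h i *\<^sub>R P i) = (\<Sum>i\<in>UNIV. (a i - b i) *\<^sub>R P i + (b i - h i) *\<^sub>R P i)"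
  unfolding sum_subtractf[symmetric] by (rule sum.cong) (simp_all add: scaleR_diff_left)
 have "norm (g - (\<Sum>i\<in>UNIV. h i *\<^sub>R P i)) \<le>
   norm (g - (\<Sum>i\<in>UNIV. a i *\<^sub>R P i)) + norm (\<Sum>i\<in>UNIV. (a i - b i) *\<^sub>R P i + (b i - h i) *\<^sub>R P i)"
  unfolding d[symmetric]
  using norm_triangle_ineq[of "g - (\<Sum>i\<in>UNIV. a i *\<^sub>R P i)" "(\<Sum>i\<in>UNIV. a i *\<^sub>R P i) - (\<Sum>i\<in>UNIV. h i *\<^sub>R P i)"] by simp
 moreover have "norm (\<Sum>i\<in>UNIV. (a i - b i) *\<^sub>R P i + (b i - h i) *\<^sub>R P i) <= (\<Sum>i\<in>UNIV. et * norm (P i) + \<bar>b i - h i\<bar> * norm (P i))"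
 proof (rule sum_norm_le)
  fix i :: 2
  have "norm ((a i - b i) *\<^sub>R P i + (b i - h i) *\<^sub>R P i) <= \<bar>a i - b i\<bar> * norm (P i) + \<bar>b i - h i\<bar> * norm (P i)"
   using norm_triangle_ineq[of "(a i - b i) *\<^sub>R P i" "(b i - h i) *\<^sub>R P i"] by simp
  also have "... <= et * norm (P i) + \<bar>b i - h i\<bar> * norm (P i)" using assms[of i] by (intro add_right_mono mult_right_mono) auto
  finally show "norm ((a i - b i) *\<^sub>R P i + (b i - h i) *\<^sub>R P i) <= et * norm (P i) + \<bar>b i - h i\<bar> * norm (P i)" .
 qed
 ultimately show ?thesis by linarith
qed

section \<open>Convergence of the correctors\<close>

text \<open>The homogenization setting reduced to what the limit argument uses. All hypotheses are
  inherited by subsequences, which is how compactness is exploited.\<close>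

locale correctors =
 fixes Om :: "R2 set" and al C be R K ka :: real and A :: "nat => R2 => real^2^2" and ep :: "nat => real"
  and ph :: "nat => nat => R2 => real" and u :: "nat => R2 => real" and G :: "nat => R2 => R2"
  and P :: "nat => 2 => R2 => R2" and w :: "nat => 2 => R2 => real" and si :: "real^2^2"
  and u0 :: "R2 => real" and H :: "R2 => R2" and ph0 :: "nat => R2 => real"
 assumes Om: "open Om" "bounded Om" "lipschitz_boundary Om" "Om \<subseteq> cball 0 R" and R: "R > 0"
  and pos: "al > 0" "C > 0" "be > 0" and ep: "!!n. ep n > 0" "ep \<longlonglongrightarrow> 0"
  and sol: "!!n. bounded_solution Om al C be (%x. A n (x /\<^sub>R ep n)) (ph n) (u n) (G n)"
  and fields: "!!n. corrector_gradients (A n) (ep n) ka K (w n) (P n)"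
  and mean: "!!i l. (%n. LINT y|lebesgue_on Y. energy_density (A n) (P n) i l y) \<longlonglongrightarrow> si $ l $ i + si $ i $ l"
  and limit: "!!j. ph0 j \<in> test_functions Om" "L2lim leb ph0 u0" "L2lim leb (%j. grad (ph0 j)) H"
  and u0_off: "!!x. x ~: Om ==> u0 x = 0"
  and eq: "!!n ze. ze \<in> C1c Om ==>
   (LINT x|leb. (A n (x /\<^sub>R ep n) *v G n x) \<bullet> grad ze x) = (LINT x|leb. (si *v H x) \<bullet> grad ze x)"
begin

lemma w: "w n i \<in> L2_loc UNIV" "(%x. P n i (x /\<^sub>R ep n)) \<in> L2_loc UNIV" "is_weak_grad UNIV (w n i) (%x. P n i (x /\<^sub>R ep n))"
 and w_near: "AE x in leb. \<bar>w n i x - x $ i\<bar> <= ep n * ka"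
 and cell: "ze \<in> C1c UNIV ==> (LINT x|leb. (A n (x /\<^sub>R ep n) *v P n i (x /\<^sub>R ep n)) \<bullet> grad ze x) = 0"
 and energy: "Y_periodic (%y. (norm (P n i y))^2)" "locint (%y. (norm (P n i y))^2)" "(LINT y|lebesgue_on Y. (norm (P n i y))^2) <= K"
 and density: "Y_periodic (energy_density (A n) (P n) i l)" "locint (energy_density (A n) (P n) i l)"
  "(LINT y|lebesgue_on Y. \<bar>energy_density (A n) (P n) i l y\<bar>) <= K"
 using fields[of n] unfolding corrector_gradients_def by blast+

lemma u_sq: "sq leb (u n)" and G_sq: "sq leb (G n)" and u_off: "x ~: Om ==> u n x = 0" and G_off: "x ~: Om ==> G n x = 0"
 using sol[of n] by (auto simp: bounded_solution_def L2lim_def)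

definition "bu = 2 * 2 powr (1 / be) * (C / al) * measure leb Om powr be"

lemma u_bound: "AE x in leb. \<bar>u n x\<bar> <= bu"
 unfolding bu_def by (rule solution_sup_bound[OF Om(1,2) pos sol])

text \<open>The radius precedes the quantifier over n: this is equicontinuity of the whole sequence,
  up to null sets.\<close>

lemma oscillation: "et > 0 ==> \<exists>r>0. \<forall>n. \<exists>m. AE y in leb. y \<in> csqr x r --> \<bar>u n y - m\<bar> <= et"
 by (rule solution_oscillation[OF Om(1,2) pos Om(3), of et x]) (use sol in blast)+

lemma oscillation': "et > 0 ==> \<exists>r>0. \<exists>m. AE y in leb. y \<in> csqr x r --> \<bar>u n y - m\<bar> <= et"
 using oscillation by blast

lemma u_near: "AE y in leb. y \<in> csqr a r --> \<bar>u n y - m\<bar> <= et ==> x \<in> sqr a r ==> \<bar>rep (u n) x - m\<bar> <= et"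
 by (rule rep_near[OF u_sq]) (rule oscillation')

lemma u_rep_AE: "AE x in leb. rep (u n) x = u n x"
 by (rule rep_AE[OF u_sq]) (rule oscillation')

lemma u_rep_continuous: "continuous_on UNIV (rep (u n))"
 by (rule continuous_rep[OF u_sq]) (rule oscillation')

lemma rep_bound: "\<bar>rep (u n) x\<bar> <= bu"
proof -
 have "AE y in leb. y \<in> csqr x 1 --> \<bar>u n y - 0\<bar> <= bu" using u_bound[of n] by eventually_elim simp
 from u_near[OF this, of x] show ?thesis by (simp add: sqr_def)
qed

lemma rep_off:
 assumes "x ~: cball 0 R" shows "rep (u n) x = 0"
proof -
 obtain d where d: "d > 0" "ball x d \<subseteq> - cball 0 R"   proof (rule openE[of "- cball (0::R2) R" x])
  show "open (- cball (0::R2) R)" by (simp add: open_Compl)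
 qed (use assms in auto)
 obtain r where r: "r > 0" "csqr x r \<subseteq> ball x d" by (rule csqr_ball[OF d(1)])
 have "u n y = 0" if "y \<in> csqr x r" for y using that r(2) d(2) Om(4) u_off by blast
 hence "AE y in leb. y \<in> csqr x r --> \<bar>u n y - 0\<bar> <= 0" by (intro AE_I2) simp
 from u_near[OF this, of x] show ?thesis using r(1) by (simp add: sqr_def)
qed

text \<open>Arzela-Ascoli for the continuous representatives, which share the bound
  \<open>bu\<close> and, by \<open>oscillation\<close>, a modulus of continuity at each
  point.\<close>

lemma subsequence_uniform:
 obtains k v where "strict_mono (k :: nat => nat)" "uniform_limit UNIV (%n. rep (u (k n))) v sequentially"
proof -
 have ec: "\<exists>d. 0 < d & (\<forall>n y. y \<in> cball 0 R & norm (x - y) < d --> norm (rep (u n) x - rep (u n) y) < e)" if e: "e > 0" for x e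
 proof -
  obtain r where r: "r > 0" "!!n. \<exists>m. AE y in leb. y \<in> csqr x r --> \<bar>u n y - m\<bar> <= e / 3"
   using oscillation[of "e / 3" x] e by auto
  have xr: "x \<in> sqr x r" using r(1) by (simp add: sqr_def)
  obtain d where d: "d > 0" "ball x d \<subseteq> sqr x r" using open_sqr xr open_contains_ball by blast
  have "norm (rep (u n) x - rep (u n) y) < e" if "norm (x - y) < d" for n y
  proof -
   obtain m where m: "AE y in leb. y \<in> csqr x r --> \<bar>u n y - m\<bar> <= e / 3" using r(2) by blast
   have "y \<in> sqr x r" using that d(2) by (auto simp: dist_norm)
   from u_near[OF m this] u_near[OF m xr] show ?thesis unfolding real_norm_def using e by linarith
  qed
  thus ?thesis using d(1) by blast
 qed
 obtain v0 k where k: "strict_mono (k :: nat => nat)"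
  "!!e. 0 < e ==> \<exists>N. \<forall>n x. n >= N & x \<in> cball 0 R --> norm (rep (u (k n)) x - v0 x) < e"
  by (rule Arzela_Ascoli[of "cball 0 R" "%n. rep (u n)" bu]) (use rep_bound ec in auto)
 show ?thesis
 proof (rule that[OF k(1)])
  \<comment> \<open>Off the ball all representatives vanish, so the limit is extended by 0 and the
    convergence is uniform on the plane.\<close>
  show "uniform_limit UNIV (%n. rep (u (k n))) (%x. if x \<in> cball 0 R then v0 x else 0) sequentially"
   unfolding uniform_limit_sequentially_iff
  proof (intro allI impI)
   fix e :: real assume "e > 0"
   from k(2)[OF this] obtain N where "\<forall>n x. n >= N & x \<in> cball 0 R --> norm (rep (u (k n)) x - v0 x) < e" by blast
   thus "\<exists>N. \<forall>n\<ge>N. \<forall>x\<in>UNIV. dist (rep (u (k n)) x) (if x \<in> cball 0 R then v0 x else 0) < e"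
    using \<open>e > 0\<close> rep_off by (intro exI[of _ N]) (auto simp: dist_norm)
  qed
 qed
qed

abbreviation "M \<equiv> lebesgue_on (cball (0::R2) R)"

lemma onM: "sq leb f ==> sq M f" "sq leb f ==> nrm2 M f <= nrm2 leb f"
 using sq_subset[of UNIV "cball 0 R" f] nrm2_subset[of UNIV "cball 0 R" f] by (auto simp: lebesgue_on_UNIV_eq)

lemma P_sq: "sq M (%x. P n i (x /\<^sub>R ep n))"
 using w(2) by (simp add: L2_loc_iff)

lemma corrector_integrable: "integrable M (%x. G n x - (\<Sum>i\<in>UNIV. H x $ i *\<^sub>R P n i (x /\<^sub>R ep n)))"
proof (intro Bochner_Integration.integrable_diff Bochner_Integration.integrable_sum)
 have H2: "sq M H" using onM(1)[OF L2limD(2)[OF limit(3)]] .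
 have fin: "emeasure M (space M) < \<infinity>" by (rule emeasure_compact_lebesgue_on) simp
 show "integrable M (G n)" by (rule sq_imp_integrable_finite[OF onM(1)[OF G_sq] fin])
 show "integrable M (%x. H x $ i *\<^sub>R P n i (x /\<^sub>R ep n))" for i
  by (rule Bochner_Integration.integrable_bound[OF sq_norm_mult_integrable[OF sq_component[OF H2, of i] P_sq[of n i]]])
    (use sq_meas[OF sq_component[OF H2, of i]] sq_meas[OF P_sq[of n i]] in auto)
qed

lemma correctors_subseq:
 assumes r: "strict_mono (r :: nat => nat)"
 shows "correctors Om al C be R K ka (%n. A (r n)) (%n. ep (r n)) (%n. ph (r n)) (%n. u (r n)) (%n. G (r n)) (%n. P (r n)) (%n. w (r n)) si u0 H ph0"
proof
 show "(%n. ep (r n)) \<longlonglongrightarrow> 0" using LIMSEQ_subseq_LIMSEQ[OF ep(2) r] by (simp add: o_def)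
 show "(%n. LINT y|lebesgue_on Y. energy_density (A (r n)) (P (r n)) i l y) \<longlonglongrightarrow> si $ l $ i + si $ i $ l" for i l
  using LIMSEQ_subseq_LIMSEQ[OF mean r] by (simp add: o_def)
qed (fact Om R pos ep sol fields limit u0_off eq)+

end

text \<open>A uniform limit v is assumed but not yet known to be the homogenized solution; the
  identification is part of what follows.\<close>

locale correctors_limit = correctors +
 fixes v :: "R2 => real"
 assumes v: "uniform_limit UNIV (%n. rep (u n)) v sequentially"
begin

lemma v_cont: "continuous_on UNIV v"
 by (rule uniform_limit_theorem[OF _ v]) (simp_all add: u_rep_continuous)

lemma v_off: "x ~: cball 0 R ==> v x = 0"
proof -
 assume x: "x ~: cball 0 R"
 have "(%n. rep (u n) x) \<longlonglongrightarrow> v x" by (rule tendsto_uniform_limitI[OF v]) simp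
 thus ?thesis by (simp add: rep_off[OF x] LIMSEQ_const_iff)
qed

lemma v_bounded: "\<exists>B. \<forall>x. \<bar>v x\<bar> <= B"
proof -
 have "\<exists>B. \<forall>x. norm (v x) <= B"
  by (rule bounded_compact_support[of v "cball 0 R", OF v_cont _ compact_cball]) (use v_off in auto)
 thus ?thesis by simp
qed

lemma unif_u: "unif_AE u v"
 unfolding unif_AE_def
proof (intro allI impI)
 fix e :: real assume e: "e > 0"
 have "eventually (%n. \<forall>x. dist (rep (u n) x) (v x) < e) sequentially"
  using uniform_limitD[OF v e] by simp
 thus "eventually (%n. AE x in leb. \<bar>u n x - v x\<bar> <= e) sequentially"
 proof eventually_elim
  case (elim n)
  show ?case using u_rep_AE[of n]
  proof eventually_elim
   case (elim x)
   thus ?case using \<open>\<forall>x. dist (rep (u n) x) (v x) < e\<close> by (metis dist_real_def less_imp_le)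
  qed
 qed
qed

lemma unif_w: "unif_AE (%n. w n i) (%x. x $ i)"
 unfolding unif_AE_def
proof (intro allI impI)
 fix e :: real assume e: "e > 0"
 have "(%n. ep n * ka) \<longlonglongrightarrow> 0" using tendsto_mult_left_zero[OF ep(2)] .
 hence "eventually (%n. ep n * ka < e) sequentially" using e by (rule order_tendstoD(2))
 thus "eventually (%n. AE x in leb. \<bar>w n i x - x $ i\<bar> <= e) sequentially"
 proof eventually_elim
  case (elim n)
  show ?case using w_near[of n i] by eventually_elim (use elim in linarith)
 qed
qed

definition wv :: "nat => R2 => R2" where "wv n x = (\<chi> i. w n i x)"

definition Z :: "(R2 => real) => nat => R2 => R2" where
 "Z Ph n x = G n x - (\<Sum>i\<in>UNIV. grad Ph (wv n x) $ i *\<^sub>R P n i (x /\<^sub>R ep n))"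

definition z :: "(R2 => real) => nat => R2 => real" where
 "z Ph n x = u n x - Ph (wv n x)"

lemma test_facts:
 assumes "Ph \<in> test_functions Om"
 shows "uniformly_continuous_on UNIV Ph" "\<exists>B. \<forall>x. \<bar>Ph x\<bar> <= B" "continuous_on UNIV Ph" "x ~: cball 0 R ==> Ph x = 0"
proof -
 obtain K where K: "compact K" "K \<subseteq> Om" "!!x. x ~: K ==> Ph x = 0" using test_functionsE[OF assms] by metis
 show c: "continuous_on UNIV Ph" using C1D(3)[OF test_functions_C1[OF assms]] .
 show "uniformly_continuous_on UNIV Ph" by (rule uniformly_continuous_compact_support[OF c K(3) K(1)])
 have "\<exists>B. \<forall>x. norm (Ph x) <= B"
  by (rule bounded_compact_support[of Ph K, OF c _ K(1)]) (use K(3) in auto)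
 thus "\<exists>B. \<forall>x. \<bar>Ph x\<bar> <= B" by simp
 show "x ~: cball 0 R ==> Ph x = 0" using K Om(4) by blast
qed

lemma unif_test: "Ph \<in> test_functions Om ==> unif_AE (%n x. Ph (wv n x)) Ph"
 unfolding wv_def by (rule unif_AE_compose[OF unif_w test_facts(1)])

lemma unif_z: "Ph \<in> test_functions Om ==> unif_AE (z Ph) (%x. v x - Ph x)"
 unfolding z_def by (rule unif_AE_diff[OF unif_u unif_test])

lemma wv_meas: "wv n \<in> borel_measurable leb"
proof -
 have "w n i \<in> borel_measurable leb" for i by (rule L2_loc_measurable[OF w(1)])
 hence "(%x. \<Sum>i\<in>UNIV. w n i x *\<^sub>R (axis i 1 :: R2)) \<in> borel_measurable leb"
  by (intro borel_measurable_sum borel_measurable_scaleR) auto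
 moreover have "(%x. \<Sum>i\<in>UNIV. w n i x *\<^sub>R (axis i 1 :: R2)) = wv n"
  using basis_expansion[of "wv n _"] by (auto simp: wv_def scalar_mult_eq_scaleR)
 ultimately show ?thesis by simp
qed

lemma comp_meas: "continuous_on UNIV f ==> (%x. f (wv n x) :: real) \<in> borel_measurable leb"
 by (rule measurable_compose[OF wv_meas borel_measurable_continuous_onI])

lemma z_meas: "Ph \<in> test_functions Om ==> z Ph n \<in> borel_measurable leb"
 unfolding z_def using comp_meas[OF test_facts(3)] sq_meas[OF u_sq[of n]] by auto

text \<open>The weight is a product of two uniformly convergent factors. Since D composed with the
  correctors need not vanish off the ball, the indicator is kept in the weight; it disappears in the
  limit because D is supported in the ball.\<close>

lemma error_tendsto:
 assumes Ph: "Ph \<in> test_functions Om" and D: "D \<in> test_functions Om"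
  and g: "!!n. Y_periodic (g n)" "!!n. locint (g n)" "!!n. (LINT y|lebesgue_on Y. \<bar>g n y\<bar>) <= k"
  "(%n. LINT y|lebesgue_on Y. g n y) \<longlonglongrightarrow> m"
  and D': "!!n. D' n \<in> borel_measurable leb" "unif_AE D' D"
 shows "(%n. LINT x|M. z Ph n x * D' n x * g n (x /\<^sub>R ep n)) \<longlonglongrightarrow> m * (LINT x|leb. (v x - Ph x) * D x)"
proof -
 obtain B1 where B1: "!!x. \<bar>v x\<bar> <= B1" using v_bounded by blast
 obtain B2 where B2: "!!x. \<bar>Ph x\<bar> <= B2" using test_facts(2)[OF Ph] by blast
 obtain B3 where B3: "!!x. \<bar>D x\<bar> <= B3" using test_facts(2)[OF D] by blast
 have B: "\<bar>v x - Ph x\<bar> <= B1 + B2 + B3" "\<bar>D x\<bar> <= B1 + B2 + B3" for x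
  using B1[of x] B2[of x] B3[of x] abs_ge_zero[of "v x"] abs_ge_zero[of "Ph x"] abs_ge_zero[of "D x"] by linarith+
 have "(%n. LINT x|leb. indicator (cball 0 R) x * (z Ph n x * D' n x) * g n (x /\<^sub>R ep n)) \<longlonglongrightarrow> m * (LINT x|leb. (v x - Ph x) * D x)"
 proof (rule weak_star_limit[OF g ep R])
  show "continuous_on UNIV (%x. (v x - Ph x) * D x)"
   by (intro continuous_intros v_cont test_facts(3) Ph D)
  show "(v x - Ph x) * D x = 0" if "R < norm x" for x using test_facts(4)[OF D, of x] that by simp
  show "(%x. indicator (cball 0 R) x * (z Ph n x * D' n x)) \<in> borel_measurable leb" for n
   by (intro borel_measurable_times borel_measurable_indicator z_meas[OF Ph] D'(1)) auto
  show "unif_AE (%n x. indicator (cball 0 R) x * (z Ph n x * D' n x)) (%x. (v x - Ph x) * D x)"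
   by (rule unif_AE_indicator[OF unif_AE_mult[OF unif_z[OF Ph] D'(2) B]]) (simp add: test_facts(4)[OF D])
 qed simp
 moreover have "(LINT x|M. z Ph n x * D' n x * g n (x /\<^sub>R ep n)) = (LINT x|leb. indicator (cball 0 R) x * (z Ph n x * D' n x) * g n (x /\<^sub>R ep n))" for n
  by (subst Bochner_Integration.integral_restrict_space) (auto simp: mult.assoc)
 ultimately show ?thesis by simp
qed

lemma AE_M: "AE x in leb. Q x ==> AE x in M. Q x"
 by (rule AE_lebesgue_on_I) (auto elim: eventually_mono)

lemma sq_const_M: "sq M (%x. c :: real)"
 by (rule sq_continuous_compact) auto

lemma quadratic_bound:
 fixes t :: real
 assumes "a * t^2 <= b * t + e" "a > 0" "b >= 0" "t >= 0"
 shows "t <= b / a + sqrt (\<bar>e\<bar> / a)"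
proof (rule ccontr)
 let ?s = "sqrt (\<bar>e\<bar> / a)"
 assume "\<not> t <= b / a + ?s"
 hence t: "b / a + ?s < t" by simp
 have s: "?s >= 0" "a * ?s^2 = \<bar>e\<bar>" using assms(2) by auto
 have b: "b / a >= 0" using assms by simp
 have "?s * (a * ?s) < t * (a * t - b)"
 proof (rule mult_strict_mono')
  show "?s < t" using t b by linarith
  have "a * (b / a + ?s) < a * t" using t assms(2) by (rule mult_strict_left_mono)
  thus "a * ?s < a * t - b" using assms(2) by (simp add: distrib_left)
 qed (use s assms(2) in auto)
 thus False using assms(1) s(2) abs_ge_self[of e] by (simp add: power2_eq_square algebra_simps)
qed

text \<open>In the error of \<open>corrector_estimate\<close> the oscillating terms tend to the mean
  of the density times the integral of (v - Ph) against the second derivative, and the terms with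
  \<open>si\<close> tend to the same value, since the limiting means are the symmetrised entries of
  \<open>si\<close>.\<close>

lemma Z_estimate:
 assumes Ph: "Ph \<in> test_functions Om"
 obtains err where "err \<longlonglongrightarrow> 0"
  "eventually (%n. sq M (z Ph n) & sq M (Z Ph n) & nrm2 M (z Ph n) <= sqrt (measure leb Om) * nrm2 M (Z Ph n) &
   al * (nrm2 M (Z Ph n))^2 <= norm si * nrm2 leb (%x. H x - grad Ph x) * nrm2 M (Z Ph n) + err n) sequentially"
proof -
 obtain K0 where K0: "compact K0" "K0 \<subseteq> Om" "!!x. x ~: K0 ==> Ph x = 0" using test_functionsE[OF Ph] by metis
 obtain d K1 where K1: "d > 0" "compact K1" "K1 \<subseteq> Om" "K0 \<subseteq> K1" "!!x y. x ~: K1 ==> norm (y - x) <= d ==> y ~: K0"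
  using compact_neighbourhood[OF K0(1,2) Om(1)] by blast
 have PhU: "Ph \<in> test_functions UNIV" using Ph by (auto simp: test_functions_def)
 define D where "D = (%i l x. grad (%x. grad Ph x $ i) x $ l)"
 have D: "D i l \<in> test_functions Om" for i l
  unfolding D_def by (intro test_functions_grad Ph)
 define s where "s = (%n. energy_density (A n) (P n))"
 define X where "X = (%n i l. LINT x|M. z Ph n x * D i l (wv n x) * s n i l (x /\<^sub>R ep n))"
 define X' where "X' = (%n i l. LINT x|M. z Ph n x * D i l x)"
 define c where "c = (%i l. si $ l $ i + si $ i $ l)"
 define err where "err = (%n. (\<Sum>i\<in>UNIV. \<Sum>l\<in>UNIV. X n i l - c i l * X' n i l) / 2)"
 let ?V = "%i l. LINT x|leb. (v x - Ph x) * D i l x"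
 have "(%n. X n i l) \<longlonglongrightarrow> c i l * ?V i l" for i l
  unfolding X_def c_def
  by (rule error_tendsto[OF Ph D]) (use density mean in \<open>simp_all add: s_def comp_meas test_facts(3)[OF D] unif_test[OF D]\<close>)
 \<comment> \<open>The same lemma with the constant density 1, whose mean is 1.\<close>
 moreover have "(%n. X' n i l) \<longlonglongrightarrow> 1 * ?V i l" for i l
 proof -

  have "(%n. LINT x|M. z Ph n x * D i l x * (%y. 1) (x /\<^sub>R ep n)) \<longlonglongrightarrow> 1 * ?V i l"
  proof (rule error_tendsto[OF Ph D, where k = 1])
   show "Y_periodic (%y. 1 :: real)" by (simp add: Y_periodic_def)
   show "locint (%y. 1)" by (rule locint_const)
   show "(LINT y|lebesgue_on Y. \<bar>1::real\<bar>) <= 1" "(%n. LINT y|lebesgue_on Y. 1) \<longlonglongrightarrow> (1 :: real)" using measure_on_Y by simp_all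
   show "D i l \<in> borel_measurable leb" by (rule continuous_lebesgue_measurable[OF test_facts(3)[OF D]])
  qed (rule unif_AE_const)
  thus ?thesis by (simp add: X'_def)
 qed
 ultimately have "err \<longlonglongrightarrow> (\<Sum>i\<in>UNIV. \<Sum>l\<in>UNIV. c i l * ?V i l - c i l * (1 * ?V i l)) / 2"
  unfolding err_def by (intro tendsto_divide tendsto_sum tendsto_diff tendsto_mult tendsto_const) auto
 hence err: "err \<longlonglongrightarrow> 0" by simp
 have H2: "sq leb H" using L2limD(2)[OF limit(3)] .
 have g2: "sq leb (grad Ph)" by (rule C1c_sq(2)[OF test_functions_C1c[OF Ph]])
 have "(%n. ep n * ka) \<longlonglongrightarrow> 0" using tendsto_mult_left_zero[OF ep(2)] .
 \<comment> \<open>The two coordinate displacements then add up to less than d, so Ph at the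
   displaced point vanishes off the neighbourhood K1 of its support.\<close>
 hence "eventually (%n. ep n * ka < d / 3) sequentially" by (rule order_tendstoD(2)) (use K1(1) in simp)
 hence "eventually (%n. sq M (z Ph n) & sq M (Z Ph n) & nrm2 M (z Ph n) <= sqrt (measure leb Om) * nrm2 M (Z Ph n) &
   al * (nrm2 M (Z Ph n))^2 <= norm si * nrm2 leb (%x. H x - grad Ph x) * nrm2 M (Z Ph n) + err n) sequentially"
 proof eventually_elim
  case (elim n)
  have b: "(%x. A n (x /\<^sub>R ep n)) \<in> borel_measurable leb" "AE x in leb. \<forall>xs. al * (norm xs)^2 <= (A n (x /\<^sub>R ep n) *v xs) \<bullet> xs"
   "!!j. ph n j \<in> C1c Om" "L2lim leb (ph n) (u n)" "L2lim leb (%j. grad (ph n j)) (G n)"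
   using sol[of n] by (auto simp: bounded_solution_def)
  obtain B where B: "AE x in leb. norm (A n (x /\<^sub>R ep n)) <= B" using sol[of n] unfolding bounded_solution_def by blast
  have bu0: "bu >= 0" using pos by (simp add: bu_def)
  have near: "Ph y = 0" if x: "x ~: K1" and y: "!!i. \<bar>y $ i - x $ i\<bar> <= ep n * ka" for x y
  proof -
   have "norm (y - x) <= (\<Sum>i\<in>UNIV. \<bar>(y - x) $ i\<bar>)" by (rule norm_le_l1_cart)
   also have "... <= ep n * ka + ep n * ka" unfolding sum_2 vector_minus_component by (intro add_mono y)
   also have "... <= d" using elim K1(1) by linarith
   finally show ?thesis using K1(5)[OF x] K0(3) by blast
  qed
  note ce = corrector_estimate[OF Om(1,4) b(3,4,5) bu0 u_bound b(1) B b(2) pos(1) w(3,1,2) w_near cell PhU K1(2,3) near H2 eq,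
   folded wv_def, folded z_def Z_def D_def]
  have Z2: "sq M (Z Ph n)" using ce(2) by (simp add: Z_def[abs_def] wv_def)
  have z2: "sq M (z Ph n)" using ce(1) by (simp add: z_def[abs_def] wv_def)
  have "al * (nrm2 M (Z Ph n))^2 <= (LINT x|M. (si *v (H x - grad Ph x)) \<bullet> Z Ph n x) + err n"
   using ce(4) by (simp add: Z_def[abs_def] z_def[abs_def] wv_def err_def X_def X'_def c_def D_def s_def energy_density_def)
  moreover have "(LINT x|M. (si *v (H x - grad Ph x)) \<bullet> Z Ph n x) <= norm si * nrm2 leb (%x. H x - grad Ph x) * nrm2 M (Z Ph n)"
  proof -
   have h: "sq M (%x. H x - grad Ph x)" "nrm2 M (%x. H x - grad Ph x) <= nrm2 leb (%x. H x - grad Ph x)"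
    using onM sq_diff[OF H2 g2] by auto
   have sh: "sq M (%x. si *v (H x - grad Ph x))" by (rule sq_matvec[of "%_. si" M "norm si", OF _ _ h(1)]) auto
   have "(LINT x|M. (si *v (H x - grad Ph x)) \<bullet> Z Ph n x) <= nrm2 M (%x. si *v (H x - grad Ph x)) * nrm2 M (Z Ph n)"
    using inner_nrm2_bound[OF sh Z2] by linarith
   also have "... <= (norm si * nrm2 M (%x. H x - grad Ph x)) * nrm2 M (Z Ph n)"
    by (rule mult_right_mono[OF nrm2_matvec[of "%_. si" M "norm si", OF _ _ h(1)]]) auto
   also have "... <= norm si * nrm2 leb (%x. H x - grad Ph x) * nrm2 M (Z Ph n)"
    using h(2) by (intro mult_right_mono mult_left_mono) auto
   finally show ?thesis .
  qed
  moreover have "nrm2 M (z Ph n) <= sqrt (measure leb Om) * nrm2 M (Z Ph n)"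
   using ce(3) by (simp add: Z_def[abs_def] z_def[abs_def] wv_def)
  ultimately show ?case using Z2 z2 by linarith
 qed
 with err show ?thesis by (rule that)
qed

text \<open>The norm of Z occurs on both sides; solving the quadratic inequality leaves the distance
  of the gradients and a square root of the vanishing error.\<close>

lemma Z_limsup:
 assumes Ph: "Ph \<in> test_functions Om" and et: "et > 0"
 shows "eventually (%n. sq M (z Ph n) & sq M (Z Ph n) & nrm2 M (z Ph n) <= sqrt (measure leb Om) * nrm2 M (Z Ph n) &
   nrm2 M (Z Ph n) <= norm si / al * nrm2 leb (%x. H x - grad Ph x) + et) sequentially"
proof -
 obtain err where err: "err \<longlonglongrightarrow> 0"
  and ev: "eventually (%n. sq M (z Ph n) & sq M (Z Ph n) & nrm2 M (z Ph n) <= sqrt (measure leb Om) * nrm2 M (Z Ph n) &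
   al * (nrm2 M (Z Ph n))^2 <= norm si * nrm2 leb (%x. H x - grad Ph x) * nrm2 M (Z Ph n) + err n) sequentially"
  by (rule Z_estimate[OF Ph])
 have "(%n. sqrt (\<bar>err n\<bar> / al)) \<longlonglongrightarrow> sqrt (\<bar>0\<bar> / al)"
  by (rule tendsto_real_sqrt[OF tendsto_divide[OF tendsto_rabs[OF err] tendsto_const]]) (use pos in simp)
 hence "eventually (%n. sqrt (\<bar>err n\<bar> / al) < et) sequentially" using et by (intro order_tendstoD(2)) auto
 with ev show ?thesis
 proof eventually_elim
  case (elim n)
  have "nrm2 M (Z Ph n) <= norm si * nrm2 leb (%x. H x - grad Ph x) / al + sqrt (\<bar>err n\<bar> / al)"
   by (rule quadratic_bound) (use elim(1) pos in auto)
  thus ?case using elim by simp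
 qed
qed

text \<open>z is uniformly close to v - Ph on the ball, so the Poincare bound on z by Z passes to
  the limit.\<close>

lemma v_close:
 assumes Ph: "Ph \<in> test_functions Om"
 shows "nrm2 M (%x. v x - Ph x) <= sqrt (measure leb Om) * (norm si / al * nrm2 leb (%x. H x - grad Ph x))"
  (is "?l <= ?m * ?h")
proof (rule field_le_epsilon)
 fix e :: real assume e: "e > 0"
 define c1 where "c1 = nrm2 M (%x. 1 :: real)"
 have c1: "c1 >= 0" by (simp add: c1_def)
 define et where "et = e / (?m + c1 + 1)"
 have et: "et > 0" "?m * et + c1 * et <= e"
 proof -
  show "et > 0" using e c1 by (simp add: et_def add_nonneg_pos)
  hence "(?m + c1) * et <= (?m + c1 + 1) * et" by (intro mult_right_mono) auto
  also have "... = e" using c1 by (simp add: et_def add_nonneg_pos less_imp_neq[symmetric])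
  finally show "?m * et + c1 * et <= e" by (simp add: distrib_right)
 qed
 have "eventually (%n. ?l <= ?m * ?h + e) sequentially"
  using Z_limsup[OF Ph et(1)] unif_AED[OF unif_z[OF Ph] et(1)]
 proof eventually_elim
  case (elim n)
  have vs: "sq M (%x. v x - Ph x)"
   by (rule sq_continuous_compact) (intro continuous_intros v_cont test_facts(3)[OF Ph], simp)
  have z: "sq M (z Ph n)" using elim(1) by blast
  have "nrm2 M (%x. (v x - Ph x) - z Ph n x) <= et * c1"
   unfolding c1_def
  proof (rule nrm2_dominated[OF sq_const_M])
   show "(%x. v x - Ph x - z Ph n x) \<in> borel_measurable M" by (rule sq_meas[OF sq_diff[OF vs z]])
   show "AE x in M. norm (v x - Ph x - z Ph n x) <= et * norm (1::real)"
    by (rule AE_M, use elim(2) in eventually_elim) (simp add: abs_minus_commute)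
  qed (use et in simp)
  with nrm2_triangle_diff[OF vs z] have "?l <= nrm2 M (z Ph n) + et * c1" by linarith
  also have "nrm2 M (z Ph n) <= ?m * (?h + et)"
   by (rule order_trans[OF _ mult_left_mono]) (use elim(1) in auto)
  finally show ?case using et(2) by (simp add: algebra_simps)
 qed
 thus "?l <= ?m * ?h + e" by (simp add: eventually_sequentially) blast
qed

lemma limit_gradient: "(%j. nrm2 leb (%x. H x - grad (ph0 j) x)) \<longlonglongrightarrow> 0"
 using L2limD(3)[OF limit(3)] by (subst nrm2_commute)

text \<open>Take Ph along the approximants of u0: by \<open>v_close\<close> they converge to v in L2
  as well, since their gradients converge to that of u0.\<close>

lemma v_eq_u0: "AE x in leb. v x = u0 x"
proof -
 have u2: "sq leb u0" using L2limD(2)[OF limit(2)] .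
 have p2: "sq leb (ph0 j)" for j using L2limD(1)[OF limit(2)] .
 have vs: "sq M v" by (rule sq_continuous_compact[OF v_cont]) simp
 have "nrm2 M (%x. v x - u0 x) <= 0"
 proof (rule LIMSEQ_le_const)
  show "(%j. sqrt (measure leb Om) * (norm si / al * nrm2 leb (%x. H x - grad (ph0 j) x)) + nrm2 leb (%x. ph0 j x - u0 x)) \<longlonglongrightarrow> 0"
   by (rule tendsto_eq_rhs[OF tendsto_add[OF tendsto_mult_right_zero[OF tendsto_mult_right_zero[OF limit_gradient]] L2limD(3)[OF limit(2)]]]) simp
  have "nrm2 M (%x. v x - u0 x) <= sqrt (measure leb Om) * (norm si / al * nrm2 leb (%x. H x - grad (ph0 j) x)) + nrm2 leb (%x. ph0 j x - u0 x)" for j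
  proof -
   have d: "sq M (%x. v x - ph0 j x)" "sq M (%x. ph0 j x - u0 x)"         using sq_diff[OF vs onM(1)[OF p2[of j]]] sq_diff[OF onM(1)[OF p2[of j]] onM(1)[OF u2]] .
   have "nrm2 M (%x. v x - u0 x) <= nrm2 M (%x. v x - ph0 j x) + nrm2 M (%x. ph0 j x - u0 x)"
    using nrm2_triangle[OF d] by simp
   thus ?thesis using v_close[OF limit(1), of j] onM(2)[OF sq_diff[OF p2[of j] u2]] by linarith
  qed
  thus "\<exists>N. \<forall>j\<ge>N. nrm2 M (%x. v x - u0 x) <= sqrt (measure leb Om) * (norm si / al * nrm2 leb (%x. H x - grad (ph0 j) x)) + nrm2 leb (%x. ph0 j x - u0 x)" by blast
 qed
 hence "nrm2 M (%x. v x - u0 x) = 0" using nrm2_nonneg[of M] by (simp add: order_antisym)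
 hence "AE x in M. v x - u0 x = 0" using nrm2_zero_iff[OF sq_diff[OF vs onM(1)[OF u2]]] by simp
 hence "AE x in leb. x \<in> cball 0 R --> v x - u0 x = 0" by (simp add: AE_restrict_space_iff)
 thus ?thesis
 proof eventually_elim
  case (elim x)
  show ?case
  using Om(4) elim u0_off v_off by fastforce
 qed
qed

text \<open>Periodicity turns the energy on one cell into a bound on the ball, uniform in n, through
  the averaging estimate for the squared gradients.\<close>

lemma P_bound: "\<exists>E\<ge>0. eventually (%n. \<forall>i. nrm2 M (%x. P n i (x /\<^sub>R ep n)) <= E) sequentially"
proof -
 define h where "h = (%x :: R2. max 0 (min 1 (R + 1 - norm x)))"
 have h: "continuous_on UNIV h" unfolding h_def by (intro continuous_intros)
 have hb: "0 <= h x" "h x <= 1" "R + 1 < norm x ==> h x = 0" "norm x <= R ==> h x = 1" for x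
  by (auto simp: h_def)
 define E where "E = K * \<bar>(LINT x|leb. h x)\<bar> + 2 * K * 1 * (2 * (R + 1) + 7)^2"
 have K0: "K >= 0"
  by (rule order_trans[OF _ energy(3)[of 0 1]]) simp
 have "eventually (%n. ep n < 1) sequentially" by (rule order_tendstoD(2)[OF ep(2)]) simp
 hence "eventually (%n. \<forall>i. nrm2 M (%x. P n i (x /\<^sub>R ep n)) <= sqrt E) sequentially"
 proof (eventually_elim, intro allI)
  fix n i assume n: "ep n < 1"
  let ?g = "%y. (norm (P n i y))^2"
  \<comment> \<open>A crude use of the estimate: the cut-off has values in [0, 1], so oscillation 1
    is allowed and only boundedness of the integral is obtained.\<close>
  note pa = periodic_average[OF energy(1,2)[of n i] _ ep(1)[of n] _ _ h _ continuous_lebesgue_measurable[OF h], of K "R + 1" 1 1]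
  have b: "\<bar>h x - h y\<bar> <= 1 & \<bar>h x - h y\<bar> <= 1" for x y using hb(1,2)[of x] hb(1,2)[of y] by auto
  have I: "integrable leb (%x. h x * ?g (x /\<^sub>R ep n))"
   by (rule pa(1)) (use n R hb b energy(3) in auto)
  have "\<bar>(LINT x|leb. h x * ?g (x /\<^sub>R ep n)) - (LINT y|lebesgue_on Y. ?g y) * (LINT x|leb. h x)\<bar> <= 2 * K * 1 * (2 * (R + 1) + 7)^2"
   by (rule pa(2)) (use n R hb b energy(3) in auto)
  moreover have "(LINT y|lebesgue_on Y. ?g y) * (LINT x|leb. h x) <= K * \<bar>(LINT x|leb. h x)\<bar>"
   by (rule order_trans[OF mult_left_mono[OF abs_ge_self] mult_right_mono[OF energy(3)]]) auto
  ultimately have le: "(LINT x|leb. h x * ?g (x /\<^sub>R ep n)) <= E" unfolding E_def by linarith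
  have "(nrm2 M (%x. P n i (x /\<^sub>R ep n)))^2 = (LINT x|leb. indicator (cball 0 R) x * ?g (x /\<^sub>R ep n))"
   unfolding nrm2_square by (subst integral_restrict_space) auto
  also have "... <= (LINT x|leb. h x * ?g (x /\<^sub>R ep n))"
  proof (rule integral_mono[OF _ I])
   show "integrable leb (%x. indicator (cball 0 R) x * ?g (x /\<^sub>R ep n))"
    using sq_int[OF P_sq[of n i]] by (simp add: integrable_restrict_space)
   show "indicator (cball 0 R) x * ?g (x /\<^sub>R ep n) <= h x * ?g (x /\<^sub>R ep n)" for x
    by (rule mult_right_mono) (use hb(1,4)[of x] in \<open>auto simp: indicator_def\<close>)
  qed
  finally have "(nrm2 M (%x. P n i (x /\<^sub>R ep n)))^2 <= E" using le by simp
  thus "nrm2 M (%x. P n i (x /\<^sub>R ep n)) <= sqrt E" by (rule real_le_rsqrt)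
 qed
 moreover have "sqrt E >= 0" using K0 by (simp add: E_def)
 ultimately show ?thesis by blast
qed

text \<open>Choose Ph close to the limit first and only then n large. Z is small in L2; exchanging
  the derivatives of Ph for those of u costs their L2 distance times the L2 norm of the corrector
  gradients.\<close>

lemma corrector_L1:
 "(%n. LINT x|M. norm (G n x - (\<Sum>i\<in>UNIV. H x $ i *\<^sub>R P n i (x /\<^sub>R ep n)))) \<longlonglongrightarrow> 0"
proof (rule LIMSEQ_I)
 fix e :: real assume e: "e > 0"
 let ?P = "%n i x. P n i (x /\<^sub>R ep n)"
 obtain E where E: "E >= 0" "eventually (%n. \<forall>i. nrm2 M (?P n i) <= E) sequentially" using P_bound by blast
 define c1 where "c1 = nrm2 M (%x. 1 :: real)"
 have c1: "c1 >= 0" by (simp add: c1_def)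
 define c where "c = norm si / al"
 have c: "c >= 0" using pos by (simp add: c_def)
 have l1: "integrable M (%x. norm (f x))" "(LINT x|M. norm (f x)) <= nrm2 M f * c1" if "sq M f" for f :: "R2 => R2"
  using sq_norm_mult_integrable[OF that sq_const_M[of 1]] Cauchy_Schwarz_nrm2[OF that sq_const_M[of 1]] by (simp_all add: c1_def)
 \<comment> \<open>Here c1 is the price for passing from L2 to L1 on the ball, and 2 E accounts for
   the two corrector gradients.\<close>
 have "(%j. (c1 * c + 2 * E) * nrm2 leb (%x. H x - grad (ph0 j) x)) \<longlonglongrightarrow> 0"
  by (rule tendsto_mult_right_zero[OF limit_gradient])
 hence "eventually (%j. (c1 * c + 2 * E) * nrm2 leb (%x. H x - grad (ph0 j) x) < e / 2) sequentially"
  using e by (intro order_tendstoD(2)) auto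
 then obtain j where j: "(c1 * c + 2 * E) * nrm2 leb (%x. H x - grad (ph0 j) x) < e / 2" by (auto simp: eventually_sequentially)
 define Ph where "Ph = ph0 j"
 define h where "h = nrm2 leb (%x. H x - grad Ph x)"
 have Ph: "Ph \<in> test_functions Om" by (simp add: Ph_def limit(1))
 have H2: "sq leb H" using L2limD(2)[OF limit(3)] .
 have g2: "sq leb (grad Ph)" by (rule C1c_sq(2)[OF test_functions_C1c[OF Ph]])
 \<comment> \<open>Collects the factors of et: one from Z and one for each of the two uniform errors
   of the derivatives; the added 1 keeps it positive.\<close>
 define s where "s = c1 + 2 * (E * c1) + 1"
 define et where "et = e / (2 * s)"
 have den: "s > 0" using c1 E(1) by (simp add: s_def add_nonneg_pos)
 have et: "et > 0" using e den by (simp add: et_def)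
 have "(c1 + 2 * (E * c1)) * et <= s * et" using et by (intro mult_right_mono) (auto simp: s_def)
 also have "... = e / 2" using den by (simp add: et_def)
 finally have et2: "(c1 + 2 * (E * c1)) * et <= e / 2" .
 have gu: "unif_AE (%n x. grad Ph (wv n x) $ i) (%x. grad Ph x $ i)" for i
  by (rule unif_test[OF test_functions_grad[OF Ph]])
 have "eventually (%n. norm ((LINT x|M. norm (G n x - (\<Sum>i\<in>UNIV. H x $ i *\<^sub>R ?P n i x))) - 0) < e) sequentially"
  using Z_limsup[OF Ph et] E(2) unif_AED[OF gu[of 1] et] unif_AED[OF gu[of 2] et]
 proof eventually_elim
  case (elim n)
  have Z: "sq M (Z Ph n)" "nrm2 M (Z Ph n) <= c * h + et" using elim(1) by (auto simp: c_def h_def)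
  have d: "AE x in M. \<bar>grad Ph (wv n x) $ i - grad Ph x $ i\<bar> <= et" for i
   using AE_M[OF elim(3)] AE_M[OF elim(4)] exhaust_2[of i] by auto
  have hi: "sq M (%x. (grad Ph x - H x) $ i)" "nrm2 M (%x. (grad Ph x - H x) $ i) <= h" for i
  proof -
   have s: "sq leb (%x. grad Ph x - H x)" by (rule sq_diff[OF g2 H2])
   show "sq M (%x. (grad Ph x - H x) $ i)" by (rule sq_component[OF onM(1)[OF s]])
   hence "nrm2 M (%x. (grad Ph x - H x) $ i) <= 1 * nrm2 M (%x. grad Ph x - H x)"
    by (intro nrm2_dominated[OF onM(1)[OF s]] sq_meas) (auto simp: component_le_norm_cart simp del: vector_minus_component)
   also have "... <= h" using onM(2)[OF s] by (simp add: h_def nrm2_commute[of leb H])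
   finally show "nrm2 M (%x. (grad Ph x - H x) $ i) <= h" .
  qed
  let ?F = "%x. norm (Z Ph n x) + (\<Sum>i\<in>UNIV. et * norm (?P n i x) + norm ((grad Ph x - H x) $ i) * norm (?P n i x))"
  have FI: "integrable M (%x. et * norm (?P n i x) + norm ((grad Ph x - H x) $ i) * norm (?P n i x))" for i
   using l1(1)[OF P_sq[of n i]] sq_norm_mult_integrable[OF hi(1)[of i] P_sq[of n i]]
   by (intro Bochner_Integration.integrable_add integrable_mult_right) auto
  have "(LINT x|M. norm (G n x - (\<Sum>i\<in>UNIV. H x $ i *\<^sub>R ?P n i x))) <= (LINT x|M. ?F x)"
  proof (rule integral_mono_AE)
   have s: "sq M (%x. Z Ph n x)" using Z(1) .
   show "integrable M ?F"
    by (rule Bochner_Integration.integrable_add[OF l1(1)[OF Z(1)] Bochner_Integration.integrable_sum]) (rule FI)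
   show "integrable M (%x. norm (G n x - (\<Sum>i\<in>UNIV. H x $ i *\<^sub>R ?P n i x)))"
    by (rule integrable_norm[OF corrector_integrable])
   show "AE x in M. norm (G n x - (\<Sum>i\<in>UNIV. H x $ i *\<^sub>R ?P n i x)) <= ?F x"
    using d[of 1] d[of 2]
   proof eventually_elim
    case (elim x)
    have di: "\<bar>grad Ph (wv n x) $ i - grad Ph x $ i\<bar> <= et" for i using elim exhaust_2[of i] by auto
    show ?case using corrector_split[of "%i. grad Ph (wv n x) $ i" "%i. grad Ph x $ i" et "G n x" "%i. H x $ i" "%i. ?P n i x", OF di]
     by (simp only: Z_def vector_minus_component real_norm_def)
   qed
  qed
  also have "... = (LINT x|M. norm (Z Ph n x)) + (\<Sum>i\<in>UNIV. LINT x|M. et * norm (?P n i x) + norm ((grad Ph x - H x) $ i) * norm (?P n i x))"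
   using l1(1)[OF Z(1)] FI by (simp add: Bochner_Integration.integral_sum)
  also have "... <= (c * h + et) * c1 + (\<Sum>i\<in>(UNIV::2 set). et * (E * c1) + h * E)"
  proof (intro add_mono sum_mono)
   show "(LINT x|M. norm (Z Ph n x)) <= (c * h + et) * c1"
    by (rule order_trans[OF l1(2)[OF Z(1)] mult_right_mono[OF Z(2) c1]])
   fix i :: 2
   have Pi: "nrm2 M (?P n i) <= E" using elim(2) by blast
   have "(LINT x|M. et * norm (?P n i x) + norm ((grad Ph x - H x) $ i) * norm (?P n i x))
     = et * (LINT x|M. norm (?P n i x)) + (LINT x|M. norm ((grad Ph x - H x) $ i) * norm (?P n i x))"
    using l1(1)[OF P_sq[of n i]] sq_norm_mult_integrable[OF hi(1)[of i] P_sq[of n i]] by simp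
   also have "... <= et * (E * c1) + h * E"
   proof (rule add_mono)
    show "et * (LINT x|M. norm (?P n i x)) <= et * (E * c1)"
     using et by (intro mult_left_mono order_trans[OF l1(2)[OF P_sq] mult_right_mono[OF Pi c1]]) auto
    have "(LINT x|M. norm ((grad Ph x - H x) $ i) * norm (?P n i x)) <= nrm2 M (%x. (grad Ph x - H x) $ i) * nrm2 M (?P n i)"
     by (rule Cauchy_Schwarz_nrm2[OF hi(1) P_sq])
    also have "... <= h * E" using hi(2)[of i] Pi by (intro mult_mono) (auto simp: h_def)
    finally show "(LINT x|M. norm ((grad Ph x - H x) $ i) * norm (?P n i x)) <= h * E" .
   qed
   finally show "(LINT x|M. et * norm (?P n i x) + norm ((grad Ph x - H x) $ i) * norm (?P n i x)) <= et * (E * c1) + h * E" .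
  qed
  also have "... = (c1 * c + 2 * E) * h + (c1 + 2 * (E * c1)) * et" by (simp add: algebra_simps)
  also have "... < e" using j et2 by (simp add: h_def Ph_def)
  finally show ?case by simp
 qed
 thus "\<exists>N. \<forall>n\<ge>N. norm ((LINT x|M. norm (G n x - (\<Sum>i\<in>UNIV. H x $ i *\<^sub>R ?P n i x))) - 0) < e"
  by (simp add: eventually_sequentially)
qed

lemma rep_u0: "rep u0 = v"
proof -
 have "rep u0 = rep v"
  by (rule rep_cong_AE[OF locint_sq[OF L2limD(2)[OF limit(2)]] locint_continuous[OF v_cont]])
    (use v_eq_u0 in eventually_elim, simp)
 thus ?thesis by (simp add: rep_eq_continuous[OF v_cont] fun_eq_iff)
qed

end

text \<open>Every subsequence has a further subsequence along which both conclusions hold, and its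
  limit \<open>rep u0\<close> does not depend on the choice; a failure for the full sequence would
  persist along some subsequence.\<close>

lemma (in correctors) convergence:
 "uniform_limit UNIV (%n. rep (u n)) (rep u0) sequentially & continuous_on UNIV (rep u0) & (AE x in leb. rep u0 x = u0 x) &
  (%n. LINT x|lebesgue_on (cball 0 R). norm (G n x - (\<Sum>i\<in>UNIV. H x $ i *\<^sub>R P n i (x /\<^sub>R ep n)))) \<longlonglongrightarrow> 0"
proof -
 define a where "a = (%n. LINT x|lebesgue_on (cball 0 R). norm (G n x - (\<Sum>i\<in>UNIV. H x $ i *\<^sub>R P n i (x /\<^sub>R ep n))))"
 have a0: "a n >= 0" for n by (simp add: a_def)
 have sub: "\<exists>k. strict_mono (k :: nat => nat) & uniform_limit UNIV (%n. rep (u (r (k n)))) (rep u0) sequentially &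
   continuous_on UNIV (rep u0) & (AE x in leb. rep u0 x = u0 x) & (%n. a (r (k n))) \<longlonglongrightarrow> 0"
  if r: "strict_mono (r :: nat => nat)" for r
 proof -
  interpret r: correctors Om al C be R K ka "%n. A (r n)" "%n. ep (r n)" "%n. ph (r n)" "%n. u (r n)" "%n. G (r n)" "%n. P (r n)" "%n. w (r n)" si u0 H ph0
   by (rule correctors_subseq[OF r])
  obtain k v where k: "strict_mono (k :: nat => nat)" "uniform_limit UNIV (%n. rep (u (r (k n)))) v sequentially"
   by (rule r.subsequence_uniform)
  interpret k: correctors_limit Om al C be R K ka "%n. A (r (k n))" "%n. ep (r (k n))" "%n. ph (r (k n))" "%n. u (r (k n))" "%n. G (r (k n))" "%n. P (r (k n))" "%n. w (r (k n))" si u0 H ph0 v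
   by (intro correctors_limit.intro r.correctors_subseq[OF k(1)]) (unfold_locales, rule k(2))
  show ?thesis
   using k k.corrector_L1 k.v_cont k.v_eq_u0 unfolding k.rep_u0 a_def by blast
 qed
 have u: "uniform_limit UNIV (%n. rep (u n)) (rep u0) sequentially"
 proof (rule ccontr)
  assume "\<not> ?thesis"
  then obtain e where e: "e > 0" "!!N. \<exists>n\<ge>N. \<exists>x. dist (rep (u n) x) (rep u0 x) >= e"
   unfolding uniform_limit_sequentially_iff by (meson UNIV_I not_less)
  hence "infinite {n. \<exists>x. dist (rep (u n) x) (rep u0 x) >= e}" unfolding infinite_nat_iff_unbounded_le by blast
  from infinite_enumerate[OF this] obtain r :: "nat => nat" where r: "strict_mono r" "!!n. \<exists>x. dist (rep (u (r n)) x) (rep u0 x) >= e" by blast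
  obtain k where "uniform_limit UNIV (%n. rep (u (r (k n)))) (rep u0) sequentially" using sub[OF r(1)] by blast
  then obtain N where "\<forall>n\<ge>N. \<forall>x. dist (rep (u (r (k n))) x) (rep u0 x) < e"
   using e(1) unfolding uniform_limit_sequentially_iff by blast
  thus False using r(2)[of "k N"] by (meson le_refl not_less)
 qed
 have "a \<longlonglongrightarrow> 0"
 proof (rule ccontr)
  assume "\<not> ?thesis"
  then obtain e where e: "e > 0" "!!N. \<exists>n\<ge>N. norm (a n - 0) >= e"
   unfolding LIMSEQ_iff by (meson not_less)
  hence "infinite {n. norm (a n - 0) >= e}" unfolding infinite_nat_iff_unbounded_le by blast
  from infinite_enumerate[OF this] obtain r :: "nat => nat" where r: "strict_mono r" "!!n. norm (a (r n) - 0) >= e" by blast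
  obtain k where "(%n. a (r (k n))) \<longlonglongrightarrow> 0" using sub[OF r(1)] by blast
  then obtain N where "\<forall>n\<ge>N. norm (a (r (k n)) - 0) < e" using e(1) unfolding LIMSEQ_iff by blast
  thus False using r(2)[of "k N"] by (meson le_refl not_less)
 qed
 thus ?thesis using u sub[OF strict_mono_id] unfolding a_def by blast
qed

lemma is_weak_grad_subset:
 assumes U: "open U" and w: "is_weak_grad UNIV w P"
 shows "is_weak_grad U w P"
proof -
 have Um: "U \<in> sets leb" using U by simp
 have "(LINT x|lebesgue_on U. w x * grad ph x $ i) = - (LINT x|lebesgue_on U. P x $ i * ph x)" if ph: "ph \<in> test_functions U" for ph i
 proof -
  obtain K where K: "K \<subseteq> U" "!!x. x ~: K ==> ph x = 0" "!!x. x ~: K ==> grad ph x = 0"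
   using C1c_support[OF test_functions_C1c[OF ph]] by metis
  have 0: "ph x = 0" "grad ph x = 0" if "x ~: U" for x using K that by blast+
  have "ph \<in> test_functions UNIV" using ph by (auto simp: test_functions_def)
  with w have "(LINT x|leb. w x * grad ph x $ i) = - (LINT x|leb. P x $ i * ph x)"
   by (simp add: is_weak_grad_def lebesgue_on_UNIV_eq)
  moreover have "(LINT x|lebesgue_on U. w x * grad ph x $ i) = (LINT x|leb. w x * grad ph x $ i)"
   by (rule integral_lebesgue_on_vanish[OF Um]) (simp add: 0)
  moreover have "(LINT x|lebesgue_on U. P x $ i * ph x) = (LINT x|leb. P x $ i * ph x)"
   by (rule integral_lebesgue_on_vanish[OF Um]) (simp add: 0)
  ultimately show ?thesis by simp
 qed
 thus ?thesis using w by (auto simp: is_weak_grad_def L1_loc_def)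
qed

text \<open>The weak equation is rewritten over the whole plane with the gradient extended by 0, as
  the estimates on squares crossing the boundary require.\<close>

lemma dirichlet_solution_extension:
 assumes U: "open U" and d: "dirichlet_solution U A f u"
 obtains ph where "!!j. ph j \<in> test_functions U" "L2lim leb ph (%x. indicator U x *\<^sub>R u x)"
  "L2lim leb (%j. grad (ph j)) (%x. indicator U x *\<^sub>R wgrad U u x)"
  "!!ps. ps \<in> test_functions U ==> (LINT x|leb. (A x *v (indicator U x *\<^sub>R wgrad U u x)) \<bullet> grad ps x) = f ps"
proof -
 have u: "u \<in> H1_0 U" and eq: "!!ps. ps \<in> test_functions U ==> (LINT x|lebesgue_on U. (A x *v wgrad U u x) \<bullet> grad ps x) = f ps"
  using d by (auto simp: dirichlet_solution_def)
 have "(LINT x|leb. (A x *v (indicator U x *\<^sub>R wgrad U u x)) \<bullet> grad ps x) = f ps" if "ps \<in> test_functions U" for ps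
 proof -
  have "(LINT x|lebesgue_on U. (A x *v wgrad U u x) \<bullet> grad ps x) = (LINT x|leb. indicator U x *\<^sub>R ((A x *v wgrad U u x) \<bullet> grad ps x))"
   by (rule Bochner_Integration.integral_restrict_space) (use U in simp)
  also have "... = (LINT x|leb. (A x *v (indicator U x *\<^sub>R wgrad U u x)) \<bullet> grad ps x)"
   by (simp add: matrix_vector_mult_scaleR)
  finally show ?thesis using eq[OF that] by simp
 qed
 note eq' = this
 show ?thesis by (rule H1_0_extension[OF U u]) (rule that; (assumption | rule eq' | blast))
qed

lemma bounded_solutionI:
 assumes U: "open U" and A: "A \<in> L_inf" and coer: "!!xs. AE x in leb. (A x *v xs) \<bullet> xs >= al * (norm xs)^2" and s: "s > 0"
  and ph: "!!j. ph j \<in> test_functions U" "L2lim leb ph (%x. indicator U x *\<^sub>R u x)"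
  "L2lim leb (%j. grad (ph j)) (%x. indicator U x *\<^sub>R G x)"
  and test: "sq leb (%x. A (x /\<^sub>R s) *v (indicator U x *\<^sub>R G x)) ==> dual_bound U C be (%x. A (x /\<^sub>R s) *v (indicator U x *\<^sub>R G x))"
 shows "bounded_solution U al C be (%x. A (x /\<^sub>R s)) ph (%x. indicator U x *\<^sub>R u x) (%x. indicator U x *\<^sub>R G x)"
  and "sq leb (%x. A (x /\<^sub>R s) *v (indicator U x *\<^sub>R G x))"
proof -
 obtain B where B: "A \<in> borel_measurable leb" "AE x in leb. norm (A x) <= B" by (rule Linf_bound[OF A])
 have m: "(%x. A (x /\<^sub>R s)) \<in> borel_measurable leb"
  using measurable_scale_shift[of "1 / s" A 0] B(1) s by (simp add: divide_inverse)
 have b: "AE x in leb. norm (A (x /\<^sub>R s)) <= B"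
  using AE_scale_shift[OF B(2), of "1 / s" 0] s by (simp add: divide_inverse)
 have c: "AE x in leb. \<forall>xs. al * (norm xs)^2 <= (A (x /\<^sub>R s) *v xs) \<bullet> xs"
  using AE_scale_shift[OF coercive_all[OF coer], of "1 / s" 0] s by (simp add: divide_inverse)
 show q: "sq leb (%x. A (x /\<^sub>R s) *v (indicator U x *\<^sub>R G x))" by (rule sq_matvec[OF m b L2limD(2)[OF ph(3)]])
 show "bounded_solution U al C be (%x. A (x /\<^sub>R s)) ph (%x. indicator U x *\<^sub>R u x) (%x. indicator U x *\<^sub>R G x)"
  unfolding bounded_solution_def
 proof (intro conjI allI impI)
  show "\<exists>B. AE x in leb. norm (A (x /\<^sub>R s)) <= B" using b by blast
  show "ph j \<in> C1c U" for j by (rule test_functions_C1c[OF ph(1)])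
  show "indicator U x *\<^sub>R u x = 0" "indicator U x *\<^sub>R G x = 0" if "x ~: U" for x using that by simp_all
 qed (fact m c ph test[OF q])+
qed

text \<open>Extended by 0, the solutions form an instance of \<open>correctors\<close> with be = 1/2
  - 1/q; it remains to return from the extensions to \<Omega> and from the chosen gradients to
  \<open>wgrad\<close>.\<close>

theorem theorem3p1:
  fixes \<Omega> :: "R2 set"
    and \<Sigma> :: "nat \<Rightarrow> R2 \<Rightarrow> real ^ 2 ^ 2"
    and \<alpha> q :: real
    and \<epsilon> :: "nat \<Rightarrow> real"
    and W :: "nat \<Rightarrow> R2 \<Rightarrow> R2 \<Rightarrow> real"
    and \<sigma>_eff :: "nat \<Rightarrow> real ^ 2 ^ 2"
    and \<sigma>_star :: "real ^ 2 ^ 2"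
    and f :: "(R2 \<Rightarrow> real) \<Rightarrow> real"
    and u_n :: "nat \<Rightarrow> R2 \<Rightarrow> real"
    and u :: "R2 \<Rightarrow> real"
  assumes "open \<Omega>" and "bounded \<Omega>" and "lipschitz_boundary \<Omega>"
    and "\<And>n. \<Sigma> n \<in> L_inf"
    and "\<And>n. Y_periodic (\<Sigma> n)"
    and "\<alpha> > 0"
    and "\<And>n \<xi>. AE x in lebesgue. (\<Sigma> n x *v \<xi>) \<bullet> \<xi> \<ge> \<alpha> * (norm \<xi>)^2"
    and "\<And>n. \<epsilon> n > 0" and "\<epsilon> \<longlonglongrightarrow> 0"
    and "\<And>n \<xi>. cell_solution (\<Sigma> n) \<xi> (W n \<xi>)"
    and "\<And>n. effective_matrix (\<Sigma> n) (W n) (\<sigma>_eff n)"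
    and "\<sigma>_eff \<longlonglongrightarrow> \<sigma>_star"
    and "q > 2" and "f \<in> H_minus1 \<Omega> \<inter> W_minus1 \<Omega> q"
    and "\<And>n. dirichlet_solution \<Omega> (\<lambda>x. \<Sigma> n (x /\<^sub>R \<epsilon> n)) f (u_n n)"
    and "dirichlet_solution \<Omega> (\<lambda>x. \<sigma>_star) f u"
  shows "converges_uniformly \<Omega> u_n u \<and>
    converges_L1 \<Omega>
      (\<lambda>n x. wgrad \<Omega> (u_n n) x -
        (\<Sum>i\<in>UNIV. wgrad \<Omega> u x $ i *\<^sub>R wgrad \<Omega> (rescale (\<epsilon> n) (W n (axis i 1))) x))
      (\<lambda>x. 0)"
proof -
 have \<Omega>m: "\<Omega> \<in> sets leb" using assms(1) by simp
 obtain R where R: "R > 0" "\<Omega> \<subseteq> cball 0 R"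
  using bounded_subset_ballD[OF assms(2), of 0] ball_subset_cball by blast
 \<comment> \<open>Convergence of the effective matrices is the source of the uniform energy bound
   for the cell solutions.\<close>
 obtain b where b: "norm (\<sigma>_eff n) <= b" for n
  using convergent_imp_Bseq[OF convergentI[OF assms(12)]] by (auto simp: Bseq_def)
 have bi: "\<sigma>_eff n $ i $ i <= b" for n i
 proof -
  have "\<bar>\<sigma>_eff n $ i $ i\<bar> <= norm (\<sigma>_eff n $ i)" by (rule component_le_norm_cart)
  also have "... <= norm (\<sigma>_eff n)" by (rule Finite_Cartesian_Product.norm_nth_le)
  finally show ?thesis using b[of n] by linarith
 qed
 let ?K = "2 * \<bar>b\<bar> + \<bar>b\<bar> / \<alpha>"
 have K: "2 * b <= ?K" "b / \<alpha> <= ?K"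
 proof -
  have "b / \<alpha> <= \<bar>b\<bar> / \<alpha>" "0 <= \<bar>b\<bar> / \<alpha>" using assms(6) by (auto intro: divide_right_mono)
  thus "2 * b <= ?K" "b / \<alpha> <= ?K" by linarith+
 qed
 define \<kappa> where "\<kappa> = 2 * (3 * (60 * sqrt (b / \<alpha>) + 1) + 64 / \<alpha> + 2)"
 let ?w = "%n i. rescale (\<epsilon> n) (W n (axis i 1))"
 have "\<exists>P. corrector_gradients (\<Sigma> n) (\<epsilon> n) \<kappa> ?K (?w n) P &
   (\<forall>i l. (LINT y|lebesgue_on Y. energy_density (\<Sigma> n) P i l y) = \<sigma>_eff n $ l $ i + \<sigma>_eff n $ i $ l)" for n
  using rescaled_cell[OF assms(4)[of n] assms(5)[of n] assms(6) assms(7)[where n = n] assms(10)[of n] assms(11)[of n] assms(8)[of n] bi[of n] K]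
  unfolding \<kappa>_def by blast
 then obtain P where P: "corrector_gradients (\<Sigma> n) (\<epsilon> n) \<kappa> ?K (?w n) (P n)"
  "(LINT y|lebesgue_on Y. energy_density (\<Sigma> n) (P n) i l y) = \<sigma>_eff n $ l $ i + \<sigma>_eff n $ i $ l" for n i l by metis
 \<comment> \<open>One constant for all n: the right-hand side f is the same for every coefficient
   field.\<close>
 obtain C where C: "C > 0" and test: "!!F. sq leb F ==> (!!\<phi>. \<phi> \<in> test_functions \<Omega> ==> (LINT x|leb. F x \<bullet> grad \<phi> x) = f \<phi>) ==> dual_bound \<Omega> C (1 / 2 - 1 / q) F"
  using W_minus1_bound[OF assms(1,2,13)] assms(14) by blast
 let ?v = "%n x. indicator \<Omega> x *\<^sub>R u_n n x" and ?G = "%n x. indicator \<Omega> x *\<^sub>R wgrad \<Omega> (u_n n) x"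
 let ?ul = "%x. indicator \<Omega> x *\<^sub>R u x" and ?H = "%x. indicator \<Omega> x *\<^sub>R wgrad \<Omega> u x"
 define approx where "approx = (%n \<phi>. (\<forall>j. \<phi> j \<in> test_functions \<Omega>) & L2lim leb \<phi> (?v n) & L2lim leb (%j. grad (\<phi> j)) (?G n))"
 have "\<exists>\<phi>. approx n \<phi>" for n
  by (rule dirichlet_solution_extension[OF assms(1) assms(15)[of n]]) (unfold approx_def, blast)
 then obtain \<phi> where \<phi>0': "!!n. approx n (\<phi> n)" by metis
 have \<phi>: "\<phi> n j \<in> test_functions \<Omega>" "L2lim leb (\<phi> n) (?v n)" "L2lim leb (%j. grad (\<phi> n j)) (?G n)" for n j
  using \<phi>0'[of n] unfolding approx_def by blast+
 have \<phi>4: "(LINT x|leb. (\<Sigma> n (x /\<^sub>R \<epsilon> n) *v ?G n x) \<bullet> grad \<psi> x) = f \<psi>" if "\<psi> \<in> test_functions \<Omega>" for n \<psi>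
  by (rule dirichlet_solution_extension[OF assms(1) assms(15)[of n]]) (use that in blast)
 obtain \<phi>0 where \<phi>0: "!!j. \<phi>0 j \<in> test_functions \<Omega>" "L2lim leb \<phi>0 ?ul" "L2lim leb (%j. grad (\<phi>0 j)) ?H"
  "!!\<psi>. \<psi> \<in> test_functions \<Omega> ==> (LINT x|leb. (\<sigma>_star *v ?H x) \<bullet> grad \<psi> x) = f \<psi>"
  by (rule dirichlet_solution_extension[OF assms(1) assms(16)]) blast
 have sol: "bounded_solution \<Omega> \<alpha> C (1 / 2 - 1 / q) (%x. \<Sigma> n (x /\<^sub>R \<epsilon> n)) (\<phi> n) (?v n) (?G n)"
  "sq leb (%x. \<Sigma> n (x /\<^sub>R \<epsilon> n) *v ?G n x)" for n
  by (rule bounded_solutionI[OF assms(1) assms(4)[of n] assms(7)[where n = n] assms(8)[of n] \<phi>[of n]], erule test, rule \<phi>4, assumption)+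
 have sH: "sq leb (%x. \<sigma>_star *v ?H x)"
  by (rule sq_matvec[of "%_. \<sigma>_star" leb "norm \<sigma>_star", OF _ _ L2limD(2)[OF \<phi>0(3)]]) auto
 interpret c: correctors \<Omega> \<alpha> C "1 / 2 - 1 / q" R ?K \<kappa> \<Sigma> \<epsilon> \<phi> ?v ?G P ?w \<sigma>_star ?ul ?H \<phi>0
 proof
  show "0 < 1 / 2 - 1 / q" using assms(13) by (simp add: field_simps)
  show "bounded_solution \<Omega> \<alpha> C (1 / 2 - 1 / q) (%x. \<Sigma> n (x /\<^sub>R \<epsilon> n)) (\<phi> n) (?v n) (?G n)" for n by (rule sol(1))
  show "(%n. LINT y|lebesgue_on Y. energy_density (\<Sigma> n) (P n) i l y) \<longlonglongrightarrow> \<sigma>_star $ l $ i + \<sigma>_star $ i $ l" for i l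
   unfolding P(2) by (intro tendsto_add tendsto_vec_nth assms(12))
  show "(LINT x|leb. (\<Sigma> n (x /\<^sub>R \<epsilon> n) *v ?G n x) \<bullet> grad \<zeta> x) = (LINT x|leb. (\<sigma>_star *v ?H x) \<bullet> grad \<zeta> x)"
   if "\<zeta> \<in> C1c \<Omega>" for n \<zeta>
   by (rule test_functions_extend_eq[OF assms(1) sol(2) sH _ that]) (rule trans[OF \<phi>4 \<phi>0(4)[symmetric]])
  show "?ul x = 0" if "x ~: \<Omega>" for x using that by simp
 qed (fact assms R C P(1) \<phi>0)+
 note conv = c.convergence
 have AEO: "AE x in lebesgue_on \<Omega>. rep v x = g x" if "AE x in leb. rep v x = indicator \<Omega> x *\<^sub>R g x" for v g
  by (rule AE_lebesgue_on_I[OF \<Omega>m], use that in eventually_elim) simp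
 have "converges_uniformly \<Omega> u_n u"
  unfolding converges_uniformly_def
 proof (intro exI conjI allI)
  show "continuous_on \<Omega> (rep (?v n))" for n by (rule continuous_on_subset[OF c.u_rep_continuous]) simp
  show "AE x in lebesgue_on \<Omega>. rep (?v n) x = u_n n x" for n by (rule AEO[OF c.u_rep_AE])
  show "continuous_on \<Omega> (rep ?ul)" using conv continuous_on_subset by blast
  show "AE x in lebesgue_on \<Omega>. rep ?ul x = u x" by (rule AEO) (use conv in blast)
  show "uniform_limit \<Omega> (%n. rep (?v n)) (rep ?ul) sequentially" using conv uniform_limit_on_subset by blast
 qed
 moreover have "converges_L1 \<Omega> (%n x. wgrad \<Omega> (u_n n) x -
    (\<Sum>i\<in>UNIV. wgrad \<Omega> u x $ i *\<^sub>R wgrad \<Omega> (rescale (\<epsilon> n) (W n (axis i 1))) x)) (%x. 0)"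
 proof -
  define F where "F = (%n x. wgrad \<Omega> (u_n n) x - (\<Sum>i\<in>UNIV. wgrad \<Omega> u x $ i *\<^sub>R wgrad \<Omega> (rescale (\<epsilon> n) (W n (axis i 1))) x))"
  define E where "E = (%n x. ?G n x - (\<Sum>i\<in>UNIV. ?H x $ i *\<^sub>R P n i (x /\<^sub>R \<epsilon> n)))"
  have E0: "E n x = 0" if "x ~: cball 0 R" for n x
  proof -
   have "x ~: \<Omega>" using that R(2) by blast
   thus ?thesis by (simp add: E_def)
  qed
  have EI: "integrable leb (E n)" for n
  proof -
   have "integrable leb (%x. indicator (cball 0 R) x *\<^sub>R E n x)"
    using c.corrector_integrable[of n] by (simp add: E_def integrable_restrict_space)
   moreover have "(%x. indicator (cball 0 R) x *\<^sub>R E n x) = E n" using E0 by (intro ext) (simp add: indicator_def)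
   ultimately show ?thesis by simp
  qed
  \<comment> \<open>The weak gradient of the rescaled cell solution on the plane is also one on
    \<Omega>, so the arbitrary representative there agrees with it almost everywhere.\<close>
  have wP: "AE x in leb. x \<in> \<Omega> --> wgrad \<Omega> (rescale (\<epsilon> n) (W n (axis i 1))) x = P n i (x /\<^sub>R \<epsilon> n)" for n i
   by (rule wgrad_AE[OF assms(1) is_weak_grad_subset[OF assms(1)]]) (rule c.w(3))
  \<comment> \<open>The integrand of the theorem, cut off outside \<Omega>, equals almost everywhere
    the one controlled on the large ball, which vanishes off \<Omega> since both extended gradients
    do.\<close>
  have FE: "AE x in leb. indicator \<Omega> x *\<^sub>R F n x = E n x" for n
   using wP[of n 1] wP[of n 2]
  proof eventually_elim
   case (elim x)
   show ?case
   proof (cases "x \<in> \<Omega>")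
    case True
    hence "wgrad \<Omega> (rescale (\<epsilon> n) (W n (axis i 1))) x = P n i (x /\<^sub>R \<epsilon> n)" for i
     using elim exhaust_2[of i] by auto
    thus ?thesis using True by (simp add: E_def F_def)
   qed (simp add: E_def)
  qed
  have Fm: "(%x. indicator \<Omega> x *\<^sub>R F n x) \<in> borel_measurable leb" for n
   by (rule measurable_AE_lebesgue[OF _ FE]) (use EI in auto)
  have "integrable leb (%x. indicator \<Omega> x *\<^sub>R F n x)" for n
   by (rule integrable_cong_AE_imp[OF EI[of n] Fm]) (use FE[of n] in eventually_elim, simp)
  hence FI: "integrable (lebesgue_on \<Omega>) (F n)" for n using \<Omega>m by (simp add: integrable_restrict_space)
  have "(LINT x|lebesgue_on \<Omega>. norm (F n x)) = (LINT x|lebesgue_on (cball 0 R). norm (E n x))" for n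
  proof -
   have "(LINT x|lebesgue_on \<Omega>. norm (F n x)) = (LINT x|leb. norm (indicator \<Omega> x *\<^sub>R F n x))"
    using \<Omega>m by (subst integral_restrict_space) auto
   also have "... = (LINT x|leb. norm (E n x))"
   proof (rule integral_cong_AE)
    show "(%x. norm (indicator \<Omega> x *\<^sub>R F n x)) \<in> borel_measurable leb" using Fm[of n] by measurable
    show "(%x. norm (E n x)) \<in> borel_measurable leb" using EI[of n] by auto
    show "AE x in leb. norm (indicator \<Omega> x *\<^sub>R F n x) = norm (E n x)" using FE[of n] by eventually_elim (simp only:)
   qed
   also have "... = (LINT x|lebesgue_on (cball 0 R). norm (E n x))"
    by (rule integral_lebesgue_on_vanish[symmetric]) (simp_all add: E0)
   finally show ?thesis .
  qed
  hence "(%n. LINT x|lebesgue_on \<Omega>. norm (F n x - 0)) \<longlonglongrightarrow> 0" using conv by (simp add: E_def)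
  thus ?thesis using FI unfolding converges_L1_def F_def by simp
 qed
 ultimately show ?thesis ..
qed

end
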